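(* Let $(\mathsf C,\mathcal S_{\mathsf C})$ be a category with covers such that $\mathsf{Gpd}_\infty(\mathsf C)$ admits the canonical iCFO structure. Let $(\mathsf D,\mathcal S_{\mathsf D})$ be a descent category and $F\colon(\mathsf C,\mathcal S_{\mathsf C})\to(\mathsf D,\mathcal S_{\mathsf D})$ any geometric functor. (1) $F_\bullet\colon\mathsf{Gpd}_\infty(\mathsf C)\to\mathsf{Gpd}_\infty(\mathsf D)$ is an exact functor with respect to the class of covering fibrations. Moreover, $F_\bullet$ preserves all fibrations, and hence path objects. (2) If $F$ reflects covers, then $F_\bullet$ reflects all fibrations and weak equivalences. (3) If $F$ preserves finite limits, then $F_\bullet$ is exact.
   Context: **Category with covers** $(\mathsf C,\mathcal S)$: a category with a subcategory $\mathcal S$ of covers such that (a) $\mathsf C$ has a terminal object $*$ and every $X\to*$ is a cover; (b) pullbacks of covers exist and are covers; (c) if $f$ and $g\circ f$ are covers, so is $g$; (d) every cover is an effective epimorphism. **Descent category** $(\mathsf D,\mathcal S)$: a category with all finite limits and a subcategory $\mathcal S$ of covers such that the identity of the terminal object is a cover, covers are closed under base change, if $f$ and $g\circ f$ are covers so is $g$, and every cover is an effective epimorphism. A functor $F$ from a category with covers to a descent category is **geometric** if it sends covers to covers and preserves pullbacks of covers; it **reflects covers** if $F(f)$ a cover implies $f$ a cover. **Simplicial notions** (for a category with covers the limits involved are required to exist). $X^K=\hom(K,X_\bullet)$ is the matching object for a finite simplicial set $K$. $f\colon X_\bullet\to Y_\bullet$ is a Kan fibration if all $X_n\to X^{\Lambda^n_k}\times_{Y^{\Lambda^n_k}}Y_n$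 ($n\ge1$, $0\le k\le n$) are covers; a covering fibration if moreover $f_0$ is a cover; a hypercover if all $X_m\to X^{\partial\Delta^m}\times_{Y^{\partial\Delta^m}}Y_m$ ($m\ge0$) are covers. $X_\bullet$ is an $\infty$-groupoid if $X_\bullet\to*$ is a Kan fibration; $\mathsf{Gpd}_\infty$ denotes the full subcategory of these. For an $\infty$-groupoid $X$, $X^I_n=\hom(\Delta^n\times\Delta^1,X_\bullet)$ exists and defines an $\infty$-groupoid with maps $X\to X^I\xrightarrow{(d^0,d^1)}X\times X$ factoring the diagonal. A geometric functor induces levelwise $F_\bullet\colon\mathsf{Gpd}_\infty(\mathsf C)\to\mathsf{Gpd}_\infty(\mathsf D)$. **iCFO.** A category with finite products and two wide subcategories, weak equivalences and fibrations (acyclic fibration = both), such that: isomorphisms are acyclic fibrations; weak equivalences satisfy 2-out-of-3; if the pullback of a fibration exists, it is a fibration; the pullback of any acyclic fibration exists and is an acyclic fibration; every $X$ has a path object (a factorization of the diagonal $X\to X^I\to X\times X$ into a weak equivalence and a fibration); every $X\to*$ is a fibration. A category of fibrant objects (CFO) is an iCFO in which all pullbacks of fibrations exist. The **canonical** (i)CFO structure on $\mathsf{Gpd}_\infty$ is the one with fibrations the Kan fibrations, acyclic fibrations the hypercovers, and functorial path objects $X\to X^I\xrightarrow{(d^0,d^1)}X\times X$ given by $X^I_n=\hom(\Delta^n\times\Delta^1,X_\bullet)$, with the first map induced by the codegeneracy $\Delta^1\to\Delta^0$ and $d^0,d^1$ induced by the two cofaces $\Delta^0\rightrightarrows\Delta^1$;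 its weak equivalences are then the $f\colon X\to Y$ such that $X\times_{f,Y,d^0}Y^I\to Y$ (induced by $d^1$) is a hypercover. For a descent category $\mathsf D$, $\mathsf{Gpd}_\infty(\mathsf D)$ always carries the canonical CFO structure (Behrend–Getzler). **Exactness.** Let $S$ be a subcategory of fibrations containing all acyclic fibrations and all morphisms to the terminal object. A functor between iCFOs is exact with respect to $S$ if it preserves the terminal object and acyclic fibrations, maps every fibration in $S$ to a fibration, and maps every pullback square along a fibration in $S$ to a pullback square. It is exact if this holds for $S$ the class of all fibrations.
   Formalization: In (1), exactness with respect to covering fibrations is stated for geometric F that preserve the terminal object; without this it fails, e.g. for a functor constant at a non-terminal object of D. *)

theory Defs
  imports Main "HOL-Library.FuncSet"
begin

section \<open>Categories and functors\<close>

record ('o, 'm) category =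
  Obj :: "'o set"
  Arr :: "'m set"
  Dom :: "'m \<Rightarrow> 'o"
  Cod :: "'m \<Rightarrow> 'o"
  Ident :: "'o \<Rightarrow> 'm"
  Comp :: "'m \<Rightarrow> 'm \<Rightarrow> 'm"  (infixr "\<cdot>\<index>" 70)

definition hom :: "('o, 'm) category \<Rightarrow> 'o \<Rightarrow> 'o \<Rightarrow> 'm set" where
  "hom C a b = {f \<in> Arr C. Dom C f = a \<and> Cod C f = b}"

locale category =
  fixes C :: "('o, 'm) category"
  assumes Dom_in: "f \<in> Arr C \<Longrightarrow> Dom C f \<in> Obj C"
    and Cod_in: "f \<in> Arr C \<Longrightarrow> Cod C f \<in> Obj C"
    and Ident_in: "a \<in> Obj C \<Longrightarrow> Ident C a \<in> hom C a a"
    and Comp_in: "f \<in> hom C a b \<Longrightarrow> g \<in> hom C b c \<Longrightarrow> g \<cdot>\<^bsub>C\<^esub> f \<in> hom C a c"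
    and Ident_left: "f \<in> hom C a b \<Longrightarrow> Ident C b \<cdot>\<^bsub>C\<^esub> f = f"
    and Ident_right: "f \<in> hom C a b \<Longrightarrow> f \<cdot>\<^bsub>C\<^esub> Ident C a = f"
    and Comp_assoc: "f \<in> hom C a b \<Longrightarrow> g \<in> hom C b c \<Longrightarrow> h \<in> hom C c d \<Longrightarrow>
      (h \<cdot>\<^bsub>C\<^esub> g) \<cdot>\<^bsub>C\<^esub> f = h \<cdot>\<^bsub>C\<^esub> (g \<cdot>\<^bsub>C\<^esub> f)"

definition opp :: "('o, 'm) category \<Rightarrow> ('o, 'm) category" where
  "opp C = \<lparr>Obj = Obj C, Arr = Arr C, Dom = Cod C, Cod = Dom C, Ident = Ident C,
            Comp = (\<lambda>g f. f \<cdot>\<^bsub>C\<^esub> g)\<rparr>"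

definition full_subcategory :: "('o, 'm) category \<Rightarrow> 'o set \<Rightarrow> ('o, 'm) category" where
  "full_subcategory C A =
     C\<lparr>Obj := Obj C \<inter> A, Arr := {f \<in> Arr C. Dom C f \<in> A \<and> Cod C f \<in> A}\<rparr>"

definition subcategory :: "('o, 'm) category \<Rightarrow> 'm set \<Rightarrow> bool" where
  "subcategory C S \<longleftrightarrow> S \<subseteq> Arr C
     \<and> (\<forall>f\<in>S. Ident C (Dom C f) \<in> S \<and> Ident C (Cod C f) \<in> S)
     \<and> (\<forall>f\<in>S. \<forall>g\<in>S. Cod C f = Dom C g \<longrightarrow> g \<cdot>\<^bsub>C\<^esub> f \<in> S)"

definition wide_subcategory :: "('o, 'm) category \<Rightarrow> 'm set \<Rightarrow> bool" where
  "wide_subcategory C S \<longleftrightarrow> subcategory C S \<and> (\<forall>a\<in>Obj C. Ident C a \<in> S)"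

definition iso_arrow :: "('o, 'm) category \<Rightarrow> 'm \<Rightarrow> bool" where
  "iso_arrow C f \<longleftrightarrow> f \<in> Arr C \<and> (\<exists>g\<in>hom C (Cod C f) (Dom C f).
     g \<cdot>\<^bsub>C\<^esub> f = Ident C (Dom C f) \<and> f \<cdot>\<^bsub>C\<^esub> g = Ident C (Cod C f))"

record ('o, 'm, 'p, 'n) cat_functor =
  FObj :: "'o \<Rightarrow> 'p"
  FArr :: "'m \<Rightarrow> 'n"

locale cat_functor = dom: category C + cod: category D
  for C :: "('o, 'm) category" and D :: "('p, 'n) category"
    and F :: "('o, 'm, 'p, 'n) cat_functor" +
  assumes FObj_in: "a \<in> Obj C \<Longrightarrow> FObj F a \<in> Obj D"
    and FArr_in: "f \<in> hom C a b \<Longrightarrow> FArr F f \<in> hom D (FObj F a) (FObj F b)"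
    and FArr_Ident: "a \<in> Obj C \<Longrightarrow> FArr F (Ident C a) = Ident D (FObj F a)"
    and FArr_Comp: "f \<in> hom C a b \<Longrightarrow> g \<in> hom C b c \<Longrightarrow>
      FArr F (g \<cdot>\<^bsub>C\<^esub> f) = FArr F g \<cdot>\<^bsub>D\<^esub> FArr F f"


section \<open>Limits\<close>

definition terminal_object :: "('o, 'm) category \<Rightarrow> 'o \<Rightarrow> bool" where
  "terminal_object C t \<longleftrightarrow> t \<in> Obj C \<and> (\<forall>a\<in>Obj C. \<exists>!f. f \<in> hom C a t)"

definition is_product ::
    "('o, 'm) category \<Rightarrow> 'i set \<Rightarrow> ('i \<Rightarrow> 'o) \<Rightarrow> 'o \<Rightarrow> ('i \<Rightarrow> 'm) \<Rightarrow> bool" where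
  "is_product C I A P p \<longleftrightarrow> P \<in> Obj C \<and> (\<forall>i\<in>I. p i \<in> hom C P (A i))
     \<and> (\<forall>T\<in>Obj C. \<forall>h. (\<forall>i\<in>I. h i \<in> hom C T (A i)) \<longrightarrow>
          (\<exists>!u. u \<in> hom C T P \<and> (\<forall>i\<in>I. p i \<cdot>\<^bsub>C\<^esub> u = h i)))"

definition has_finite_products :: "('o, 'm) category \<Rightarrow> bool" where
  "has_finite_products C \<longleftrightarrow> (\<forall>(n::nat) A. (\<forall>i<n. A i \<in> Obj C) \<longrightarrow>
     (\<exists>P p. is_product C {..<n} A P p))"

text \<open>The square with legs \<open>f\<close>, \<open>g\<close> into a common object and projections \<open>p\<close> (to the domain
  of \<open>f\<close>) and \<open>q\<close> (to the domain of \<open>g\<close>) is a pullback; \<open>q\<close> is the base change of \<open>f\<close>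
  along \<open>g\<close>.\<close>

definition is_pullback :: "('o, 'm) category \<Rightarrow> 'm \<Rightarrow> 'm \<Rightarrow> 'm \<Rightarrow> 'm \<Rightarrow> bool" where
  "is_pullback C f g p q \<longleftrightarrow> f \<in> Arr C \<and> g \<in> Arr C \<and> Cod C f = Cod C g
     \<and> p \<in> hom C (Dom C p) (Dom C f) \<and> q \<in> hom C (Dom C p) (Dom C g)
     \<and> f \<cdot>\<^bsub>C\<^esub> p = g \<cdot>\<^bsub>C\<^esub> q
     \<and> (\<forall>T\<in>Obj C. \<forall>h\<in>hom C T (Dom C f). \<forall>k\<in>hom C T (Dom C g).
          f \<cdot>\<^bsub>C\<^esub> h = g \<cdot>\<^bsub>C\<^esub> k \<longrightarrow>
          (\<exists>!u. u \<in> hom C T (Dom C p) \<and> p \<cdot>\<^bsub>C\<^esub> u = h \<and> q \<cdot>\<^bsub>C\<^esub> u = k))"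

definition is_coequalizer :: "('o, 'm) category \<Rightarrow> 'm \<Rightarrow> 'm \<Rightarrow> 'm \<Rightarrow> bool" where
  "is_coequalizer C p q f \<longleftrightarrow> p \<in> Arr C \<and> q \<in> hom C (Dom C p) (Cod C p)
     \<and> f \<in> hom C (Cod C p) (Cod C f) \<and> f \<cdot>\<^bsub>C\<^esub> p = f \<cdot>\<^bsub>C\<^esub> q
     \<and> (\<forall>h\<in>Arr C. Dom C h = Cod C p \<and> h \<cdot>\<^bsub>C\<^esub> p = h \<cdot>\<^bsub>C\<^esub> q \<longrightarrow>
          (\<exists>!u. u \<in> hom C (Cod C f) (Cod C h) \<and> u \<cdot>\<^bsub>C\<^esub> f = h))"

definition effective_epi :: "('o, 'm) category \<Rightarrow> 'm \<Rightarrow> bool" where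
  "effective_epi C f \<longleftrightarrow> (\<exists>p q. is_pullback C f f p q \<and> is_coequalizer C p q f)"

definition is_cone :: "('o, 'm) category \<Rightarrow> ('i, 'j) category \<Rightarrow>
    ('i, 'j, 'o, 'm) cat_functor \<Rightarrow> 'o \<Rightarrow> ('i \<Rightarrow> 'm) \<Rightarrow> bool" where
  "is_cone C J G L p \<longleftrightarrow> L \<in> Obj C \<and> (\<forall>i\<in>Obj J. p i \<in> hom C L (FObj G i))
     \<and> (\<forall>a\<in>Arr J. FArr G a \<cdot>\<^bsub>C\<^esub> p (Dom J a) = p (Cod J a))"

definition is_limit :: "('o, 'm) category \<Rightarrow> ('i, 'j) category \<Rightarrow>
    ('i, 'j, 'o, 'm) cat_functor \<Rightarrow> 'o \<Rightarrow> ('i \<Rightarrow> 'm) \<Rightarrow> bool" where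
  "is_limit C J G L p \<longleftrightarrow> is_cone C J G L p
     \<and> (\<forall>T h. is_cone C J G T h \<longrightarrow>
          (\<exists>!u. u \<in> hom C T L \<and> (\<forall>i\<in>Obj J. p i \<cdot>\<^bsub>C\<^esub> u = h i)))"

text \<open>Every finite category is isomorphic to one whose objects and arrows are natural numbers.\<close>

definition finite_category :: "(nat, nat) category \<Rightarrow> bool" where
  "finite_category J \<longleftrightarrow> category J \<and> finite (Obj J) \<and> finite (Arr J)"

definition has_finite_limits :: "('o, 'm) category \<Rightarrow> bool" where
  "has_finite_limits C \<longleftrightarrow>
     (\<forall>J G. finite_category J \<and> cat_functor J C G \<longrightarrow> (\<exists>L p. is_limit C J G L p))"

definition comp_functor :: "('p, 'n, 'q, 'l) cat_functor \<Rightarrow> ('o, 'm, 'p, 'n) cat_functor \<Rightarrow>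
    ('o, 'm, 'q, 'l) cat_functor" where
  "comp_functor F G = \<lparr>FObj = FObj F \<circ> FObj G, FArr = FArr F \<circ> FArr G\<rparr>"

text \<open>\<open>C\<close> need not have all finite limits; those that exist are preserved.\<close>

definition preserves_finite_limits :: "('o, 'm) category \<Rightarrow> ('p, 'n) category \<Rightarrow>
    ('o, 'm, 'p, 'n) cat_functor \<Rightarrow> bool" where
  "preserves_finite_limits C D F \<longleftrightarrow>
     (\<forall>J G L p. finite_category J \<and> cat_functor J C G \<and> is_limit C J G L p \<longrightarrow>
        is_limit D J (comp_functor F G) (FObj F L) (\<lambda>i. FArr F (p i)))"

definition preserves_terminal :: "('o, 'm) category \<Rightarrow> ('p, 'n) category \<Rightarrow>
    ('o, 'm, 'p, 'n) cat_functor \<Rightarrow> bool" where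
  "preserves_terminal C D F \<longleftrightarrow> (\<forall>t. terminal_object C t \<longrightarrow> terminal_object D (FObj F t))"


section \<open>Categories with covers, descent categories, geometric functors\<close>

locale category_with_covers = category C
  for C :: "('o, 'm) category" and S :: "'m set" +
  assumes covers_subcategory: "subcategory C S"
    and has_terminal: "\<exists>t. terminal_object C t"
    and to_terminal_cover: "terminal_object C t \<Longrightarrow> f \<in> Arr C \<Longrightarrow> Cod C f = t \<Longrightarrow> f \<in> S"
    and cover_pullback_exists:
      "f \<in> S \<Longrightarrow> g \<in> Arr C \<Longrightarrow> Cod C f = Cod C g \<Longrightarrow> \<exists>p q. is_pullback C f g p q"
    and cover_base_change: "f \<in> S \<Longrightarrow> is_pullback C f g p q \<Longrightarrow> q \<in> S"
    and cover_cancel: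
      "f \<in> S \<Longrightarrow> g \<in> Arr C \<Longrightarrow> Cod C f = Dom C g \<Longrightarrow> g \<cdot>\<^bsub>C\<^esub> f \<in> S \<Longrightarrow> g \<in> S"
    and cover_effective_epi: "f \<in> S \<Longrightarrow> effective_epi C f"

locale descent_category = category D
  for D :: "('o, 'm) category" and S :: "'m set" +
  assumes finite_limits: "has_finite_limits D"
    and covers_subcategory: "subcategory D S"
    and terminal_Ident_cover: "terminal_object D t \<Longrightarrow> Ident D t \<in> S"
    and cover_base_change: "f \<in> S \<Longrightarrow> is_pullback D f g p q \<Longrightarrow> q \<in> S"
    and cover_cancel:
      "f \<in> S \<Longrightarrow> g \<in> Arr D \<Longrightarrow> Cod D f = Dom D g \<Longrightarrow> g \<cdot>\<^bsub>D\<^esub> f \<in> S \<Longrightarrow> g \<in> S"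
    and cover_effective_epi: "f \<in> S \<Longrightarrow> effective_epi D f"

text \<open>Preservation of the terminal object is not part of the definition and does not follow from
  it: the functor constant at any object of \<open>D\<close> is geometric.\<close>

locale geometric_functor = cat_functor C D F
  for C :: "('o, 'm) category" and SC :: "'m set"
    and D :: "('p, 'n) category" and SD :: "'n set"
    and F :: "('o, 'm, 'p, 'n) cat_functor" +
  assumes maps_covers: "f \<in> SC \<Longrightarrow> FArr F f \<in> SD"
    and preserves_cover_pullbacks: "f \<in> SC \<Longrightarrow> is_pullback C f g p q \<Longrightarrow>
      is_pullback D (FArr F f) (FArr F g) (FArr F p) (FArr F q)"

definition reflects_covers :: "('o, 'm) category \<Rightarrow> 'm set \<Rightarrow> 'n set \<Rightarrow>
    ('o, 'm, 'p, 'n) cat_functor \<Rightarrow> bool" where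
  "reflects_covers C SC SD F \<longleftrightarrow> (\<forall>f\<in>Arr C. FArr F f \<in> SD \<longrightarrow> f \<in> SC)"


section \<open>Simplicial sets and simplicial objects\<close>

text \<open>The simplex category: the object \<open>n\<close> is the ordinal \<open>{0..n}\<close>, and \<open>(m, n, \<theta>)\<close> is a
  monotone map \<open>{0..m} \<rightarrow> {0..n}\<close>, normalised to be \<open>undefined\<close> off \<open>{0..m}\<close>.\<close>

type_synonym delta_arr = "nat \<times> nat \<times> (nat \<Rightarrow> nat)"

definition Delta :: "(nat, delta_arr) category" where
  "Delta = \<lparr>Obj = UNIV,
     Arr = {(m, n, \<theta>). \<theta> \<in> {..m} \<rightarrow>\<^sub>E {..n} \<and> mono_on {..m} \<theta>},
     Dom = (\<lambda>(m, n, \<theta>). m),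
     Cod = (\<lambda>(m, n, \<theta>). n),
     Ident = (\<lambda>n. (n, n, restrict (\<lambda>i. i) {..n})),
     Comp = (\<lambda>(n, p, \<phi>) (m, n', \<theta>). (m, p, compose {..m} \<phi> \<theta>))\<rparr>"

definition coface :: "nat \<Rightarrow> nat \<Rightarrow> delta_arr" where
  "coface n i = (n, Suc n, restrict (\<lambda>j. if j < i then j else Suc j) {..n})"

definition to_point :: "nat \<Rightarrow> delta_arr" where
  "to_point n = (n, 0, restrict (\<lambda>j. 0) {..n})"

definition delta_image :: "delta_arr \<Rightarrow> nat set" where
  "delta_image = (\<lambda>(m, n, \<theta>). \<theta> ` {..m})"

text \<open>\<open>sact K \<theta>\<close> is the (contravariant) action \<open>K\<^sub>n \<rightarrow> K\<^sub>m\<close> of \<open>\<theta>: [m] \<rightarrow> [n]\<close>.\<close>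

record 'a sset =
  simplices :: "nat \<Rightarrow> 'a set"
  sact :: "delta_arr \<Rightarrow> 'a \<Rightarrow> 'a"

definition std_simplex :: "nat \<Rightarrow> delta_arr sset" where
  "std_simplex n = \<lparr>simplices = (\<lambda>m. hom Delta m n), sact = (\<lambda>\<theta> \<sigma>. \<sigma> \<cdot>\<^bsub>Delta\<^esub> \<theta>)\<rparr>"

definition boundary :: "nat \<Rightarrow> delta_arr sset" where
  "boundary n = (std_simplex n)
     \<lparr>simplices := (\<lambda>m. {\<sigma> \<in> hom Delta m n. delta_image \<sigma> \<noteq> {..n}})\<rparr>"

definition horn :: "nat \<Rightarrow> nat \<Rightarrow> delta_arr sset" where
  "horn n k = (std_simplex n)
     \<lparr>simplices := (\<lambda>m. {\<sigma> \<in> hom Delta m n. \<not> {..n} - {k} \<subseteq> delta_image \<sigma>})\<rparr>"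

definition sset_product :: "'a sset \<Rightarrow> 'b sset \<Rightarrow> ('a \<times> 'b) sset" where
  "sset_product K L = \<lparr>simplices = (\<lambda>m. simplices K m \<times> simplices L m),
     sact = (\<lambda>\<theta> (\<sigma>, \<tau>). (sact K \<theta> \<sigma>, sact L \<theta> \<tau>))\<rparr>"

type_synonym ('o, 'm) sobj = "(nat, delta_arr, 'o, 'm) cat_functor"
type_synonym ('o, 'm) smap = "('o, 'm) sobj \<times> ('o, 'm) sobj \<times> (nat \<Rightarrow> 'm)"

text \<open>Simplicial objects are contravariant functors on \<open>Delta\<close>, made extensional so that
  equality of functors is equality of terms; a simplicial map carries its source and target.\<close>

definition simplicial_objects :: "('o, 'm) category \<Rightarrow> ('o, 'm) sobj set" where
  "simplicial_objects C = {X. cat_functor (opp Delta) C X \<and> FArr X \<in> extensional (Arr Delta)}"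

definition simplicial_category ::
    "('o, 'm) category \<Rightarrow> (('o, 'm) sobj, ('o, 'm) smap) category" where
  "simplicial_category C = \<lparr>Obj = simplicial_objects C,
     Arr = {(X, Y, f). X \<in> simplicial_objects C \<and> Y \<in> simplicial_objects C
              \<and> (\<forall>n. f n \<in> hom C (FObj X n) (FObj Y n))
              \<and> (\<forall>\<theta>\<in>Arr Delta. f (Dom Delta \<theta>) \<cdot>\<^bsub>C\<^esub> FArr X \<theta> = FArr Y \<theta> \<cdot>\<^bsub>C\<^esub> f (Cod Delta \<theta>))},
     Dom = (\<lambda>(X, Y, f). X),
     Cod = (\<lambda>(X, Y, f). Y),
     Ident = (\<lambda>X. (X, X, \<lambda>n. Ident C (FObj X n))),
     Comp = (\<lambda>(Y, Z, g) (X, Y', f). (X, Z, \<lambda>n. g n \<cdot>\<^bsub>C\<^esub> f n))\<rparr>"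

definition constant_sobj :: "('o, 'm) category \<Rightarrow> 'o \<Rightarrow> ('o, 'm) sobj" where
  "constant_sobj C a = \<lparr>FObj = (\<lambda>n. a), FArr = restrict (\<lambda>\<theta>. Ident C a) (Arr Delta)\<rparr>"

definition levelwise :: "('o, 'm, 'p, 'n) cat_functor \<Rightarrow>
    (('o, 'm) sobj, ('o, 'm) smap, ('p, 'n) sobj, ('p, 'n) smap) cat_functor" where
  "levelwise F = (let FX = (\<lambda>X. \<lparr>FObj = FObj F \<circ> FObj X,
                                 FArr = restrict (FArr F \<circ> FArr X) (Arr Delta)\<rparr>)
     in \<lparr>FObj = FX, FArr = (\<lambda>(X, Y, f). (FX X, FX Y, \<lambda>n. FArr F (f n)))\<rparr>)"


section \<open>Matching objects\<close>

text \<open>A cone with vertex \<open>T\<close> is a map of simplicial sets from \<open>K\<close> to the simplicial set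
  \<open>n \<mapsto> hom T X\<^sub>n\<close>; the matching object \<open>X\<^sup>K\<close> represents \<open>T \<mapsto> {cones with vertex T}\<close>.\<close>

definition matching_cone :: "('o, 'm) category \<Rightarrow> ('o, 'm) sobj \<Rightarrow> 'a sset \<Rightarrow> 'o \<Rightarrow>
    (nat \<Rightarrow> 'a \<Rightarrow> 'm) \<Rightarrow> bool" where
  "matching_cone C X K T \<rho> \<longleftrightarrow> T \<in> Obj C
     \<and> (\<forall>m. \<forall>\<sigma>\<in>simplices K m. \<rho> m \<sigma> \<in> hom C T (FObj X m))
     \<and> (\<forall>\<theta>\<in>Arr Delta. \<forall>\<sigma>\<in>simplices K (Cod Delta \<theta>).
          FArr X \<theta> \<cdot>\<^bsub>C\<^esub> \<rho> (Cod Delta \<theta>) \<sigma> = \<rho> (Dom Delta \<theta>) (sact K \<theta> \<sigma>))"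

definition matching_object :: "('o, 'm) category \<Rightarrow> ('o, 'm) sobj \<Rightarrow> 'a sset \<Rightarrow> 'o \<Rightarrow>
    (nat \<Rightarrow> 'a \<Rightarrow> 'm) \<Rightarrow> bool" where
  "matching_object C X K M \<pi> \<longleftrightarrow> matching_cone C X K M \<pi>
     \<and> (\<forall>T \<rho>. matching_cone C X K T \<rho> \<longrightarrow>
          (\<exists>!u. u \<in> hom C T M \<and> (\<forall>m. \<forall>\<sigma>\<in>simplices K m. \<pi> m \<sigma> \<cdot>\<^bsub>C\<^esub> u = \<rho> m \<sigma>)))"

text \<open>For a subcomplex \<open>K\<close> of the \<open>n\<close>-simplex and \<open>f: X \<rightarrow> Y\<close>, the object
  \<open>X\<^sup>K \<times>\<^bsub>Y\<^sup>K\<^esub> Y\<^sub>n\<close> as a single limit: a cone is a pair of a \<open>K\<close>-cone \<open>\<rho>\<close> in \<open>X\<close> and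
  \<open>y: T \<rightarrow> Y\<^sub>n\<close> with the same image among \<open>K\<close>-cones in \<open>Y\<close>. Only this limit is
  required to exist. Asking for \<open>X\<^sup>K\<close> and \<open>Y\<^sup>K\<close> separately would be wrong for
  \<open>K = \<partial>\<Delta>\<^sup>n\<close>, where in a category with covers they need not exist even for the identity
  of an \<open>\<infinity>\<close>-groupoid.\<close>

definition relative_cone :: "('o, 'm) category \<Rightarrow> ('o, 'm) smap \<Rightarrow> nat \<Rightarrow> delta_arr sset \<Rightarrow>
    'o \<Rightarrow> (nat \<Rightarrow> delta_arr \<Rightarrow> 'm) \<Rightarrow> 'm \<Rightarrow> bool" where
  "relative_cone C = (\<lambda>(X, Y, f) n K T \<rho> y. matching_cone C X K T \<rho> \<and> y \<in> hom C T (FObj Y n)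
     \<and> (\<forall>m. \<forall>\<sigma>\<in>simplices K m. f m \<cdot>\<^bsub>C\<^esub> \<rho> m \<sigma> = FArr Y \<sigma> \<cdot>\<^bsub>C\<^esub> y))"

definition relative_matching_object :: "('o, 'm) category \<Rightarrow> ('o, 'm) smap \<Rightarrow> nat \<Rightarrow>
    delta_arr sset \<Rightarrow> 'o \<Rightarrow> (nat \<Rightarrow> delta_arr \<Rightarrow> 'm) \<Rightarrow> 'm \<Rightarrow> bool" where
  "relative_matching_object C f n K M \<pi> q \<longleftrightarrow> relative_cone C f n K M \<pi> q
     \<and> (\<forall>T \<rho> y. relative_cone C f n K T \<rho> y \<longrightarrow>
          (\<exists>!u. u \<in> hom C T M \<and> (\<forall>m. \<forall>\<sigma>\<in>simplices K m. \<pi> m \<sigma> \<cdot>\<^bsub>C\<^esub> u = \<rho> m \<sigma>)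
                \<and> q \<cdot>\<^bsub>C\<^esub> u = y))"

lemma matching_cone_comp:
  assumes C: "category C" and X: "X \<in> simplicial_objects C"
    and M: "matching_cone C X K M \<pi>" and u: "u \<in> hom C T M"
  shows "matching_cone C X K T (\<lambda>m \<sigma>. \<pi> m \<sigma> \<cdot>\<^bsub>C\<^esub> u)"
proof -
  interpret category C by (fact C)
  have H: "FArr X \<theta> \<in> hom C (FObj X (Cod Delta \<theta>)) (FObj X (Dom Delta \<theta>))"
    if "\<theta> \<in> Arr Delta" for \<theta>
    using X cat_functor.FArr_in[of "opp Delta" C X \<theta>] that
    unfolding simplicial_objects_def by (fastforce simp: opp_def hom_def)
  have "T \<in> Obj C" using u Dom_in unfolding hom_def by auto
  moreover have \<pi>: "\<pi> m \<sigma> \<in> hom C M (FObj X m)" if "\<sigma> \<in> simplices K m" for m \<sigma>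
    using M that unfolding matching_cone_def by auto
  moreover have "FArr X \<theta> \<cdot>\<^bsub>C\<^esub> (\<pi> (Cod Delta \<theta>) \<sigma> \<cdot>\<^bsub>C\<^esub> u)
      = \<pi> (Dom Delta \<theta>) (sact K \<theta> \<sigma>) \<cdot>\<^bsub>C\<^esub> u"
    if "\<theta> \<in> Arr Delta" "\<sigma> \<in> simplices K (Cod Delta \<theta>)" for \<theta> \<sigma>
    using Comp_assoc[OF u \<pi>[OF that(2)] H[OF that(1)]] M that
    unfolding matching_cone_def by auto
  ultimately show ?thesis using Comp_in[OF u] unfolding matching_cone_def by auto
qed

text \<open>When \<open>X\<^sup>K\<close> and \<open>Y\<^sup>K\<close> do exist, a pullback of \<open>X\<^sup>K \<rightarrow> Y\<^sup>K \<leftarrow> Y\<^sub>n\<close> is a relative matching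
  object.\<close>

lemma relative_matching_object_pullback:
  assumes C: "category C"
    and f: "(X, Y, f) \<in> Arr (simplicial_category C)"
    and X: "matching_object C X K MX \<pi>" and Y: "matching_object C Y K MY \<pi>'"
    and fK: "fK \<in> hom C MX MY"
      "\<And>m \<sigma>. \<sigma> \<in> simplices K m \<Longrightarrow> \<pi>' m \<sigma> \<cdot>\<^bsub>C\<^esub> fK = f m \<cdot>\<^bsub>C\<^esub> \<pi> m \<sigma>"
    and r: "r \<in> hom C (FObj Y n) MY"
      "\<And>m \<sigma>. \<sigma> \<in> simplices K m \<Longrightarrow> \<pi>' m \<sigma> \<cdot>\<^bsub>C\<^esub> r = FArr Y \<sigma>"
    and pb: "is_pullback C fK r p q"
  shows "relative_matching_object C (X, Y, f) n K (Dom C p) (\<lambda>m \<sigma>. \<pi> m \<sigma> \<cdot>\<^bsub>C\<^esub> p) q"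
proof -
  interpret category C by (fact C)
  let ?P = "Dom C p"
  have p: "p \<in> hom C ?P MX" and q: "q \<in> hom C ?P (FObj Y n)"
    and pq: "fK \<cdot>\<^bsub>C\<^esub> p = r \<cdot>\<^bsub>C\<^esub> q"
    and univ: "\<And>T h k. T \<in> Obj C \<Longrightarrow> h \<in> hom C T MX \<Longrightarrow> k \<in> hom C T (FObj Y n) \<Longrightarrow>
      fK \<cdot>\<^bsub>C\<^esub> h = r \<cdot>\<^bsub>C\<^esub> k \<Longrightarrow>
      \<exists>!u. u \<in> hom C T ?P \<and> p \<cdot>\<^bsub>C\<^esub> u = h \<and> q \<cdot>\<^bsub>C\<^esub> u = k"
    using pb fK(1) r(1) unfolding is_pullback_def hom_def by auto
  have XS: "X \<in> simplicial_objects C" and YS: "Y \<in> simplicial_objects C"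
    and fm: "\<And>m. f m \<in> hom C (FObj X m) (FObj Y m)"
    using f unfolding simplicial_category_def by auto
  have MX: "matching_cone C X K MX \<pi>" and MY: "matching_cone C Y K MY \<pi>'"
    using X Y unfolding matching_object_def by auto
  have \<pi>: "\<pi> m \<sigma> \<in> hom C MX (FObj X m)" if "\<sigma> \<in> simplices K m" for m \<sigma>
    using MX that unfolding matching_cone_def by auto
  have \<pi>': "\<pi>' m \<sigma> \<in> hom C MY (FObj Y m)" if "\<sigma> \<in> simplices K m" for m \<sigma>
    using MY that unfolding matching_cone_def by auto
  have Y\<sigma>: "FArr Y \<sigma> \<in> hom C (FObj Y n) (FObj Y m)" if "\<sigma> \<in> simplices K m" for m \<sigma>
    using r(2)[OF that] Comp_in[OF r(1) \<pi>'[OF that]] by simp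
  have agree: "\<pi>' m \<sigma> \<cdot>\<^bsub>C\<^esub> (fK \<cdot>\<^bsub>C\<^esub> h) = f m \<cdot>\<^bsub>C\<^esub> (\<pi> m \<sigma> \<cdot>\<^bsub>C\<^esub> h)"
    if "\<sigma> \<in> simplices K m" "h \<in> hom C T MX" for m \<sigma> h T
    using Comp_assoc[OF that(2) fK(1) \<pi>'[OF that(1)]]
      Comp_assoc[OF that(2) \<pi>[OF that(1)] fm] fK(2)[OF that(1)] by simp
  have agree': "\<pi>' m \<sigma> \<cdot>\<^bsub>C\<^esub> (r \<cdot>\<^bsub>C\<^esub> y) = FArr Y \<sigma> \<cdot>\<^bsub>C\<^esub> y"
    if "\<sigma> \<in> simplices K m" "y \<in> hom C T (FObj Y n)" for m \<sigma> y T
    using Comp_assoc[OF that(2) r(1) \<pi>'[OF that(1)]] r(2)[OF that(1)] by simp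
  have cone: "relative_cone C (X, Y, f) n K ?P (\<lambda>m \<sigma>. \<pi> m \<sigma> \<cdot>\<^bsub>C\<^esub> p) q"
    unfolding relative_cone_def
    using matching_cone_comp[OF C XS MX p] q pq agree[OF _ p] agree'[OF _ q] by simp
  have "\<exists>!u. u \<in> hom C T ?P \<and> (\<forall>m. \<forall>\<sigma>\<in>simplices K m. (\<pi> m \<sigma> \<cdot>\<^bsub>C\<^esub> p) \<cdot>\<^bsub>C\<^esub> u = \<rho> m \<sigma>)
          \<and> q \<cdot>\<^bsub>C\<^esub> u = y"
    if "relative_cone C (X, Y, f) n K T \<rho> y" for T \<rho> y
  proof -
    have \<rho>: "matching_cone C X K T \<rho>" and y: "y \<in> hom C T (FObj Y n)"
      and \<rho>y: "\<And>m \<sigma>. \<sigma> \<in> simplices K m \<Longrightarrow> f m \<cdot>\<^bsub>C\<^esub> \<rho> m \<sigma> = FArr Y \<sigma> \<cdot>\<^bsub>C\<^esub> y"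
      using that unfolding relative_cone_def by auto
    have T: "T \<in> Obj C" using \<rho> unfolding matching_cone_def by auto
    have ex: "\<exists>!u. u \<in> hom C T MX \<and> (\<forall>m. \<forall>\<sigma>\<in>simplices K m. \<pi> m \<sigma> \<cdot>\<^bsub>C\<^esub> u = \<rho> m \<sigma>)"
      using X \<rho> unfolding matching_object_def by auto
    then obtain h where h: "h \<in> hom C T MX"
      and h\<rho>: "\<And>m \<sigma>. \<sigma> \<in> simplices K m \<Longrightarrow> \<pi> m \<sigma> \<cdot>\<^bsub>C\<^esub> h = \<rho> m \<sigma>" by blast
    note ry = Comp_in[OF y r(1)] and fh = Comp_in[OF h fK(1)]
    have "\<exists>!u. u \<in> hom C T MY
        \<and> (\<forall>m. \<forall>\<sigma>\<in>simplices K m. \<pi>' m \<sigma> \<cdot>\<^bsub>C\<^esub> u = \<pi>' m \<sigma> \<cdot>\<^bsub>C\<^esub> (r \<cdot>\<^bsub>C\<^esub> y))"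
      using Y matching_cone_comp[OF C YS MY ry] unfolding matching_object_def by simp
    moreover have "\<pi>' m \<sigma> \<cdot>\<^bsub>C\<^esub> (fK \<cdot>\<^bsub>C\<^esub> h) = \<pi>' m \<sigma> \<cdot>\<^bsub>C\<^esub> (r \<cdot>\<^bsub>C\<^esub> y)"
      if "\<sigma> \<in> simplices K m" for m \<sigma>
      using agree[OF that h] agree'[OF that y] h\<rho>[OF that] \<rho>y[OF that] by simp
    ultimately have eq: "fK \<cdot>\<^bsub>C\<^esub> h = r \<cdot>\<^bsub>C\<^esub> y"
      using ry fh by (elim ex1E) (metis (no_types, lifting))
    have key: "(\<forall>m. \<forall>\<sigma>\<in>simplices K m. (\<pi> m \<sigma> \<cdot>\<^bsub>C\<^esub> p) \<cdot>\<^bsub>C\<^esub> u = \<rho> m \<sigma>) \<longleftrightarrow> p \<cdot>\<^bsub>C\<^esub> u = h"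
      if u: "u \<in> hom C T ?P" for u
    proof -
      have "(\<pi> m \<sigma> \<cdot>\<^bsub>C\<^esub> p) \<cdot>\<^bsub>C\<^esub> u = \<pi> m \<sigma> \<cdot>\<^bsub>C\<^esub> (p \<cdot>\<^bsub>C\<^esub> u)" if "\<sigma> \<in> simplices K m" for m \<sigma>
        by (rule Comp_assoc[OF u p \<pi>[OF that]])
      then have "(\<forall>m. \<forall>\<sigma>\<in>simplices K m. (\<pi> m \<sigma> \<cdot>\<^bsub>C\<^esub> p) \<cdot>\<^bsub>C\<^esub> u = \<rho> m \<sigma>) \<longleftrightarrow>
          (\<forall>m. \<forall>\<sigma>\<in>simplices K m. \<pi> m \<sigma> \<cdot>\<^bsub>C\<^esub> (p \<cdot>\<^bsub>C\<^esub> u) = \<rho> m \<sigma>)" by simp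
      also have "\<dots> \<longleftrightarrow> p \<cdot>\<^bsub>C\<^esub> u = h"
      proof
        assume "\<forall>m. \<forall>\<sigma>\<in>simplices K m. \<pi> m \<sigma> \<cdot>\<^bsub>C\<^esub> (p \<cdot>\<^bsub>C\<^esub> u) = \<rho> m \<sigma>"
        then show "p \<cdot>\<^bsub>C\<^esub> u = h"
          by (intro Uniq_D[OF ex1_iff_ex_Uniq[THEN iffD1, OF ex, THEN conjunct2]]) (simp_all add: Comp_in[OF u p] h h\<rho>)
      qed (simp add: h\<rho>)
      finally show ?thesis .
    qed
    show ?thesis
      by (rule iffD1[OF _ univ[OF T h y eq]], rule arg_cong[where f=Ex1], rule ext)
        (use key in blast)
  qed
  with cone show ?thesis unfolding relative_matching_object_def by blast
qed

text \<open>\<open>X\<^sup>K \<times>\<^bsub>Y\<^sup>K\<^esub> Y\<^sub>n\<close> exists and the canonical map to it from \<open>X\<^sub>n\<close> is a cover.\<close>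

definition matching_map_cover :: "('o, 'm) category \<Rightarrow> 'm set \<Rightarrow> ('o, 'm) smap \<Rightarrow> nat \<Rightarrow>
    delta_arr sset \<Rightarrow> bool" where
  "matching_map_cover C S = (\<lambda>(X, Y, f) n K. \<exists>M \<pi> q u.
     relative_matching_object C (X, Y, f) n K M \<pi> q \<and> u \<in> hom C (FObj X n) M
     \<and> (\<forall>m. \<forall>\<sigma>\<in>simplices K m. \<pi> m \<sigma> \<cdot>\<^bsub>C\<^esub> u = FArr X \<sigma>) \<and> q \<cdot>\<^bsub>C\<^esub> u = f n
     \<and> u \<in> S)"

definition kan_fibration :: "('o, 'm) category \<Rightarrow> 'm set \<Rightarrow> ('o, 'm) smap \<Rightarrow> bool" where
  "kan_fibration C S f \<longleftrightarrow> f \<in> Arr (simplicial_category C)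
     \<and> (\<forall>n\<ge>1. \<forall>k\<le>n. matching_map_cover C S f n (horn n k))"

definition hypercover :: "('o, 'm) category \<Rightarrow> 'm set \<Rightarrow> ('o, 'm) smap \<Rightarrow> bool" where
  "hypercover C S f \<longleftrightarrow> f \<in> Arr (simplicial_category C)
     \<and> (\<forall>m. matching_map_cover C S f m (boundary m))"

definition infinity_groupoid :: "('o, 'm) category \<Rightarrow> 'm set \<Rightarrow> ('o, 'm) sobj \<Rightarrow> bool" where
  "infinity_groupoid C S X \<longleftrightarrow> (\<exists>t f. terminal_object C t
     \<and> f \<in> hom (simplicial_category C) X (constant_sobj C t) \<and> kan_fibration C S f)"

definition Gpd :: "('o, 'm) category \<Rightarrow> 'm set \<Rightarrow> (('o, 'm) sobj, ('o, 'm) smap) category" where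
  "Gpd C S = full_subcategory (simplicial_category C) {X. infinity_groupoid C S X}"

definition kan_fibrations :: "('o, 'm) category \<Rightarrow> 'm set \<Rightarrow> ('o, 'm) smap set" where
  "kan_fibrations C S = {f \<in> Arr (Gpd C S). kan_fibration C S f}"

definition covering_fibrations :: "('o, 'm) category \<Rightarrow> 'm set \<Rightarrow> ('o, 'm) smap set" where
  "covering_fibrations C S = {(X, Y, f) \<in> kan_fibrations C S. f 0 \<in> S}"

definition hypercovers :: "('o, 'm) category \<Rightarrow> 'm set \<Rightarrow> ('o, 'm) smap set" where
  "hypercovers C S = {f \<in> Arr (Gpd C S). hypercover C S f}"


section \<open>Path spaces and weak equivalences\<close>

text \<open>\<open>P\<close> is \<open>X\<^sup>I\<close>, i.e. \<open>P\<^sub>n = hom(\<Delta>\<^sup>n \<times> \<Delta>\<^sup>1, X)\<close> with universal cone \<open>ev n\<close> and the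
  simplicial structure induced by the functoriality of \<open>\<Delta>\<^sup>n\<close> in \<open>n\<close>.\<close>

definition path_space :: "('o, 'm) category \<Rightarrow> ('o, 'm) sobj \<Rightarrow> ('o, 'm) sobj \<Rightarrow>
    (nat \<Rightarrow> nat \<Rightarrow> delta_arr \<times> delta_arr \<Rightarrow> 'm) \<Rightarrow> bool" where
  "path_space C X P ev \<longleftrightarrow> P \<in> simplicial_objects C
     \<and> (\<forall>n. matching_object C X (sset_product (std_simplex n) (std_simplex 1)) (FObj P n) (ev n))
     \<and> (\<forall>\<theta>\<in>Arr Delta. \<forall>k. \<forall>\<sigma>\<in>hom Delta k (Dom Delta \<theta>). \<forall>\<tau>\<in>hom Delta k 1.
          ev (Dom Delta \<theta>) k (\<sigma>, \<tau>) \<cdot>\<^bsub>C\<^esub> FArr P \<theta> = ev (Cod Delta \<theta>) k (\<theta> \<cdot>\<^bsub>Delta\<^esub> \<sigma>, \<tau>))"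

text \<open>The maps \<open>s: X \<rightarrow> X\<^sup>I\<close> induced by \<open>\<Delta>\<^sup>1 \<rightarrow> \<Delta>\<^sup>0\<close> and \<open>d i: X\<^sup>I \<rightarrow> X\<close> induced by the
  \<open>i\<close>-th coface \<open>\<Delta>\<^sup>0 \<rightarrow> \<Delta>\<^sup>1\<close> (the one omitting the vertex \<open>i\<close>), under the identifications
  \<open>\<Delta>\<^sup>n \<times> \<Delta>\<^sup>0 = \<Delta>\<^sup>n\<close> and \<open>hom(\<Delta>\<^sup>n, X) = X\<^sub>n\<close>, the latter by evaluation at the identity of
  \<open>[n]\<close>.\<close>

definition canonical_path :: "('o, 'm) category \<Rightarrow> 'm set \<Rightarrow> ('o, 'm) sobj \<Rightarrow> ('o, 'm) sobj \<Rightarrow>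
    ('o, 'm) smap \<Rightarrow> (nat \<Rightarrow> ('o, 'm) smap) \<Rightarrow> bool" where
  "canonical_path C S X P s d \<longleftrightarrow> s \<in> hom (Gpd C S) X P \<and> (\<forall>i<2. d i \<in> hom (Gpd C S) P X)
     \<and> (\<exists>ev. path_space C X P ev
          \<and> (\<forall>n k. \<forall>\<sigma>\<in>hom Delta k n. \<forall>\<tau>\<in>hom Delta k 1.
               ev n k (\<sigma>, \<tau>) \<cdot>\<^bsub>C\<^esub> snd (snd s) n = FArr X \<sigma>)
          \<and> (\<forall>i<2. \<forall>n. snd (snd (d i)) n =
               ev n n (Ident Delta n, coface 0 i \<cdot>\<^bsub>Delta\<^esub> to_point n)))"

definition weak_equivalences :: "('o, 'm) category \<Rightarrow> 'm set \<Rightarrow> ('o, 'm) smap set" where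
  "weak_equivalences C S = {f \<in> Arr (Gpd C S).
     \<exists>P s d p q. canonical_path C S (Cod (Gpd C S) f) P s d
       \<and> is_pullback (Gpd C S) f (d 0) p q
       \<and> d 1 \<cdot>\<^bsub>Gpd C S\<^esub> q \<in> hypercovers C S}"


section \<open>Incomplete categories of fibrant objects and exact functors\<close>

text \<open>\<open>s\<close> followed by the map with components \<open>d 0\<close>, \<open>d 1\<close> factors the diagonal of \<open>X\<close> into a
  weak equivalence and a fibration.\<close>

definition path_object :: "('o, 'm) category \<Rightarrow> 'm set \<Rightarrow> 'm set \<Rightarrow> 'o \<Rightarrow> 'o \<Rightarrow> 'm \<Rightarrow>
    (nat \<Rightarrow> 'm) \<Rightarrow> bool" where
  "path_object E W Fib X P s d \<longleftrightarrow> s \<in> hom E X P \<and> s \<in> W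
     \<and> (\<exists>Q pr dd diag. is_product E {..<2::nat} (\<lambda>i. X) Q pr
          \<and> diag \<in> hom E X Q \<and> (\<forall>i<2. pr i \<cdot>\<^bsub>E\<^esub> diag = Ident E X)
          \<and> dd \<in> hom E P Q \<and> (\<forall>i<2. pr i \<cdot>\<^bsub>E\<^esub> dd = d i)
          \<and> dd \<cdot>\<^bsub>E\<^esub> s = diag \<and> dd \<in> Fib)"

locale iCFO = category E
  for E :: "('o, 'm) category" and W :: "'m set" and Fib :: "'m set" +
  assumes finite_products: "has_finite_products E"
    and weak_equivalences_wide: "wide_subcategory E W"
    and fibrations_wide: "wide_subcategory E Fib"
    and iso_acyclic_fibration: "iso_arrow E f \<Longrightarrow> f \<in> W \<inter> Fib"
    and two_of_three_left: "f \<in> hom E a b \<Longrightarrow> g \<in> hom E b c \<Longrightarrow> f \<in> W \<Longrightarrow>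
      g \<cdot>\<^bsub>E\<^esub> f \<in> W \<Longrightarrow> g \<in> W"
    and two_of_three_right: "f \<in> hom E a b \<Longrightarrow> g \<in> hom E b c \<Longrightarrow> g \<in> W \<Longrightarrow>
      g \<cdot>\<^bsub>E\<^esub> f \<in> W \<Longrightarrow> f \<in> W"
    and fibration_base_change: "f \<in> Fib \<Longrightarrow> is_pullback E f g p q \<Longrightarrow> q \<in> Fib"
    and acyclic_pullback_exists: "f \<in> W \<inter> Fib \<Longrightarrow> g \<in> Arr E \<Longrightarrow> Cod E f = Cod E g \<Longrightarrow>
      \<exists>p q. is_pullback E f g p q"
    and acyclic_base_change: "f \<in> W \<inter> Fib \<Longrightarrow> is_pullback E f g p q \<Longrightarrow> q \<in> W \<inter> Fib"
    and path_object_exists: "X \<in> Obj E \<Longrightarrow> \<exists>P s d. path_object E W Fib X P s d"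
    and to_terminal_fibration: "terminal_object E t \<Longrightarrow> f \<in> Arr E \<Longrightarrow> Cod E f = t \<Longrightarrow> f \<in> Fib"

definition admits_canonical_iCFO :: "('o, 'm) category \<Rightarrow> 'm set \<Rightarrow> bool" where
  "admits_canonical_iCFO C S \<longleftrightarrow> iCFO (Gpd C S) (weak_equivalences C S) (kan_fibrations C S)
     \<and> weak_equivalences C S \<inter> kan_fibrations C S = hypercovers C S
     \<and> (\<forall>X\<in>Obj (Gpd C S). \<exists>P s d. canonical_path C S X P s d
          \<and> path_object (Gpd C S) (weak_equivalences C S) (kan_fibrations C S) X P s d)"

definition exactness_class :: "('o, 'm) category \<Rightarrow> 'm set \<Rightarrow> 'm set \<Rightarrow> 'm set \<Rightarrow> bool" where
  "exactness_class E W Fib S \<longleftrightarrow> subcategory E S \<and> S \<subseteq> Fib \<and> W \<inter> Fib \<subseteq> S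
     \<and> (\<forall>t. \<forall>f\<in>Arr E. terminal_object E t \<and> Cod E f = t \<longrightarrow> f \<in> S)"

definition exact_wrt :: "('o, 'm) category \<Rightarrow> 'm set \<Rightarrow> 'm set \<Rightarrow>
    ('p, 'n) category \<Rightarrow> 'n set \<Rightarrow> 'n set \<Rightarrow> 'm set \<Rightarrow> ('o, 'm, 'p, 'n) cat_functor \<Rightarrow> bool" where
  "exact_wrt E W Fib E' W' Fib' S G \<longleftrightarrow> cat_functor E E' G \<and> exactness_class E W Fib S
     \<and> preserves_terminal E E' G
     \<and> (\<forall>f\<in>W \<inter> Fib. FArr G f \<in> W' \<inter> Fib')
     \<and> (\<forall>f\<in>S. FArr G f \<in> Fib')
     \<and> (\<forall>f g p q. f \<in> S \<and> is_pullback E f g p q \<longrightarrow>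
          is_pullback E' (FArr G f) (FArr G g) (FArr G p) (FArr G q))"

end

theory Submission
  imports Defs
begin

text \<open>Every limit that occurs is assembled from pullbacks along covers. Let \<open>f: X \<rightarrow> Y\<close> be a simplicial
  map and \<open>y\<close> a cone in \<open>Y\<close> over a complex \<open>K\<close> with vertex \<open>B\<close>. Attaching an \<open>m\<close>-simplex to \<open>K\<close> along
  \<open>H\<close> replaces \<open>X\<^sup>K \<times>\<^bsub>Y\<^sup>K\<^esub> B\<close> by its pullback along \<open>X\<^sub>m \<rightarrow> X\<^sup>H \<times>\<^bsub>Y\<^sup>H\<^esub> Y\<^sub>m\<close>, and a geometric functor
  preserves this pullback when the latter map is a cover. Horns are built from the distinguished
  vertex by attaching simplices along horns of lower dimension, boundaries by attaching simplices
  along boundaries, and the prism \<open>\<Delta>\<^sup>n \<times> \<Delta>\<^sup>1\<close> by attaching its top-dimensional simplices along faces.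
  Hence \<open>F\<close> preserves the relative matching objects of Kan fibrations and of hypercovers as well as
  path spaces, and by induction on the dimension it reflects both classes if it reflects covers. The
  functor need not preserve the terminal object, but horns and prisms are connected, so that their
  matching objects relative to a map to a constant object do not depend on that object.

  The same filtration, started from \<open>X\<^sub>0 \<times>\<^bsub>Y\<^sub>0\<^esub> W\<^sub>0\<close>, shows that the pullback of a Kan fibration \<open>X \<rightarrow> Y\<close>
  along \<open>W \<rightarrow> Y\<close> exists levelwise, and is preserved by \<open>F\<close>, as soon as this holds in level 0. Since
  evaluation at level 0 is represented by constant objects, every pullback of groupoids along a Kan
  fibration is levelwise, and it is preserved by \<open>F\<close> if \<open>f\<^sub>0\<close> is a cover or if \<open>F\<close> preserves finite
  limits. Weak equivalences are handled through canonical paths, where \<open>d\<^sup>0\<close> is a hypercover by the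
  axioms of an iCFO and therefore has a cover in level 0.\<close>

section \<open>Categories\<close>

text \<open>Existence is the obstacle: C has few limits, so no matching object may be assumed and
  every one must be produced by base changes of covers known at that point. Therefore existence in
  C, preservation by F and the cover property of the comparison map are proved in a single
  induction, the predicate \<open>preserved\<close> recording the limit in C together with its image
  in D. Stating the limits over an arbitrary cone \<open>y\<close> with vertex \<open>B\<close> lets
  the same induction serve for relative matching objects (B = Y_n), for base changes (B = W_n) and
  for prisms over a constant object. The second obstacle is that F* may fail to be terminal. Then
  F(X \<times> X) is the fibre product of FX with itself over F*, which is only a subobject of FX
  \<times> FX. A path object P is still sent to a path object because horns are connected: the image
  of a horn of FP in F* is constant, so a simplex of FX \<times> FX that extends the image of such a
  horn already lies in that subobject. So FP \<rightarrow> F(X \<times> X) stays a Kan fibration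
  after composition with the monomorphism into FX \<times> FX.\<close>

context category
begin

lemma Arr_hom: "f \<in> Arr C \<Longrightarrow> f \<in> hom C (Dom C f) (Cod C f)"
  by (simp add: hom_def)

lemma homI: "f \<in> Arr C \<Longrightarrow> Dom C f = a \<Longrightarrow> Cod C f = b \<Longrightarrow> f \<in> hom C a b"
  by (simp add: hom_def)

lemma homD:
  assumes "f \<in> hom C a b"
  shows "f \<in> Arr C" "Dom C f = a" "Cod C f = b" "a \<in> Obj C" "b \<in> Obj C"
  using assms Dom_in Cod_in by (auto simp: hom_def)

lemma Comp_simps [simp]:
  assumes "f \<in> Arr C" "g \<in> Arr C" "Cod C f = Dom C g"
  shows "g \<cdot>\<^bsub>C\<^esub> f \<in> Arr C" "Dom C (g \<cdot>\<^bsub>C\<^esub> f) = Dom C f" "Cod C (g \<cdot>\<^bsub>C\<^esub> f) = Cod C g"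
  using Comp_in[of f "Dom C f" "Dom C g" g "Cod C g"] assms by (auto simp: hom_def)

lemma Ident_simps [simp]:
  assumes "a \<in> Obj C"
  shows "Ident C a \<in> Arr C" "Dom C (Ident C a) = a" "Cod C (Ident C a) = a"
  using Ident_in[OF assms] by (auto simp: hom_def)

lemma Ident_Comp [simp]:
  "f \<in> Arr C \<Longrightarrow> Cod C f = b \<Longrightarrow> Ident C b \<cdot>\<^bsub>C\<^esub> f = f"
  "f \<in> Arr C \<Longrightarrow> Dom C f = a \<Longrightarrow> f \<cdot>\<^bsub>C\<^esub> Ident C a = f"
  using Ident_left Ident_right by (auto simp: hom_def)

lemma assoc:
  assumes "f \<in> Arr C" "g \<in> Arr C" "h \<in> Arr C" "Cod C f = Dom C g" "Cod C g = Dom C h"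
  shows "(h \<cdot>\<^bsub>C\<^esub> g) \<cdot>\<^bsub>C\<^esub> f = h \<cdot>\<^bsub>C\<^esub> (g \<cdot>\<^bsub>C\<^esub> f)"
  using Comp_assoc[of f "Dom C f" "Dom C g" g "Dom C h" h "Cod C h"] assms by (simp add: hom_def)

lemma iso_arrow_inverse:
  assumes "iso_arrow C i" "i \<in> hom C a b"
  obtains j where "j \<in> hom C b a" "iso_arrow C j" "j \<cdot>\<^bsub>C\<^esub> i = Ident C a" "i \<cdot>\<^bsub>C\<^esub> j = Ident C b"
  using assms unfolding iso_arrow_def by (auto simp: hom_def)

lemma iso_arrowI:
  assumes "i \<in> hom C a b" "j \<in> hom C b a" "j \<cdot>\<^bsub>C\<^esub> i = Ident C a" "i \<cdot>\<^bsub>C\<^esub> j = Ident C b"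
  shows "iso_arrow C i"
  using assms unfolding iso_arrow_def by (auto simp: hom_def)

section \<open>Pullback squares and terminal objects up to isomorphism\<close>

lemma is_pullbackI:
  assumes "f \<in> hom C a c" "g \<in> hom C b c" "p \<in> hom C P a" "q \<in> hom C P b" "f \<cdot>\<^bsub>C\<^esub> p = g \<cdot>\<^bsub>C\<^esub> q"
    and "\<And>T h k. h \<in> hom C T a \<Longrightarrow> k \<in> hom C T b \<Longrightarrow> f \<cdot>\<^bsub>C\<^esub> h = g \<cdot>\<^bsub>C\<^esub> k \<Longrightarrow>
      \<exists>u\<in>hom C T P. p \<cdot>\<^bsub>C\<^esub> u = h \<and> q \<cdot>\<^bsub>C\<^esub> u = k"
    and "\<And>T u v. u \<in> hom C T P \<Longrightarrow> v \<in> hom C T P \<Longrightarrow> p \<cdot>\<^bsub>C\<^esub> u = p \<cdot>\<^bsub>C\<^esub> v \<Longrightarrow> q \<cdot>\<^bsub>C\<^esub> u = q \<cdot>\<^bsub>C\<^esub> v \<Longrightarrow> u = v"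
  shows "is_pullback C f g p q"
proof -
  have "\<exists>!u. u \<in> hom C T P \<and> p \<cdot>\<^bsub>C\<^esub> u = h \<and> q \<cdot>\<^bsub>C\<^esub> u = k"
    if hk: "h \<in> hom C T a" "k \<in> hom C T b" "f \<cdot>\<^bsub>C\<^esub> h = g \<cdot>\<^bsub>C\<^esub> k" for T h k
  proof -
    obtain u where "u \<in> hom C T P \<and> p \<cdot>\<^bsub>C\<^esub> u = h \<and> q \<cdot>\<^bsub>C\<^esub> u = k" using assms(6)[OF hk] by blast
    then show ?thesis using assms(7) by (intro ex1I[of _ u]) auto
  qed
  then show ?thesis unfolding is_pullback_def
    using assms(3-5) homD(1-3)[OF assms(1)] homD(1-3)[OF assms(2)] homD(2)[OF assms(3)] by simp
qed

lemma is_pullbackD: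
  assumes "is_pullback C f g p q"
  shows "f \<in> Arr C" "g \<in> Arr C" "Cod C g = Cod C f" "p \<in> Arr C" "q \<in> Arr C"
    "Cod C p = Dom C f" "Cod C q = Dom C g" "Dom C q = Dom C p" "f \<cdot>\<^bsub>C\<^esub> p = g \<cdot>\<^bsub>C\<^esub> q"
  using assms unfolding is_pullback_def hom_def by auto

lemma pullback_lift:
  assumes "is_pullback C f g p q"
    and "h \<in> hom C T (Dom C f)" "k \<in> hom C T (Dom C g)" "f \<cdot>\<^bsub>C\<^esub> h = g \<cdot>\<^bsub>C\<^esub> k"
  obtains u where "u \<in> hom C T (Dom C p)" "p \<cdot>\<^bsub>C\<^esub> u = h" "q \<cdot>\<^bsub>C\<^esub> u = k"
proof -
  have "T \<in> Obj C" using homD(4)[OF assms(2)] .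
  then show ?thesis using assms that unfolding is_pullback_def by blast
qed

lemma pullback_eq:
  assumes "is_pullback C f g p q"
    and "u \<in> hom C T (Dom C p)" "v \<in> hom C T (Dom C p)" "p \<cdot>\<^bsub>C\<^esub> u = p \<cdot>\<^bsub>C\<^esub> v" "q \<cdot>\<^bsub>C\<^esub> u = q \<cdot>\<^bsub>C\<^esub> v"
  shows "u = v"
proof -
  note d = is_pullbackD[OF assms(1)] and u = homD[OF assms(2)] and v = homD[OF assms(3)]
  have "f \<cdot>\<^bsub>C\<^esub> (p \<cdot>\<^bsub>C\<^esub> u) = g \<cdot>\<^bsub>C\<^esub> (q \<cdot>\<^bsub>C\<^esub> u)"
    using d u by (simp add: assoc[symmetric])
  moreover have "p \<cdot>\<^bsub>C\<^esub> u \<in> hom C T (Dom C f)" "q \<cdot>\<^bsub>C\<^esub> u \<in> hom C T (Dom C g)"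
    using d u by (auto simp: hom_def)
  moreover have "T \<in> Obj C" by (fact u(4))
  ultimately have "\<exists>!w. w \<in> hom C T (Dom C p) \<and> p \<cdot>\<^bsub>C\<^esub> w = p \<cdot>\<^bsub>C\<^esub> u \<and> q \<cdot>\<^bsub>C\<^esub> w = q \<cdot>\<^bsub>C\<^esub> u"
    using assms(1) unfolding is_pullback_def by blast
  then show ?thesis using assms(2-5) by metis
qed

lemma pullback_swap:
  assumes "is_pullback C f g p q"
  shows "is_pullback C g f q p"
proof -
  note d = is_pullbackD[OF assms]
  show ?thesis
  proof (rule is_pullbackI)
    show "g \<in> hom C (Dom C g) (Cod C f)" "f \<in> hom C (Dom C f) (Cod C f)"
      "q \<in> hom C (Dom C p) (Dom C g)" "p \<in> hom C (Dom C p) (Dom C f)" "g \<cdot>\<^bsub>C\<^esub> q = f \<cdot>\<^bsub>C\<^esub> p"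
      using d by (auto simp: hom_def)
  next
    fix T h k assume "h \<in> hom C T (Dom C g)" "k \<in> hom C T (Dom C f)" "g \<cdot>\<^bsub>C\<^esub> h = f \<cdot>\<^bsub>C\<^esub> k"
    then show "\<exists>u\<in>hom C T (Dom C p). q \<cdot>\<^bsub>C\<^esub> u = h \<and> p \<cdot>\<^bsub>C\<^esub> u = k"
      by (metis pullback_lift[OF assms])
  qed (use pullback_eq[OF assms] in blast)
qed

text \<open>Base change along a composite is iterated base change. It serves to pull back along maps
  of the form g_0 \<circ> W(v), with v a vertex, when only the square over g_0 is given.\<close>

lemma pullback_paste:
  assumes 1: "is_pullback C f g p q" and 2: "is_pullback C q h r s"
  shows "is_pullback C f (g \<cdot>\<^bsub>C\<^esub> h) (p \<cdot>\<^bsub>C\<^esub> r) s"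
proof -
  note d = is_pullbackD[OF 1] is_pullbackD[OF 2]
  show ?thesis
  proof (rule is_pullbackI)
    show "f \<in> hom C (Dom C f) (Cod C f)" "g \<cdot>\<^bsub>C\<^esub> h \<in> hom C (Dom C h) (Cod C f)"
      "p \<cdot>\<^bsub>C\<^esub> r \<in> hom C (Dom C r) (Dom C f)" "s \<in> hom C (Dom C r) (Dom C h)"
      using d by (auto simp: hom_def)
    have "f \<cdot>\<^bsub>C\<^esub> (p \<cdot>\<^bsub>C\<^esub> r) = (f \<cdot>\<^bsub>C\<^esub> p) \<cdot>\<^bsub>C\<^esub> r" by (rule assoc[symmetric]) (use d in simp_all)
    also have "\<dots> = (g \<cdot>\<^bsub>C\<^esub> q) \<cdot>\<^bsub>C\<^esub> r" using d by simp
    also have "\<dots> = g \<cdot>\<^bsub>C\<^esub> (q \<cdot>\<^bsub>C\<^esub> r)" by (rule assoc) (use d in simp_all)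
    also have "\<dots> = g \<cdot>\<^bsub>C\<^esub> (h \<cdot>\<^bsub>C\<^esub> s)" using d by simp
    also have "\<dots> = (g \<cdot>\<^bsub>C\<^esub> h) \<cdot>\<^bsub>C\<^esub> s" by (rule assoc[symmetric]) (use d in simp_all)
    finally show "f \<cdot>\<^bsub>C\<^esub> (p \<cdot>\<^bsub>C\<^esub> r) = (g \<cdot>\<^bsub>C\<^esub> h) \<cdot>\<^bsub>C\<^esub> s" .
  next
    fix T x y assume x: "x \<in> hom C T (Dom C f)" and y: "y \<in> hom C T (Dom C h)"
      and xy: "f \<cdot>\<^bsub>C\<^esub> x = (g \<cdot>\<^bsub>C\<^esub> h) \<cdot>\<^bsub>C\<^esub> y"
    have hy: "h \<cdot>\<^bsub>C\<^esub> y \<in> hom C T (Dom C g)" "f \<cdot>\<^bsub>C\<^esub> x = g \<cdot>\<^bsub>C\<^esub> (h \<cdot>\<^bsub>C\<^esub> y)"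
      using homD[OF y] d xy by (auto simp: assoc hom_def)
    obtain v where v: "v \<in> hom C T (Dom C p)" "p \<cdot>\<^bsub>C\<^esub> v = x" "q \<cdot>\<^bsub>C\<^esub> v = h \<cdot>\<^bsub>C\<^esub> y"
      by (rule pullback_lift[OF 1 x hy])
    have "v \<in> hom C T (Dom C q)" using v d by simp
    then obtain u where u: "u \<in> hom C T (Dom C r)" "r \<cdot>\<^bsub>C\<^esub> u = v" "s \<cdot>\<^bsub>C\<^esub> u = y"
      using pullback_lift[OF 2 _ y v(3)] by blast
    moreover have "(p \<cdot>\<^bsub>C\<^esub> r) \<cdot>\<^bsub>C\<^esub> u = p \<cdot>\<^bsub>C\<^esub> (r \<cdot>\<^bsub>C\<^esub> u)"
      by (rule assoc) (use d homD[OF u(1)] in simp_all)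
    ultimately show "\<exists>u\<in>hom C T (Dom C r). (p \<cdot>\<^bsub>C\<^esub> r) \<cdot>\<^bsub>C\<^esub> u = x \<and> s \<cdot>\<^bsub>C\<^esub> u = y"
      using v by auto
  next
    fix T u v assume u: "u \<in> hom C T (Dom C r)" and v: "v \<in> hom C T (Dom C r)"
      and e: "(p \<cdot>\<^bsub>C\<^esub> r) \<cdot>\<^bsub>C\<^esub> u = (p \<cdot>\<^bsub>C\<^esub> r) \<cdot>\<^bsub>C\<^esub> v" "s \<cdot>\<^bsub>C\<^esub> u = s \<cdot>\<^bsub>C\<^esub> v"
    note uv = homD[OF u] homD[OF v]
    have "p \<cdot>\<^bsub>C\<^esub> (r \<cdot>\<^bsub>C\<^esub> u) = p \<cdot>\<^bsub>C\<^esub> (r \<cdot>\<^bsub>C\<^esub> v)" using e d uv by (simp add: assoc)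
    moreover have "q \<cdot>\<^bsub>C\<^esub> (r \<cdot>\<^bsub>C\<^esub> u) = q \<cdot>\<^bsub>C\<^esub> (r \<cdot>\<^bsub>C\<^esub> v)"
    proof -
      have "q \<cdot>\<^bsub>C\<^esub> (r \<cdot>\<^bsub>C\<^esub> x) = h \<cdot>\<^bsub>C\<^esub> (s \<cdot>\<^bsub>C\<^esub> x)" if "x \<in> hom C T (Dom C r)" for x
        using d homD[OF that] by (simp add: assoc[symmetric])
      then show ?thesis using u v e by simp
    qed
    ultimately have "r \<cdot>\<^bsub>C\<^esub> u = r \<cdot>\<^bsub>C\<^esub> v"
      by (intro pullback_eq[OF 1, of "r \<cdot>\<^bsub>C\<^esub> u" T "r \<cdot>\<^bsub>C\<^esub> v"] homI) (use d uv in simp_all)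
    then show "u = v" using pullback_eq[OF 2 u v] e by simp
  qed
qed

lemma pullback_unique:
  assumes 1: "is_pullback C f g p q" and 2: "is_pullback C f g p' q'"
  obtains i where "i \<in> hom C (Dom C p') (Dom C p)" "iso_arrow C i" "p \<cdot>\<^bsub>C\<^esub> i = p'" "q \<cdot>\<^bsub>C\<^esub> i = q'"
proof -
  note d = is_pullbackD[OF 1] is_pullbackD[OF 2]
  have p: "p \<in> hom C (Dom C p) (Dom C f)" "q \<in> hom C (Dom C p) (Dom C g)"
    "p' \<in> hom C (Dom C p') (Dom C f)" "q' \<in> hom C (Dom C p') (Dom C g)"
    using d by (auto simp: hom_def)
  obtain i where i: "i \<in> hom C (Dom C p') (Dom C p)" "p \<cdot>\<^bsub>C\<^esub> i = p'" "q \<cdot>\<^bsub>C\<^esub> i = q'"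
    using pullback_lift[OF 1 p(3,4)] d by metis
  obtain j where j: "j \<in> hom C (Dom C p) (Dom C p')" "p' \<cdot>\<^bsub>C\<^esub> j = p" "q' \<cdot>\<^bsub>C\<^esub> j = q"
    using pullback_lift[OF 2 p(1,2)] d by metis
  note ij = homD[OF i(1)] homD[OF j(1)]
  have "i \<cdot>\<^bsub>C\<^esub> j = Ident C (Dom C p)"
  proof (rule pullback_eq[OF 1, of _ "Dom C p"])
    show "p \<cdot>\<^bsub>C\<^esub> (i \<cdot>\<^bsub>C\<^esub> j) = p \<cdot>\<^bsub>C\<^esub> Ident C (Dom C p)" "q \<cdot>\<^bsub>C\<^esub> (i \<cdot>\<^bsub>C\<^esub> j) = q \<cdot>\<^bsub>C\<^esub> Ident C (Dom C p)"
      using i j d ij by (simp_all add: assoc[symmetric])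
  qed (use ij in \<open>auto simp: hom_def\<close>)
  moreover have "j \<cdot>\<^bsub>C\<^esub> i = Ident C (Dom C p')"
  proof (rule pullback_eq[OF 2, of _ "Dom C p'"])
    show "p' \<cdot>\<^bsub>C\<^esub> (j \<cdot>\<^bsub>C\<^esub> i) = p' \<cdot>\<^bsub>C\<^esub> Ident C (Dom C p')" "q' \<cdot>\<^bsub>C\<^esub> (j \<cdot>\<^bsub>C\<^esub> i) = q' \<cdot>\<^bsub>C\<^esub> Ident C (Dom C p')"
      using i j d ij by (simp_all add: assoc[symmetric])
  qed (use ij in \<open>auto simp: hom_def\<close>)
  ultimately have "iso_arrow C i" using iso_arrowI[OF i(1) j(1)] by simp
  then show ?thesis using that i by blast
qed

text \<open>Allows a square obtained by construction to be traded for a given one whose vertex is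
  merely isomorphic.\<close>

lemma pullback_iso:
  assumes 1: "is_pullback C f g p q" and i: "i \<in> hom C Z (Dom C p)" "iso_arrow C i"
  shows "is_pullback C f g (p \<cdot>\<^bsub>C\<^esub> i) (q \<cdot>\<^bsub>C\<^esub> i)"
proof -
  note d = is_pullbackD[OF 1] and ii = homD[OF i(1)]
  obtain j where j: "j \<in> hom C (Dom C p) Z" "j \<cdot>\<^bsub>C\<^esub> i = Ident C Z" "i \<cdot>\<^bsub>C\<^esub> j = Ident C (Dom C p)"
    using iso_arrow_inverse[OF i(2,1)] by blast
  show ?thesis
  proof (rule is_pullbackI)
    show "f \<in> hom C (Dom C f) (Cod C f)" "g \<in> hom C (Dom C g) (Cod C f)"
      "p \<cdot>\<^bsub>C\<^esub> i \<in> hom C Z (Dom C f)" "q \<cdot>\<^bsub>C\<^esub> i \<in> hom C Z (Dom C g)"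
      using d ii by (auto simp: hom_def)
    show "f \<cdot>\<^bsub>C\<^esub> (p \<cdot>\<^bsub>C\<^esub> i) = g \<cdot>\<^bsub>C\<^esub> (q \<cdot>\<^bsub>C\<^esub> i)" using d ii by (simp add: assoc[symmetric])
  next
    fix T x y assume x: "x \<in> hom C T (Dom C f)" "y \<in> hom C T (Dom C g)" "f \<cdot>\<^bsub>C\<^esub> x = g \<cdot>\<^bsub>C\<^esub> y"
    obtain u where u: "u \<in> hom C T (Dom C p)" "p \<cdot>\<^bsub>C\<^esub> u = x" "q \<cdot>\<^bsub>C\<^esub> u = y"
      by (rule pullback_lift[OF 1 x])
    have "i \<cdot>\<^bsub>C\<^esub> (j \<cdot>\<^bsub>C\<^esub> u) = u" using ii homD[OF u(1)] homD[OF j(1)] j by (simp add: assoc[symmetric])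
    then have "(p \<cdot>\<^bsub>C\<^esub> i) \<cdot>\<^bsub>C\<^esub> (j \<cdot>\<^bsub>C\<^esub> u) = x \<and> (q \<cdot>\<^bsub>C\<^esub> i) \<cdot>\<^bsub>C\<^esub> (j \<cdot>\<^bsub>C\<^esub> u) = y"
      using ii homD[OF u(1)] homD[OF j(1)] d u by (simp add: assoc)
    then show "\<exists>u\<in>hom C T Z. (p \<cdot>\<^bsub>C\<^esub> i) \<cdot>\<^bsub>C\<^esub> u = x \<and> (q \<cdot>\<^bsub>C\<^esub> i) \<cdot>\<^bsub>C\<^esub> u = y"
      using Comp_in[OF u(1) j(1)] by blast
  next
    fix T u v assume u: "u \<in> hom C T Z" and v: "v \<in> hom C T Z"
      and e: "(p \<cdot>\<^bsub>C\<^esub> i) \<cdot>\<^bsub>C\<^esub> u = (p \<cdot>\<^bsub>C\<^esub> i) \<cdot>\<^bsub>C\<^esub> v" "(q \<cdot>\<^bsub>C\<^esub> i) \<cdot>\<^bsub>C\<^esub> u = (q \<cdot>\<^bsub>C\<^esub> i) \<cdot>\<^bsub>C\<^esub> v"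
    note uv = homD[OF u] homD[OF v]
    have "i \<cdot>\<^bsub>C\<^esub> u = i \<cdot>\<^bsub>C\<^esub> v"
      by (rule pullback_eq[OF 1, of _ T]) (use d uv ii e in \<open>auto simp: assoc hom_def\<close>)
    then have "j \<cdot>\<^bsub>C\<^esub> (i \<cdot>\<^bsub>C\<^esub> u) = j \<cdot>\<^bsub>C\<^esub> (i \<cdot>\<^bsub>C\<^esub> v)" by simp
    then show "u = v" using j ii uv homD[OF j(1)] by (simp add: assoc[symmetric])
  qed
qed

text \<open>Exhibits an isomorphism as a base change of an identity, so that closure of covers under
  base change makes isomorphisms covers.\<close>

lemma pullback_Ident_iso:
  assumes i: "i \<in> hom C a b" "iso_arrow C i"
  shows "is_pullback C (Ident C b) (Ident C b) i i"
proof -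
  note ii = homD[OF i(1)]
  have "is_pullback C (Ident C b) (Ident C b) (Ident C b) (Ident C b)"
    by (rule is_pullbackI[where a=b and b=b and c=b and P=b]) (use ii in \<open>auto simp: hom_def\<close>)
  from pullback_iso[OF this, of i a] show ?thesis using i ii by simp
qed

lemma terminal_iso:
  assumes "terminal_object C t" "terminal_object C t'"
  obtains i where "i \<in> hom C t t'" "iso_arrow C i"
proof -
  have t: "t \<in> Obj C" "t' \<in> Obj C" using assms by (auto simp: terminal_object_def)
  obtain i j where ij: "i \<in> hom C t t'" "j \<in> hom C t' t"
    using assms unfolding terminal_object_def by blast
  have "j \<cdot>\<^bsub>C\<^esub> i = Ident C t" "i \<cdot>\<^bsub>C\<^esub> j = Ident C t'"
    using assms Comp_in[OF ij] Comp_in[OF ij(2,1)] Ident_in t unfolding terminal_object_def by blast+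
  then show ?thesis using that iso_arrowI[OF ij] ij by blast
qed

lemma terminal_iso_object:
  assumes t: "terminal_object C t" and i: "i \<in> hom C t t'" "iso_arrow C i"
  shows "terminal_object C t'"
  unfolding terminal_object_def
proof (intro conjI ballI)
  show "t' \<in> Obj C" using homD[OF i(1)] by simp
  fix a assume "a \<in> Obj C"
  then obtain x where x: "x \<in> hom C a t" and xu: "\<And>y. y \<in> hom C a t \<Longrightarrow> y = x"
    using t unfolding terminal_object_def by metis
  obtain j where j: "j \<in> hom C t' t" "i \<cdot>\<^bsub>C\<^esub> j = Ident C t'"
    using iso_arrow_inverse[OF i(2,1)] by blast
  have "y = i \<cdot>\<^bsub>C\<^esub> x" if y: "y \<in> hom C a t'" for y
  proof -
    have "y = i \<cdot>\<^bsub>C\<^esub> (j \<cdot>\<^bsub>C\<^esub> y)"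
      using j homD[OF j(1)] homD[OF i(1)] homD[OF y] by (simp add: assoc[symmetric])
    then show ?thesis using xu[OF Comp_in[OF y j(1)]] by simp
  qed
  then show "\<exists>!y. y \<in> hom C a t'" using Comp_in[OF x i(1)] by blast
qed

end

context cat_functor
begin

lemma FArr_simps [simp]:
  assumes "f \<in> Arr C"
  shows "FArr F f \<in> Arr D" "Dom D (FArr F f) = FObj F (Dom C f)" "Cod D (FArr F f) = FObj F (Cod C f)"
  using FArr_in[OF dom.Arr_hom[OF assms]] by (auto simp: hom_def)

lemma FArr_iso:
  assumes i: "i \<in> hom C a b" "iso_arrow C i"
  shows "iso_arrow D (FArr F i)"
proof -
  obtain j where j: "j \<in> hom C b a" "j \<cdot>\<^bsub>C\<^esub> i = Ident C a" "i \<cdot>\<^bsub>C\<^esub> j = Ident C b"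
    using dom.iso_arrow_inverse[OF i(2,1)] by blast
  have ab: "a \<in> Obj C" "b \<in> Obj C" using dom.homD[OF i(1)] by auto
  show ?thesis
    by (rule cod.iso_arrowI[OF FArr_in[OF i(1)] FArr_in[OF j(1)]])
      (use i j ab FArr_Ident FArr_Comp in metis)+
qed

end

section \<open>Finite limits\<close>

text \<open>Finite limits are quantified over categories on natural numbers, so terminal objects
  need a concrete empty diagram. Its operations are arbitrary because there are no arrows.\<close>

definition empty_category :: "(nat, nat) category" where
  "empty_category = \<lparr>Obj = {}, Arr = {}, Dom = id, Cod = id, Ident = id, Comp = (\<lambda>g f. f)\<rparr>"

text \<open>The arrows 0, 1, 2 are the identities of the objects; 3 and 4 are the legs from 0
  and 1 to 2.\<close>

definition cospan :: "(nat, nat) category" where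
  "cospan = \<lparr>Obj = {0, 1, 2}, Arr = {0, 1, 2, 3, 4},
     Dom = (\<lambda>a. if a = 3 then 0 else if a = 4 then 1 else a),
     Cod = (\<lambda>a. if a = 3 \<or> a = 4 then 2 else a),
     Ident = (\<lambda>i. i), Comp = (\<lambda>g f. if g = 3 \<or> g = 4 then g else f)\<rparr>"

definition cospan_functor :: "('o, 'm) category \<Rightarrow> 'm \<Rightarrow> 'm \<Rightarrow> (nat, nat, 'o, 'm) cat_functor" where
  "cospan_functor C f g =
     \<lparr>FObj = (\<lambda>i. if i = 0 then Dom C f else if i = 1 then Dom C g else Cod C f),
      FArr = (\<lambda>a. if a = 3 then f else if a = 4 then g else if a = 0 then Ident C (Dom C f)
                  else if a = 1 then Ident C (Dom C g) else Ident C (Cod C f))\<rparr>"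

lemma finite_empty_category: "finite_category empty_category"
  unfolding finite_category_def
  by (auto simp: empty_category_def hom_def intro!: category.intro)

lemma finite_cospan: "finite_category cospan"
  unfolding finite_category_def
proof (intro conjI)
  show "category cospan"
    by (rule category.intro) (auto simp: cospan_def hom_def split: if_splits)
qed (auto simp: cospan_def)

context category
begin

lemma empty_functor: "cat_functor empty_category C G"
proof -
  interpret J: category empty_category using finite_empty_category by (simp add: finite_category_def)
  show ?thesis by unfold_locales (auto simp: empty_category_def hom_def)
qed

lemma empty_limit_iff: "is_limit C empty_category G L p \<longleftrightarrow> terminal_object C L"
  unfolding is_limit_def is_cone_def terminal_object_def by (auto simp: empty_category_def)

lemma cospan_functor:
  assumes "f \<in> Arr C" "g \<in> Arr C" "Cod C f = Cod C g"
  shows "cat_functor cospan C (cospan_functor C f g)"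
proof -
  interpret J: category cospan using finite_cospan by (simp add: finite_category_def)
  have o: "Dom C f \<in> Obj C" "Dom C g \<in> Obj C" "Cod C f \<in> Obj C"
    using assms Dom_in Cod_in by auto
  show ?thesis
  proof unfold_locales
    show "FArr (cospan_functor C f g) (h \<cdot>\<^bsub>cospan\<^esub> k) =
        FArr (cospan_functor C f g) h \<cdot>\<^bsub>C\<^esub> FArr (cospan_functor C f g) k"
      if "k \<in> hom cospan a b" "h \<in> hom cospan b c" for h k a b c
      using that assms o by (auto simp: cospan_def cospan_functor_def hom_def split: if_splits)
  qed (use assms o in \<open>auto simp: cospan_def cospan_functor_def hom_def split: if_splits\<close>)
qed

text \<open>A cone over the cospan is determined by its components at 0 and 1: the component at 2 is
  forced by either leg, and the identities impose nothing. With this description of cones the two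
  universal properties coincide.\<close>

lemma cospan_limit_pullback:
  assumes G: "cat_functor cospan C G" and L: "is_limit C cospan G L p"
  shows "is_pullback C (FArr G 3) (FArr G 4) (p 0) (p 1)"
proof -
  interpret G: cat_functor cospan C G by (fact G)
  have f: "FArr G 3 \<in> hom C (FObj G 0) (FObj G 2)" "FArr G 4 \<in> hom C (FObj G 1) (FObj G 2)"
    by (auto intro!: G.FArr_in simp: cospan_def hom_def)
  have i: "FArr G 0 = Ident C (FObj G 0)" "FArr G 1 = Ident C (FObj G 1)"
    "FArr G 2 = Ident C (FObj G 2)"
    using G.FArr_Ident[of 0] G.FArr_Ident[of 1] G.FArr_Ident[of 2] by (auto simp: cospan_def)
  have cone: "is_cone C cospan G T h \<longleftrightarrow> T \<in> Obj C \<and> h 0 \<in> hom C T (FObj G 0)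
      \<and> h 1 \<in> hom C T (FObj G 1) \<and> h 2 \<in> hom C T (FObj G 2)
      \<and> FArr G 3 \<cdot>\<^bsub>C\<^esub> h 0 = h 2 \<and> FArr G 4 \<cdot>\<^bsub>C\<^esub> h 1 = h 2" for T h
    unfolding is_cone_def using i by (auto simp: cospan_def hom_def)
  have p: "p 0 \<in> hom C L (FObj G 0)" "p 1 \<in> hom C L (FObj G 1)" "p 2 \<in> hom C L (FObj G 2)"
    "FArr G 3 \<cdot>\<^bsub>C\<^esub> p 0 = p 2" "FArr G 4 \<cdot>\<^bsub>C\<^esub> p 1 = p 2"
    using L cone unfolding is_limit_def by auto
  have ex: "\<exists>!u. u \<in> hom C T L \<and> (\<forall>i\<in>Obj cospan. p i \<cdot>\<^bsub>C\<^esub> u = h i)" if "is_cone C cospan G T h" for T h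
    using L that unfolding is_limit_def by blast
  have ob: "Obj cospan = {0, 1, 2}" by (simp add: cospan_def)
  show ?thesis
  proof (rule is_pullbackI[OF f p(1,2)])
    show "FArr G 3 \<cdot>\<^bsub>C\<^esub> p 0 = FArr G 4 \<cdot>\<^bsub>C\<^esub> p 1" using p by simp
  next
    fix T h k assume h: "h \<in> hom C T (FObj G 0)" and k: "k \<in> hom C T (FObj G 1)"
      and e: "FArr G 3 \<cdot>\<^bsub>C\<^esub> h = FArr G 4 \<cdot>\<^bsub>C\<^esub> k"
    have "is_cone C cospan G T (\<lambda>i. if i = 0 then h else if i = 1 then k else FArr G 3 \<cdot>\<^bsub>C\<^esub> h)"
      unfolding cone using homD(4)[OF h] h k e Comp_in[OF h f(1)] by simp
    from ex[OF this] obtain u where "u \<in> hom C T L"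
      "\<forall>i\<in>Obj cospan. p i \<cdot>\<^bsub>C\<^esub> u = (if i = 0 then h else if i = 1 then k else FArr G 3 \<cdot>\<^bsub>C\<^esub> h)"
      by blast
    then show "\<exists>u\<in>hom C T L. p 0 \<cdot>\<^bsub>C\<^esub> u = h \<and> p 1 \<cdot>\<^bsub>C\<^esub> u = k" using ob by auto
  next
    fix T u v assume u: "u \<in> hom C T L" and v: "v \<in> hom C T L"
      and e: "p 0 \<cdot>\<^bsub>C\<^esub> u = p 0 \<cdot>\<^bsub>C\<^esub> v" "p 1 \<cdot>\<^bsub>C\<^esub> u = p 1 \<cdot>\<^bsub>C\<^esub> v"
    have 2: "p 2 \<cdot>\<^bsub>C\<^esub> u = FArr G 3 \<cdot>\<^bsub>C\<^esub> (p 0 \<cdot>\<^bsub>C\<^esub> u)" "FArr G 4 \<cdot>\<^bsub>C\<^esub> (p 1 \<cdot>\<^bsub>C\<^esub> u) = p 2 \<cdot>\<^bsub>C\<^esub> u"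
      if "u \<in> hom C T L" for u
      using Comp_assoc[OF that p(1) f(1)] Comp_assoc[OF that p(2) f(2)] p by auto
    have "is_cone C cospan G T (\<lambda>i. p i \<cdot>\<^bsub>C\<^esub> u)"
      unfolding cone using homD(4)[OF u] Comp_in[OF u p(1)] Comp_in[OF u p(2)] Comp_in[OF u p(3)]
        2[OF u] by simp
    moreover have "\<forall>i\<in>Obj cospan. p i \<cdot>\<^bsub>C\<^esub> v = p i \<cdot>\<^bsub>C\<^esub> u"
      using e 2(1)[OF u] 2(1)[OF v] unfolding ob by simp
    ultimately show "u = v" using ex[of T "\<lambda>i. p i \<cdot>\<^bsub>C\<^esub> u"] u v by blast
  qed
qed

lemma pullback_cospan_limit:
  assumes "is_pullback C f g p q"
  shows "is_limit C cospan (cospan_functor C f g) (Dom C p)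
    (\<lambda>i. if i = 0 then p else if i = 1 then q else f \<cdot>\<^bsub>C\<^esub> p)"
proof -
  note d = is_pullbackD[OF assms]
  let ?G = "cospan_functor C f g" and ?p = "\<lambda>i. if i = (0::nat) then p else if i = 1 then q else f \<cdot>\<^bsub>C\<^esub> p"
  have ob: "Obj cospan = {0, 1, 2}" by (simp add: cospan_def)
  have cone: "is_cone C cospan ?G T h \<longleftrightarrow> T \<in> Obj C \<and> h 0 \<in> hom C T (Dom C f)
      \<and> h 1 \<in> hom C T (Dom C g) \<and> h 2 \<in> hom C T (Cod C f) \<and> f \<cdot>\<^bsub>C\<^esub> h 0 = h 2 \<and> g \<cdot>\<^bsub>C\<^esub> h 1 = h 2" for T h
    unfolding is_cone_def by (auto simp: cospan_def cospan_functor_def hom_def)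
  have pc: "is_cone C cospan ?G (Dom C p) ?p"
    unfolding cone using d Dom_in by (auto simp: hom_def)
  have "\<exists>!u. u \<in> hom C T (Dom C p) \<and> (\<forall>i\<in>Obj cospan. ?p i \<cdot>\<^bsub>C\<^esub> u = h i)"
    if h: "is_cone C cospan ?G T h" for T h
  proof -
    have h': "h 0 \<in> hom C T (Dom C f)" "h 1 \<in> hom C T (Dom C g)" "f \<cdot>\<^bsub>C\<^esub> h 0 = h 2" "g \<cdot>\<^bsub>C\<^esub> h 1 = h 2"
      using h cone by auto
    then obtain u where u: "u \<in> hom C T (Dom C p)" "p \<cdot>\<^bsub>C\<^esub> u = h 0" "q \<cdot>\<^bsub>C\<^esub> u = h 1"
      by (metis pullback_lift[OF assms])
    have "(f \<cdot>\<^bsub>C\<^esub> p) \<cdot>\<^bsub>C\<^esub> u = h 2" using u h' d homD[OF u(1)] by (simp add: assoc)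
    then show ?thesis
      using u pullback_eq[OF assms] unfolding ob by (intro ex1I[of _ u]) auto
  qed
  then show ?thesis unfolding is_limit_def using pc by blast
qed

lemma finite_limits_terminal:
  assumes "has_finite_limits C" shows "\<exists>t. terminal_object C t"
  using assms finite_empty_category empty_functor empty_limit_iff
  unfolding has_finite_limits_def by blast

lemma finite_limits_pullback:
  assumes "has_finite_limits C" "f \<in> Arr C" "g \<in> Arr C" "Cod C f = Cod C g"
  shows "\<exists>p q. is_pullback C f g p q"
proof -
  note G = cospan_functor[OF assms(2-4)]
  obtain L p where "is_limit C cospan (cospan_functor C f g) L p"
    using assms(1) finite_cospan G unfolding has_finite_limits_def by blast
  from cospan_limit_pullback[OF G this] show ?thesis by (auto simp: cospan_functor_def)
qed

end

section \<open>Functors that preserve finite limits\<close>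

context cat_functor
begin

lemma comp_functor: "cat_functor J C G \<Longrightarrow> cat_functor J D (comp_functor F G)"
proof -
  assume "cat_functor J C G"
  then interpret G: cat_functor J C G .
  show ?thesis
  proof unfold_locales
    show "FArr (comp_functor F G) (g \<cdot>\<^bsub>J\<^esub> f) = FArr (comp_functor F G) g \<cdot>\<^bsub>D\<^esub> FArr (comp_functor F G) f"
      if "f \<in> hom J a b" "g \<in> hom J b c" for f g a b c
      using FArr_Comp[OF G.FArr_in[OF that(1)] G.FArr_in[OF that(2)]] G.FArr_Comp[OF that]
      by (simp add: comp_functor_def)
  qed (auto simp: comp_functor_def G.FObj_in FObj_in G.FArr_in FArr_in G.FArr_Ident FArr_Ident)
qed

lemma preserves_finite_limits_terminal:
  assumes "preserves_finite_limits C D F" shows "preserves_terminal C D F"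
  unfolding preserves_terminal_def
  using assms finite_empty_category dom.empty_functor dom.empty_limit_iff cod.empty_limit_iff
  unfolding preserves_finite_limits_def by blast

lemma preserves_finite_limits_pullback:
  assumes F: "preserves_finite_limits C D F" and p: "is_pullback C f g p q"
  shows "is_pullback D (FArr F f) (FArr F g) (FArr F p) (FArr F q)"
proof -
  note d = dom.is_pullbackD[OF p]
  have G: "cat_functor cospan C (cospan_functor C f g)" using dom.cospan_functor d by simp
  have "is_limit D cospan (comp_functor F (cospan_functor C f g)) (FObj F (Dom C p))
      (\<lambda>i. FArr F (if i = 0 then p else if i = 1 then q else f \<cdot>\<^bsub>C\<^esub> p))"
    using F finite_cospan G dom.pullback_cospan_limit[OF p]
    unfolding preserves_finite_limits_def by blast
  from cod.cospan_limit_pullback[OF comp_functor[OF G] this]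
  show ?thesis by (simp add: comp_functor_def cospan_functor_def)
qed

end


section \<open>Covers\<close>

text \<open>The common ground of categories with covers and descent categories, so that one
  development applies on both sides of the functor. In both cases the covers contain the identities
  as a derived fact.\<close>

locale cover_category = category C
  for C :: "('o, 'm) category" and S :: "'m set" +
  assumes covers: "subcategory C S"
    and Ident_cover: "a \<in> Obj C \<Longrightarrow> Ident C a \<in> S"
    and pullback_exists: "f \<in> S \<Longrightarrow> g \<in> Arr C \<Longrightarrow> Cod C f = Cod C g \<Longrightarrow> \<exists>p q. is_pullback C f g p q"
    and base_change: "f \<in> S \<Longrightarrow> is_pullback C f g p q \<Longrightarrow> q \<in> S"
begin

lemma cover_Comp: "f \<in> S \<Longrightarrow> g \<in> S \<Longrightarrow> Cod C f = Dom C g \<Longrightarrow> g \<cdot>\<^bsub>C\<^esub> f \<in> S"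
  using covers by (auto simp: subcategory_def)

lemma iso_cover: "iso_arrow C i \<Longrightarrow> i \<in> S"
  using base_change[OF Ident_cover pullback_Ident_iso[of i "Dom C i" "Cod C i"]] Cod_in
  by (auto simp: iso_arrow_def hom_def)

end

lemma (in category_with_covers) cover_category: "cover_category C S"
proof
  show "Ident C a \<in> S" if "a \<in> Obj C" for a
  proof -
    \<comment> \<open>A subcategory contains the identity of the domain of each of its members, and
      a \<rightarrow> * is a member.\<close>
    obtain t where t: "terminal_object C t" using has_terminal by blast
    then obtain f where f: "f \<in> hom C a t" using \<open>a \<in> Obj C\<close> by (auto simp: terminal_object_def)
    then have "f \<in> S" using to_terminal_cover[OF t] by (simp add: hom_def)
    then show ?thesis using covers_subcategory f by (auto simp: subcategory_def hom_def)
  qed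
qed (fact covers_subcategory cover_pullback_exists cover_base_change)+

lemma (in descent_category) cover_category: "cover_category D S"
proof
  show "Ident D a \<in> S" if a: "a \<in> Obj D" for a
  proof -
    obtain t where t: "terminal_object D t" using finite_limits_terminal[OF finite_limits] by blast
    then obtain f where f: "f \<in> hom D a t" using a by (auto simp: terminal_object_def)
    note ff = homD[OF f]
    \<comment> \<open>The identity of \<open>a\<close> is the base change along a \<rightarrow> * of
      the identity of the terminal object, which is a cover by axiom.\<close>
    have "is_pullback D (Ident D t) f f (Ident D a)"
      by (rule is_pullbackI[where a=t and b=a and c=t and P=a]) (use ff in \<open>auto simp: hom_def\<close>)
    then show ?thesis using cover_base_change terminal_Ident_cover[OF t] by blast
  qed
  show "\<exists>p q. is_pullback D f g p q" if "f \<in> S" "g \<in> Arr D" "Cod D f = Cod D g" for f g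
    using finite_limits_pullback[OF finite_limits] that covers_subcategory
    by (auto simp: subcategory_def)
qed (fact covers_subcategory cover_base_change)+

section \<open>Simplicial objects\<close>

abbreviation delta_fun :: "delta_arr \<Rightarrow> nat \<Rightarrow> nat" where
  "delta_fun \<theta> \<equiv> snd (snd \<theta>)"

definition delta_map :: "nat \<Rightarrow> nat \<Rightarrow> (nat \<Rightarrow> nat) \<Rightarrow> delta_arr" where
  "delta_map m n \<phi> = (m, n, restrict \<phi> {..m})"

lemma Delta_Obj [simp]: "n \<in> Obj Delta"
  by (simp add: Delta_def)

lemma Delta_hom_iff:
  "\<theta> \<in> hom Delta m n \<longleftrightarrow> (\<exists>\<phi>. \<theta> = (m, n, \<phi>) \<and> \<phi> \<in> {..m} \<rightarrow>\<^sub>E {..n} \<and> mono_on {..m} \<phi>)"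
  by (cases \<theta>) (auto simp: Delta_def hom_def)

lemma delta_map_hom:
  assumes "\<And>i. i \<le> m \<Longrightarrow> \<phi> i \<le> n" "\<And>i j. i \<le> j \<Longrightarrow> j \<le> m \<Longrightarrow> \<phi> i \<le> \<phi> j"
  shows "delta_map m n \<phi> \<in> hom Delta m n"
  using assms by (auto simp: Delta_hom_iff delta_map_def mono_on_def)

lemma delta_fun_map [simp]: "i \<le> m \<Longrightarrow> delta_fun (delta_map m n \<phi>) i = \<phi> i"
  by (simp add: delta_map_def)

lemma delta_fun_le: "\<theta> \<in> hom Delta m n \<Longrightarrow> i \<le> m \<Longrightarrow> delta_fun \<theta> i \<le> n"
  by (auto simp: Delta_hom_iff PiE_iff)

lemma delta_fun_mono: "\<theta> \<in> hom Delta m n \<Longrightarrow> i \<le> j \<Longrightarrow> j \<le> m \<Longrightarrow> delta_fun \<theta> i \<le> delta_fun \<theta> j"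
  by (auto simp: Delta_hom_iff mono_on_def)

lemma delta_eqI:
  assumes "\<theta> \<in> hom Delta m n" "\<theta>' \<in> hom Delta m n"
    and "\<And>i. i \<le> m \<Longrightarrow> delta_fun \<theta> i = delta_fun \<theta>' i"
  shows "\<theta> = \<theta>'"
proof -
  obtain t t' where e: "\<theta> = (m, n, t)" "\<theta>' = (m, n, t')" and t: "t \<in> {..m} \<rightarrow>\<^sub>E {..n}" "t' \<in> {..m} \<rightarrow>\<^sub>E {..n}"
    using assms(1,2) by (auto simp: Delta_hom_iff)
  have "t = t'" by (rule PiE_ext[OF t]) (use assms(3) e in auto)
  then show ?thesis by (simp add: e)
qed

lemma delta_Comp:
  assumes "\<theta> \<in> hom Delta k m" "\<phi> \<in> hom Delta m n"
  shows "\<phi> \<cdot>\<^bsub>Delta\<^esub> \<theta> \<in> hom Delta k n"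
    and "i \<le> k \<Longrightarrow> delta_fun (\<phi> \<cdot>\<^bsub>Delta\<^esub> \<theta>) i = delta_fun \<phi> (delta_fun \<theta> i)"
proof -
  obtain t p where e: "\<theta> = (k, m, t)" "\<phi> = (m, n, p)" and t: "t \<in> {..k} \<rightarrow>\<^sub>E {..m}" "mono_on {..k} t"
    and p: "p \<in> {..m} \<rightarrow>\<^sub>E {..n}" "mono_on {..m} p"
    using assms by (auto simp: Delta_hom_iff)
  have c: "\<phi> \<cdot>\<^bsub>Delta\<^esub> \<theta> = (k, n, compose {..k} p t)" by (simp add: Delta_def e)
  show "\<phi> \<cdot>\<^bsub>Delta\<^esub> \<theta> \<in> hom Delta k n"
    using t p unfolding c Delta_hom_iff by (fastforce simp: compose_def mono_on_def PiE_iff)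
  show "i \<le> k \<Longrightarrow> delta_fun (\<phi> \<cdot>\<^bsub>Delta\<^esub> \<theta>) i = delta_fun \<phi> (delta_fun \<theta> i)"
    unfolding c by (simp add: e compose_def)
qed

lemma delta_Ident:
  shows "Ident Delta n \<in> hom Delta n n"
    and "i \<le> n \<Longrightarrow> delta_fun (Ident Delta n) i = i"
  by (auto simp: Delta_def hom_def mono_on_def)

interpretation Delta: category Delta
proof
  show "\<phi> \<cdot>\<^bsub>Delta\<^esub> \<theta> \<in> hom Delta a c" if "\<theta> \<in> hom Delta a b" "\<phi> \<in> hom Delta b c" for \<theta> \<phi> a b c
    using delta_Comp that by blast
  show "Ident Delta b \<cdot>\<^bsub>Delta\<^esub> \<theta> = \<theta>" if "\<theta> \<in> hom Delta a b" for \<theta> a b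
    by (rule delta_eqI[OF delta_Comp(1)[OF that delta_Ident(1)] that])
      (simp add: delta_Comp(2)[OF that delta_Ident(1)] delta_Ident(2)[OF delta_fun_le[OF that]])
  show "\<theta> \<cdot>\<^bsub>Delta\<^esub> Ident Delta a = \<theta>" if "\<theta> \<in> hom Delta a b" for \<theta> a b
    by (rule delta_eqI[OF delta_Comp(1)[OF delta_Ident(1) that] that])
      (simp add: delta_Comp(2)[OF delta_Ident(1) that] delta_Ident(2))
  show "(h \<cdot>\<^bsub>Delta\<^esub> g) \<cdot>\<^bsub>Delta\<^esub> f = h \<cdot>\<^bsub>Delta\<^esub> (g \<cdot>\<^bsub>Delta\<^esub> f)"
    if f: "f \<in> hom Delta a b" and g: "g \<in> hom Delta b c" and h: "h \<in> hom Delta c d"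
    for f g h a b c d
  proof -
    note gf = delta_Comp[OF f g] and hg = delta_Comp[OF g h]
    show ?thesis
      by (rule delta_eqI[OF delta_Comp(1)[OF f hg(1)] delta_Comp(1)[OF gf(1) h]])
        (simp add: delta_Comp(2)[OF f hg(1)] delta_Comp(2)[OF gf(1) h] gf(2) hg(2) delta_fun_le[OF f])
  qed
qed (use delta_Ident in simp_all)

lemma delta_image_hom: "\<theta> \<in> hom Delta m n \<Longrightarrow> delta_image \<theta> = delta_fun \<theta> ` {..m}"
  by (auto simp: delta_image_def Delta_hom_iff)

lemma delta_image_subset: "\<theta> \<in> hom Delta m n \<Longrightarrow> delta_image \<theta> \<subseteq> {..n}"
  using delta_fun_le[of \<theta> m n] by (auto simp: delta_image_hom)

lemma delta_image_Comp:
  "\<theta> \<in> hom Delta k m \<Longrightarrow> \<phi> \<in> hom Delta m n \<Longrightarrow> delta_image (\<phi> \<cdot>\<^bsub>Delta\<^esub> \<theta>) = delta_fun \<phi> ` delta_image \<theta>"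
  using delta_Comp[of \<theta> k m \<phi> n] by (auto simp: delta_image_hom image_image intro!: image_cong)

lemma to_point_hom: "to_point n \<in> hom Delta n 0"
  by (auto simp: to_point_def Delta_hom_iff mono_on_def)

lemma delta_to_point: "\<theta> \<in> hom Delta n 0 \<Longrightarrow> \<theta> = to_point n"
  using delta_fun_le[of \<theta> n 0] by (intro delta_eqI[OF _ to_point_hom]) (auto simp: to_point_def)

lemma coface_hom: "i \<le> Suc n \<Longrightarrow> coface n i \<in> hom Delta n (Suc n)"
  by (auto simp: coface_def Delta_hom_iff mono_on_def)

definition vertex :: "nat \<Rightarrow> nat \<Rightarrow> delta_arr" where
  "vertex n k = delta_map 0 n (\<lambda>_. k)"

lemma vertex_hom: "k \<le> n \<Longrightarrow> vertex n k \<in> hom Delta 0 n"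
  unfolding vertex_def by (rule delta_map_hom) auto

lemma vertex_Comp:
  assumes "\<theta> \<in> hom Delta m n" "i \<le> m"
  shows "\<theta> \<cdot>\<^bsub>Delta\<^esub> vertex m i = vertex n (delta_fun \<theta> i)"
  by (rule delta_eqI[OF delta_Comp(1)[OF vertex_hom assms(1)] vertex_hom])
    (use assms delta_fun_le[OF assms] delta_Comp(2)[OF vertex_hom[OF assms(2)] assms(1)] in \<open>simp_all add: vertex_def\<close>)

section \<open>Simplicial objects and maps with values in a category\<close>

context category
begin

lemma sobj_hom:
  assumes "X \<in> simplicial_objects C" "\<theta> \<in> hom Delta m n"
  shows "FArr X \<theta> \<in> hom C (FObj X n) (FObj X m)"
  using assms cat_functor.FArr_in[of "opp Delta" C X \<theta> n m]
  by (auto simp: simplicial_objects_def opp_def hom_def)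

lemma sobj_Obj:
  assumes "X \<in> simplicial_objects C" shows "FObj X n \<in> Obj C"
  using homD(4)[OF sobj_hom[OF assms delta_Ident(1)]] by blast

lemma sobj_Comp:
  assumes X: "X \<in> simplicial_objects C" and "\<theta> \<in> hom Delta k m" "\<phi> \<in> hom Delta m n"
  shows "FArr X (\<phi> \<cdot>\<^bsub>Delta\<^esub> \<theta>) = FArr X \<theta> \<cdot>\<^bsub>C\<^esub> FArr X \<phi>"
  using assms cat_functor.FArr_Comp[of "opp Delta" C X \<phi> n m \<theta> k]
  by (auto simp: simplicial_objects_def opp_def hom_def)

lemma sobj_Ident:
  assumes X: "X \<in> simplicial_objects C"
  shows "FArr X (Ident Delta n) = Ident C (FObj X n)"
  using assms cat_functor.FArr_Ident[of "opp Delta" C X n]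
  by (auto simp: simplicial_objects_def opp_def)

text \<open>Contravariance is unfolded once here, so that simplicial objects can be constructed with
  equations phrased in \<open>Delta\<close> itself.\<close>

lemma sobjI:
  assumes hom: "\<And>\<theta> m n. \<theta> \<in> hom Delta m n \<Longrightarrow> FArr X \<theta> \<in> hom C (FObj X n) (FObj X m)"
    and Ident: "\<And>n. FArr X (Ident Delta n) = Ident C (FObj X n)"
    and Comp: "\<And>\<theta> \<phi> k m n. \<theta> \<in> hom Delta k m \<Longrightarrow> \<phi> \<in> hom Delta m n \<Longrightarrow>
      FArr X (\<phi> \<cdot>\<^bsub>Delta\<^esub> \<theta>) = FArr X \<theta> \<cdot>\<^bsub>C\<^esub> FArr X \<phi>"
    and ext: "FArr X \<in> extensional (Arr Delta)"
  shows "X \<in> simplicial_objects C"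
proof -
  have h: "f \<in> hom (opp Delta) a b \<longleftrightarrow> f \<in> hom Delta b a" for f a b
    by (auto simp: opp_def hom_def)
  have "cat_functor (opp Delta) C X"
  proof unfold_locales
    show "f \<in> Arr (opp Delta) \<Longrightarrow> Dom (opp Delta) f \<in> Obj (opp Delta)"
      "f \<in> Arr (opp Delta) \<Longrightarrow> Cod (opp Delta) f \<in> Obj (opp Delta)" for f
      by (simp_all add: opp_def)
    show "Ident (opp Delta) a \<in> hom (opp Delta) a a" for a
      using delta_Ident(1) by (simp add: h) (simp add: opp_def)
    show "FObj X a \<in> Obj C" for a using homD(4)[OF hom[OF delta_Ident(1)]] .
    fix f g k a b c d
    assume f: "f \<in> hom (opp Delta) a b" and g: "g \<in> hom (opp Delta) b c"
    have c: "g \<cdot>\<^bsub>opp Delta\<^esub> f = f \<cdot>\<^bsub>Delta\<^esub> g" for f g by (simp add: opp_def)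
    show "g \<cdot>\<^bsub>opp Delta\<^esub> f \<in> hom (opp Delta) a c"
      using f g delta_Comp(1) unfolding c h by blast
    show "FArr X (g \<cdot>\<^bsub>opp Delta\<^esub> f) = FArr X g \<cdot>\<^bsub>C\<^esub> FArr X f"
      unfolding c using f g Comp h by blast
    show "k \<in> hom (opp Delta) c d \<Longrightarrow> (k \<cdot>\<^bsub>opp Delta\<^esub> g) \<cdot>\<^bsub>opp Delta\<^esub> f = k \<cdot>\<^bsub>opp Delta\<^esub> (g \<cdot>\<^bsub>opp Delta\<^esub> f)"
      unfolding c using Delta.Comp_assoc f g h by metis
  next
    fix f a b assume f: "f \<in> hom (opp Delta) a b"
    show "Ident (opp Delta) b \<cdot>\<^bsub>opp Delta\<^esub> f = f" "f \<cdot>\<^bsub>opp Delta\<^esub> Ident (opp Delta) a = f"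
      using f Delta.Ident_left Delta.Ident_right unfolding h by (auto simp: opp_def)
    show "FArr X f \<in> hom C (FObj X a) (FObj X b)" using hom f h by blast
  next
    show "FArr X (Ident (opp Delta) a) = Ident C (FObj X a)" for a
      using Ident by (simp add: opp_def)
  qed
  then show ?thesis using ext by (simp add: simplicial_objects_def)
qed

lemma smapD:
  assumes "(X, Y, f) \<in> Arr (simplicial_category C)"
  shows "X \<in> simplicial_objects C" "Y \<in> simplicial_objects C"
    "f n \<in> hom C (FObj X n) (FObj Y n)"
    "\<theta> \<in> hom Delta m n \<Longrightarrow> f m \<cdot>\<^bsub>C\<^esub> FArr X \<theta> = FArr Y \<theta> \<cdot>\<^bsub>C\<^esub> f n"
  using assms by (auto simp: simplicial_category_def hom_def)

lemma smapI:
  assumes "X \<in> simplicial_objects C" "Y \<in> simplicial_objects C"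
    and "\<And>n. f n \<in> hom C (FObj X n) (FObj Y n)"
    and "\<And>\<theta> m n. \<theta> \<in> hom Delta m n \<Longrightarrow> f m \<cdot>\<^bsub>C\<^esub> FArr X \<theta> = FArr Y \<theta> \<cdot>\<^bsub>C\<^esub> f n"
  shows "(X, Y, f) \<in> Arr (simplicial_category C)"
  using assms by (auto simp: simplicial_category_def hom_def)

lemma smap_Comp:
  assumes f: "(X, Y, f) \<in> Arr (simplicial_category C)" and g: "(Y, Z, g) \<in> Arr (simplicial_category C)"
  shows "(X, Z, \<lambda>n. g n \<cdot>\<^bsub>C\<^esub> f n) \<in> Arr (simplicial_category C)"
proof (rule smapI)
  note f' = smapD(3,4)[OF f] and g' = smapD(3,4)[OF g]
  show "X \<in> simplicial_objects C" "Z \<in> simplicial_objects C" using smapD f g by blast+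
  show "g n \<cdot>\<^bsub>C\<^esub> f n \<in> hom C (FObj X n) (FObj Z n)" for n using Comp_in f' g' by blast
  fix \<theta> m n assume t: "\<theta> \<in> hom Delta m n"
  note X = sobj_hom[OF smapD(1)[OF f] t] and Y = sobj_hom[OF smapD(2)[OF f] t]
    and Z = sobj_hom[OF smapD(2)[OF g] t]
  have "(g m \<cdot>\<^bsub>C\<^esub> f m) \<cdot>\<^bsub>C\<^esub> FArr X \<theta> = g m \<cdot>\<^bsub>C\<^esub> (f m \<cdot>\<^bsub>C\<^esub> FArr X \<theta>)" by (rule Comp_assoc[OF X f'(1) g'(1)])
  also have "\<dots> = g m \<cdot>\<^bsub>C\<^esub> (FArr Y \<theta> \<cdot>\<^bsub>C\<^esub> f n)" by (simp add: f'(2)[OF t])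
  also have "\<dots> = (g m \<cdot>\<^bsub>C\<^esub> FArr Y \<theta>) \<cdot>\<^bsub>C\<^esub> f n" by (rule Comp_assoc[OF f'(1) Y g'(1), symmetric])
  also have "\<dots> = (FArr Z \<theta> \<cdot>\<^bsub>C\<^esub> g n) \<cdot>\<^bsub>C\<^esub> f n" by (simp add: g'(2)[OF t])
  also have "\<dots> = FArr Z \<theta> \<cdot>\<^bsub>C\<^esub> (g n \<cdot>\<^bsub>C\<^esub> f n)" by (rule Comp_assoc[OF f'(1) g'(1) Z])
  finally show "(g m \<cdot>\<^bsub>C\<^esub> f m) \<cdot>\<^bsub>C\<^esub> FArr X \<theta> = FArr Z \<theta> \<cdot>\<^bsub>C\<^esub> (g n \<cdot>\<^bsub>C\<^esub> f n)" .
qed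

lemma smap_Ident:
  assumes X: "X \<in> simplicial_objects C"
  shows "(X, X, \<lambda>n. Ident C (FObj X n)) \<in> Arr (simplicial_category C)"
proof (rule smapI[OF X X])
  show "Ident C (FObj X n) \<in> hom C (FObj X n) (FObj X n)" for n using Ident_in sobj_Obj[OF X] by blast
  show "Ident C (FObj X m) \<cdot>\<^bsub>C\<^esub> FArr X \<theta> = FArr X \<theta> \<cdot>\<^bsub>C\<^esub> Ident C (FObj X n)" if "\<theta> \<in> hom Delta m n" for \<theta> m n
    using sobj_hom[OF X that] Ident_left Ident_right by simp
qed

lemma simplicial_category_simps [simp]:
  "Obj (simplicial_category C) = simplicial_objects C"
  "Dom (simplicial_category C) (X, Y, f) = X"
  "Cod (simplicial_category C) (X, Y, f) = Y"
  "Ident (simplicial_category C) X = (X, X, \<lambda>n. Ident C (FObj X n))"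
  "(Y', Z, g) \<cdot>\<^bsub>simplicial_category C\<^esub> (X, Y, f) = (X, Z, \<lambda>n. g n \<cdot>\<^bsub>C\<^esub> f n)"
  by (simp_all add: simplicial_category_def)

lemma simplicial_category: "category (simplicial_category C)"
proof
  fix f assume "f \<in> Arr (simplicial_category C)"
  then show "Dom (simplicial_category C) f \<in> Obj (simplicial_category C)"
    "Cod (simplicial_category C) f \<in> Obj (simplicial_category C)"
    by (cases f, auto dest: smapD)+
next
  show "Ident (simplicial_category C) a \<in> hom (simplicial_category C) a a"
    if "a \<in> Obj (simplicial_category C)" for a
    using that smap_Ident by (auto simp: hom_def)
next
  fix f g h a b c d
  assume f: "f \<in> hom (simplicial_category C) a b" and g: "g \<in> hom (simplicial_category C) b c"
  obtain f' g' where e: "f = (a, b, f')" "g = (b, c, g')"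
    using f g by (cases f, cases g) (auto simp: hom_def)
  have fg: "(a, b, f') \<in> Arr (simplicial_category C)" "(b, c, g') \<in> Arr (simplicial_category C)"
    using f g e by (auto simp: hom_def)
  show "g \<cdot>\<^bsub>simplicial_category C\<^esub> f \<in> hom (simplicial_category C) a c"
    using smap_Comp[OF fg] by (simp add: hom_def e)
  assume h: "h \<in> hom (simplicial_category C) c d"
  obtain h' where e': "h = (c, d, h')" using h by (cases h) (auto simp: hom_def)
  have h'': "(c, d, h') \<in> Arr (simplicial_category C)" using h e' by (auto simp: hom_def)
  show "(h \<cdot>\<^bsub>simplicial_category C\<^esub> g) \<cdot>\<^bsub>simplicial_category C\<^esub> f =
      h \<cdot>\<^bsub>simplicial_category C\<^esub> (g \<cdot>\<^bsub>simplicial_category C\<^esub> f)"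
    using Comp_assoc[OF smapD(3)[OF fg(1)] smapD(3)[OF fg(2)] smapD(3)[OF h'']] by (simp add: e e')
next
  fix f a b assume f: "f \<in> hom (simplicial_category C) a b"
  obtain f' where e: "f = (a, b, f')" using f by (cases f) (auto simp: hom_def)
  have f'': "(a, b, f') \<in> Arr (simplicial_category C)" using f e by (auto simp: hom_def)
  show "Ident (simplicial_category C) b \<cdot>\<^bsub>simplicial_category C\<^esub> f = f"
    "f \<cdot>\<^bsub>simplicial_category C\<^esub> Ident (simplicial_category C) a = f"
    using Ident_left[OF smapD(3)[OF f'']] Ident_right[OF smapD(3)[OF f'']] by (simp_all add: e)
qed

lemma constant_sobj_simps [simp]:
  "FObj (constant_sobj C a) n = a"
  "\<theta> \<in> hom Delta m n \<Longrightarrow> FArr (constant_sobj C a) \<theta> = Ident C a"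
  by (simp_all add: constant_sobj_def hom_def)

lemma constant_sobj: "a \<in> Obj C \<Longrightarrow> constant_sobj C a \<in> simplicial_objects C"
proof (rule sobjI)
  assume a: "a \<in> Obj C"
  show "FArr (constant_sobj C a) \<theta> \<in> hom C (FObj (constant_sobj C a) n) (FObj (constant_sobj C a) m)"
    if "\<theta> \<in> hom Delta m n" for \<theta> m n
    using Ident_in[OF a] that by simp
  show "FArr (constant_sobj C a) (\<phi> \<cdot>\<^bsub>Delta\<^esub> \<theta>) = FArr (constant_sobj C a) \<theta> \<cdot>\<^bsub>C\<^esub> FArr (constant_sobj C a) \<phi>"
    if "\<theta> \<in> hom Delta k m" "\<phi> \<in> hom Delta m n" for \<theta> \<phi> k m n
    using a that delta_Comp(1)[OF that] by simp
qed (auto simp: constant_sobj_def delta_Ident Delta.Ident_simps)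

lemma to_constant_iff:
  assumes X: "X \<in> simplicial_objects C" and a: "a \<in> Obj C"
  shows "(X, constant_sobj C a, f) \<in> Arr (simplicial_category C) \<longleftrightarrow>
    (\<forall>n. f n \<in> hom C (FObj X n) a) \<and> (\<forall>m n. \<forall>\<theta>\<in>hom Delta m n. f m \<cdot>\<^bsub>C\<^esub> FArr X \<theta> = f n)"
proof
  assume f: "(X, constant_sobj C a, f) \<in> Arr (simplicial_category C)"
  show "(\<forall>n. f n \<in> hom C (FObj X n) a) \<and> (\<forall>m n. \<forall>\<theta>\<in>hom Delta m n. f m \<cdot>\<^bsub>C\<^esub> FArr X \<theta> = f n)"
    using smapD(3)[OF f] smapD(4)[OF f] Ident_left by fastforce
next
  assume f: "(\<forall>n. f n \<in> hom C (FObj X n) a) \<and> (\<forall>m n. \<forall>\<theta>\<in>hom Delta m n. f m \<cdot>\<^bsub>C\<^esub> FArr X \<theta> = f n)"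
  then have "Ident C a \<cdot>\<^bsub>C\<^esub> f n = f n" for n using Ident_left by blast
  then show "(X, constant_sobj C a, f) \<in> Arr (simplicial_category C)"
    by (intro smapI[OF X constant_sobj[OF a]]) (use f in simp_all)
qed

lemma to_constant_terminal:
  assumes X: "X \<in> simplicial_objects C" and t: "terminal_object C t"
  shows "\<exists>f. (X, constant_sobj C t, f) \<in> Arr (simplicial_category C)"
proof -
  have "\<forall>n. \<exists>f. f \<in> hom C (FObj X n) t" using t sobj_Obj[OF X] by (auto simp: terminal_object_def)
  then obtain f where f: "\<And>n. f n \<in> hom C (FObj X n) t" by metis
  have u: "g = h" if "g \<in> hom C a t" "h \<in> hom C a t" for a g h
    using t that homD(4)[OF that(1)] unfolding terminal_object_def by blast
  have "f m \<cdot>\<^bsub>C\<^esub> FArr X \<theta> = f n" if "\<theta> \<in> hom Delta m n" for m n \<theta>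
    using u Comp_in[OF sobj_hom[OF X that] f] f by blast
  moreover have "t \<in> Obj C" using t by (simp add: terminal_object_def)
  ultimately have "(X, constant_sobj C t, f) \<in> Arr (simplicial_category C)"
    using to_constant_iff[OF X] f by blast
  then show ?thesis by blast
qed

end

section \<open>The levelwise functor on simplicial objects\<close>

context cat_functor
begin

abbreviation "LX X \<equiv> FObj (levelwise F) X"

lemma levelwise_simps:
  "FObj (LX X) n = FObj F (FObj X n)"
  "FArr (levelwise F) (X, Y, f) = (LX X, LX Y, \<lambda>n. FArr F (f n))"
  "\<theta> \<in> Arr Delta \<Longrightarrow> FArr (LX X) \<theta> = FArr F (FArr X \<theta>)"
  by (simp_all add: levelwise_def Let_def)

lemma levelwise_FArr: "\<theta> \<in> hom Delta m n \<Longrightarrow> FArr (LX X) \<theta> = FArr F (FArr X \<theta>)"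
  by (simp add: levelwise_simps hom_def)

lemma levelwise_sobj:
  assumes X: "X \<in> simplicial_objects C"
  shows "LX X \<in> simplicial_objects D"
proof (rule cod.sobjI)
  show "FArr (LX X) \<theta> \<in> hom D (FObj (LX X) n) (FObj (LX X) m)" if "\<theta> \<in> hom Delta m n" for \<theta> m n
    using FArr_in[OF dom.sobj_hom[OF X that]] levelwise_FArr[OF that] by (simp add: levelwise_simps)
  show "FArr (LX X) (Ident Delta n) = Ident D (FObj (LX X) n)" for n
    using dom.sobj_Ident[OF X] FArr_Ident[OF dom.sobj_Obj[OF X]] levelwise_FArr[OF delta_Ident(1)]
    by (simp add: levelwise_simps)
  show "FArr (LX X) (\<phi> \<cdot>\<^bsub>Delta\<^esub> \<theta>) = FArr (LX X) \<theta> \<cdot>\<^bsub>D\<^esub> FArr (LX X) \<phi>"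
    if "\<theta> \<in> hom Delta k m" "\<phi> \<in> hom Delta m n" for \<theta> \<phi> k m n
    using dom.sobj_Comp[OF X that] FArr_Comp[OF dom.sobj_hom[OF X that(2)] dom.sobj_hom[OF X that(1)]]
      levelwise_FArr[OF that(1)] levelwise_FArr[OF that(2)] levelwise_FArr[OF delta_Comp(1)[OF that]]
    by simp
qed (simp add: levelwise_def Let_def)

lemma levelwise_smap:
  assumes f: "(X, Y, f) \<in> Arr (simplicial_category C)"
  shows "(LX X, LX Y, \<lambda>n. FArr F (f n)) \<in> Arr (simplicial_category D)"
proof (rule cod.smapI)
  note f' = dom.smapD[OF f]
  show "LX X \<in> simplicial_objects D" "LX Y \<in> simplicial_objects D" using levelwise_sobj f' by auto
  show "FArr F (f n) \<in> hom D (FObj (LX X) n) (FObj (LX Y) n)" for n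
    using FArr_in[OF f'(3)] by (simp add: levelwise_simps)
  show "FArr F (f m) \<cdot>\<^bsub>D\<^esub> FArr (LX X) \<theta> = FArr (LX Y) \<theta> \<cdot>\<^bsub>D\<^esub> FArr F (f n)" if "\<theta> \<in> hom Delta m n" for \<theta> m n
    using f'(4)[OF that] levelwise_FArr[OF that]
      FArr_Comp[OF dom.sobj_hom[OF f'(1) that] f'(3)] FArr_Comp[OF f'(3) dom.sobj_hom[OF f'(2) that]]
    by simp
qed

lemma levelwise_constant:
  "a \<in> Obj C \<Longrightarrow> LX (constant_sobj C a) = constant_sobj D (FObj F a)"
  by (simp add: levelwise_def constant_sobj_def Let_def FArr_Ident cong: restrict_cong)
    (auto simp: FArr_Ident restrict_def fun_eq_iff)

end

section \<open>Matching objects relative to a cone in the base\<close>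

text \<open>The record of simplicial sets carries no laws. Functoriality is demanded on simplices
  only, since the action is a total function whose other values have no meaning.\<close>

definition is_sset :: "'a sset \<Rightarrow> bool" where
  "is_sset K \<longleftrightarrow>
     (\<forall>k m. \<forall>\<theta>\<in>hom Delta k m. \<forall>\<sigma>\<in>simplices K m. sact K \<theta> \<sigma> \<in> simplices K k)
   \<and> (\<forall>j k m. \<forall>\<theta>\<in>hom Delta j k. \<forall>\<phi>\<in>hom Delta k m. \<forall>\<sigma>\<in>simplices K m.
        sact K (\<phi> \<cdot>\<^bsub>Delta\<^esub> \<theta>) \<sigma> = sact K \<theta> (sact K \<phi> \<sigma>))
   \<and> (\<forall>m. \<forall>\<sigma>\<in>simplices K m. sact K (Ident Delta m) \<sigma> = \<sigma>)"

definition subcomplex :: "'a sset \<Rightarrow> (nat \<Rightarrow> 'a set) \<Rightarrow> bool" where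
  "subcomplex K A \<longleftrightarrow> (\<forall>m. A m \<subseteq> simplices K m)
     \<and> (\<forall>k m. \<forall>\<theta>\<in>hom Delta k m. \<forall>\<sigma>\<in>A m. sact K \<theta> \<sigma> \<in> A k)"

text \<open>A subcomplex keeps the action of the ambient simplicial set, so that enlarging it
  changes nothing but the sets of simplices.\<close>

abbreviation sub :: "'a sset \<Rightarrow> (nat \<Rightarrow> 'a set) \<Rightarrow> 'a sset" where
  "sub K A \<equiv> K\<lparr>simplices := A\<rparr>"

lemma is_ssetD:
  assumes "is_sset K"
  shows "\<theta> \<in> hom Delta k m \<Longrightarrow> \<sigma> \<in> simplices K m \<Longrightarrow> sact K \<theta> \<sigma> \<in> simplices K k"
    "\<theta> \<in> hom Delta j k \<Longrightarrow> \<phi> \<in> hom Delta k m \<Longrightarrow> \<sigma> \<in> simplices K m \<Longrightarrow>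
      sact K (\<phi> \<cdot>\<^bsub>Delta\<^esub> \<theta>) \<sigma> = sact K \<theta> (sact K \<phi> \<sigma>)"
    "\<sigma> \<in> simplices K m \<Longrightarrow> sact K (Ident Delta m) \<sigma> = \<sigma>"
  using assms unfolding is_sset_def by auto

lemma subcomplexD:
  assumes "subcomplex K A"
  shows "\<sigma> \<in> A m \<Longrightarrow> \<sigma> \<in> simplices K m"
    "\<theta> \<in> hom Delta k m \<Longrightarrow> \<sigma> \<in> A m \<Longrightarrow> sact K \<theta> \<sigma> \<in> A k"
  using assms unfolding subcomplex_def by auto

lemma std_simplex_simps [simp]:
  "simplices (std_simplex n) m = hom Delta m n"
  "sact (std_simplex n) \<theta> \<sigma> = \<sigma> \<cdot>\<^bsub>Delta\<^esub> \<theta>"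
  by (simp_all add: std_simplex_def)

lemma is_sset_std_simplex: "is_sset (std_simplex n)"
  unfolding is_sset_def using delta_Comp(1) Delta.Comp_assoc[symmetric] Delta.Ident_right by auto

lemma sset_product_simps [simp]:
  "simplices (sset_product K L) m = simplices K m \<times> simplices L m"
  "sact (sset_product K L) \<theta> (\<sigma>, \<tau>) = (sact K \<theta> \<sigma>, sact L \<theta> \<tau>)"
  by (simp_all add: sset_product_def)

lemma is_sset_product: "is_sset K \<Longrightarrow> is_sset L \<Longrightarrow> is_sset (sset_product K L)"
  unfolding is_sset_def by auto

lemma matching_cone_iff:
  "matching_cone C X K T \<rho> \<longleftrightarrow> T \<in> Obj C
     \<and> (\<forall>m. \<forall>\<sigma>\<in>simplices K m. \<rho> m \<sigma> \<in> hom C T (FObj X m))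
     \<and> (\<forall>k m. \<forall>\<theta>\<in>hom Delta k m. \<forall>\<sigma>\<in>simplices K m. FArr X \<theta> \<cdot>\<^bsub>C\<^esub> \<rho> m \<sigma> = \<rho> k (sact K \<theta> \<sigma>))"
  unfolding matching_cone_def by (auto simp: hom_def)

text \<open>For a cone \<open>y\<close> in \<^term>\<open>Y\<close> with vertex \<^term>\<open>B\<close>, the limit below is the fibre product
  \<open>X\<^sup>K \<times>\<^bsub>Y\<^sup>K\<^esub> B\<close>. With \<open>B = Y\<^sub>n\<close> and \<open>y\<close> the canonical cone it is the relative matching object.\<close>

definition over_cone :: "('o, 'm) category \<Rightarrow> ('o, 'm) sobj \<Rightarrow> (nat \<Rightarrow> 'm) \<Rightarrow> 'o \<Rightarrow>
    (nat \<Rightarrow> 'a \<Rightarrow> 'm) \<Rightarrow> 'a sset \<Rightarrow> 'o \<Rightarrow> (nat \<Rightarrow> 'a \<Rightarrow> 'm) \<Rightarrow> 'm \<Rightarrow> bool" where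
  "over_cone C X f B y K T \<rho> w \<longleftrightarrow> matching_cone C X K T \<rho> \<and> w \<in> hom C T B
     \<and> (\<forall>m. \<forall>\<sigma>\<in>simplices K m. f m \<cdot>\<^bsub>C\<^esub> \<rho> m \<sigma> = y m \<sigma> \<cdot>\<^bsub>C\<^esub> w)"

definition over_limit :: "('o, 'm) category \<Rightarrow> ('o, 'm) sobj \<Rightarrow> (nat \<Rightarrow> 'm) \<Rightarrow> 'o \<Rightarrow>
    (nat \<Rightarrow> 'a \<Rightarrow> 'm) \<Rightarrow> 'a sset \<Rightarrow> 'o \<Rightarrow> (nat \<Rightarrow> 'a \<Rightarrow> 'm) \<Rightarrow> 'm \<Rightarrow> bool" where
  "over_limit C X f B y K M \<pi> q \<longleftrightarrow> over_cone C X f B y K M \<pi> q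
     \<and> (\<forall>T \<rho> w. over_cone C X f B y K T \<rho> w \<longrightarrow>
          (\<exists>!u. u \<in> hom C T M \<and> (\<forall>m. \<forall>\<sigma>\<in>simplices K m. \<pi> m \<sigma> \<cdot>\<^bsub>C\<^esub> u = \<rho> m \<sigma>) \<and> q \<cdot>\<^bsub>C\<^esub> u = w))"

lemma relative_matching_object_over:
  "relative_matching_object C (X, Y, f) n K = over_limit C X f (FObj Y n) (\<lambda>m. FArr Y) K"
  by (intro ext) (simp add: relative_matching_object_def over_limit_def relative_cone_def over_cone_def)

lemma over_cone_cong:
  assumes "\<And>m \<sigma>. \<sigma> \<in> simplices K m \<Longrightarrow> y m \<sigma> = y' m \<sigma>" "\<And>m \<sigma>. \<sigma> \<in> simplices K m \<Longrightarrow> \<rho> m \<sigma> = \<rho>' m \<sigma>"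
    and "\<And>k m \<theta> \<sigma>. \<theta> \<in> hom Delta k m \<Longrightarrow> \<sigma> \<in> simplices K m \<Longrightarrow> sact K \<theta> \<sigma> \<in> simplices K k"
  shows "over_cone C X f B y K T \<rho> w \<longleftrightarrow> over_cone C X f B y' K T \<rho>' w"
  unfolding over_cone_def matching_cone_iff using assms by simp

text \<open>Cones are total functions of which only the values on simplices count. Closure of
  \<open>K\<close> under the action is assumed because naturality also evaluates a cone at
  \<open>sact K \<theta> \<sigma>\<close>.\<close>

lemma over_limit_cong:
  assumes "\<And>m \<sigma>. \<sigma> \<in> simplices K m \<Longrightarrow> y m \<sigma> = y' m \<sigma>" "\<And>m \<sigma>. \<sigma> \<in> simplices K m \<Longrightarrow> \<pi> m \<sigma> = \<pi>' m \<sigma>"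
    and "\<And>k m \<theta> \<sigma>. \<theta> \<in> hom Delta k m \<Longrightarrow> \<sigma> \<in> simplices K m \<Longrightarrow> sact K \<theta> \<sigma> \<in> simplices K k"
  shows "over_limit C X f B y K M \<pi> q \<longleftrightarrow> over_limit C X f B y' K M \<pi>' q"
proof -
  have 1: "over_cone C X f B y' K M \<pi> q \<longleftrightarrow> over_cone C X f B y' K M \<pi>' q"
    by (rule over_cone_cong) (use assms in auto)
  have 2: "over_cone C X f B y K T \<rho> w \<longleftrightarrow> over_cone C X f B y' K T \<rho> w" for T \<rho> w
    by (rule over_cone_cong) (use assms in auto)
  show ?thesis unfolding over_limit_def 2 1 using assms(2) by simp
qed

context category
begin

lemma over_limitD:
  assumes "over_limit C X f B y K M \<pi> q"
  shows "M \<in> Obj C" "\<sigma> \<in> simplices K m \<Longrightarrow> \<pi> m \<sigma> \<in> hom C M (FObj X m)"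
    "\<theta> \<in> hom Delta k m \<Longrightarrow> \<sigma> \<in> simplices K m \<Longrightarrow> FArr X \<theta> \<cdot>\<^bsub>C\<^esub> \<pi> m \<sigma> = \<pi> k (sact K \<theta> \<sigma>)"
    "q \<in> hom C M B" "\<sigma> \<in> simplices K m \<Longrightarrow> f m \<cdot>\<^bsub>C\<^esub> \<pi> m \<sigma> = y m \<sigma> \<cdot>\<^bsub>C\<^esub> q"
  using assms unfolding over_limit_def over_cone_def matching_cone_iff by auto

lemma over_limit_lift:
  assumes "over_limit C X f B y K M \<pi> q" "over_cone C X f B y K T \<rho> w"
  obtains u where "u \<in> hom C T M" "\<And>m \<sigma>. \<sigma> \<in> simplices K m \<Longrightarrow> \<pi> m \<sigma> \<cdot>\<^bsub>C\<^esub> u = \<rho> m \<sigma>" "q \<cdot>\<^bsub>C\<^esub> u = w"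
  using assms unfolding over_limit_def by blast

lemma over_cone_Comp:
  assumes f: "(X, Y, f) \<in> Arr (simplicial_category C)"
    and y: "\<forall>m. \<forall>\<sigma>\<in>simplices K m. y m \<sigma> \<in> hom C B (FObj Y m)"
    and M: "over_cone C X f B y K M \<pi> q" and u: "u \<in> hom C T M"
  shows "over_cone C X f B y K T (\<lambda>m \<sigma>. \<pi> m \<sigma> \<cdot>\<^bsub>C\<^esub> u) (q \<cdot>\<^bsub>C\<^esub> u)"
proof -
  have \<pi>: "\<pi> m \<sigma> \<in> hom C M (FObj X m)" "f m \<cdot>\<^bsub>C\<^esub> \<pi> m \<sigma> = y m \<sigma> \<cdot>\<^bsub>C\<^esub> q" if "\<sigma> \<in> simplices K m" for m \<sigma>
    using M that unfolding over_cone_def matching_cone_iff by auto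
  have q: "q \<in> hom C M B" using M unfolding over_cone_def by auto
  have "f m \<cdot>\<^bsub>C\<^esub> (\<pi> m \<sigma> \<cdot>\<^bsub>C\<^esub> u) = y m \<sigma> \<cdot>\<^bsub>C\<^esub> (q \<cdot>\<^bsub>C\<^esub> u)" if "\<sigma> \<in> simplices K m" for m \<sigma>
    using Comp_assoc[OF u \<pi>(1)[OF that] smapD(3)[OF f]] Comp_assoc[OF u q y[rule_format, OF that]]
      \<pi>(2)[OF that] by simp
  then show ?thesis
    using matching_cone_comp[OF category_axioms smapD(1)[OF f] _ u] M Comp_in[OF u q]
    unfolding over_cone_def by blast
qed

lemma over_limit_eq:
  assumes f: "(X, Y, f) \<in> Arr (simplicial_category C)"
    and y: "\<forall>m. \<forall>\<sigma>\<in>simplices K m. y m \<sigma> \<in> hom C B (FObj Y m)"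
    and M: "over_limit C X f B y K M \<pi> q" and u: "u \<in> hom C T M" and v: "v \<in> hom C T M"
    and e: "\<And>m \<sigma>. \<sigma> \<in> simplices K m \<Longrightarrow> \<pi> m \<sigma> \<cdot>\<^bsub>C\<^esub> u = \<pi> m \<sigma> \<cdot>\<^bsub>C\<^esub> v" "q \<cdot>\<^bsub>C\<^esub> u = q \<cdot>\<^bsub>C\<^esub> v"
  shows "u = v"
proof -
  have "over_cone C X f B y K T (\<lambda>m \<sigma>. \<pi> m \<sigma> \<cdot>\<^bsub>C\<^esub> u) (q \<cdot>\<^bsub>C\<^esub> u)"
    using over_cone_Comp[OF f y _ u] M unfolding over_limit_def by blast
  then have "\<exists>!w. w \<in> hom C T M \<and> (\<forall>m. \<forall>\<sigma>\<in>simplices K m. \<pi> m \<sigma> \<cdot>\<^bsub>C\<^esub> w = \<pi> m \<sigma> \<cdot>\<^bsub>C\<^esub> u) \<and> q \<cdot>\<^bsub>C\<^esub> w = q \<cdot>\<^bsub>C\<^esub> u"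
    using M unfolding over_limit_def by blast
  moreover have "v \<in> hom C T M \<and> (\<forall>m. \<forall>\<sigma>\<in>simplices K m. \<pi> m \<sigma> \<cdot>\<^bsub>C\<^esub> v = \<pi> m \<sigma> \<cdot>\<^bsub>C\<^esub> u) \<and> q \<cdot>\<^bsub>C\<^esub> v = q \<cdot>\<^bsub>C\<^esub> u"
    using v e by simp
  ultimately show ?thesis using u by blast
qed

lemma over_limitI:
  assumes "over_cone C X f B y K M \<pi> q"
    and "\<And>T \<rho> w. over_cone C X f B y K T \<rho> w \<Longrightarrow>
      \<exists>u\<in>hom C T M. (\<forall>m. \<forall>\<sigma>\<in>simplices K m. \<pi> m \<sigma> \<cdot>\<^bsub>C\<^esub> u = \<rho> m \<sigma>) \<and> q \<cdot>\<^bsub>C\<^esub> u = w"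
    and "\<And>T u v. u \<in> hom C T M \<Longrightarrow> v \<in> hom C T M \<Longrightarrow>
      (\<And>m \<sigma>. \<sigma> \<in> simplices K m \<Longrightarrow> \<pi> m \<sigma> \<cdot>\<^bsub>C\<^esub> u = \<pi> m \<sigma> \<cdot>\<^bsub>C\<^esub> v) \<Longrightarrow> q \<cdot>\<^bsub>C\<^esub> u = q \<cdot>\<^bsub>C\<^esub> v \<Longrightarrow> u = v"
  shows "over_limit C X f B y K M \<pi> q"
  unfolding over_limit_def
proof (intro conjI allI impI)
  fix T \<rho> w assume c: "over_cone C X f B y K T \<rho> w"
  obtain u where u: "u \<in> hom C T M" "\<forall>m. \<forall>\<sigma>\<in>simplices K m. \<pi> m \<sigma> \<cdot>\<^bsub>C\<^esub> u = \<rho> m \<sigma>" "q \<cdot>\<^bsub>C\<^esub> u = w"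
    using assms(2)[OF c] by blast
  then show "\<exists>!u. u \<in> hom C T M \<and> (\<forall>m. \<forall>\<sigma>\<in>simplices K m. \<pi> m \<sigma> \<cdot>\<^bsub>C\<^esub> u = \<rho> m \<sigma>) \<and> q \<cdot>\<^bsub>C\<^esub> u = w"
    by (intro ex1I[of _ u] conjI, simp_all) (rule assms(3), auto)
qed (fact assms(1))

lemma over_limit_unique:
  assumes f: "(X, Y, f) \<in> Arr (simplicial_category C)"
    and y: "\<forall>m. \<forall>\<sigma>\<in>simplices K m. y m \<sigma> \<in> hom C B (FObj Y m)"
    and M: "over_limit C X f B y K M \<pi> q" and M': "over_limit C X f B y K M' \<pi>' q'"
  obtains i where "i \<in> hom C M' M" "iso_arrow C i"
    "\<And>m \<sigma>. \<sigma> \<in> simplices K m \<Longrightarrow> \<pi> m \<sigma> \<cdot>\<^bsub>C\<^esub> i = \<pi>' m \<sigma>" "q \<cdot>\<^bsub>C\<^esub> i = q'"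
proof -
  have c: "over_cone C X f B y K M \<pi> q" "over_cone C X f B y K M' \<pi>' q'"
    using M M' unfolding over_limit_def by auto
  obtain i where i: "i \<in> hom C M' M" "\<And>m \<sigma>. \<sigma> \<in> simplices K m \<Longrightarrow> \<pi> m \<sigma> \<cdot>\<^bsub>C\<^esub> i = \<pi>' m \<sigma>" "q \<cdot>\<^bsub>C\<^esub> i = q'"
    using over_limit_lift[OF M c(2)] by blast
  obtain j where j: "j \<in> hom C M M'" "\<And>m \<sigma>. \<sigma> \<in> simplices K m \<Longrightarrow> \<pi>' m \<sigma> \<cdot>\<^bsub>C\<^esub> j = \<pi> m \<sigma>" "q' \<cdot>\<^bsub>C\<^esub> j = q"
    using over_limit_lift[OF M' c(1)] by blast
  note d = over_limitD[OF M] and d' = over_limitD[OF M']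
  have "i \<cdot>\<^bsub>C\<^esub> j = Ident C M"
  proof (rule over_limit_eq[OF f y M Comp_in[OF j(1) i(1)] Ident_in[OF d(1)]])
    show "\<pi> m \<sigma> \<cdot>\<^bsub>C\<^esub> (i \<cdot>\<^bsub>C\<^esub> j) = \<pi> m \<sigma> \<cdot>\<^bsub>C\<^esub> Ident C M" if "\<sigma> \<in> simplices K m" for m \<sigma>
      using Comp_assoc[OF j(1) i(1) d(2)[OF that]] i(2)[OF that] j(2)[OF that]
        Ident_right[OF d(2)[OF that]] by simp
    show "q \<cdot>\<^bsub>C\<^esub> (i \<cdot>\<^bsub>C\<^esub> j) = q \<cdot>\<^bsub>C\<^esub> Ident C M"
      using Comp_assoc[OF j(1) i(1) d(4)] i(3) j(3) Ident_right[OF d(4)] by simp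
  qed
  moreover have "j \<cdot>\<^bsub>C\<^esub> i = Ident C M'"
  proof (rule over_limit_eq[OF f y M' Comp_in[OF i(1) j(1)] Ident_in[OF d'(1)]])
    show "\<pi>' m \<sigma> \<cdot>\<^bsub>C\<^esub> (j \<cdot>\<^bsub>C\<^esub> i) = \<pi>' m \<sigma> \<cdot>\<^bsub>C\<^esub> Ident C M'" if "\<sigma> \<in> simplices K m" for m \<sigma>
      using Comp_assoc[OF i(1) j(1) d'(2)[OF that]] i(2)[OF that] j(2)[OF that]
        Ident_right[OF d'(2)[OF that]] by simp
    show "q' \<cdot>\<^bsub>C\<^esub> (j \<cdot>\<^bsub>C\<^esub> i) = q' \<cdot>\<^bsub>C\<^esub> Ident C M'"
      using Comp_assoc[OF i(1) j(1) d'(4)] i(3) j(3) Ident_right[OF d'(4)] by simp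
  qed
  ultimately have "iso_arrow C i" using iso_arrowI[OF i(1) j(1)] by simp
  then show ?thesis using that i by blast
qed

text \<open>The gluing map \<open>M \<rightarrow> X\<^sup>H \<times>\<^bsub>Y\<^sup>H\<^esub> Y\<^sub>m\<close> restricts along the attaching map \<open>s\<close> of an \<open>m\<close>-simplex.\<close>

lemma attaching_map:
  assumes K: "is_sset K" and A: "subcomplex K A" and s: "s \<in> simplices K m"
    and f: "(X, Y, f) \<in> Arr (simplicial_category C)" and y: "matching_cone C Y K B y"
    and M: "over_limit C X f B y (sub K A) M \<pi> q"
    and N: "over_limit C X f (FObj Y m) (\<lambda>k. FArr Y)
      (sub (std_simplex m) (\<lambda>k. {\<theta> \<in> hom Delta k m. sact K \<theta> s \<in> A k})) N \<nu> r"
  obtains v where "v \<in> hom C M N" "\<And>k \<theta>. \<theta> \<in> hom Delta k m \<Longrightarrow> sact K \<theta> s \<in> A k \<Longrightarrow>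
      \<nu> k \<theta> \<cdot>\<^bsub>C\<^esub> v = \<pi> k (sact K \<theta> s)" "r \<cdot>\<^bsub>C\<^esub> v = y m s \<cdot>\<^bsub>C\<^esub> q"
proof -
  note d = over_limitD[OF M, simplified]
  have y': "y k \<sigma> \<in> hom C B (FObj Y k)" if "\<sigma> \<in> simplices K k" for k \<sigma>
    using y that unfolding matching_cone_iff by blast
  have yn: "FArr Y \<theta> \<cdot>\<^bsub>C\<^esub> y m s = y k (sact K \<theta> s)" if "\<theta> \<in> hom Delta k m" for k \<theta>
    using y that s unfolding matching_cone_iff by blast
  have "over_cone C X f (FObj Y m) (\<lambda>k. FArr Y)
      (sub (std_simplex m) (\<lambda>k. {\<theta> \<in> hom Delta k m. sact K \<theta> s \<in> A k}))
      M (\<lambda>k \<theta>. \<pi> k (sact K \<theta> s)) (y m s \<cdot>\<^bsub>C\<^esub> q)"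
    unfolding over_cone_def matching_cone_iff
  proof (intro conjI allI ballI, simp_all)
    show "M \<in> Obj C" by (fact d(1))
    show "y m s \<cdot>\<^bsub>C\<^esub> q \<in> hom C M (FObj Y m)" using Comp_in[OF d(4) y'[OF s]] .
  next
    fix k \<theta> assume t: "\<theta> \<in> hom Delta k m \<and> sact K \<theta> s \<in> A k"
    then show "\<pi> k (sact K \<theta> s) \<in> hom C M (FObj X k)" using d(2) by blast
    show "f k \<cdot>\<^bsub>C\<^esub> \<pi> k (sact K \<theta> s) = FArr Y \<theta> \<cdot>\<^bsub>C\<^esub> (y m s \<cdot>\<^bsub>C\<^esub> q)"
      using d(5) t Comp_assoc[OF d(4) y'[OF s] sobj_hom[OF smapD(2)[OF f]]] yn by metis
  next
    fix j k \<phi> \<theta> assume p: "\<phi> \<in> hom Delta j k" and t: "\<theta> \<in> hom Delta k m \<and> sact K \<theta> s \<in> A k"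
    show "FArr X \<phi> \<cdot>\<^bsub>C\<^esub> \<pi> k (sact K \<theta> s) = \<pi> j (sact K (\<theta> \<cdot>\<^bsub>Delta\<^esub> \<phi>) s)"
      using d(3)[OF p] t is_ssetD(2)[OF K p _ s] by simp
  qed
  then show ?thesis by (rule over_limit_lift[OF N]) (use that in auto)
qed

text \<open>A cone over the enlarged complex is a cone over the old one together with a map T
  \<rightarrow> X_m, the value at \<open>s\<close>, that agrees with it on the gluing locus; this
  agreement is an equation of maps into \<open>N\<close>, hence a pullback. Injectivity of the
  attaching map makes \<open>\<theta>\<close> unique for each new simplex, so that the projections
  are well defined.\<close>

lemma over_limit_attach:
  assumes K: "is_sset K" and A: "subcomplex K A" and s: "s \<in> simplices K m"
    and inj: "\<And>k. inj_on (\<lambda>\<theta>. sact K \<theta> s) (hom Delta k m)"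
    and f: "(X, Y, f) \<in> Arr (simplicial_category C)" and y: "matching_cone C Y K B y"
    and M: "over_limit C X f B y (sub K A) M \<pi> q"
    and N: "over_limit C X f (FObj Y m) (\<lambda>k. FArr Y)
      (sub (std_simplex m) (\<lambda>k. {\<theta> \<in> hom Delta k m. sact K \<theta> s \<in> A k})) N \<nu> r"
    and u: "u \<in> hom C (FObj X m) N"
      "\<And>k \<theta>. \<theta> \<in> hom Delta k m \<Longrightarrow> sact K \<theta> s \<in> A k \<Longrightarrow> \<nu> k \<theta> \<cdot>\<^bsub>C\<^esub> u = FArr X \<theta>" "r \<cdot>\<^bsub>C\<^esub> u = f m"
    and v: "v \<in> hom C M N" "\<And>k \<theta>. \<theta> \<in> hom Delta k m \<Longrightarrow> sact K \<theta> s \<in> A k \<Longrightarrow>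
      \<nu> k \<theta> \<cdot>\<^bsub>C\<^esub> v = \<pi> k (sact K \<theta> s)" "r \<cdot>\<^bsub>C\<^esub> v = y m s \<cdot>\<^bsub>C\<^esub> q"
    and pb: "is_pullback C u v x p"
  shows "over_limit C X f B y (sub K (\<lambda>k. A k \<union> (\<lambda>\<theta>. sact K \<theta> s) ` hom Delta k m)) (Dom C x)
    (\<lambda>k \<sigma>. if \<sigma> \<in> A k then \<pi> k \<sigma> \<cdot>\<^bsub>C\<^esub> p else FArr X (the_inv_into (hom Delta k m) (\<lambda>\<theta>. sact K \<theta> s) \<sigma>) \<cdot>\<^bsub>C\<^esub> x)
    (q \<cdot>\<^bsub>C\<^esub> p)" (is "over_limit C X f B y ?K ?P ?\<rho>0 _")
proof -
  define R where "R = ?\<rho>0"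
  note d = over_limitD[OF M, simplified]
  note X = smapD(1)[OF f] and Y = smapD(2)[OF f] and fn = smapD(3)[OF f]
  have x: "x \<in> hom C ?P (FObj X m)" and p: "p \<in> hom C ?P M" and up: "u \<cdot>\<^bsub>C\<^esub> x = v \<cdot>\<^bsub>C\<^esub> p"
    using is_pullbackD[OF pb] homD[OF u(1)] homD[OF v(1)] by (auto simp: hom_def)
  have y': "y k \<sigma> \<in> hom C B (FObj Y k)" if "\<sigma> \<in> simplices K k" for k \<sigma>
    using y that unfolding matching_cone_iff by blast
  have yn: "FArr Y \<theta> \<cdot>\<^bsub>C\<^esub> y m s = y k (sact K \<theta> s)" if "\<theta> \<in> hom Delta k m" for k \<theta>
    using y that s unfolding matching_cone_iff by blast
  have \<nu>: "\<nu> k \<theta> \<in> hom C N (FObj X k)" if "\<theta> \<in> hom Delta k m" "sact K \<theta> s \<in> A k" for k \<theta>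
    using over_limitD(2)[OF N, simplified] that by blast
  have r: "r \<in> hom C N (FObj Y m)" using over_limitD(4)[OF N] .
  have XA: "R k \<sigma> = \<pi> k \<sigma> \<cdot>\<^bsub>C\<^esub> p" if "\<sigma> \<in> A k" for k \<sigma> using that by (simp add: R_def)
  \<comment> \<open>On the overlap the two prescriptions agree: the pullback square equates the
    composites into \<open>N\<close>, and \<open>\<nu>\<close> reads off either of them.\<close>
  have Xs: "R k (sact K \<theta> s) = FArr X \<theta> \<cdot>\<^bsub>C\<^esub> x" if t: "\<theta> \<in> hom Delta k m" for k \<theta>
  proof (cases "sact K \<theta> s \<in> A k")
    case True
    have "\<pi> k (sact K \<theta> s) \<cdot>\<^bsub>C\<^esub> p = (\<nu> k \<theta> \<cdot>\<^bsub>C\<^esub> v) \<cdot>\<^bsub>C\<^esub> p" using v(2)[OF t True] by simp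
    also have "\<dots> = \<nu> k \<theta> \<cdot>\<^bsub>C\<^esub> (u \<cdot>\<^bsub>C\<^esub> x)" using Comp_assoc[OF p v(1) \<nu>[OF t True]] up by simp
    also have "\<dots> = FArr X \<theta> \<cdot>\<^bsub>C\<^esub> x" using Comp_assoc[OF x u(1) \<nu>[OF t True]] u(2)[OF t True] by simp
    finally show ?thesis using XA[OF True] by simp
  next
    case False
    then show ?thesis by (simp add: R_def the_inv_into_f_f[OF inj t])
  qed
  have homs: "R k \<sigma> \<in> hom C ?P (FObj X k)" if sk: "\<sigma> \<in> simplices ?K k" for k \<sigma>
  proof (cases "\<sigma> \<in> A k")
    case True
    then show ?thesis using Comp_in[OF p d(2)] XA by simp
  next
    case False
    then obtain \<theta> where t: "\<theta> \<in> hom Delta k m" "\<sigma> = sact K \<theta> s" using sk by auto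
    show ?thesis unfolding t(2) Xs[OF t(1)] using Comp_in[OF x sobj_hom[OF X t(1)]] .
  qed
  have cone: "over_cone C X f B y ?K ?P R (q \<cdot>\<^bsub>C\<^esub> p)"
    unfolding over_cone_def matching_cone_iff
  proof (intro conjI allI ballI)
    show "?P \<in> Obj C" using homD(4)[OF x] .
    show "q \<cdot>\<^bsub>C\<^esub> p \<in> hom C ?P B" using Comp_in[OF p d(4)] .
    fix k \<sigma> assume "\<sigma> \<in> simplices ?K k"
    then show "R k \<sigma> \<in> hom C ?P (FObj X k)" by (rule homs)
  next
    fix j k \<phi> \<sigma> assume p': "\<phi> \<in> hom Delta j k" and sk: "\<sigma> \<in> simplices ?K k"
    show "FArr X \<phi> \<cdot>\<^bsub>C\<^esub> R k \<sigma> = R j (sact ?K \<phi> \<sigma>)"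
    proof (cases "\<sigma> \<in> A k")
      case True
      have "FArr X \<phi> \<cdot>\<^bsub>C\<^esub> (\<pi> k \<sigma> \<cdot>\<^bsub>C\<^esub> p) = (FArr X \<phi> \<cdot>\<^bsub>C\<^esub> \<pi> k \<sigma>) \<cdot>\<^bsub>C\<^esub> p"
        by (rule Comp_assoc[OF p d(2)[OF True] sobj_hom[OF X p'], symmetric])
      also have "\<dots> = \<pi> j (sact K \<phi> \<sigma>) \<cdot>\<^bsub>C\<^esub> p" using d(3)[OF p' True] by simp
      finally show ?thesis using XA[OF True] XA[OF subcomplexD(2)[OF A p' True]] by simp
    next
      case False
      then obtain \<theta> where t: "\<theta> \<in> hom Delta k m" "\<sigma> = sact K \<theta> s" using sk by auto
      have "FArr X \<phi> \<cdot>\<^bsub>C\<^esub> (FArr X \<theta> \<cdot>\<^bsub>C\<^esub> x) = (FArr X \<phi> \<cdot>\<^bsub>C\<^esub> FArr X \<theta>) \<cdot>\<^bsub>C\<^esub> x"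
        by (rule Comp_assoc[OF x sobj_hom[OF X t(1)] sobj_hom[OF X p'], symmetric])
      also have "\<dots> = FArr X (\<theta> \<cdot>\<^bsub>Delta\<^esub> \<phi>) \<cdot>\<^bsub>C\<^esub> x" using sobj_Comp[OF X p' t(1)] by simp
      finally show ?thesis
        using Xs[OF t(1)] Xs[OF delta_Comp(1)[OF p' t(1)]] is_ssetD(2)[OF K p' t(1) s] t(2) by simp
    qed
  next
    fix k \<sigma> assume sk: "\<sigma> \<in> simplices ?K k"
    show "f k \<cdot>\<^bsub>C\<^esub> R k \<sigma> = y k \<sigma> \<cdot>\<^bsub>C\<^esub> (q \<cdot>\<^bsub>C\<^esub> p)"
    proof (cases "\<sigma> \<in> A k")
      case True
      then show ?thesis
        using Comp_assoc[OF p d(2)[OF True] fn] Comp_assoc[OF p d(4) y'[OF subcomplexD(1)[OF A True]]]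
          d(5)[OF True] XA[OF True] by simp
    next
      case False
      then obtain \<theta> where t: "\<theta> \<in> hom Delta k m" "\<sigma> = sact K \<theta> s" using sk by auto
      note Yt = sobj_hom[OF Y t(1)] and Xt = sobj_hom[OF X t(1)]
      have "f k \<cdot>\<^bsub>C\<^esub> (FArr X \<theta> \<cdot>\<^bsub>C\<^esub> x) = (FArr Y \<theta> \<cdot>\<^bsub>C\<^esub> f m) \<cdot>\<^bsub>C\<^esub> x"
        using Comp_assoc[OF x Xt fn] smapD(4)[OF f t(1)] by simp
      also have "\<dots> = FArr Y \<theta> \<cdot>\<^bsub>C\<^esub> (r \<cdot>\<^bsub>C\<^esub> (u \<cdot>\<^bsub>C\<^esub> x))"
        using Comp_assoc[OF x fn Yt] Comp_assoc[OF x u(1) r] u(3) by simp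
      also have "\<dots> = FArr Y \<theta> \<cdot>\<^bsub>C\<^esub> (y m s \<cdot>\<^bsub>C\<^esub> (q \<cdot>\<^bsub>C\<^esub> p))"
        using up Comp_assoc[OF p v(1) r] v(3) Comp_assoc[OF p d(4) y'[OF s]] by simp
      also have "\<dots> = y k \<sigma> \<cdot>\<^bsub>C\<^esub> (q \<cdot>\<^bsub>C\<^esub> p)"
        using Comp_assoc[OF Comp_in[OF p d(4)] y'[OF s] Yt] yn[OF t(1)] t(2) by simp
      finally show ?thesis using Xs[OF t(1)] t(2) by simp
    qed
  qed
  \<comment> \<open>\<open>s\<close> corresponds to the identity of [m], so the projection at
    \<open>s\<close> is \<open>x\<close> itself. Uniqueness of the \<open>x\<close>-component of a
    lift is read off from it.\<close>
  have s': "s = sact K (Ident Delta m) s" using is_ssetD(3)[OF K s] by simp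
  have xs: "R m s = x"
    using Xs[OF delta_Ident(1)] s' sobj_Ident[OF X] Ident_left[OF x] by metis
  have s'': "s \<in> simplices ?K m" using s' delta_Ident(1) by auto
  show ?thesis unfolding R_def[symmetric]
  proof (rule over_limitI[OF cone])
    fix T \<rho> w assume c: "over_cone C X f B y ?K T \<rho> w"
    have \<rho>: "\<rho> k \<sigma> \<in> hom C T (FObj X k)" "f k \<cdot>\<^bsub>C\<^esub> \<rho> k \<sigma> = y k \<sigma> \<cdot>\<^bsub>C\<^esub> w" if "\<sigma> \<in> simplices ?K k" for k \<sigma>
      using c that unfolding over_cone_def matching_cone_iff by blast+
    have \<rho>n: "FArr X \<theta> \<cdot>\<^bsub>C\<^esub> \<rho> k \<sigma> = \<rho> j (sact K \<theta> \<sigma>)" if "\<theta> \<in> hom Delta j k" "\<sigma> \<in> simplices ?K k" for j k \<sigma> \<theta>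
      using c that unfolding over_cone_def matching_cone_iff by fastforce
    have "over_cone C X f B y (sub K A) T \<rho> w"
      using c unfolding over_cone_def matching_cone_iff by auto
    then obtain a where a: "a \<in> hom C T M" "\<And>m \<sigma>. \<sigma> \<in> A m \<Longrightarrow> \<pi> m \<sigma> \<cdot>\<^bsub>C\<^esub> a = \<rho> m \<sigma>" "q \<cdot>\<^bsub>C\<^esub> a = w"
      by (rule over_limit_lift[OF M]) auto
    \<comment> \<open>The value of the cone at \<open>s\<close> and the map induced into
      \<open>M\<close> have to agree in \<open>N\<close>. This is tested on the projections of
      \<open>N\<close>, where it is naturality of \<open>\<rho>\<close>, and on the leg into
      Y_m.\<close>
    note b = \<rho>(1)[OF s'']
    have "u \<cdot>\<^bsub>C\<^esub> \<rho> m s = v \<cdot>\<^bsub>C\<^esub> a"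
    proof (rule over_limit_eq[OF f _ N Comp_in[OF b u(1)] Comp_in[OF a(1) v(1)]])
      show "\<forall>k. \<forall>\<sigma>\<in>simplices (sub (std_simplex m) (\<lambda>k. {\<theta> \<in> hom Delta k m. sact K \<theta> s \<in> A k})) k.
          FArr Y \<sigma> \<in> hom C (FObj Y m) (FObj Y k)"
        using sobj_hom[OF Y] by auto
      show "r \<cdot>\<^bsub>C\<^esub> (u \<cdot>\<^bsub>C\<^esub> \<rho> m s) = r \<cdot>\<^bsub>C\<^esub> (v \<cdot>\<^bsub>C\<^esub> a)"
        using Comp_assoc[OF b u(1) r] Comp_assoc[OF a(1) v(1) r] u(3) v(3) \<rho>(2)[OF s'']
          Comp_assoc[OF a(1) d(4) y'[OF s]] a(3) by simp
      fix k \<theta> assume "\<theta> \<in> simplices (sub (std_simplex m) (\<lambda>k. {\<theta> \<in> hom Delta k m. sact K \<theta> s \<in> A k})) k"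
      then have t: "\<theta> \<in> hom Delta k m" "sact K \<theta> s \<in> A k" by auto
      show "\<nu> k \<theta> \<cdot>\<^bsub>C\<^esub> (u \<cdot>\<^bsub>C\<^esub> \<rho> m s) = \<nu> k \<theta> \<cdot>\<^bsub>C\<^esub> (v \<cdot>\<^bsub>C\<^esub> a)"
        using Comp_assoc[OF b u(1) \<nu>[OF t]] Comp_assoc[OF a(1) v(1) \<nu>[OF t]] u(2)[OF t] v(2)[OF t]
          \<rho>n[OF t(1) s''] a(2)[OF t(2)] by simp
    qed
    then obtain c where c: "c \<in> hom C T ?P" "x \<cdot>\<^bsub>C\<^esub> c = \<rho> m s" "p \<cdot>\<^bsub>C\<^esub> c = a"
      using pullback_lift[OF pb, of "\<rho> m s" T a] b a(1) homD[OF u(1)] homD[OF v(1)] by metis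
    have "R k \<sigma> \<cdot>\<^bsub>C\<^esub> c = \<rho> k \<sigma>" if sk: "\<sigma> \<in> simplices ?K k" for k \<sigma>
    proof (cases "\<sigma> \<in> A k")
      case True
      then show ?thesis using Comp_assoc[OF c(1) p d(2)[OF True]] c(3) a(2)[OF True] XA[OF True] by simp
    next
      case False
      then obtain \<theta> where t: "\<theta> \<in> hom Delta k m" "\<sigma> = sact K \<theta> s" using sk by auto
      show ?thesis unfolding t(2) Xs[OF t(1)]
        using Comp_assoc[OF c(1) x sobj_hom[OF X t(1)]] c(2) \<rho>n[OF t(1) s''] by simp
    qed
    moreover have "(q \<cdot>\<^bsub>C\<^esub> p) \<cdot>\<^bsub>C\<^esub> c = w" using Comp_assoc[OF c(1) p d(4)] c(3) a(3) by simp
    ultimately show "\<exists>u\<in>hom C T ?P. (\<forall>m. \<forall>\<sigma>\<in>simplices ?K m. R m \<sigma> \<cdot>\<^bsub>C\<^esub> u = \<rho> m \<sigma>) \<and> (q \<cdot>\<^bsub>C\<^esub> p) \<cdot>\<^bsub>C\<^esub> u = w"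
      using c(1) by blast
  next
    fix T a b assume a: "a \<in> hom C T ?P" and b: "b \<in> hom C T ?P"
      and e: "\<And>m \<sigma>. \<sigma> \<in> simplices ?K m \<Longrightarrow> R m \<sigma> \<cdot>\<^bsub>C\<^esub> a = R m \<sigma> \<cdot>\<^bsub>C\<^esub> b" "(q \<cdot>\<^bsub>C\<^esub> p) \<cdot>\<^bsub>C\<^esub> a = (q \<cdot>\<^bsub>C\<^esub> p) \<cdot>\<^bsub>C\<^esub> b"
    have "p \<cdot>\<^bsub>C\<^esub> a = p \<cdot>\<^bsub>C\<^esub> b"
    proof (rule over_limit_eq[OF f _ M Comp_in[OF a p] Comp_in[OF b p]])
      show "\<forall>m. \<forall>\<sigma>\<in>simplices (sub K A) m. y m \<sigma> \<in> hom C B (FObj Y m)"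
        using y' subcomplexD(1)[OF A] by simp
      show "\<pi> m \<sigma> \<cdot>\<^bsub>C\<^esub> (p \<cdot>\<^bsub>C\<^esub> a) = \<pi> m \<sigma> \<cdot>\<^bsub>C\<^esub> (p \<cdot>\<^bsub>C\<^esub> b)" if "\<sigma> \<in> simplices (sub K A) m" for m \<sigma>
        using e(1)[of \<sigma> m] that Comp_assoc[OF a p d(2)] Comp_assoc[OF b p d(2)] XA by simp
      show "q \<cdot>\<^bsub>C\<^esub> (p \<cdot>\<^bsub>C\<^esub> a) = q \<cdot>\<^bsub>C\<^esub> (p \<cdot>\<^bsub>C\<^esub> b)"
        using e(2) Comp_assoc[OF a p d(4)] Comp_assoc[OF b p d(4)] by simp
    qed
    moreover have "x \<cdot>\<^bsub>C\<^esub> a = x \<cdot>\<^bsub>C\<^esub> b" using e(1)[OF s''] unfolding xs .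
    ultimately show "a = b" using pullback_eq[OF pb a b] by simp
  qed
qed

end

definition matching_map :: "('o, 'm) category \<Rightarrow> ('o, 'm) sobj \<Rightarrow> (nat \<Rightarrow> 'm) \<Rightarrow> nat \<Rightarrow> delta_arr sset \<Rightarrow>
    'o \<Rightarrow> (nat \<Rightarrow> delta_arr \<Rightarrow> 'm) \<Rightarrow> 'm \<Rightarrow> 'm \<Rightarrow> bool" where
  "matching_map C X f n K M \<pi> q u \<longleftrightarrow> u \<in> hom C (FObj X n) M
     \<and> (\<forall>m. \<forall>\<sigma>\<in>simplices K m. \<pi> m \<sigma> \<cdot>\<^bsub>C\<^esub> u = FArr X \<sigma>) \<and> q \<cdot>\<^bsub>C\<^esub> u = f n"

lemma matching_map_cover_iff:
  "matching_map_cover C S (X, Y, f) n K \<longleftrightarrow> (\<exists>M \<pi> q u.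
     over_limit C X f (FObj Y n) (\<lambda>m. FArr Y) K M \<pi> q \<and> matching_map C X f n K M \<pi> q u \<and> u \<in> S)"
  unfolding matching_map_cover_def matching_map_def relative_matching_object_over by auto

text \<open>Off \<open>A\<close> a simplex has the form \<open>sact K \<theta> s\<close>; the
  inverse function recovers \<open>\<theta>\<close>, which is unique when the attaching map is
  injective.\<close>

definition attach_proj :: "('o, 'm) category \<Rightarrow> ('o, 'm) sobj \<Rightarrow> 'a sset \<Rightarrow> (nat \<Rightarrow> 'a set) \<Rightarrow> 'a \<Rightarrow> nat \<Rightarrow>
    (nat \<Rightarrow> 'a \<Rightarrow> 'm) \<Rightarrow> 'm \<Rightarrow> 'm \<Rightarrow> nat \<Rightarrow> 'a \<Rightarrow> 'm" where
  "attach_proj C X K A s m \<pi> x p k \<sigma> = (if \<sigma> \<in> A k then \<pi> k \<sigma> \<cdot>\<^bsub>C\<^esub> p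
     else FArr X (the_inv_into (hom Delta k m) (\<lambda>\<theta>. sact K \<theta> s) \<sigma>) \<cdot>\<^bsub>C\<^esub> x)"

definition attach :: "'a sset \<Rightarrow> (nat \<Rightarrow> 'a set) \<Rightarrow> 'a \<Rightarrow> nat \<Rightarrow> nat \<Rightarrow> 'a set" where
  "attach K A s m k = A k \<union> (\<lambda>\<theta>. sact K \<theta> s) ` hom Delta k m"

text \<open>The gluing locus: the preimage of \<open>A\<close> under the map from the m-simplex to
  \<open>K\<close> that represents \<open>s\<close>.\<close>

definition attaching :: "'a sset \<Rightarrow> (nat \<Rightarrow> 'a set) \<Rightarrow> 'a \<Rightarrow> nat \<Rightarrow> delta_arr sset" where
  "attaching K A s m = sub (std_simplex m) (\<lambda>k. {\<theta> \<in> hom Delta k m. sact K \<theta> s \<in> A k})"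

lemma simplices_attaching [simp]:
  "simplices (attaching K A s m) k = {\<theta> \<in> hom Delta k m. sact K \<theta> s \<in> A k}"
  by (simp add: attaching_def)

lemma subcomplex_attach:
  assumes K: "is_sset K" and A: "subcomplex K A" and s: "s \<in> simplices K m"
  shows "subcomplex K (attach K A s m)"
  unfolding subcomplex_def attach_def
proof (intro conjI allI ballI)
  show "A k \<union> (\<lambda>\<theta>. sact K \<theta> s) ` hom Delta k m \<subseteq> simplices K k" for k
    using subcomplexD(1)[OF A] is_ssetD(1)[OF K _ s] by blast
  fix j k \<theta> \<sigma> assume t: "\<theta> \<in> hom Delta j k" and "\<sigma> \<in> A k \<union> (\<lambda>\<theta>. sact K \<theta> s) ` hom Delta k m"
  then consider "\<sigma> \<in> A k" | \<phi> where "\<phi> \<in> hom Delta k m" "\<sigma> = sact K \<phi> s" by blast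
  then show "sact K \<theta> \<sigma> \<in> A j \<union> (\<lambda>\<theta>. sact K \<theta> s) ` hom Delta j m"
  proof cases
    case 1
    then show ?thesis using subcomplexD(2)[OF A t] by blast
  next
    case 2
    then show ?thesis using is_ssetD(2)[OF K t _ s] delta_Comp(1)[OF t 2(1)] by (metis UnI2 imageI)
  qed
qed

lemma subcomplex_closed:
  "subcomplex K A \<Longrightarrow> \<theta> \<in> hom Delta k m \<Longrightarrow> \<sigma> \<in> simplices (sub K A) m \<Longrightarrow>
    sact (sub K A) \<theta> \<sigma> \<in> simplices (sub K A) k"
  using subcomplexD(2)[of K A \<theta> k m \<sigma>] by simp

context category
begin

text \<open>Without simplices a cone is nothing but its leg into \<open>B\<close>. This is the
  initial stage of the filtrations.\<close>

lemma over_limit_empty: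
  assumes B: "B \<in> Obj C"
  shows "over_limit C X f B y (sub K (\<lambda>_. {})) B \<pi> (Ident C B)"
proof (rule over_limitI)
  show "over_cone C X f B y (sub K (\<lambda>_. {})) B \<pi> (Ident C B)"
    using Ident_in[OF B] B by (simp add: over_cone_def matching_cone_iff)
next
  fix T \<rho> w assume "over_cone C X f B y (sub K (\<lambda>_. {})) T \<rho> w"
  then have "w \<in> hom C T B" by (simp add: over_cone_def)
  then show "\<exists>u\<in>hom C T B. (\<forall>m. \<forall>\<sigma>\<in>simplices (sub K (\<lambda>_. {})) m. \<pi> m \<sigma> \<cdot>\<^bsub>C\<^esub> u = \<rho> m \<sigma>) \<and> Ident C B \<cdot>\<^bsub>C\<^esub> u = w"
    using Ident_left by auto
next
  fix T u v assume "u \<in> hom C T B" "v \<in> hom C T B" "Ident C B \<cdot>\<^bsub>C\<^esub> u = Ident C B \<cdot>\<^bsub>C\<^esub> v"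
  then show "u = v" using Ident_left by simp
qed

lemma matching_cone_std_simplex:
  assumes Y: "Y \<in> simplicial_objects C" and b: "b \<in> hom C B (FObj Y n)"
  shows "matching_cone C Y (std_simplex n) B (\<lambda>m \<sigma>. FArr Y \<sigma> \<cdot>\<^bsub>C\<^esub> b)"
  unfolding matching_cone_iff
proof (intro conjI allI ballI)
  show "B \<in> Obj C" using homD(4)[OF b] .
  show "FArr Y \<sigma> \<cdot>\<^bsub>C\<^esub> b \<in> hom C B (FObj Y m)" if "\<sigma> \<in> simplices (std_simplex n) m" for m \<sigma>
    using Comp_in[OF b sobj_hom[OF Y]] that by simp
  show "FArr Y \<theta> \<cdot>\<^bsub>C\<^esub> (FArr Y \<sigma> \<cdot>\<^bsub>C\<^esub> b) = FArr Y (sact (std_simplex n) \<theta> \<sigma>) \<cdot>\<^bsub>C\<^esub> b"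
    if t: "\<theta> \<in> hom Delta k m" and s: "\<sigma> \<in> simplices (std_simplex n) m" for k m \<theta> \<sigma>
    using Comp_assoc[OF b sobj_hom[OF Y] sobj_hom[OF Y t]] sobj_Comp[OF Y t] s by simp
qed

lemma matching_cone_simplices:
  assumes Y: "Y \<in> simplicial_objects C"
  shows "matching_cone C Y (std_simplex n) (FObj Y n) (\<lambda>m. FArr Y)"
  unfolding matching_cone_iff using sobj_hom[OF Y] sobj_Comp[OF Y, symmetric] sobj_Obj[OF Y] by simp

text \<open>Yoneda: a cone over the full simplex is determined by its value at the identity of [n],
  and its leg into Y_n is the image of that value under f_n.\<close>

lemma over_limit_simplex:
  assumes f: "(X, Y, f) \<in> Arr (simplicial_category C)"
  shows "over_limit C X f (FObj Y n) (\<lambda>m. FArr Y) (std_simplex n) (FObj X n) (\<lambda>m. FArr X) (f n)"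
proof (rule over_limitI)
  note X = smapD(1)[OF f]
  show "over_cone C X f (FObj Y n) (\<lambda>m. FArr Y) (std_simplex n) (FObj X n) (\<lambda>m. FArr X) (f n)"
    unfolding over_cone_def using matching_cone_simplices[OF X] smapD(3,4)[OF f] by simp
next
  note X = smapD(1)[OF f]
  fix T \<rho> w assume c: "over_cone C X f (FObj Y n) (\<lambda>m. FArr Y) (std_simplex n) T \<rho> w"
  have r: "\<rho> n (Ident Delta n) \<in> hom C T (FObj X n)"
    and n: "\<And>k \<sigma>. \<sigma> \<in> hom Delta k n \<Longrightarrow> FArr X \<sigma> \<cdot>\<^bsub>C\<^esub> \<rho> n (Ident Delta n) = \<rho> k (Ident Delta n \<cdot>\<^bsub>Delta\<^esub> \<sigma>)"
    and e: "f n \<cdot>\<^bsub>C\<^esub> \<rho> n (Ident Delta n) = FArr Y (Ident Delta n) \<cdot>\<^bsub>C\<^esub> w" and w: "w \<in> hom C T (FObj Y n)"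
    using c delta_Ident(1)[of n] unfolding over_cone_def matching_cone_iff by auto
  have "FArr X \<sigma> \<cdot>\<^bsub>C\<^esub> \<rho> n (Ident Delta n) = \<rho> k \<sigma>" if "\<sigma> \<in> hom Delta k n" for k \<sigma>
    using n[OF that] Delta.Ident_left[OF that] by simp
  moreover have "f n \<cdot>\<^bsub>C\<^esub> \<rho> n (Ident Delta n) = w"
    using e sobj_Ident[OF smapD(2)[OF f]] Ident_left[OF w] by simp
  ultimately show "\<exists>u\<in>hom C T (FObj X n). (\<forall>m. \<forall>\<sigma>\<in>simplices (std_simplex n) m. FArr X \<sigma> \<cdot>\<^bsub>C\<^esub> u = \<rho> m \<sigma>) \<and> f n \<cdot>\<^bsub>C\<^esub> u = w"
    using r by (intro bexI[of _ "\<rho> n (Ident Delta n)"]) auto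
next
  fix T u v assume u: "u \<in> hom C T (FObj X n)" "v \<in> hom C T (FObj X n)"
    and e: "\<And>m \<sigma>. \<sigma> \<in> simplices (std_simplex n) m \<Longrightarrow> FArr X \<sigma> \<cdot>\<^bsub>C\<^esub> u = FArr X \<sigma> \<cdot>\<^bsub>C\<^esub> v"
  show "u = v"
    using e[of "Ident Delta n" n] delta_Ident(1) sobj_Ident[OF smapD(1)[OF f]] Ident_left[OF u(1)]
      Ident_left[OF u(2)] by simp
qed

text \<open>Yoneda again: over the full simplex a cone amounts to a map to X_n and a map to
  \<open>B\<close> that agree in Y_n. In this way limits over complexes produce pullbacks in each
  level.\<close>

lemma over_limit_simplex_pullback:
  assumes f: "(X, Y, f) \<in> Arr (simplicial_category C)" and b: "b \<in> hom C B (FObj Y n)"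
    and M: "over_limit C X f B (\<lambda>m \<sigma>. FArr Y \<sigma> \<cdot>\<^bsub>C\<^esub> b) (std_simplex n) M \<pi> q"
  shows "is_pullback C (f n) b (\<pi> n (Ident Delta n)) q"
proof -
  note d = over_limitD[OF M, simplified] and X = smapD(1)[OF f] and Y = smapD(2)[OF f]
  let ?i = "Ident Delta n"
  note i = delta_Ident(1)[of n]
  show ?thesis
  proof (rule is_pullbackI[OF smapD(3)[OF f] b d(2)[OF i] d(4)])
    show "f n \<cdot>\<^bsub>C\<^esub> \<pi> n ?i = b \<cdot>\<^bsub>C\<^esub> q"
      using d(5)[OF i] sobj_Ident[OF Y] Ident_left[OF b] by simp
  next
    fix T h k assume h: "h \<in> hom C T (FObj X n)" and k: "k \<in> hom C T B" and e: "f n \<cdot>\<^bsub>C\<^esub> h = b \<cdot>\<^bsub>C\<^esub> k"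
    have "over_cone C X f B (\<lambda>m \<sigma>. FArr Y \<sigma> \<cdot>\<^bsub>C\<^esub> b) (std_simplex n) T (\<lambda>m \<sigma>. FArr X \<sigma> \<cdot>\<^bsub>C\<^esub> h) k"
      unfolding over_cone_def
    proof (intro conjI allI ballI)
      show "matching_cone C X (std_simplex n) T (\<lambda>m \<sigma>. FArr X \<sigma> \<cdot>\<^bsub>C\<^esub> h)"
        by (rule matching_cone_std_simplex[OF X h])
      fix m \<sigma> assume "\<sigma> \<in> simplices (std_simplex n) m"
      then have s: "\<sigma> \<in> hom Delta m n" by simp
      show "f m \<cdot>\<^bsub>C\<^esub> (FArr X \<sigma> \<cdot>\<^bsub>C\<^esub> h) = (FArr Y \<sigma> \<cdot>\<^bsub>C\<^esub> b) \<cdot>\<^bsub>C\<^esub> k"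
        using Comp_assoc[OF h sobj_hom[OF X s] smapD(3)[OF f]] Comp_assoc[OF h smapD(3)[OF f] sobj_hom[OF Y s]]
          Comp_assoc[OF k b sobj_hom[OF Y s]] smapD(4)[OF f s] e by simp
    qed (fact k)
    then obtain u where u: "u \<in> hom C T M" "\<And>m \<sigma>. \<sigma> \<in> hom Delta m n \<Longrightarrow> \<pi> m \<sigma> \<cdot>\<^bsub>C\<^esub> u = FArr X \<sigma> \<cdot>\<^bsub>C\<^esub> h" "q \<cdot>\<^bsub>C\<^esub> u = k"
      by (rule over_limit_lift[OF M]) auto
    have "\<pi> n ?i \<cdot>\<^bsub>C\<^esub> u = h" using u(2)[OF i] sobj_Ident[OF X] Ident_left[OF h] by simp
    then show "\<exists>u\<in>hom C T M. \<pi> n ?i \<cdot>\<^bsub>C\<^esub> u = h \<and> q \<cdot>\<^bsub>C\<^esub> u = k" using u by blast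
  next
    fix T u v assume u: "u \<in> hom C T M" and v: "v \<in> hom C T M"
      and e: "\<pi> n ?i \<cdot>\<^bsub>C\<^esub> u = \<pi> n ?i \<cdot>\<^bsub>C\<^esub> v" "q \<cdot>\<^bsub>C\<^esub> u = q \<cdot>\<^bsub>C\<^esub> v"
    show "u = v"
    proof (rule over_limit_eq[OF f _ M u v])
      show "\<forall>m. \<forall>\<sigma>\<in>simplices (std_simplex n) m. FArr Y \<sigma> \<cdot>\<^bsub>C\<^esub> b \<in> hom C B (FObj Y m)"
        using Comp_in[OF b sobj_hom[OF Y]] by simp
      have "\<pi> m \<sigma> \<cdot>\<^bsub>C\<^esub> w = FArr X \<sigma> \<cdot>\<^bsub>C\<^esub> (\<pi> n ?i \<cdot>\<^bsub>C\<^esub> w)" if "w \<in> hom C T M" "\<sigma> \<in> hom Delta m n" for m \<sigma> w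
        using d(3)[OF that(2) i] Comp_assoc[OF that(1) d(2)[OF i] sobj_hom[OF X that(2)]]
          Delta.Ident_left[OF that(2)] by simp
      then show "\<pi> m \<sigma> \<cdot>\<^bsub>C\<^esub> u = \<pi> m \<sigma> \<cdot>\<^bsub>C\<^esub> v" if "\<sigma> \<in> simplices (std_simplex n) m" for m \<sigma>
        using that u v e by simp
    qed (fact e(2))
  qed
qed

text \<open>The Yoneda cone on X_n restricts to every subcomplex of the simplex, so the canonical
  map exists as soon as its target does.\<close>

lemma matching_map_exists:
  assumes f: "(X, Y, f) \<in> Arr (simplicial_category C)"
    and K: "subcomplex (std_simplex n) A"
    and M: "over_limit C X f (FObj Y n) (\<lambda>m. FArr Y) (sub (std_simplex n) A) M \<pi> q"
  shows "\<exists>u. matching_map C X f n (sub (std_simplex n) A) M \<pi> q u"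
proof -
  have "over_cone C X f (FObj Y n) (\<lambda>m. FArr Y) (sub (std_simplex n) A) (FObj X n) (\<lambda>m. FArr X) (f n)"
    using over_limit_simplex[OF f, of n] subcomplexD(1)[OF K]
    unfolding over_limit_def over_cone_def matching_cone_iff by simp
  then show ?thesis
    unfolding matching_map_def by (rule over_limit_lift[OF M]) blast
qed

end

section \<open>Transport of matching objects along a geometric functor\<close>

context cat_functor
begin

lemma levelwise_matching_cone:
  assumes X: "X \<in> simplicial_objects C" and c: "matching_cone C X K T \<rho>"
  shows "matching_cone D (LX X) K (FObj F T) (\<lambda>m \<sigma>. FArr F (\<rho> m \<sigma>))"
proof -
  have r: "\<rho> m \<sigma> \<in> hom C T (FObj X m)" if "\<sigma> \<in> simplices K m" for m \<sigma>
    using c that unfolding matching_cone_iff by blast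
  have n: "FArr X \<theta> \<cdot>\<^bsub>C\<^esub> \<rho> m \<sigma> = \<rho> k (sact K \<theta> \<sigma>)" if "\<theta> \<in> hom Delta k m" "\<sigma> \<in> simplices K m" for k m \<theta> \<sigma>
    using c that unfolding matching_cone_iff by blast
  have T: "T \<in> Obj C" using c unfolding matching_cone_iff by blast
  show ?thesis unfolding matching_cone_iff
  proof (intro conjI allI ballI)
    show "FArr (LX X) \<theta> \<cdot>\<^bsub>D\<^esub> FArr F (\<rho> m \<sigma>) = FArr F (\<rho> k (sact K \<theta> \<sigma>))"
      if "\<theta> \<in> hom Delta k m" "\<sigma> \<in> simplices K m" for k m \<theta> \<sigma>
      using n[OF that] FArr_Comp[OF r[OF that(2)] dom.sobj_hom[OF X that(1)]] levelwise_FArr[OF that(1)] by simp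
  qed (use FArr_in[OF r] FObj_in[OF T] in \<open>simp_all add: levelwise_simps\<close>)
qed

text \<open>Containment of \<open>K\<close> in the simplex matters because the levelwise image of X
  acts through \<open>F\<close> on arrows of \<open>Delta\<close> only and is undefined
  elsewhere.\<close>

lemma levelwise_matching_map:
  assumes X: "X \<in> simplicial_objects C" and K: "\<And>k. simplices K k \<subseteq> hom Delta k n"
    and r: "\<And>m \<sigma>. \<sigma> \<in> simplices K m \<Longrightarrow> \<pi> m \<sigma> \<in> hom C M (FObj X m)" and q: "q \<in> hom C M B"
    and u: "matching_map C X f n K M \<pi> q u"
  shows "matching_map D (LX X) (\<lambda>n. FArr F (f n)) n K (FObj F M) (\<lambda>m \<sigma>. FArr F (\<pi> m \<sigma>)) (FArr F q) (FArr F u)"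
proof -
  have u': "u \<in> hom C (FObj X n) M" "\<And>m \<sigma>. \<sigma> \<in> simplices K m \<Longrightarrow> \<pi> m \<sigma> \<cdot>\<^bsub>C\<^esub> u = FArr X \<sigma>" "q \<cdot>\<^bsub>C\<^esub> u = f n"
    using u unfolding matching_map_def by auto
  have "FArr F (\<pi> m \<sigma>) \<cdot>\<^bsub>D\<^esub> FArr F u = FArr (LX X) \<sigma>" if "\<sigma> \<in> simplices K m" for m \<sigma>
    using FArr_Comp[OF u'(1) r[OF that]] u'(2)[OF that] levelwise_FArr[of \<sigma> m n X] K[of m] that
    by (metis subsetD)
  then show ?thesis unfolding matching_map_def
    using FArr_in[OF u'(1)] FArr_Comp[OF u'(1) q] u'(3) by (simp add: levelwise_simps)
qed

end

locale geometric_pair = C: cover_category C SC + D: cover_category D SD + geometric_functor C SC D SD F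
  for C :: "('o, 'm) category" and SC :: "'m set"
    and D :: "('p, 'n) category" and SD :: "'n set"
    and F :: "('o, 'm, 'p, 'n) cat_functor"
begin

abbreviation "Ff f \<equiv> (\<lambda>n. FArr F (f n))"
abbreviation "Fy y \<equiv> (\<lambda>m \<sigma>. FArr F (y m \<sigma>))"

text \<open>The limit in \<open>C\<close> and its image in \<open>D\<close> are carried together, so
  that one induction over a filtration both constructs a limit and shows that \<open>F\<close>
  preserves it.\<close>

definition preserved :: "('o, 'm) sobj \<Rightarrow> (nat \<Rightarrow> 'm) \<Rightarrow> 'o \<Rightarrow> (nat \<Rightarrow> 'a \<Rightarrow> 'm) \<Rightarrow> 'a sset \<Rightarrow> 'o \<Rightarrow>
    (nat \<Rightarrow> 'a \<Rightarrow> 'm) \<Rightarrow> 'm \<Rightarrow> bool" where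
  "preserved X f B y K M \<pi> q \<longleftrightarrow> over_limit C X f B y K M \<pi> q
     \<and> over_limit D (LX X) (Ff f) (FObj F B) (Fy y) K (FObj F M) (Fy \<pi>) (FArr F q)"

definition preserved_cover :: "('o, 'm) smap \<Rightarrow> nat \<Rightarrow> delta_arr sset \<Rightarrow> bool" where
  "preserved_cover = (\<lambda>(X, Y, f) n K. \<exists>M \<pi> q u. preserved X f (FObj Y n) (\<lambda>m. FArr Y) K M \<pi> q
     \<and> matching_map C X f n K M \<pi> q u \<and> u \<in> SC)"

text \<open>In \<open>D\<close> the tautological cone is \<open>FArr (LX Y)\<close>, while
  \<open>preserved\<close> speaks of the image of \<open>FArr Y\<close>. They agree on arrows of
  \<open>Delta\<close>, which is all that a subcomplex of the simplex involves.\<close>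

lemma preserved_relative:
  assumes "preserved X f (FObj Y n) (\<lambda>m. FArr Y) (sub (std_simplex n) A) M \<pi> q" "subcomplex (std_simplex n) A"
  shows "over_limit D (LX X) (Ff f) (FObj (LX Y) n) (\<lambda>m. FArr (LX Y)) (sub (std_simplex n) A)
    (FObj F M) (Fy \<pi>) (FArr F q)"
proof -
  have "over_limit D (LX X) (Ff f) (FObj F (FObj Y n)) (\<lambda>m. FArr (LX Y)) (sub (std_simplex n) A)
    (FObj F M) (Fy \<pi>) (FArr F q) \<longleftrightarrow> over_limit D (LX X) (Ff f) (FObj F (FObj Y n)) (\<lambda>m \<sigma>. FArr F (FArr Y \<sigma>))
    (sub (std_simplex n) A) (FObj F M) (Fy \<pi>) (FArr F q)"
  proof (rule over_limit_cong)
    show "FArr (LX Y) \<sigma> = FArr F (FArr Y \<sigma>)" if "\<sigma> \<in> simplices (sub (std_simplex n) A) m" for m \<sigma>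
      using levelwise_FArr[of \<sigma> m n Y] subcomplexD(1)[OF assms(2)] that by simp
    show "sact (sub (std_simplex n) A) \<theta> \<sigma> \<in> simplices (sub (std_simplex n) A) k"
      if "\<theta> \<in> hom Delta k m" "\<sigma> \<in> simplices (sub (std_simplex n) A) m" for k m \<theta> \<sigma>
      using subcomplex_closed[OF assms(2) that] .
  qed simp
  then show ?thesis using assms(1) unfolding preserved_def levelwise_simps(1) by blast
qed

text \<open>The attaching pullback is assumed in both categories instead of being derived from a
  cover. So the lemma applies also to the first vertex of a cone, where the map to be pulled back is
  f_0.\<close>

lemma preserved_attach:
  assumes K: "is_sset K" and A: "subcomplex K A" and s: "s \<in> simplices K m"
    and inj: "\<And>k. inj_on (\<lambda>\<theta>. sact K \<theta> s) (hom Delta k m)"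
    and f: "(X, Y, f) \<in> Arr (simplicial_category C)" and y: "matching_cone C Y K B y"
    and M: "preserved X f B y (sub K A) M \<pi> q"
    and N: "preserved X f (FObj Y m) (\<lambda>k. FArr Y) (attaching K A s m) N \<nu> r"
    and u: "matching_map C X f m (attaching K A s m) N \<nu> r u"
    and v: "v \<in> hom C M N" "\<And>k \<theta>. \<theta> \<in> hom Delta k m \<Longrightarrow> sact K \<theta> s \<in> A k \<Longrightarrow>
      \<nu> k \<theta> \<cdot>\<^bsub>C\<^esub> v = \<pi> k (sact K \<theta> s)" "r \<cdot>\<^bsub>C\<^esub> v = y m s \<cdot>\<^bsub>C\<^esub> q"
    and pb: "is_pullback C u v x p" "is_pullback D (FArr F u) (FArr F v) (FArr F x) (FArr F p)"
  shows "preserved X f B y (sub K (attach K A s m)) (Dom C x) (attach_proj C X K A s m \<pi> x p) (q \<cdot>\<^bsub>C\<^esub> p)"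
proof -
  have MC: "over_limit C X f B y (sub K A) M \<pi> q"
    and MD: "over_limit D (LX X) (Ff f) (FObj F B) (Fy y) (sub K A) (FObj F M) (Fy \<pi>) (FArr F q)"
    using M unfolding preserved_def by auto
  have sub: "subcomplex (std_simplex m) (\<lambda>k. {\<theta> \<in> hom Delta k m. sact K \<theta> s \<in> A k})"
    unfolding subcomplex_def using delta_Comp(1) is_ssetD(2)[OF K _ _ s] subcomplexD(2)[OF A] by simp
  have NC: "over_limit C X f (FObj Y m) (\<lambda>k. FArr Y) (attaching K A s m) N \<nu> r"
    using N unfolding preserved_def by auto
  have ND: "over_limit D (LX X) (Ff f) (FObj (LX Y) m) (\<lambda>k. FArr (LX Y)) (attaching K A s m)
      (FObj F N) (Fy \<nu>) (FArr F r)"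
    using preserved_relative[OF N[unfolded attaching_def] sub] unfolding attaching_def .
  have u': "u \<in> hom C (FObj X m) N" "\<And>k \<theta>. \<theta> \<in> hom Delta k m \<Longrightarrow> sact K \<theta> s \<in> A k \<Longrightarrow> \<nu> k \<theta> \<cdot>\<^bsub>C\<^esub> u = FArr X \<theta>"
    "r \<cdot>\<^bsub>C\<^esub> u = f m"
    using u unfolding matching_map_def by auto
  note d = C.over_limitD[OF MC, simplified] and dN = C.over_limitD[OF NC, simplified]
  note p = C.is_pullbackD[OF pb(1)]
  have x: "x \<in> hom C (Dom C x) (FObj X m)" and p': "p \<in> hom C (Dom C x) M"
    using p C.homD[OF u'(1)] C.homD[OF v(1)] by (auto simp: hom_def)
  have C: "over_limit C X f B y (sub K (attach K A s m)) (Dom C x) (attach_proj C X K A s m \<pi> x p) (q \<cdot>\<^bsub>C\<^esub> p)"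
    using C.over_limit_attach[OF K A s inj f y MC NC[unfolded attaching_def] u' v pb(1)]
    unfolding attach_def attach_proj_def .
  note y' = levelwise_matching_cone[OF C.smapD(2)[OF f] y]
  have "over_limit D (LX X) (Ff f) (FObj F B) (Fy y) (sub K (attach K A s m)) (Dom D (FArr F x))
      (attach_proj D (LX X) K A s m (Fy \<pi>) (FArr F x) (FArr F p)) (FArr F q \<cdot>\<^bsub>D\<^esub> FArr F p)"
    unfolding attach_def attach_proj_def
  proof (rule D.over_limit_attach[OF K A s inj levelwise_smap[OF f] y' MD ND[unfolded attaching_def] _ _ _ _ _ _ pb(2)])
    show "FArr F u \<in> hom D (FObj (LX X) m) (FObj F N)" "FArr F v \<in> hom D (FObj F M) (FObj F N)"
      using FArr_in u'(1) v(1) by (simp_all add: levelwise_simps)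
    show "FArr F (\<nu> k \<theta>) \<cdot>\<^bsub>D\<^esub> FArr F u = FArr (LX X) \<theta>" if "\<theta> \<in> hom Delta k m" "sact K \<theta> s \<in> A k" for k \<theta>
      using FArr_Comp[OF u'(1) dN(2)] u'(2) that levelwise_FArr by simp
    show "FArr F (\<nu> k \<theta>) \<cdot>\<^bsub>D\<^esub> FArr F v = FArr F (\<pi> k (sact K \<theta> s))" if "\<theta> \<in> hom Delta k m" "sact K \<theta> s \<in> A k" for k \<theta>
      using FArr_Comp[OF v(1) dN(2)] v(2) that by simp
    show "FArr F r \<cdot>\<^bsub>D\<^esub> FArr F u = FArr F (f m)" using FArr_Comp[OF u'(1) dN(4)] u'(3) by simp
    have "y m s \<in> hom C B (FObj Y m)" using y s unfolding matching_cone_iff by blast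
    from FArr_Comp[OF d(4) this]
    show "FArr F r \<cdot>\<^bsub>D\<^esub> FArr F v = FArr F (y m s) \<cdot>\<^bsub>D\<^esub> FArr F q" using FArr_Comp[OF v(1) dN(4)] v(3) by simp
  qed
  moreover have "Dom D (FArr F x) = FObj F (Dom C x)" using p by simp
  moreover have "FArr F q \<cdot>\<^bsub>D\<^esub> FArr F p = FArr F (q \<cdot>\<^bsub>C\<^esub> p)" using FArr_Comp[OF p' d(4)] by simp
  \<comment> \<open>The projections constructed in \<open>D\<close> are the images of those
    constructed in \<open>C\<close>, separately on old and new simplices.\<close>
  moreover have "over_limit D (LX X) (Ff f) (FObj F B) (Fy y) (sub K (attach K A s m)) (FObj F (Dom C x))
      (attach_proj D (LX X) K A s m (Fy \<pi>) (FArr F x) (FArr F p)) (FArr F (q \<cdot>\<^bsub>C\<^esub> p)) \<longleftrightarrow>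
    over_limit D (LX X) (Ff f) (FObj F B) (Fy y) (sub K (attach K A s m)) (FObj F (Dom C x))
      (Fy (attach_proj C X K A s m \<pi> x p)) (FArr F (q \<cdot>\<^bsub>C\<^esub> p))"
  proof (rule over_limit_cong)
    fix k \<sigma> assume sk: "\<sigma> \<in> simplices (sub K (attach K A s m)) k"
    show "attach_proj D (LX X) K A s m (Fy \<pi>) (FArr F x) (FArr F p) k \<sigma> = FArr F (attach_proj C X K A s m \<pi> x p k \<sigma>)"
    proof (cases "\<sigma> \<in> A k")
      case True
      then show ?thesis using FArr_Comp[OF p' d(2)] by (simp add: attach_proj_def)
    next
      case False
      then obtain \<theta> where t: "\<theta> \<in> hom Delta k m" "\<sigma> = sact K \<theta> s" using sk by (auto simp: attach_def)
      have "the_inv_into (hom Delta k m) (\<lambda>\<theta>. sact K \<theta> s) \<sigma> = \<theta>"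
        unfolding t(2) by (rule the_inv_into_f_f[OF inj t(1)])
      then show ?thesis
        using False FArr_Comp[OF x C.sobj_hom[OF C.smapD(1)[OF f] t(1)]] levelwise_FArr[OF t(1)]
        by (simp add: attach_proj_def)
    qed
  qed (use subcomplex_closed[OF subcomplex_attach[OF K A s]] in auto)
  ultimately show ?thesis unfolding preserved_def using C by simp
qed

text \<open>The matching map \<open>u\<close> is a cover. This gives at once the existence of the
  pullback, its preservation by \<open>F\<close>, and the cover property of the restriction
  \<open>p\<close> to the previous stage, which is a base change of \<open>u\<close>.\<close>

lemma preserved_attach_cover:
  assumes K: "is_sset K" and A: "subcomplex K A" and s: "s \<in> simplices K m"
    and inj: "\<And>k. inj_on (\<lambda>\<theta>. sact K \<theta> s) (hom Delta k m)"
    and f: "(X, Y, f) \<in> Arr (simplicial_category C)" and y: "matching_cone C Y K B y"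
    and M: "preserved X f B y (sub K A) M \<pi> q"
    and N: "preserved_cover (X, Y, f) m (attaching K A s m)"
  obtains M' \<pi>' p where "preserved X f B y (sub K (attach K A s m)) M' \<pi>' (q \<cdot>\<^bsub>C\<^esub> p)" "p \<in> hom C M' M" "p \<in> SC"
    "\<And>k \<sigma>. \<sigma> \<in> A k \<Longrightarrow> \<pi>' k \<sigma> = \<pi> k \<sigma> \<cdot>\<^bsub>C\<^esub> p"
proof -
  obtain N \<nu> r u where N: "preserved X f (FObj Y m) (\<lambda>k. FArr Y) (attaching K A s m) N \<nu> r"
    and u: "matching_map C X f m (attaching K A s m) N \<nu> r u" and uS: "u \<in> SC"
    using N unfolding preserved_cover_def by auto
  have MC: "over_limit C X f B y (sub K A) M \<pi> q" using M unfolding preserved_def by auto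
  have NC: "over_limit C X f (FObj Y m) (\<lambda>k. FArr Y) (sub (std_simplex m) (\<lambda>k. {\<theta> \<in> hom Delta k m. sact K \<theta> s \<in> A k})) N \<nu> r"
    using N unfolding preserved_def attaching_def by auto
  obtain v where v: "v \<in> hom C M N" "\<And>k \<theta>. \<theta> \<in> hom Delta k m \<Longrightarrow> sact K \<theta> s \<in> A k \<Longrightarrow>
      \<nu> k \<theta> \<cdot>\<^bsub>C\<^esub> v = \<pi> k (sact K \<theta> s)" "r \<cdot>\<^bsub>C\<^esub> v = y m s \<cdot>\<^bsub>C\<^esub> q"
    by (rule C.attaching_map[OF K A s f y MC NC]) blast
  have uv: "Cod C u = Cod C v" "v \<in> Arr C"
    using u C.homD[OF v(1)] unfolding matching_map_def hom_def by auto
  obtain x p where pb: "is_pullback C u v x p" using C.pullback_exists[OF uS uv(2,1)] by blast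
  have pbD: "is_pullback D (FArr F u) (FArr F v) (FArr F x) (FArr F p)"
    by (rule preserves_cover_pullbacks[OF uS pb])
  have "p \<in> hom C (Dom C x) M" using C.is_pullbackD[OF pb] C.homD[OF v(1)] by (simp add: hom_def)
  then show ?thesis
    using that preserved_attach[OF K A s inj f y M N u v pb pbD] C.base_change[OF uS pb]
    by (simp add: attach_proj_def)
qed

end

section \<open>Subcomplexes of the simplex\<close>

text \<open>Whether a simplex of the n-simplex lies in a subcomplex depends only on its set of
  vertices. Encoding subcomplexes by families of vertex sets reduces horns and boundaries to set
  algebra.\<close>

definition image_in :: "nat \<Rightarrow> nat set set \<Rightarrow> nat \<Rightarrow> delta_arr set" where
  "image_in n \<K> k = {\<sigma> \<in> hom Delta k n. delta_image \<sigma> \<in> \<K>}"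

text \<open>The join with the vertex \<open>k\<close>, meant for families of sets that avoid
  \<open>k\<close>. Over \<open>{{}}\<close> it is the vertex \<open>k\<close>, over the proper
  subsets of the opposite facet the horn at \<open>k\<close>, over all subsets of that facet the
  full simplex.\<close>

definition cone_family :: "nat \<Rightarrow> nat set set \<Rightarrow> nat set set" where
  "cone_family k \<K> = {A. A - {k} \<in> \<K>}"

definition down_closed :: "'a set set \<Rightarrow> bool" where
  "down_closed \<K> \<longleftrightarrow> (\<forall>A\<in>\<K>. Pow A \<subseteq> \<K>)"

definition enum :: "nat set \<Rightarrow> nat \<Rightarrow> nat" where
  "enum A i = sorted_list_of_set A ! i"

text \<open>The nondegenerate simplex with vertex set \<open>A\<close>; the dimension
  \<open>card A - 1\<close> is meaningful for nonempty \<open>A\<close>.\<close>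

definition face :: "nat \<Rightarrow> nat set \<Rightarrow> delta_arr" where
  "face n A = delta_map (card A - 1) n (enum A)"

lemma down_closedD: "down_closed \<K> \<Longrightarrow> A \<in> \<K> \<Longrightarrow> B \<subseteq> A \<Longrightarrow> B \<in> \<K>"
  unfolding down_closed_def by blast

lemma delta_image_nonempty: "\<sigma> \<in> hom Delta k n \<Longrightarrow> delta_image \<sigma> \<noteq> {}"
  by (simp add: delta_image_hom)

text \<open>The image of a simplex is a nonempty subset of {..n}; on other sets two families may
  differ without changing the complex.\<close>

lemma image_in_cong:
  assumes "\<And>A. A \<subseteq> {..n} \<Longrightarrow> A \<noteq> {} \<Longrightarrow> A \<in> \<K> \<longleftrightarrow> A \<in> \<L>"
  shows "image_in n \<K> = image_in n \<L>"
proof -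
  have "delta_image \<sigma> \<in> \<K> \<longleftrightarrow> delta_image \<sigma> \<in> \<L>" if "\<sigma> \<in> hom Delta k n" for k \<sigma>
    using assms delta_image_subset[OF that] delta_image_nonempty[OF that] by blast
  then show ?thesis unfolding image_in_def by auto
qed

lemma subcomplex_image_in:
  assumes "down_closed \<K>" shows "subcomplex (std_simplex n) (image_in n \<K>)"
  unfolding subcomplex_def
proof (intro conjI allI ballI)
  fix k m \<theta> \<sigma> assume t: "\<theta> \<in> hom Delta k m" and s: "\<sigma> \<in> image_in n \<K> m"
  then have s': "\<sigma> \<in> hom Delta m n" "delta_image \<sigma> \<in> \<K>" by (auto simp: image_in_def)
  have "delta_image (\<sigma> \<cdot>\<^bsub>Delta\<^esub> \<theta>) \<subseteq> delta_image \<sigma>"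
    using delta_image_Comp[OF t s'(1)] delta_image_hom[OF s'(1)] delta_image_subset[OF t] by auto
  then show "sact (std_simplex n) \<theta> \<sigma> \<in> image_in n \<K> k"
    using delta_Comp(1)[OF t s'(1)] down_closedD[OF assms s'(2)] by (simp add: image_in_def)
qed (auto simp: image_in_def)

lemma horn_image_in: "horn n k = sub (std_simplex n) (image_in n {A. \<not> {..n} - {k} \<subseteq> A})"
  unfolding horn_def image_in_def by simp

lemma boundary_image_in: "boundary n = sub (std_simplex n) (image_in n {A. A \<noteq> {..n}})"
  unfolding boundary_def image_in_def by simp

lemma subcomplex_horn: "subcomplex (std_simplex n) (image_in n {A. \<not> {..n} - {k} \<subseteq> A})"
  by (rule subcomplex_image_in) (auto simp: down_closed_def)

lemma subcomplex_boundary: "subcomplex (std_simplex n) (image_in n {A. A \<noteq> {..n}})"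
proof -
  \<comment> \<open>\<open>{A. A \<noteq> {..n}}\<close> contains proper supersets of {..n} and so
    is not down-closed. It is replaced by a down-closed family with the same members among the
    subsets of {..n}.\<close>
  have "image_in n {A. A \<noteq> {..n}} = image_in n {A. \<not> {..n} \<subseteq> A}" by (rule image_in_cong) auto
  then show ?thesis using subcomplex_image_in[of "{A. \<not> {..n} \<subseteq> A}" n] by (auto simp: down_closed_def)
qed

lemma enum:
  assumes "A \<subseteq> {..n}" "A \<noteq> {}"
  shows "strict_mono_on {..card A - 1} (enum A)" "enum A ` {..card A - 1} = A"
proof -
  have fin: "finite A" using assms(1) finite_subset by blast
  let ?xs = "sorted_list_of_set A"
  have l: "length ?xs = card A" "set ?xs = A" "sorted_wrt (<) ?xs" using fin by simp_all
  have c: "card A > 0" using fin assms(2) by (simp add: card_gt_0_iff)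
  show "strict_mono_on {..card A - 1} (enum A)"
    unfolding enum_def using l c by (intro strict_mono_onI) (auto simp: sorted_wrt_nth_less)
  have "{..card A - 1} = {..<card A}" using c by auto
  moreover have "(\<lambda>i. ?xs ! i) ` {..<card A} = A" using l by (auto simp: set_conv_nth)
  ultimately show "enum A ` {..card A - 1} = A" unfolding enum_def by simp
qed

lemma face_hom:
  assumes "A \<subseteq> {..n}" "A \<noteq> {}"
  shows "face n A \<in> hom Delta (card A - 1) n"
    and "i \<le> card A - 1 \<Longrightarrow> delta_fun (face n A) i = enum A i"
proof -
  show "face n A \<in> hom Delta (card A - 1) n"
    unfolding face_def
  proof (rule delta_map_hom)
    show "enum A i \<le> n" if "i \<le> card A - 1" for i using enum(2)[OF assms] that assms(1) by blast
    show "enum A i \<le> enum A j" if "i \<le> j" "j \<le> card A - 1" for i j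
      using strict_mono_on_leD[OF enum(1)[OF assms]] that by simp
  qed
qed (simp add: face_def)

text \<open>A strictly increasing \<open>s\<close> reflects the order, so a pointwise choice of
  preimages of the values of \<open>\<sigma>\<close> is automatically monotone.\<close>

lemma delta_factor:
  assumes s: "s \<in> hom Delta m n" "strict_mono_on {..m} (delta_fun s)"
    and t: "\<sigma> \<in> hom Delta k n" "delta_image \<sigma> \<subseteq> delta_fun s ` {..m}"
  obtains \<theta> where "\<theta> \<in> hom Delta k m" "\<sigma> = s \<cdot>\<^bsub>Delta\<^esub> \<theta>"
proof -
  have "\<forall>i\<in>{..k}. \<exists>j\<in>{..m}. delta_fun s j = delta_fun \<sigma> i"
    using t delta_image_hom[OF t(1)] by (metis image_iff subsetD)
  then obtain h where h: "\<And>i. i \<le> k \<Longrightarrow> h i \<le> m" "\<And>i. i \<le> k \<Longrightarrow> delta_fun s (h i) = delta_fun \<sigma> i"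
    by (metis atMost_iff)
  have "h i \<le> h j" if "i \<le> j" "j \<le> k" for i j
  proof (rule ccontr)
    assume "\<not> h i \<le> h j"
    then have "delta_fun s (h j) < delta_fun s (h i)"
      using strict_mono_onD[OF s(2), of "h j" "h i"] h(1) that by simp
    then show False using h(2) delta_fun_mono[OF t(1) that] that by simp
  qed
  then have t': "delta_map k m h \<in> hom Delta k m" using h(1) by (intro delta_map_hom) auto
  moreover have "\<sigma> = s \<cdot>\<^bsub>Delta\<^esub> delta_map k m h"
    by (rule delta_eqI[OF t(1) delta_Comp(1)[OF t' s(1)]]) (simp add: delta_Comp(2)[OF t' s(1)] h(2))
  ultimately show ?thesis using that by blast
qed

lemma inj_on_Comp_delta:
  assumes s: "s \<in> hom Delta m n" "inj_on (delta_fun s) {..m}"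
  shows "inj_on (\<lambda>\<theta>. s \<cdot>\<^bsub>Delta\<^esub> \<theta>) (hom Delta k m)"
proof (rule inj_onI)
  fix \<theta> \<theta>' assume t: "\<theta> \<in> hom Delta k m" "\<theta>' \<in> hom Delta k m" and e: "s \<cdot>\<^bsub>Delta\<^esub> \<theta> = s \<cdot>\<^bsub>Delta\<^esub> \<theta>'"
  show "\<theta> = \<theta>'"
  proof (rule delta_eqI[OF t])
    fix i assume i: "i \<le> k"
    have "delta_fun s (delta_fun \<theta> i) = delta_fun s (delta_fun \<theta>' i)"
      using delta_Comp(2)[OF t(1) s(1) i] delta_Comp(2)[OF t(2) s(1) i] e by simp
    then show "delta_fun \<theta> i = delta_fun \<theta>' i"
      using s(2) delta_fun_le[OF t(1) i] delta_fun_le[OF t(2) i] by (auto dest: inj_onD)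
  qed
qed

lemma face_strict:
  assumes "A \<subseteq> {..n}" "A \<noteq> {}"
  shows "strict_mono_on {..card A - 1} (delta_fun (face n A))" "delta_fun (face n A) ` {..card A - 1} = A"
proof -
  have "delta_fun (face n A) i = enum A i" if "i \<in> {..card A - 1}" for i using face_hom(2)[OF assms] that by simp
  then show "strict_mono_on {..card A - 1} (delta_fun (face n A))" "delta_fun (face n A) ` {..card A - 1} = A"
    using enum[OF assms] by (simp_all add: monotone_on_def)
qed

text \<open>The simplices that factor through a face are exactly those with image in its vertex set,
  hence gluing the face adjoins \<open>Pow A\<close> to the family.\<close>

lemma attach_image_in:
  assumes A: "A \<subseteq> {..n}" "A \<noteq> {}"
  shows "attach (std_simplex n) (image_in n \<K>) (face n A) (card A - 1) = image_in n (\<K> \<union> Pow A)"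
proof (rule ext, rule set_eqI)
  fix k \<sigma>
  note s = face_hom(1)[OF A] face_strict[OF A]
  have "(\<exists>\<theta>\<in>hom Delta k (card A - 1). \<sigma> = face n A \<cdot>\<^bsub>Delta\<^esub> \<theta>) \<longleftrightarrow> \<sigma> \<in> hom Delta k n \<and> delta_image \<sigma> \<subseteq> A"
  proof
    assume "\<exists>\<theta>\<in>hom Delta k (card A - 1). \<sigma> = face n A \<cdot>\<^bsub>Delta\<^esub> \<theta>"
    then obtain \<theta> where t: "\<theta> \<in> hom Delta k (card A - 1)" "\<sigma> = face n A \<cdot>\<^bsub>Delta\<^esub> \<theta>" by blast
    show "\<sigma> \<in> hom Delta k n \<and> delta_image \<sigma> \<subseteq> A"
      unfolding t(2) using delta_Comp(1)[OF t(1) s(1)] delta_image_Comp[OF t(1) s(1)] delta_image_subset[OF t(1)] s(3)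
      by auto
  next
    assume "\<sigma> \<in> hom Delta k n \<and> delta_image \<sigma> \<subseteq> A"
    then show "\<exists>\<theta>\<in>hom Delta k (card A - 1). \<sigma> = face n A \<cdot>\<^bsub>Delta\<^esub> \<theta>"
      using delta_factor[OF s(1,2), of \<sigma> k] s(3) by metis
  qed
  then show "\<sigma> \<in> attach (std_simplex n) (image_in n \<K>) (face n A) (card A - 1) k \<longleftrightarrow> \<sigma> \<in> image_in n (\<K> \<union> Pow A) k"
    unfolding attach_def image_in_def by auto
qed

text \<open>\<open>enum A\<close> translates positions in the new simplex into vertices. Comparing
  the resulting family with that of a horn or a boundary identifies the matching map that has to be
  a cover.\<close>

lemma attaching_image_in:
  assumes A: "A \<subseteq> {..n}" "A \<noteq> {}"
  shows "attaching (std_simplex n) (image_in n \<K>) (face n A) (card A - 1) =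
    sub (std_simplex (card A - 1)) (image_in (card A - 1) {B. enum A ` B \<in> \<K>})"
proof -
  have "face n A \<cdot>\<^bsub>Delta\<^esub> \<theta> \<in> image_in n \<K> k \<longleftrightarrow> enum A ` delta_image \<theta> \<in> \<K>" if t: "\<theta> \<in> hom Delta k (card A - 1)" for k \<theta>
  proof -
    have "delta_fun (face n A) ` delta_image \<theta> = enum A ` delta_image \<theta>"
      using delta_image_subset[OF t] face_hom(2)[OF A] by (intro image_cong) auto
    then show ?thesis
      unfolding image_in_def using delta_Comp(1)[OF t face_hom(1)[OF A]] delta_image_Comp[OF t face_hom(1)[OF A]] by simp
  qed
  then have "(\<lambda>k. {\<theta> \<in> hom Delta k (card A - 1). face n A \<cdot>\<^bsub>Delta\<^esub> \<theta> \<in> image_in n \<K> k}) =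
      image_in (card A - 1) {B. enum A ` B \<in> \<K>}"
    unfolding image_in_def[of "card A - 1"] by auto
  then show ?thesis unfolding attaching_def by simp
qed

section \<open>Filtrations of cones and of boundaries by their faces\<close>

context geometric_pair
begin

lemma preserved_attach_face:
  assumes A: "A \<subseteq> {..n}" "A \<noteq> {}" and \<K>: "down_closed \<K>"
    and f: "(X, Y, f) \<in> Arr (simplicial_category C)" and y: "matching_cone C Y (std_simplex n) B y"
    and M: "preserved X f B y (sub (std_simplex n) (image_in n \<K>)) M \<pi> q"
    and N: "preserved_cover (X, Y, f) (card A - 1)
      (sub (std_simplex (card A - 1)) (image_in (card A - 1) {B. enum A ` B \<in> \<K>}))"
  obtains M' \<pi>' p where "preserved X f B y (sub (std_simplex n) (image_in n (\<K> \<union> Pow A))) M' \<pi>' (q \<cdot>\<^bsub>C\<^esub> p)"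
    "p \<in> hom C M' M" "p \<in> SC" "\<And>k \<sigma>. \<sigma> \<in> image_in n \<K> k \<Longrightarrow> \<pi>' k \<sigma> = \<pi> k \<sigma> \<cdot>\<^bsub>C\<^esub> p"
proof -
  note s = face_hom(1)[OF A] face_strict[OF A]
  have inj: "inj_on (\<lambda>\<theta>. sact (std_simplex n) \<theta> (face n A)) (hom Delta k (card A - 1))" for k
    using inj_on_Comp_delta[OF s(1) strict_mono_on_imp_inj_on[OF s(2)]] by simp
  have s': "face n A \<in> simplices (std_simplex n) (card A - 1)" using s(1) by simp
  note N' = N[folded attaching_image_in[OF A]]
  show ?thesis
    by (rule preserved_attach_cover[OF is_sset_std_simplex subcomplex_image_in[OF \<K>] s' inj f y M N',
          unfolded attach_image_in[OF A]]) (rule that)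
qed

text \<open>Passes from \<open>\<K>\<close> to \<open>\<L>\<close> by adding one set
  \<open>A\<close> at a time. \<open>E\<close> gives the complex that a family stands for and
  \<open>G A\<close> the vertices of the simplex glued when \<open>A\<close> is added:
  \<open>cone_family k\<close> and \<open>insert k\<close> for cones, identities for boundaries. The
  restriction map from the last stage to the first is a composite of covers.\<close>

lemma face_chain:
  assumes f: "(X, Y, f) \<in> Arr (simplicial_category C)" and y: "matching_cone C Y (std_simplex n) B y"
    and le: "\<K> \<subseteq> \<L>" "down_closed \<K>" "down_closed \<L>" "finite \<L>" and e: "{} \<in> \<K>"
    and E: "\<And>\<J>. down_closed \<J> \<Longrightarrow> down_closed (E \<J>)"
    and P: "\<And>\<J> A. \<K> \<subseteq> \<J> \<Longrightarrow> \<J> \<subseteq> \<L> \<Longrightarrow> down_closed \<J> \<Longrightarrow> A \<in> \<L> - \<J> \<Longrightarrow> (\<And>B. B \<subset> A \<Longrightarrow> B \<in> \<J>) \<Longrightarrow>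
      G A \<subseteq> {..n} \<and> G A \<noteq> {} \<and> image_in n (E \<J> \<union> Pow (G A)) = image_in n (E (insert A \<J>))
      \<and> preserved_cover (X, Y, f) (card (G A) - 1)
          (sub (std_simplex (card (G A) - 1)) (image_in (card (G A) - 1) {B. enum (G A) ` B \<in> E \<J>}))"
    and M: "preserved X f B y (sub (std_simplex n) (image_in n (E \<K>))) M \<pi> q"
    and mono: "\<And>\<J> \<J>'. \<J> \<subseteq> \<J>' \<Longrightarrow> E \<J> \<subseteq> E \<J>'"
  shows "\<exists>M' \<pi>' p. preserved X f B y (sub (std_simplex n) (image_in n (E \<L>))) M' \<pi>' (q \<cdot>\<^bsub>C\<^esub> p)
    \<and> p \<in> hom C M' M \<and> p \<in> SC \<and> (\<forall>k. \<forall>\<sigma>\<in>image_in n (E \<K>) k. \<pi>' k \<sigma> = \<pi> k \<sigma> \<cdot>\<^bsub>C\<^esub> p)"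
  using le(1,2) e P M
proof (induction "card (\<L> - \<K>)" arbitrary: \<K> M \<pi> q rule: less_induct)
  case less
  have MC: "over_limit C X f B y (sub (std_simplex n) (image_in n (E \<K>))) M \<pi> q"
    using less.prems(5) unfolding preserved_def by blast
  note d = C.over_limitD[OF MC]
  show ?case
  proof (cases "\<K> = \<L>")
    case True
    have "\<forall>k. \<forall>\<sigma>\<in>image_in n (E \<K>) k. \<pi> k \<sigma> = \<pi> k \<sigma> \<cdot>\<^bsub>C\<^esub> Ident C M"
      using C.Ident_right[OF d(2)] by simp
    then show ?thesis
      using less.prems(5) C.Ident_in[OF d(1)] C.Ident_cover[OF d(1)] C.Ident_right[OF d(4)] True
      by (intro exI[of _ M] exI[of _ \<pi>] exI[of _ "Ident C M"]) simp
  next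
    case False
    \<comment> \<open>A missing set of least cardinality has all its proper subsets present, so
      exactly one new simplex is glued.\<close>
    obtain A where A: "A \<in> \<L> - \<K>" and min: "\<And>B. B \<in> \<L> - \<K> \<Longrightarrow> card A \<le> card B"
      using ex_has_least_nat[of "\<lambda>A. A \<in> \<L> - \<K>" _ card] False less.prems(1) by blast
    \<comment> \<open>Down-closedness places \<open>Pow A\<close> inside the finite family
      \<open>\<L>\<close>.\<close>
    have "finite (Pow A)" using le(3,4) A unfolding down_closed_def by (meson DiffD1 finite_subset)
    then have "finite A" by simp
    then have sm: "B \<in> \<K>" if "B \<subset> A" for B
      using min[of B] psubset_card_mono[OF \<open>finite A\<close> that] down_closedD[OF le(3), of A B] A that by fastforce
    note P' = less.prems(4)[OF subset_refl less.prems(1,2) A sm]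
    have G: "G A \<subseteq> {..n}" "G A \<noteq> {}" and fe: "image_in n (E \<K> \<union> Pow (G A)) = image_in n (E (insert A \<K>))"
      and N: "preserved_cover (X, Y, f) (card (G A) - 1)
          (sub (std_simplex (card (G A) - 1)) (image_in (card (G A) - 1) {B. enum (G A) ` B \<in> E \<K>}))"
      using P' by blast+
    obtain M1 \<pi>1 p1 where 1: "preserved X f B y (sub (std_simplex n) (image_in n (E \<K> \<union> Pow (G A)))) M1 \<pi>1 (q \<cdot>\<^bsub>C\<^esub> p1)"
      "p1 \<in> hom C M1 M" "p1 \<in> SC" "\<And>k \<sigma>. \<sigma> \<in> image_in n (E \<K>) k \<Longrightarrow> \<pi>1 k \<sigma> = \<pi> k \<sigma> \<cdot>\<^bsub>C\<^esub> p1"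
      by (rule preserved_attach_face[OF G E[OF less.prems(2)] f y less.prems(5) N]) blast
    have dc: "down_closed (insert A \<K>)"
      using less.prems(2) sm unfolding down_closed_def by (auto simp: subset_iff psubset_eq; blast)
    have "\<exists>M' \<pi>' p. preserved X f B y (sub (std_simplex n) (image_in n (E \<L>))) M' \<pi>' ((q \<cdot>\<^bsub>C\<^esub> p1) \<cdot>\<^bsub>C\<^esub> p)
      \<and> p \<in> hom C M' M1 \<and> p \<in> SC \<and> (\<forall>k. \<forall>\<sigma>\<in>image_in n (E (insert A \<K>)) k. \<pi>' k \<sigma> = \<pi>1 k \<sigma> \<cdot>\<^bsub>C\<^esub> p)"
    proof (rule less.hyps)
      have "\<L> - insert A \<K> \<subset> \<L> - \<K>" using A by blast
      then show "card (\<L> - insert A \<K>) < card (\<L> - \<K>)" using le(4) by (intro psubset_card_mono) auto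
      show "insert A \<K> \<subseteq> \<L>" using A less.prems(1) by blast
      show "down_closed (insert A \<K>)" by (fact dc)
      show "{} \<in> insert A \<K>" using less.prems(3) by blast
      show "preserved X f B y (sub (std_simplex n) (image_in n (E (insert A \<K>)))) M1 \<pi>1 (q \<cdot>\<^bsub>C\<^esub> p1)"
        using 1(1) fe by simp
    qed (rule less.prems(4), blast+)
    then obtain M' \<pi>' p where 2: "preserved X f B y (sub (std_simplex n) (image_in n (E \<L>))) M' \<pi>' ((q \<cdot>\<^bsub>C\<^esub> p1) \<cdot>\<^bsub>C\<^esub> p)"
      "p \<in> hom C M' M1" "p \<in> SC" "\<And>k \<sigma>. \<sigma> \<in> image_in n (E (insert A \<K>)) k \<Longrightarrow> \<pi>' k \<sigma> = \<pi>1 k \<sigma> \<cdot>\<^bsub>C\<^esub> p" by blast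
    have "p1 \<cdot>\<^bsub>C\<^esub> p \<in> SC" using C.cover_Comp[OF 2(3) 1(3)] C.homD[OF 1(2)] C.homD[OF 2(2)] by simp
    moreover have "\<pi>' k \<sigma> = \<pi> k \<sigma> \<cdot>\<^bsub>C\<^esub> (p1 \<cdot>\<^bsub>C\<^esub> p)" if s: "\<sigma> \<in> image_in n (E \<K>) k" for k \<sigma>
    proof -
      have "\<sigma> \<in> image_in n (E (insert A \<K>)) k" using s mono[of \<K> "insert A \<K>"] unfolding image_in_def by blast
      then show ?thesis
        using 2(4) 1(4)[OF s] C.Comp_assoc[OF 2(2) 1(2) d(2)] s by simp
    qed
    ultimately show ?thesis
      using 2(1) C.Comp_assoc[OF 2(2) 1(2) d(4)] C.Comp_in[OF 2(2) 1(2)]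
      by (intro exI[of _ M'] exI[of _ \<pi>'] exI[of _ "p1 \<cdot>\<^bsub>C\<^esub> p"]) simp
  qed
qed

text \<open>When all proper subsets of \<open>A\<close> are present but \<open>A\<close> is not, the
  simplex on \<open>insert k A\<close> meets the cone in all its facets except the one opposite
  \<open>k\<close>. The gluing locus is therefore a horn, whose matching map is a cover by
  hypothesis. The bound \<open>N\<close> lets the chain run inside an induction on the dimension of
  horns.\<close>

lemma cone_chain:
  assumes f: "(X, Y, f) \<in> Arr (simplicial_category C)" and y: "matching_cone C Y (std_simplex n) B y"
    and k: "k \<le> n" and horns: "\<forall>m j. 1 \<le> m \<longrightarrow> m \<le> N \<longrightarrow> j \<le> m \<longrightarrow> preserved_cover (X, Y, f) m (horn m j)"
    and \<K>: "\<K> \<subseteq> \<L>" "down_closed \<K>" "down_closed \<L>" "{} \<in> \<K>" "\<L> \<subseteq> Pow ({..n} - {k})"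
    and N: "\<forall>A\<in>\<L> - \<K>. card A \<le> N"
    and M: "preserved X f B y (sub (std_simplex n) (image_in n (cone_family k \<K>))) M \<pi> q"
  shows "\<exists>M' \<pi>' p. preserved X f B y (sub (std_simplex n) (image_in n (cone_family k \<L>))) M' \<pi>' (q \<cdot>\<^bsub>C\<^esub> p)
    \<and> p \<in> hom C M' M \<and> p \<in> SC \<and> (\<forall>j. \<forall>\<sigma>\<in>image_in n (cone_family k \<K>) j. \<pi>' j \<sigma> = \<pi> j \<sigma> \<cdot>\<^bsub>C\<^esub> p)"
proof (rule face_chain[OF f y \<K>(1-3) _ \<K>(4), where G="insert k"])
  show "finite \<L>" using \<K>(5) finite_subset by blast
  show "down_closed (cone_family k \<J>)" if "down_closed \<J>" for \<J>
    unfolding down_closed_def cone_family_def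
    by (auto intro: down_closedD[OF that, OF _ Diff_mono])
  show "preserved X f B y (sub (std_simplex n) (image_in n (cone_family k \<K>))) M \<pi> q" by (fact M)
  show "cone_family k \<J> \<subseteq> cone_family k \<J>'" if "\<J> \<subseteq> \<J>'" for \<J> \<J>' using that unfolding cone_family_def by blast
  fix \<J> A assume \<J>: "\<K> \<subseteq> \<J>" "\<J> \<subseteq> \<L>" "down_closed \<J>" and A: "A \<in> \<L> - \<J>" and sm: "\<And>B. B \<subset> A \<Longrightarrow> B \<in> \<J>"
  have Ak: "A \<subseteq> {..n} - {k}" using A \<K>(5) by blast
  have fin: "finite A" using Ak finite_subset by blast
  let ?A = "insert k A" and ?m = "card (insert k A) - 1"
  have "k \<notin> A" using Ak by blast
  then have m: "?m = card A" using fin by simp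
  \<comment> \<open>The empty set is present from the start, so the glued simplex has dimension at
    least 1, the range in which horns are considered.\<close>
  have ne: "A \<noteq> {}" using A \<J>(1) \<K>(4) by blast
  have mm: "1 \<le> ?m" "?m \<le> N" unfolding m using ne fin N A \<J>(1) by (auto simp: Suc_le_eq card_gt_0_iff)
  have A': "?A \<subseteq> {..n}" "?A \<noteq> {}" using Ak k by auto
  note en = enum[OF A']
  have inj: "inj_on (enum ?A) {..?m}" using strict_mono_on_imp_inj_on[OF en(1)] .
  \<comment> \<open>\<open>j\<close> is the position of \<open>k\<close> in the increasing
    enumeration of the glued simplex, hence the index of its horn.\<close>
  obtain j where j: "j \<le> ?m" "enum ?A j = k" using en(2) by (metis atMost_iff image_iff insertI1)
  have key: "T \<in> \<J> \<longleftrightarrow> T \<noteq> A" if "T \<subseteq> A" for T using sm[of T] A that by blast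
  have "image_in n (cone_family k \<J> \<union> Pow ?A) = image_in n (cone_family k (insert A \<J>))"
  proof (rule image_in_cong)
    fix S :: "nat set"
    have "S \<in> cone_family k \<J> \<union> Pow ?A \<longleftrightarrow> S - {k} \<in> \<J> \<or> S - {k} \<subseteq> A"
      unfolding cone_family_def by auto
    also have "\<dots> \<longleftrightarrow> S - {k} \<in> insert A \<J>" using sm by blast
    finally show "S \<in> cone_family k \<J> \<union> Pow ?A \<longleftrightarrow> S \<in> cone_family k (insert A \<J>)"
      unfolding cone_family_def by simp
  qed
  moreover have "image_in ?m {B. enum ?A ` B \<in> cone_family k \<J>} = image_in ?m {B. \<not> {..?m} - {j} \<subseteq> B}"
  proof (rule image_in_cong)
    fix S assume S: "S \<subseteq> {..?m}"
    have e: "enum ?A ` S - {k} = enum ?A ` (S - {j})"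
      using inj_on_image_set_diff[OF inj, of S "{j}"] S j by auto
    have "enum ?A ` ({..?m} - {j}) = A"
      using inj_on_image_set_diff[OF inj, of "{..?m}" "{j}"] j en(2) Ak by auto
    then have "enum ?A ` (S - {j}) = A \<longleftrightarrow> S - {j} = {..?m} - {j}"
      using inj_on_image_eq_iff[OF inj, of "S - {j}" "{..?m} - {j}"] S by auto
    moreover have "enum ?A ` (S - {j}) \<subseteq> A"
      using \<open>enum ?A ` ({..?m} - {j}) = A\<close> S by blast
    ultimately have "enum ?A ` (S - {j}) \<in> \<J> \<longleftrightarrow> S - {j} \<noteq> {..?m} - {j}"
      using key by simp
    also have "\<dots> \<longleftrightarrow> \<not> {..?m} - {j} \<subseteq> S" using S by blast
    finally show "S \<in> {B. enum ?A ` B \<in> cone_family k \<J>} \<longleftrightarrow> S \<in> {B. \<not> {..?m} - {j} \<subseteq> B}"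
      unfolding cone_family_def by (simp add: e)
  qed
  ultimately show "?A \<subseteq> {..n} \<and> ?A \<noteq> {} \<and> image_in n (cone_family k \<J> \<union> Pow ?A) = image_in n (cone_family k (insert A \<J>))
      \<and> preserved_cover (X, Y, f) ?m (sub (std_simplex ?m) (image_in ?m {B. enum ?A ` B \<in> cone_family k \<J>}))"
    using A' horns[rule_format, OF mm j(1)] unfolding horn_image_in by simp
qed

text \<open>With all proper subsets of \<open>A\<close> present the new simplex is glued along its
  whole boundary. Its dimension is \<open>card A - 1\<close>, so sets of at most \<open>N\<close>
  elements involve only boundaries below dimension \<open>N\<close>; a vertex is glued along the
  empty boundary of dimension 0.\<close>

lemma boundary_chain:
  assumes f: "(X, Y, f) \<in> Arr (simplicial_category C)" and y: "matching_cone C Y (std_simplex n) B y"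
    and bd: "\<forall>m<N. preserved_cover (X, Y, f) m (boundary m)"
    and \<K>: "\<K> \<subseteq> \<L>" "down_closed \<K>" "down_closed \<L>" "{} \<in> \<K>" "\<L> \<subseteq> Pow {..n}"
    and N: "\<forall>A\<in>\<L> - \<K>. card A \<le> N"
    and M: "preserved X f B y (sub (std_simplex n) (image_in n \<K>)) M \<pi> q"
  shows "\<exists>M' \<pi>' p. preserved X f B y (sub (std_simplex n) (image_in n \<L>)) M' \<pi>' (q \<cdot>\<^bsub>C\<^esub> p)
    \<and> p \<in> hom C M' M \<and> p \<in> SC \<and> (\<forall>j. \<forall>\<sigma>\<in>image_in n \<K> j. \<pi>' j \<sigma> = \<pi> j \<sigma> \<cdot>\<^bsub>C\<^esub> p)"
proof (rule face_chain[OF f y \<K>(1-3) _ \<K>(4), where G="\<lambda>A. A" and E="\<lambda>\<J>. \<J>"])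
  show "finite \<L>" using \<K>(5) finite_subset by blast
  show "preserved X f B y (sub (std_simplex n) (image_in n \<K>)) M \<pi> q" by (fact M)
  fix \<J> A assume \<J>: "\<K> \<subseteq> \<J>" "\<J> \<subseteq> \<L>" "down_closed \<J>" and A: "A \<in> \<L> - \<J>" and sm: "\<And>B. B \<subset> A \<Longrightarrow> B \<in> \<J>"
  have An: "A \<subseteq> {..n}" using A \<K>(5) by blast
  have fin: "finite A" using An finite_subset by blast
  have ne: "A \<noteq> {}" using A \<J>(1) \<K>(4) by blast
  let ?m = "card A - 1"
  have m: "?m < N" using ne fin N[rule_format, of A] A \<J>(1) by (metis DiffD1 DiffD2 DiffI One_nat_def Suc_pred card_gt_0_iff less_eq_Suc_le subsetD)
  note en = enum[OF An ne]
  have inj: "inj_on (enum A) {..?m}" using strict_mono_on_imp_inj_on[OF en(1)] .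
  have key: "T \<in> \<J> \<longleftrightarrow> T \<noteq> A" if "T \<subseteq> A" for T using sm[of T] A that by blast
  have "image_in n (\<J> \<union> Pow A) = image_in n (insert A \<J>)"
    using sm by (intro image_in_cong) blast
  moreover have "image_in ?m {B. enum A ` B \<in> \<J>} = image_in ?m {B. B \<noteq> {..?m}}"
  proof (rule image_in_cong)
    fix S assume S: "S \<subseteq> {..?m}"
    have "enum A ` S = A \<longleftrightarrow> S = {..?m}" using inj_on_image_eq_iff[OF inj S, of "{..?m}"] en(2) by auto
    moreover have "enum A ` S \<subseteq> A" using en(2) S by blast
    ultimately show "S \<in> {B. enum A ` B \<in> \<J>} \<longleftrightarrow> S \<in> {B. B \<noteq> {..?m}}"
      using key by simp
  qed
  ultimately show "A \<subseteq> {..n} \<and> A \<noteq> {} \<and> image_in n (\<J> \<union> Pow A) = image_in n (insert A \<J>)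
      \<and> preserved_cover (X, Y, f) ?m (sub (std_simplex ?m) (image_in ?m {B. enum A ` B \<in> \<J>}))"
    using An ne bd[rule_format, OF m] unfolding boundary_image_in by simp
qed

end

section \<open>Kan fibrations and groupoids\<close>

text \<open>Relative matching objects are unique up to isomorphism and isomorphisms are covers, so
  the choice made in \<open>matching_map_cover\<close> is harmless.\<close>

lemma (in cover_category) matching_map_in_covers:
  assumes f: "(X, Y, f) \<in> Arr (simplicial_category C)" and A: "subcomplex (std_simplex n) A"
    and M: "over_limit C X f (FObj Y n) (\<lambda>m. FArr Y) (sub (std_simplex n) A) M \<pi> q"
    and u: "matching_map C X f n (sub (std_simplex n) A) M \<pi> q u"
    and mc: "matching_map_cover C S (X, Y, f) n (sub (std_simplex n) A)"
  shows "u \<in> S"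
proof -
  obtain M' \<pi>' q' u' where M': "over_limit C X f (FObj Y n) (\<lambda>m. FArr Y) (sub (std_simplex n) A) M' \<pi>' q'"
    and u': "matching_map C X f n (sub (std_simplex n) A) M' \<pi>' q' u'" "u' \<in> S"
    using mc unfolding matching_map_cover_iff by blast
  have y: "\<forall>m. \<forall>\<sigma>\<in>simplices (sub (std_simplex n) A) m. FArr Y \<sigma> \<in> hom C (FObj Y n) (FObj Y m)"
    using subcomplexD(1)[OF A] sobj_hom[OF smapD(2)[OF f]] by simp
  obtain i where i: "i \<in> hom C M' M" "iso_arrow C i"
    "\<And>m \<sigma>. \<sigma> \<in> simplices (sub (std_simplex n) A) m \<Longrightarrow> \<pi> m \<sigma> \<cdot>\<^bsub>C\<^esub> i = \<pi>' m \<sigma>" "q \<cdot>\<^bsub>C\<^esub> i = q'"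
    using over_limit_unique[OF f y M M'] by blast
  note d = over_limitD[OF M] and uu = u[unfolded matching_map_def] u'(1)[unfolded matching_map_def]
  have "u = i \<cdot>\<^bsub>C\<^esub> u'"
  proof (rule over_limit_eq[OF f y M])
    show "u \<in> hom C (FObj X n) M" "i \<cdot>\<^bsub>C\<^esub> u' \<in> hom C (FObj X n) M" using uu Comp_in i(1) by blast+
    show "\<pi> m \<sigma> \<cdot>\<^bsub>C\<^esub> u = \<pi> m \<sigma> \<cdot>\<^bsub>C\<^esub> (i \<cdot>\<^bsub>C\<^esub> u')" if "\<sigma> \<in> simplices (sub (std_simplex n) A) m" for m \<sigma>
      using Comp_assoc[OF _ i(1) d(2)[OF that], of u'] i(3)[OF that] uu that by metis
    show "q \<cdot>\<^bsub>C\<^esub> u = q \<cdot>\<^bsub>C\<^esub> (i \<cdot>\<^bsub>C\<^esub> u')" using Comp_assoc[OF _ i(1) d(4), of u'] i(4) uu by metis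
  qed
  moreover have "Cod C u' = Dom C i" using uu i(1) by (auto simp: hom_def)
  ultimately show ?thesis using cover_Comp[OF u'(2) iso_cover[OF i(2)]] by simp
qed

text \<open>Connectedness in a single step from a centre, which is easy to verify. The edge may
  point either way, because the distinguished vertex of a horn can lie between the others.\<close>

definition star_connected :: "'a sset \<Rightarrow> 'a \<Rightarrow> bool" where
  "star_connected K v \<longleftrightarrow> v \<in> simplices K 0 \<and> (\<forall>z\<in>simplices K 0. \<exists>e\<in>simplices K 1.
     {sact K (vertex 1 0) e, sact K (vertex 1 1) e} = {v, z})"

context category
begin

text \<open>A constant object distinguishes neither a simplex from its first vertex nor the two ends
  of an edge, and every vertex is joined to \<open>v\<close> by an edge.\<close>

lemma star_connected_constant:
  assumes K: "star_connected K v" "\<And>\<sigma> m. \<sigma> \<in> simplices K m \<Longrightarrow> sact K (vertex m 0) \<sigma> \<in> simplices K 0"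
    and X: "X \<in> simplicial_objects C" and a: "a \<in> Obj C"
    and g: "(X, constant_sobj C a, g) \<in> Arr (simplicial_category C)"
    and \<rho>: "matching_cone C X K T \<rho>" and s: "\<sigma> \<in> simplices K m"
  shows "g m \<cdot>\<^bsub>C\<^esub> \<rho> m \<sigma> = g 0 \<cdot>\<^bsub>C\<^esub> \<rho> 0 v"
proof -
  have g': "g n \<in> hom C (FObj X n) a" "\<theta> \<in> hom Delta m n \<Longrightarrow> g m \<cdot>\<^bsub>C\<^esub> FArr X \<theta> = g n" for n m \<theta>
    using g to_constant_iff[OF X a] by auto
  have r: "\<rho> m \<sigma> \<in> hom C T (FObj X m)" "\<theta> \<in> hom Delta k m \<Longrightarrow> FArr X \<theta> \<cdot>\<^bsub>C\<^esub> \<rho> m \<sigma> = \<rho> k (sact K \<theta> \<sigma>)"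
    if "\<sigma> \<in> simplices K m" for k m \<sigma> \<theta>
    using \<rho> that unfolding matching_cone_iff by blast+
  have step: "g k \<cdot>\<^bsub>C\<^esub> \<rho> k (sact K \<theta> \<sigma>) = g m \<cdot>\<^bsub>C\<^esub> \<rho> m \<sigma>" if "\<sigma> \<in> simplices K m" "\<theta> \<in> hom Delta k m" for k m \<sigma> \<theta>
    using Comp_assoc[OF r(1)[OF that(1)] sobj_hom[OF X that(2)] g'(1)] r(2)[OF that] g'(2)[OF that(2)] by simp
  let ?z = "sact K (vertex m 0) \<sigma>"
  have z: "?z \<in> simplices K 0" using K(2) s by blast
  obtain e where e: "e \<in> simplices K 1" "{sact K (vertex 1 0) e, sact K (vertex 1 1) e} = {v, ?z}"
    using K(1) z unfolding star_connected_def by blast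
  have "g 0 \<cdot>\<^bsub>C\<^esub> \<rho> 0 (sact K (vertex 1 0) e) = g 1 \<cdot>\<^bsub>C\<^esub> \<rho> 1 e" "g 0 \<cdot>\<^bsub>C\<^esub> \<rho> 0 (sact K (vertex 1 1) e) = g 1 \<cdot>\<^bsub>C\<^esub> \<rho> 1 e"
    using step[OF e(1) vertex_hom] by simp_all
  then have "g 0 \<cdot>\<^bsub>C\<^esub> \<rho> 0 v = g 0 \<cdot>\<^bsub>C\<^esub> \<rho> 0 ?z" using e(2) by (metis doubleton_eq_iff)
  then show ?thesis using step[OF s vertex_hom] by simp
qed

text \<open>The leg into \<open>a\<close> carries no information, being forced to be the value of
  \<open>g\<close> at the centre \<open>v\<close>. What remains is the absolute matching object, so
  F* can be exchanged for a terminal object of \<open>D\<close>.\<close>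

lemma over_constant_iff:
  assumes K: "star_connected K v" "\<And>\<sigma> m. \<sigma> \<in> simplices K m \<Longrightarrow> sact K (vertex m 0) \<sigma> \<in> simplices K 0"
    and g: "(X, constant_sobj C a, g) \<in> Arr (simplicial_category C)"
  shows "over_limit C X g a (\<lambda>_ _. Ident C a) K M \<pi> q \<longleftrightarrow> matching_object C X K M \<pi> \<and> q = g 0 \<cdot>\<^bsub>C\<^esub> \<pi> 0 v"
proof -
  note X = smapD(1)[OF g]
  have a: "a \<in> Obj C" using homD(5)[OF smapD(3)[OF g, of 0]] by simp
  have v: "v \<in> simplices K 0" using K(1) by (simp add: star_connected_def)
  have g0: "g n \<in> hom C (FObj X n) a" for n using smapD(3)[OF g] by simp
  have cone: "over_cone C X g a (\<lambda>_ _. Ident C a) K T \<rho> w \<longleftrightarrow> matching_cone C X K T \<rho> \<and> w = g 0 \<cdot>\<^bsub>C\<^esub> \<rho> 0 v" for T \<rho> w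
  proof
    assume "over_cone C X g a (\<lambda>_ _. Ident C a) K T \<rho> w"
    then show "matching_cone C X K T \<rho> \<and> w = g 0 \<cdot>\<^bsub>C\<^esub> \<rho> 0 v"
      using v Ident_left unfolding over_cone_def by metis
  next
    assume r: "matching_cone C X K T \<rho> \<and> w = g 0 \<cdot>\<^bsub>C\<^esub> \<rho> 0 v"
    then have w: "w \<in> hom C T a" using v g0 Comp_in unfolding matching_cone_iff by blast
    then show "over_cone C X g a (\<lambda>_ _. Ident C a) K T \<rho> w"
      unfolding over_cone_def using r star_connected_constant[OF K X a g] Ident_left[OF w] by metis
  qed
  have "(\<forall>m. \<forall>\<sigma>\<in>simplices K m. \<pi> m \<sigma> \<cdot>\<^bsub>C\<^esub> u = \<rho> m \<sigma>) \<and> q \<cdot>\<^bsub>C\<^esub> u = g 0 \<cdot>\<^bsub>C\<^esub> \<rho> 0 v \<longleftrightarrow>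
      (\<forall>m. \<forall>\<sigma>\<in>simplices K m. \<pi> m \<sigma> \<cdot>\<^bsub>C\<^esub> u = \<rho> m \<sigma>)"
    if "matching_cone C X K M \<pi>" "q = g 0 \<cdot>\<^bsub>C\<^esub> \<pi> 0 v" "u \<in> hom C T M" for T u \<rho>
  proof -
    have "\<pi> 0 v \<in> hom C M (FObj X 0)" using that(1) v unfolding matching_cone_iff by blast
    then have "q \<cdot>\<^bsub>C\<^esub> u = g 0 \<cdot>\<^bsub>C\<^esub> (\<pi> 0 v \<cdot>\<^bsub>C\<^esub> u)" using Comp_assoc[OF that(3) _ g0] that(2) by simp
    then show ?thesis using v by auto
  qed
  then have ex: "(\<exists>!u. u \<in> hom C T M \<and> (\<forall>m. \<forall>\<sigma>\<in>simplices K m. \<pi> m \<sigma> \<cdot>\<^bsub>C\<^esub> u = \<rho> m \<sigma>) \<and> q \<cdot>\<^bsub>C\<^esub> u = g 0 \<cdot>\<^bsub>C\<^esub> \<rho> 0 v) \<longleftrightarrow>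
      (\<exists>!u. u \<in> hom C T M \<and> (\<forall>m. \<forall>\<sigma>\<in>simplices K m. \<pi> m \<sigma> \<cdot>\<^bsub>C\<^esub> u = \<rho> m \<sigma>))"
    if "matching_cone C X K M \<pi>" "q = g 0 \<cdot>\<^bsub>C\<^esub> \<pi> 0 v" for T \<rho>
    using that by (intro arg_cong[where f=Ex1] ext) blast
  show ?thesis
  proof (cases "matching_cone C X K M \<pi> \<and> q = g 0 \<cdot>\<^bsub>C\<^esub> \<pi> 0 v")
    case True
    then show ?thesis unfolding over_limit_def cone matching_object_def using ex by simp
  next
    case False
    then show ?thesis unfolding over_limit_def cone matching_object_def by blast
  qed
qed

end

text \<open>Membership in the horn only concerns vertices other than \<open>k\<close>, so the edge
  from any vertex of the horn to \<open>k\<close> stays inside it.\<close>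

lemma star_connected_horn:
  assumes "1 \<le> n" "k \<le> n" shows "star_connected (horn n k) (vertex n k)"
proof -
  have im: "delta_image (vertex n i) = {i}" if "i \<le> n" for i
    using delta_image_hom[OF vertex_hom[OF that]] by (simp add: vertex_def)
  have ne: "\<exists>w\<le>n. w \<noteq> k" using assms by (metis One_nat_def le_0_eq le_numeral_extra(4) nat_le_linear not_less_eq_eq zero_le)
  have v: "vertex n k \<in> simplices (horn n k) 0"
    using vertex_hom[OF assms(2)] im[OF assms(2)] ne by (auto simp: horn_def)
  have "\<exists>e\<in>simplices (horn n k) 1. {sact (horn n k) (vertex 1 0) e, sact (horn n k) (vertex 1 1) e} = {vertex n k, z}"
    if z: "z \<in> simplices (horn n k) 0" for z
  proof -
    have zh: "z \<in> hom Delta 0 n" "\<not> {..n} - {k} \<subseteq> delta_image z" using z by (auto simp: horn_def)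
    let ?i = "delta_fun z 0"
    have i: "?i \<le> n" using delta_fun_le[OF zh(1)] by simp
    have zv: "z = vertex n ?i"
      by (rule delta_eqI[OF zh(1) vertex_hom[OF i]]) (simp add: vertex_def)
    \<comment> \<open>Monotonicity forces the smaller vertex to come first; if \<open>z\<close> is
      the vertex \<open>k\<close> itself the edge is degenerate.\<close>
    let ?e = "delta_map 1 n (\<lambda>l. if l = 0 then min ?i k else max ?i k)"
    have e: "?e \<in> hom Delta 1 n" using i assms by (intro delta_map_hom) auto
    have ie: "delta_image ?e = {?i, k}"
    proof -
      have "{..1::nat} = {0, 1}" by auto
      then show ?thesis unfolding delta_image_hom[OF e] by (auto simp: delta_map_def min_def max_def)
    qed
    have "\<not> {..n} - {k} \<subseteq> {?i, k}" using zh(2) im[OF i] zv by auto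
    then have eh: "?e \<in> simplices (horn n k) 1" using e ie by (simp add: horn_def)
    have "{?e \<cdot>\<^bsub>Delta\<^esub> vertex 1 0, ?e \<cdot>\<^bsub>Delta\<^esub> vertex 1 1} = {vertex n k, vertex n ?i}"
      using vertex_Comp[OF e, of 0] vertex_Comp[OF e, of 1] by (auto simp: min_def max_def)
    then show ?thesis using eh zv by (intro bexI[of _ ?e]) (simp_all add: horn_def)
  qed
  then show ?thesis using v unfolding star_connected_def by blast
qed

lemma horn_vertex_closed: "\<sigma> \<in> simplices (horn n k) m \<Longrightarrow> sact (horn n k) (vertex m 0) \<sigma> \<in> simplices (horn n k) 0"
  unfolding horn_image_in by (rule subcomplex_closed[OF subcomplex_horn vertex_hom]) auto

context category
begin

lemma over_constant_horn:
  assumes n: "1 \<le> n" "k \<le> n" and g: "(X, constant_sobj C a, g) \<in> Arr (simplicial_category C)"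
  shows "over_limit C X g a (\<lambda>m. FArr (constant_sobj C a)) (horn n k) M \<pi> q \<longleftrightarrow>
    matching_object C X (horn n k) M \<pi> \<and> q = g 0 \<cdot>\<^bsub>C\<^esub> \<pi> 0 (vertex n k)"
proof -
  have "over_limit C X g a (\<lambda>m. FArr (constant_sobj C a)) (horn n k) M \<pi> q \<longleftrightarrow>
      over_limit C X g a (\<lambda>_ _. Ident C a) (horn n k) M \<pi> q"
    unfolding horn_image_in
  proof (rule over_limit_cong)
    fix m \<sigma> assume "\<sigma> \<in> simplices (sub (std_simplex n) (image_in n {A. \<not> {..n} - {k} \<subseteq> A})) m"
    then have "\<sigma> \<in> hom Delta m n" by (simp add: image_in_def)
    then show "FArr (constant_sobj C a) \<sigma> = Ident C a" by simp
  qed (use subcomplex_closed[OF subcomplex_horn] in auto)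
  then show ?thesis
    using over_constant_iff[OF star_connected_horn[OF n] horn_vertex_closed g] by simp
qed

end

lemma face_singleton: "face n {k} = vertex n k"
  by (simp add: face_def vertex_def delta_map_def enum_def restrict_def fun_eq_iff)

lemma cone_family_point: "cone_family k {{}} = Pow {k}"
  unfolding cone_family_def by auto

lemma image_in_cone_full: "image_in n (cone_family k (Pow ({..n} - {k}))) m = hom Delta m n"
  using delta_image_subset[of _ m n] by (fastforce simp: image_in_def cone_family_def)

lemma sub_cone_full: "sub (std_simplex n) (image_in n (cone_family k (Pow ({..n} - {k})))) = std_simplex n"
proof -
  have "image_in n (cone_family k (Pow ({..n} - {k}))) = simplices (std_simplex n)"
    by (rule ext) (simp add: image_in_cone_full)
  then show ?thesis by simp
qed

lemma image_in_horn: "image_in n (cone_family k (Pow ({..n} - {k}) - {{..n} - {k}})) = image_in n {A. \<not> {..n} - {k} \<subseteq> A}"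
  unfolding cone_family_def by (rule image_in_cong) auto

lemma horn_cone: "horn n k = sub (std_simplex n) (image_in n (cone_family k (Pow ({..n} - {k}) - {{..n} - {k}})))"
  unfolding horn_image_in image_in_horn ..

lemma down_closed_cone_family: "down_closed \<K> \<Longrightarrow> down_closed (cone_family k \<K>)"
  unfolding down_closed_def cone_family_def by (auto intro: down_closedD[of \<K>, OF _ _ Diff_mono] simp: down_closed_def)

section \<open>Horn objects of Kan fibrations and their preservation\<close>

context geometric_pair
begin

lemma preserved_cover_iff:
  "preserved_cover (X, Y, f) n K \<longleftrightarrow> (\<exists>M \<pi> q u. preserved X f (FObj Y n) (\<lambda>m. FArr Y) K M \<pi> q
     \<and> matching_map C X f n K M \<pi> q u \<and> u \<in> SC)"
  by (simp add: preserved_cover_def)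

lemma preserved_empty:
  assumes B: "B \<in> Obj C"
  shows "preserved X f B y (sub K (\<lambda>_. {})) B \<pi> (Ident C B)"
  unfolding preserved_def FArr_Ident[OF B]
  by (intro conjI C.over_limit_empty[OF B] D.over_limit_empty[OF FObj_in[OF B]])

text \<open>The apex is glued to the empty complex. The map to be pulled back is then f_0, which
  need not be a cover, so the pullback square is a hypothesis in both categories.\<close>

lemma preserved_vertex:
  assumes f: "(X, Y, f) \<in> Arr (simplicial_category C)" and y: "matching_cone C Y (std_simplex n) B y"
    and k: "k \<le> n" and pb: "is_pullback C (f 0) (y 0 (vertex n k)) x p"
      "is_pullback D (FArr F (f 0)) (FArr F (y 0 (vertex n k))) (FArr F x) (FArr F p)"
  shows "\<exists>\<pi>. preserved X f B y (sub (std_simplex n) (image_in n (cone_family k {{}}))) (Dom C x) \<pi> p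
    \<and> \<pi> 0 (vertex n k) = x"
proof -
  have B: "B \<in> Obj C" using y unfolding matching_cone_iff by blast
  note Y = C.smapD(2)[OF f] and X = C.smapD(1)[OF f]
  have v: "vertex n k \<in> simplices (std_simplex n) 0" using vertex_hom[OF k] by simp
  have yv: "y 0 (vertex n k) \<in> hom C B (FObj Y 0)" using y v unfolding matching_cone_iff by blast
  have inj: "inj_on (\<lambda>\<theta>. sact (std_simplex n) \<theta> (vertex n k)) (hom Delta j 0)" for j
    using delta_to_point by (intro inj_onI) metis
  have A: "subcomplex (std_simplex n) (\<lambda>_. {})" by (simp add: subcomplex_def)
  have at: "attaching (std_simplex n) (\<lambda>_. {}) (vertex n k) 0 = sub (std_simplex 0) (\<lambda>_. {})"
    by (simp add: attaching_def)
  note f0 = C.smapD(3)[OF f, of 0]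
  \<comment> \<open>The vertex is glued along the empty locus: its matching object is Y_0, and since
    there are no projections \<open>undefined\<close> serves as the family.\<close>
  have N: "preserved X f (FObj Y 0) (\<lambda>k. FArr Y) (attaching (std_simplex n) (\<lambda>_. {}) (vertex n k) 0)
      (FObj Y 0) undefined (Ident C (FObj Y 0))"
    unfolding at by (rule preserved_empty[OF C.sobj_Obj[OF Y]])
  have u: "matching_map C X f 0 (attaching (std_simplex n) (\<lambda>_. {}) (vertex n k) 0)
      (FObj Y 0) undefined (Ident C (FObj Y 0)) (f 0)"
    unfolding matching_map_def using f0 C.Ident_left[OF f0] by simp
  have "preserved X f B y (sub (std_simplex n) (attach (std_simplex n) (\<lambda>_. {}) (vertex n k) 0)) (Dom C x)
      (attach_proj C X (std_simplex n) (\<lambda>_. {}) (vertex n k) 0 undefined x p) (Ident C B \<cdot>\<^bsub>C\<^esub> p)"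
    by (rule preserved_attach[OF is_sset_std_simplex A v inj f y preserved_empty[OF B] N u yv _ _ pb])
      (use C.Ident_left[OF yv] C.Ident_right[OF yv] in auto)
  moreover have "attach (std_simplex n) (\<lambda>_. {}) (vertex n k) 0 = image_in n (cone_family k {{}})"
  proof -
    have "image_in n {} = (\<lambda>_. {})" by (simp add: image_in_def fun_eq_iff)
    then show ?thesis using attach_image_in[of "{k}" n "{}"] k by (simp add: face_singleton cone_family_point)
  qed
  moreover have "Ident C B \<cdot>\<^bsub>C\<^esub> p = p"
    using C.is_pullbackD[OF pb(1)] C.homD[OF yv] by simp
  moreover have "attach_proj C X (std_simplex n) (\<lambda>_. {}) (vertex n k) 0 undefined x p 0 (vertex n k) = x"
  proof -
    have i: "the_inv_into (hom Delta 0 0) (\<lambda>\<theta>. sact (std_simplex n) \<theta> (vertex n k)) (vertex n k) = Ident Delta 0"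
      using the_inv_into_f_f[OF inj delta_Ident(1)] Delta.Ident_right[OF vertex_hom[OF k]] by simp
    have "x \<in> hom C (Dom C x) (FObj X 0)" using C.is_pullbackD[OF pb(1)] C.homD[OF f0] by (simp add: hom_def)
    then show ?thesis unfolding attach_proj_def i using C.sobj_Ident[OF X] C.Ident_left by simp
  qed
  ultimately show ?thesis by metis
qed

lemma preserved_cone:
  assumes f: "(X, Y, f) \<in> Arr (simplicial_category C)" and y: "matching_cone C Y (std_simplex n) B y"
    and k: "k \<le> n" and horns: "\<forall>m j. 1 \<le> m \<longrightarrow> m \<le> N \<longrightarrow> j \<le> m \<longrightarrow> preserved_cover (X, Y, f) m (horn m j)"
    and pb: "is_pullback C (f 0) (y 0 (vertex n k)) x p"
      "is_pullback D (FArr F (f 0)) (FArr F (y 0 (vertex n k))) (FArr F x) (FArr F p)"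
    and \<K>: "down_closed \<K>" "{} \<in> \<K>" "\<K> \<subseteq> Pow ({..n} - {k})" "\<forall>A\<in>\<K>. card A \<le> N"
  shows "\<exists>M \<pi> q. preserved X f B y (sub (std_simplex n) (image_in n (cone_family k \<K>))) M \<pi> q"
proof -
  obtain \<pi> where M: "preserved X f B y (sub (std_simplex n) (image_in n (cone_family k {{}}))) (Dom C x) \<pi> p"
    using preserved_vertex[OF f y k pb] by blast
  have "{{}} \<subseteq> \<K>" "down_closed {{}}" "{} \<in> {{}}" "\<forall>A\<in>\<K> - {{}}. card A \<le> N"
    using \<K>(2,4) by (auto simp: down_closed_def)
  from cone_chain[OF f y k horns this(1,2) \<K>(1) this(3) \<K>(3) this(4) M] show ?thesis by blast
qed

text \<open>The hypothesis \<open>cover\<close> isolates the one step where being a Kan fibration is used, so that the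
  lemma serves to transport Kan fibrations along \<^term>\<open>F\<close> in both directions.\<close>

lemma preserved_cover_horns:
  assumes f: "(X, Y, f) \<in> Arr (simplicial_category C)"
    and pb: "\<And>n k. k \<le> n \<Longrightarrow> \<exists>x p. is_pullback C (f 0) (FArr Y (vertex n k)) x p
      \<and> is_pullback D (FArr F (f 0)) (FArr F (FArr Y (vertex n k))) (FArr F x) (FArr F p)"
    and cover: "\<And>n k M \<pi> q u. 1 \<le> n \<Longrightarrow> k \<le> n \<Longrightarrow> preserved X f (FObj Y n) (\<lambda>m. FArr Y) (horn n k) M \<pi> q \<Longrightarrow>
      matching_map C X f n (horn n k) M \<pi> q u \<Longrightarrow> u \<in> SC"
    and n: "1 \<le> n" "k \<le> n"
  shows "preserved_cover (X, Y, f) n (horn n k)"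
  using n
proof (induction n arbitrary: k rule: less_induct)
  case (less n)
  obtain x p where xp: "is_pullback C (f 0) (FArr Y (vertex n k)) x p"
    "is_pullback D (FArr F (f 0)) (FArr F (FArr Y (vertex n k))) (FArr F x) (FArr F p)"
    using pb[OF less.prems(2)] by blast
  let ?K = "Pow ({..n} - {k}) - {{..n} - {k}}"
  have horns: "\<forall>m j. 1 \<le> m \<longrightarrow> m \<le> n - 1 \<longrightarrow> j \<le> m \<longrightarrow> preserved_cover (X, Y, f) m (horn m j)"
    using less.IH less.prems(1) by auto
  \<comment> \<open>The facet opposite \<open>k\<close> has n vertices and the sets to be added are
    proper subsets of it. So only horns of dimension below \<open>n\<close> occur, as the induction
    requires.\<close>
  have card: "\<forall>A\<in>?K. card A \<le> n - 1"
  proof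
    fix A assume "A \<in> ?K"
    then have "A \<subset> {..n} - {k}" by blast
    then have "card A < card ({..n} - {k})" by (intro psubset_card_mono) auto
    then show "card A \<le> n - 1" using less.prems(2) by simp
  qed
  \<comment> \<open>For n \<ge> 1 the facet opposite \<open>k\<close> is nonempty, which makes the
    empty set one of its proper subsets and hence a member of \<open>?K\<close>.\<close>
  have ne: "\<exists>w\<le>n. w \<noteq> k" using less.prems by (metis One_nat_def le_0_eq le_numeral_extra(4) nat_le_linear not_less_eq_eq zero_le)
  have "down_closed ?K" "{} \<in> ?K" "?K \<subseteq> Pow ({..n} - {k})"
    using ne by (auto simp: down_closed_def)
  from preserved_cone[OF f C.matching_cone_simplices[OF C.smapD(2)[OF f]] less.prems(2) horns xp this card]
  obtain M \<pi> q where M: "preserved X f (FObj Y n) (\<lambda>m. FArr Y) (horn n k) M \<pi> q"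
    unfolding horn_cone by blast
  then have "over_limit C X f (FObj Y n) (\<lambda>m. FArr Y) (horn n k) M \<pi> q" unfolding preserved_def by blast
  then obtain u where "matching_map C X f n (horn n k) M \<pi> q u"
    using C.matching_map_exists[OF f subcomplex_horn] unfolding horn_image_in by blast
  then show ?case using M cover[OF less.prems M] unfolding preserved_cover_iff by blast
qed

text \<open>The chain is continued from the given cone to the cone over the whole opposite facet,
  that is to the full simplex. Its total restriction map is a composite of covers with source X_n up
  to isomorphism, and it is the matching map of the cone.\<close>

lemma preserved_cover_cone:
  assumes f: "(X, Y, f) \<in> Arr (simplicial_category C)" and k: "k \<le> n"
    and horns: "\<forall>m j. 1 \<le> m \<longrightarrow> j \<le> m \<longrightarrow> preserved_cover (X, Y, f) m (horn m j)"
    and pb: "is_pullback C (f 0) (FArr Y (vertex n k)) x p"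
      "is_pullback D (FArr F (f 0)) (FArr F (FArr Y (vertex n k))) (FArr F x) (FArr F p)"
    and \<K>: "down_closed \<K>" "{} \<in> \<K>" "\<K> \<subseteq> Pow ({..n} - {k})"
  shows "preserved_cover (X, Y, f) n (sub (std_simplex n) (image_in n (cone_family k \<K>)))"
proof -
  note Y = C.smapD(2)[OF f]
  note y = C.matching_cone_simplices[OF Y]
  have card: "\<forall>A\<in>Pow ({..n} - {k}). card A \<le> n"
    using card_mono[of "{..n} - {k}"] k by auto
  have horns': "\<forall>m j. 1 \<le> m \<longrightarrow> m \<le> n \<longrightarrow> j \<le> m \<longrightarrow> preserved_cover (X, Y, f) m (horn m j)"
    using horns by blast
  have card': "\<forall>A\<in>\<K>. card A \<le> n" "\<forall>A\<in>Pow ({..n} - {k}) - \<K>. card A \<le> n" using card \<K>(3) by blast+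
  obtain M \<pi> q where M: "preserved X f (FObj Y n) (\<lambda>m. FArr Y) (sub (std_simplex n) (image_in n (cone_family k \<K>))) M \<pi> q"
    using preserved_cone[OF f y k horns' pb \<K> card'(1)] by blast
  have "down_closed (Pow ({..n} - {k}))" by (auto simp: down_closed_def)
  from cone_chain[OF f y k horns' \<K>(3) \<K>(1) this \<K>(2) subset_refl card'(2) M]
  obtain M' \<pi>' p' where M': "preserved X f (FObj Y n) (\<lambda>m. FArr Y) (std_simplex n) M' \<pi>' (q \<cdot>\<^bsub>C\<^esub> p')"
    and p': "p' \<in> hom C M' M" "p' \<in> SC" "\<And>j \<sigma>. \<sigma> \<in> image_in n (cone_family k \<K>) j \<Longrightarrow> \<pi>' j \<sigma> = \<pi> j \<sigma> \<cdot>\<^bsub>C\<^esub> p'"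
    unfolding sub_cone_full by blast
  have M'C: "over_limit C X f (FObj Y n) (\<lambda>m. FArr Y) (std_simplex n) M' \<pi>' (q \<cdot>\<^bsub>C\<^esub> p')" using M' preserved_def by blast
  have MC: "over_limit C X f (FObj Y n) (\<lambda>m. FArr Y) (sub (std_simplex n) (image_in n (cone_family k \<K>))) M \<pi> q"
    using M preserved_def by blast
  have yy: "\<forall>m. \<forall>\<sigma>\<in>simplices (std_simplex n) m. FArr Y \<sigma> \<in> hom C (FObj Y n) (FObj Y m)"
    using C.sobj_hom[OF Y] by simp
  \<comment> \<open>By Yoneda the limit over the full simplex is X_n, which identifies the last
    stage of the chain.\<close>
  obtain i where i: "i \<in> hom C (FObj X n) M'" "iso_arrow C i"
    "\<And>m \<sigma>. \<sigma> \<in> simplices (std_simplex n) m \<Longrightarrow> \<pi>' m \<sigma> \<cdot>\<^bsub>C\<^esub> i = FArr X \<sigma>" "(q \<cdot>\<^bsub>C\<^esub> p') \<cdot>\<^bsub>C\<^esub> i = f n"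
    using C.over_limit_unique[OF f yy M'C C.over_limit_simplex[OF f]] by blast
  note d = C.over_limitD[OF MC]
  have "matching_map C X f n (sub (std_simplex n) (image_in n (cone_family k \<K>))) M \<pi> q (p' \<cdot>\<^bsub>C\<^esub> i)"
    unfolding matching_map_def
  proof (intro conjI allI ballI)
    show "p' \<cdot>\<^bsub>C\<^esub> i \<in> hom C (FObj X n) M" using C.Comp_in[OF i(1) p'(1)] .
    show "q \<cdot>\<^bsub>C\<^esub> (p' \<cdot>\<^bsub>C\<^esub> i) = f n" using i(4) C.Comp_assoc[OF i(1) p'(1) d(4)] by simp
    fix m \<sigma> assume s: "\<sigma> \<in> simplices (sub (std_simplex n) (image_in n (cone_family k \<K>))) m"
    then have s': "\<sigma> \<in> hom Delta m n" by (simp add: image_in_def)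
    show "\<pi> m \<sigma> \<cdot>\<^bsub>C\<^esub> (p' \<cdot>\<^bsub>C\<^esub> i) = FArr X \<sigma>"
      using C.Comp_assoc[OF i(1) p'(1) d(2)[OF s]] p'(3)[of \<sigma> m] i(3)[of \<sigma> m] s s' by simp
  qed
  moreover have "p' \<cdot>\<^bsub>C\<^esub> i \<in> SC" using C.cover_Comp[OF C.iso_cover[OF i(2)] p'(2)] C.homD[OF i(1)] C.homD[OF p'(1)] by simp
  ultimately show ?thesis using M unfolding preserved_cover_iff by blast
qed

text \<open>Operators of a constant object are identities, and base change along an identity is
  trivial. Preservation by \<open>F\<close> is obtained from the identity, which is a cover.\<close>

lemma constant_pullback:
  assumes X: "(X, constant_sobj C a, f) \<in> Arr (simplicial_category C)" and k: "k \<le> n"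
  shows "is_pullback C (f 0) (FArr (constant_sobj C a) (vertex n k)) (Ident C (FObj X 0)) (f 0)"
    "is_pullback D (FArr F (f 0)) (FArr F (FArr (constant_sobj C a) (vertex n k)))
      (FArr F (Ident C (FObj X 0))) (FArr F (f 0))"
proof -
  have f0: "f 0 \<in> hom C (FObj X 0) a" using C.smapD(3)[OF X, of 0] by simp
  note h = C.homD[OF f0]
  show 1: "is_pullback C (f 0) (FArr (constant_sobj C a) (vertex n k)) (Ident C (FObj X 0)) (f 0)"
    using h vertex_hom[OF k]
    by (intro C.is_pullbackI[where a="FObj X 0" and b=a and c=a and P="FObj X 0"]) (auto simp: hom_def)
  have "is_pullback C (Ident C a) (f 0) (f 0) (Ident C (FObj X 0))"
    using C.pullback_swap[OF 1] vertex_hom[OF k] by simp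
  from D.pullback_swap[OF preserves_cover_pullbacks[OF C.Ident_cover[OF h(5)] this]]
  show "is_pullback D (FArr F (f 0)) (FArr F (FArr (constant_sobj C a) (vertex n k)))
      (FArr F (Ident C (FObj X 0))) (FArr F (f 0))"
    using vertex_hom[OF k] by simp
qed

lemma groupoid_preserved_cover:
  assumes X: "infinity_groupoid C SC X"
  obtains t f where "terminal_object C t" "(X, constant_sobj C t, f) \<in> Arr (simplicial_category C)"
    "\<And>n k. 1 \<le> n \<Longrightarrow> k \<le> n \<Longrightarrow> preserved_cover (X, constant_sobj C t, f) n (horn n k)"
proof -
  obtain t g where t: "terminal_object C t"
    and g: "g \<in> hom (simplicial_category C) X (constant_sobj C t)" and kf: "kan_fibration C SC g"
    using X unfolding infinity_groupoid_def by blast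
  obtain f where e: "g = (X, constant_sobj C t, f)"
    using g by (cases g) (auto simp: hom_def)
  have f: "(X, constant_sobj C t, f) \<in> Arr (simplicial_category C)" using g e by (simp add: hom_def)
  have "preserved_cover (X, constant_sobj C t, f) n (horn n k)" if "1 \<le> n" "k \<le> n" for n k
  proof (rule preserved_cover_horns[OF f _ _ that])
    show "u \<in> SC" if "1 \<le> n" "k \<le> n" "preserved X f (FObj (constant_sobj C t) n) (\<lambda>m. FArr (constant_sobj C t)) (horn n k) M \<pi> q"
      "matching_map C X f n (horn n k) M \<pi> q u" for n k M \<pi> q u
      using C.matching_map_in_covers[OF f subcomplex_horn[of n k, folded horn_image_in]] that kf
      unfolding kan_fibration_def e preserved_def horn_image_in by blast
  qed (use constant_pullback[OF f] in blast)
  then show ?thesis using that t f by blast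
qed

text \<open>A vertex is the cone over \<open>{{}}\<close>, so X_n \<rightarrow> X_0 is the matching
  map of a cone relative to a map to a constant object. The simplex is filled up from the vertex by
  horns alone.\<close>

lemma groupoid_vertex_cover:
  assumes X: "infinity_groupoid C SC X" and k: "k \<le> n"
  shows "FArr X (vertex n k) \<in> SC"
proof -
  obtain t f where f: "(X, constant_sobj C t, f) \<in> Arr (simplicial_category C)"
    and horns: "\<forall>n k. 1 \<le> n \<longrightarrow> k \<le> n \<longrightarrow> preserved_cover (X, constant_sobj C t, f) n (horn n k)"
    using groupoid_preserved_cover[OF X] by metis
  note pb = constant_pullback[OF f k]
  have dc: "down_closed {{}}" "{} \<in> {{}}" "{{}} \<subseteq> Pow ({..n} - {k})" by (auto simp: down_closed_def)
  note X' = C.smapD(1)[OF f]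
  have sub: "subcomplex (std_simplex n) (image_in n (cone_family k {{}}))"
    by (rule subcomplex_image_in[OF down_closed_cone_family[OF dc(1)]])
  note y = C.matching_cone_simplices[OF C.smapD(2)[OF f]]
  have i: "Dom C (Ident C (FObj X 0)) = FObj X 0" using C.Ident_simps[OF C.sobj_Obj[OF X']] by simp
  obtain \<pi> where M: "preserved X f (FObj (constant_sobj C t) n) (\<lambda>m. FArr (constant_sobj C t))
      (sub (std_simplex n) (image_in n (cone_family k {{}}))) (FObj X 0) \<pi> (f 0)"
    and v: "\<pi> 0 (vertex n k) = Ident C (FObj X 0)"
    using preserved_vertex[OF f y k pb] unfolding i by blast
  then have MC: "over_limit C X f (FObj (constant_sobj C t) n) (\<lambda>m. FArr (constant_sobj C t))
      (sub (std_simplex n) (image_in n (cone_family k {{}}))) (FObj X 0) \<pi> (f 0)" unfolding preserved_def by blast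
  obtain u where u: "matching_map C X f n (sub (std_simplex n) (image_in n (cone_family k {{}}))) (FObj X 0) \<pi> (f 0) u"
    using C.matching_map_exists[OF f sub MC] by blast
  have "matching_map_cover C SC (X, constant_sobj C t, f) n (sub (std_simplex n) (image_in n (cone_family k {{}})))"
    using preserved_cover_cone[OF f k horns pb dc] unfolding preserved_cover_iff matching_map_cover_iff preserved_def by blast
  then have "u \<in> SC" using C.matching_map_in_covers[OF f sub MC u] by blast
  moreover have "vertex n k \<in> image_in n (cone_family k {{}}) 0"
    unfolding image_in_def cone_family_point using vertex_hom[OF k] delta_image_hom[OF vertex_hom[OF k]]
    by (auto simp: vertex_def)
  moreover have "\<pi> 0 (vertex n k) \<cdot>\<^bsub>C\<^esub> u = u" using u C.Ident_left unfolding v matching_map_def by blast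
  ultimately have "u \<in> SC" "FArr X (vertex n k) = u" using u unfolding matching_map_def by simp_all
  then show ?thesis by simp
qed

text \<open>The cover in this square is Y_n \<rightarrow> Y_0 and not f_0. This is where it matters
  that the base of the Kan fibration is a groupoid.\<close>

lemma groupoid_vertex_pullback:
  assumes f: "(X, Y, f) \<in> Arr (simplicial_category C)" and Y: "infinity_groupoid C SC Y" and k: "k \<le> n"
  shows "\<exists>x p. is_pullback C (f 0) (FArr Y (vertex n k)) x p
    \<and> is_pullback D (FArr F (f 0)) (FArr F (FArr Y (vertex n k))) (FArr F x) (FArr F p)"
proof -
  note v = groupoid_vertex_cover[OF Y k]
  have "Cod C (FArr Y (vertex n k)) = Cod C (f 0)" "f 0 \<in> Arr C"
    using C.homD[OF C.sobj_hom[OF C.smapD(2)[OF f] vertex_hom[OF k]]] C.homD[OF C.smapD(3)[OF f, of 0]] by simp_all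
  then obtain p x where "is_pullback C (FArr Y (vertex n k)) (f 0) p x"
    using C.pullback_exists[OF v] by blast
  then show ?thesis
    using C.pullback_swap D.pullback_swap preserves_cover_pullbacks[OF v] by blast
qed

lemma kan_preserved_cover:
  assumes f: "kan_fibration C SC (X, Y, f)" and Y: "infinity_groupoid C SC Y"
    and n: "1 \<le> n" "k \<le> n"
  shows "preserved_cover (X, Y, f) n (horn n k)"
proof -
  have f': "(X, Y, f) \<in> Arr (simplicial_category C)" using f by (simp add: kan_fibration_def)
  show ?thesis
  proof (rule preserved_cover_horns[OF f' _ _ n])
    show "u \<in> SC" if "1 \<le> n" "k \<le> n" "preserved X f (FObj Y n) (\<lambda>m. FArr Y) (horn n k) M \<pi> q"
      "matching_map C X f n (horn n k) M \<pi> q u" for n k M \<pi> q u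
      using C.matching_map_in_covers[OF f' subcomplex_horn[of n k, folded horn_image_in]] that f
      unfolding kan_fibration_def preserved_def horn_image_in by blast
  qed (use groupoid_vertex_pullback[OF f' Y] in blast)
qed

lemma preserved_cover_levelwise:
  assumes f: "(X, Y, f) \<in> Arr (simplicial_category C)" and A: "subcomplex (std_simplex n) A"
    and g: "preserved_cover (X, Y, f) n (sub (std_simplex n) A)"
  shows "matching_map_cover D SD (LX X, LX Y, Ff f) n (sub (std_simplex n) A)"
proof -
  obtain M \<pi> q u where M: "preserved X f (FObj Y n) (\<lambda>m. FArr Y) (sub (std_simplex n) A) M \<pi> q"
    and u: "matching_map C X f n (sub (std_simplex n) A) M \<pi> q u" "u \<in> SC"
    using g unfolding preserved_cover_iff by blast
  have MC: "over_limit C X f (FObj Y n) (\<lambda>m. FArr Y) (sub (std_simplex n) A) M \<pi> q"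
    using M unfolding preserved_def by blast
  have "matching_map D (LX X) (Ff f) n (sub (std_simplex n) A) (FObj F M) (Fy \<pi>) (FArr F q) (FArr F u)"
    by (rule levelwise_matching_map[OF C.smapD(1)[OF f] _ _ C.over_limitD(4)[OF MC] u(1)])
      (use subcomplexD(1)[OF A] C.over_limitD(2)[OF MC] in auto)
  then show ?thesis
    unfolding matching_map_cover_iff using preserved_relative[OF M A] maps_covers[OF u(2)] by blast
qed

lemma levelwise_kan_fibration:
  assumes "kan_fibration C SC (X, Y, f)" "infinity_groupoid C SC Y"
  shows "kan_fibration D SD (LX X, LX Y, Ff f)"
proof -
  have f: "(X, Y, f) \<in> Arr (simplicial_category C)" using assms by (simp add: kan_fibration_def)
  show ?thesis
    unfolding kan_fibration_def horn_image_in
    using levelwise_smap[OF f] preserved_cover_levelwise[OF f subcomplex_horn] kan_preserved_cover[OF assms, unfolded horn_image_in]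
    by blast
qed

text \<open>Applying \<open>F\<close> gives a map to the constant object on the image of a terminal
  object, which may not be terminal. Horns being connected, the horn objects over it and over a
  terminal object of \<open>D\<close> coincide, and with them the matching maps.\<close>

lemma levelwise_groupoid:
  assumes X: "infinity_groupoid C SC X" and t: "terminal_object D t"
  shows "infinity_groupoid D SD (LX X)"
proof -
  obtain a f where f: "(X, constant_sobj C a, f) \<in> Arr (simplicial_category C)"
    and horns: "\<And>n k. 1 \<le> n \<Longrightarrow> k \<le> n \<Longrightarrow> preserved_cover (X, constant_sobj C a, f) n (horn n k)"
    using groupoid_preserved_cover[OF X] by metis
  have a: "a \<in> Obj C" using C.homD(5)[OF C.smapD(3)[OF f, of 0]] by simp
  note LX = levelwise_sobj[OF C.smapD(1)[OF f]]
  obtain h where h: "(LX X, constant_sobj D t, h) \<in> Arr (simplicial_category D)"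
    using D.to_constant_terminal[OF LX t] by blast
  have Lf: "(LX X, constant_sobj D (FObj F a), Ff f) \<in> Arr (simplicial_category D)"
    using levelwise_smap[OF f] levelwise_constant[OF a] by simp
  have "matching_map_cover D SD (LX X, constant_sobj D t, h) n (horn n k)" if n: "1 \<le> n" "k \<le> n" for n k
  proof -
    have "matching_map_cover D SD (LX X, constant_sobj D (FObj F a), Ff f) n (horn n k)"
      using preserved_cover_levelwise[OF f subcomplex_horn horns[OF n, unfolded horn_image_in]] levelwise_constant[OF a]
      unfolding horn_image_in by simp
    then obtain M \<pi> q u where M: "over_limit D (LX X) (Ff f) (FObj F a) (\<lambda>m. FArr (constant_sobj D (FObj F a))) (horn n k) M \<pi> q"
      and u: "matching_map D (LX X) (Ff f) n (horn n k) M \<pi> q u" "u \<in> SD"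
      unfolding matching_map_cover_iff by auto
    let ?q = "h 0 \<cdot>\<^bsub>D\<^esub> \<pi> 0 (vertex n k)"
    have M': "over_limit D (LX X) h t (\<lambda>m. FArr (constant_sobj D t)) (horn n k) M \<pi> ?q"
      using M D.over_constant_horn[OF n Lf] D.over_constant_horn[OF n h] by blast
    have v: "vertex n k \<in> simplices (horn n k) 0" using star_connected_horn[OF n] by (simp add: star_connected_def)
    have h': "h 0 \<in> hom D (FObj (LX X) 0) t" "h 0 \<cdot>\<^bsub>D\<^esub> FArr (LX X) (vertex n k) = h n"
      using h D.to_constant_iff[OF LX, of t h] t vertex_hom[OF n(2)] by (auto simp: terminal_object_def)
    have u': "u \<in> hom D (FObj (LX X) n) M" "\<pi> 0 (vertex n k) \<cdot>\<^bsub>D\<^esub> u = FArr (LX X) (vertex n k)"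
      using u(1) v unfolding matching_map_def by blast+
    have "matching_map D (LX X) h n (horn n k) M \<pi> ?q u"
      using u(1) D.Comp_assoc[OF u'(1) D.over_limitD(2)[OF M v] h'(1)] h'(2) u'(2)
      unfolding matching_map_def by simp
    then show ?thesis unfolding matching_map_cover_iff using M' u(2) by auto
  qed
  then show ?thesis
    unfolding infinity_groupoid_def kan_fibration_def using t h
    by (intro exI[of _ t] exI[of _ "(LX X, constant_sobj D t, h)"]) (simp add: hom_def)
qed

end

section \<open>Levelwise pullbacks along Kan fibrations\<close>

context category
begin

text \<open>Structure maps come from the universal property in each level; functoriality is tested
  on the two projections.\<close>

lemma pullback_sobj:
  assumes f: "(X, Y, f) \<in> Arr (simplicial_category C)" and g: "(W, Y, g) \<in> Arr (simplicial_category C)"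
    and pb: "\<And>n. is_pullback C (f n) (g n) (P n) (Q n)"
  obtains V where "(V, X, P) \<in> Arr (simplicial_category C)" "(V, W, Q) \<in> Arr (simplicial_category C)"
proof -
  note fn = smapD(3)[OF f] and gn = smapD(3)[OF g]
  note X = smapD(1)[OF f] and W = smapD(1)[OF g] and Y = smapD(2)[OF f]
  have P: "P n \<in> hom C (Dom C (P n)) (FObj X n)" and Q: "Q n \<in> hom C (Dom C (P n)) (FObj W n)"
    and e: "f n \<cdot>\<^bsub>C\<^esub> P n = g n \<cdot>\<^bsub>C\<^esub> Q n" for n
    using is_pullbackD[OF pb[of n]] homD[OF fn[of n]] homD[OF gn[of n]] by (auto simp: hom_def)
  have ex: "\<exists>v. v \<in> hom C (Dom C (P n)) (Dom C (P m)) \<and> P m \<cdot>\<^bsub>C\<^esub> v = FArr X \<theta> \<cdot>\<^bsub>C\<^esub> P n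
      \<and> Q m \<cdot>\<^bsub>C\<^esub> v = FArr W \<theta> \<cdot>\<^bsub>C\<^esub> Q n" if t: "\<theta> \<in> hom Delta m n" for \<theta> m n
  proof -
    note Xt = sobj_hom[OF X t] and Wt = sobj_hom[OF W t] and Yt = sobj_hom[OF Y t]
    have "f m \<cdot>\<^bsub>C\<^esub> (FArr X \<theta> \<cdot>\<^bsub>C\<^esub> P n) = FArr Y \<theta> \<cdot>\<^bsub>C\<^esub> (f n \<cdot>\<^bsub>C\<^esub> P n)"
      using Comp_assoc[OF P Xt fn] Comp_assoc[OF P fn Yt] smapD(4)[OF f t] by simp
    also have "\<dots> = g m \<cdot>\<^bsub>C\<^esub> (FArr W \<theta> \<cdot>\<^bsub>C\<^esub> Q n)"
      using Comp_assoc[OF Q Wt gn] Comp_assoc[OF Q gn Yt] smapD(4)[OF g t] e by simp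
    finally have c: "f m \<cdot>\<^bsub>C\<^esub> (FArr X \<theta> \<cdot>\<^bsub>C\<^esub> P n) = g m \<cdot>\<^bsub>C\<^esub> (FArr W \<theta> \<cdot>\<^bsub>C\<^esub> Q n)" .
    have d: "Dom C (f m) = FObj X m" "Dom C (g m) = FObj W m" using homD[OF fn] homD[OF gn] by auto
    show ?thesis
      by (rule pullback_lift[OF pb[of m], unfolded d, OF Comp_in[OF P Xt] Comp_in[OF Q Wt] c]) blast
  qed
  define v where "v \<theta> = (SOME v. v \<in> hom C (Dom C (P (Cod Delta \<theta>))) (Dom C (P (Dom Delta \<theta>)))
      \<and> P (Dom Delta \<theta>) \<cdot>\<^bsub>C\<^esub> v = FArr X \<theta> \<cdot>\<^bsub>C\<^esub> P (Cod Delta \<theta>) \<and> Q (Dom Delta \<theta>) \<cdot>\<^bsub>C\<^esub> v = FArr W \<theta> \<cdot>\<^bsub>C\<^esub> Q (Cod Delta \<theta>))" for \<theta>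
  have v: "v \<theta> \<in> hom C (Dom C (P n)) (Dom C (P m))" "P m \<cdot>\<^bsub>C\<^esub> v \<theta> = FArr X \<theta> \<cdot>\<^bsub>C\<^esub> P n" "Q m \<cdot>\<^bsub>C\<^esub> v \<theta> = FArr W \<theta> \<cdot>\<^bsub>C\<^esub> Q n"
    if t: "\<theta> \<in> hom Delta m n" for \<theta> m n
  proof -
    have d: "Dom Delta \<theta> = m" "Cod Delta \<theta> = n" using t by (auto simp: hom_def)
    show "v \<theta> \<in> hom C (Dom C (P n)) (Dom C (P m))" "P m \<cdot>\<^bsub>C\<^esub> v \<theta> = FArr X \<theta> \<cdot>\<^bsub>C\<^esub> P n" "Q m \<cdot>\<^bsub>C\<^esub> v \<theta> = FArr W \<theta> \<cdot>\<^bsub>C\<^esub> Q n"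
      using someI_ex[OF ex[OF t]] unfolding v_def d by blast+
  qed
  define V where "V = \<lparr>FObj = (\<lambda>n. Dom C (P n)), FArr = restrict v (Arr Delta)\<rparr>"
  have Vo: "FObj V n = Dom C (P n)" for n by (simp add: V_def)
  have Va: "FArr V \<theta> = v \<theta>" if "\<theta> \<in> hom Delta m n" for \<theta> m n using that by (simp add: V_def hom_def)
  have VS: "V \<in> simplicial_objects C"
  proof (rule sobjI)
    show "FArr V \<theta> \<in> hom C (FObj V n) (FObj V m)" if "\<theta> \<in> hom Delta m n" for \<theta> m n
      using v(1)[OF that] Va[OF that] Vo by simp
    show "FArr V (Ident Delta n) = Ident C (FObj V n)" for n
    proof -
      note i = delta_Ident(1)[of n]
      have o: "Dom C (P n) \<in> Obj C" using homD(4)[OF P] .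
      have "v (Ident Delta n) = Ident C (Dom C (P n))"
      proof (rule pullback_eq[OF pb v(1)[OF i] Ident_in[OF o]])
        show "P n \<cdot>\<^bsub>C\<^esub> v (Ident Delta n) = P n \<cdot>\<^bsub>C\<^esub> Ident C (Dom C (P n))"
          using v(2)[OF i] sobj_Ident[OF X] Ident_left[OF P] Ident_right[OF P] by simp
        show "Q n \<cdot>\<^bsub>C\<^esub> v (Ident Delta n) = Q n \<cdot>\<^bsub>C\<^esub> Ident C (Dom C (P n))"
          using v(3)[OF i] sobj_Ident[OF W] Ident_left[OF Q] Ident_right[OF Q] by simp
      qed
      then show ?thesis using Va[OF i] Vo by simp
    qed
    show "FArr V (\<phi> \<cdot>\<^bsub>Delta\<^esub> \<theta>) = FArr V \<theta> \<cdot>\<^bsub>C\<^esub> FArr V \<phi>" if t: "\<theta> \<in> hom Delta k m" and p: "\<phi> \<in> hom Delta m n" for \<theta> \<phi> k m n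
    proof -
      note tp = delta_Comp(1)[OF t p]
      have "v (\<phi> \<cdot>\<^bsub>Delta\<^esub> \<theta>) = v \<theta> \<cdot>\<^bsub>C\<^esub> v \<phi>"
      proof (rule pullback_eq[OF pb v(1)[OF tp] Comp_in[OF v(1)[OF p] v(1)[OF t]]])
        show "P k \<cdot>\<^bsub>C\<^esub> v (\<phi> \<cdot>\<^bsub>Delta\<^esub> \<theta>) = P k \<cdot>\<^bsub>C\<^esub> (v \<theta> \<cdot>\<^bsub>C\<^esub> v \<phi>)"
          using v(2)[OF tp] sobj_Comp[OF X t p] Comp_assoc[OF P sobj_hom[OF X p] sobj_hom[OF X t]] v(2)[OF p]
            Comp_assoc[OF v(1)[OF p] P sobj_hom[OF X t]] v(2)[OF t] Comp_assoc[OF v(1)[OF p] v(1)[OF t] P] by simp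
        show "Q k \<cdot>\<^bsub>C\<^esub> v (\<phi> \<cdot>\<^bsub>Delta\<^esub> \<theta>) = Q k \<cdot>\<^bsub>C\<^esub> (v \<theta> \<cdot>\<^bsub>C\<^esub> v \<phi>)"
          using v(3)[OF tp] sobj_Comp[OF W t p] Comp_assoc[OF Q sobj_hom[OF W p] sobj_hom[OF W t]] v(3)[OF p]
            Comp_assoc[OF v(1)[OF p] Q sobj_hom[OF W t]] v(3)[OF t] Comp_assoc[OF v(1)[OF p] v(1)[OF t] Q] by simp
      qed
      then show ?thesis using Va[OF t] Va[OF p] Va[OF tp] by simp
    qed
  qed (simp add: V_def)
  have "(V, X, P) \<in> Arr (simplicial_category C)" "(V, W, Q) \<in> Arr (simplicial_category C)"
    using smapI[OF VS X, of P] smapI[OF VS W, of Q] P Q v Va Vo by simp_all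
  then show ?thesis using that by blast
qed

text \<open>For V = X \<times>_Y W, a cone in V over \<open>K\<close> is a pair of cones in X and W
  with the same image in Y. The cone in W is prescribed by \<open>y\<close>, so V^K \<times>_{W^K} B
  and X^K \<times>_{Y^K} B are the same object, with the same leg into \<open>B\<close>.\<close>

lemma over_limit_base_change:
  assumes f: "(X, Y, f) \<in> Arr (simplicial_category C)" and g: "(W, Y, g) \<in> Arr (simplicial_category C)"
    and pb: "\<And>n. is_pullback C (f n) (g n) (P n) (Q n)"
    and P: "(V, X, P) \<in> Arr (simplicial_category C)" and Q: "(V, W, Q) \<in> Arr (simplicial_category C)"
    and y: "matching_cone C W K B y" and cl: "\<And>k m \<theta> \<sigma>. \<theta> \<in> hom Delta k m \<Longrightarrow> \<sigma> \<in> simplices K m \<Longrightarrow> sact K \<theta> \<sigma> \<in> simplices K k"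
    and M: "over_limit C X f B (\<lambda>m \<sigma>. g m \<cdot>\<^bsub>C\<^esub> y m \<sigma>) K M \<pi> q"
  obtains \<pi>' where "over_limit C V Q B y K M \<pi>' q" "\<And>m \<sigma>. \<sigma> \<in> simplices K m \<Longrightarrow> P m \<cdot>\<^bsub>C\<^esub> \<pi>' m \<sigma> = \<pi> m \<sigma>"
proof -
  note fn = smapD(3)[OF f] and gn = smapD(3)[OF g] and Pn = smapD(3)[OF P] and Qn = smapD(3)[OF Q]
  note X = smapD(1)[OF f] and W = smapD(1)[OF g] and V = smapD(1)[OF P]
  note d = over_limitD[OF M]
  have dom: "Dom C (f n) = FObj X n" "Dom C (g n) = FObj W n" "Dom C (P n) = FObj V n" for n
    using homD[OF fn] homD[OF gn] homD[OF Pn] by auto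
  note eq = pullback_eq[OF pb, unfolded dom] and lift = pullback_lift[OF pb, unfolded dom]
  have y': "y m \<sigma> \<in> hom C B (FObj W m)" "\<theta> \<in> hom Delta k m \<Longrightarrow> FArr W \<theta> \<cdot>\<^bsub>C\<^esub> y m \<sigma> = y k (sact K \<theta> \<sigma>)"
    if "\<sigma> \<in> simplices K m" for k m \<sigma> \<theta> using y that unfolding matching_cone_iff by blast+
  have ex: "\<exists>x. x \<in> hom C M (FObj V m) \<and> P m \<cdot>\<^bsub>C\<^esub> x = \<pi> m \<sigma> \<and> Q m \<cdot>\<^bsub>C\<^esub> x = y m \<sigma> \<cdot>\<^bsub>C\<^esub> q" if s: "\<sigma> \<in> simplices K m" for m \<sigma>
  proof -
    have "f m \<cdot>\<^bsub>C\<^esub> \<pi> m \<sigma> = g m \<cdot>\<^bsub>C\<^esub> (y m \<sigma> \<cdot>\<^bsub>C\<^esub> q)" using d(5)[OF s] Comp_assoc[OF d(4) y'(1)[OF s] gn] by simp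
    then show ?thesis by (rule lift[OF d(2)[OF s] Comp_in[OF d(4) y'(1)[OF s]]]) blast
  qed
  define \<pi>' where "\<pi>' m \<sigma> = (SOME x. x \<in> hom C M (FObj V m) \<and> P m \<cdot>\<^bsub>C\<^esub> x = \<pi> m \<sigma> \<and> Q m \<cdot>\<^bsub>C\<^esub> x = y m \<sigma> \<cdot>\<^bsub>C\<^esub> q)" for m \<sigma>
  have p: "\<pi>' m \<sigma> \<in> hom C M (FObj V m)" "P m \<cdot>\<^bsub>C\<^esub> \<pi>' m \<sigma> = \<pi> m \<sigma>" "Q m \<cdot>\<^bsub>C\<^esub> \<pi>' m \<sigma> = y m \<sigma> \<cdot>\<^bsub>C\<^esub> q"
    if "\<sigma> \<in> simplices K m" for m \<sigma>
    using someI_ex[OF ex[OF that]] unfolding \<pi>'_def by blast+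
  have "over_limit C V Q B y K M \<pi>' q"
  proof (rule over_limitI)
    show "over_cone C V Q B y K M \<pi>' q"
      unfolding over_cone_def matching_cone_iff
    proof (intro conjI allI ballI)
      fix k m \<theta> \<sigma> assume t: "\<theta> \<in> hom Delta k m" and s: "\<sigma> \<in> simplices K m"
      note s' = cl[OF t s]
      note Vt = sobj_hom[OF V t] and Xt = sobj_hom[OF X t] and Wt = sobj_hom[OF W t]
      show "FArr V \<theta> \<cdot>\<^bsub>C\<^esub> \<pi>' m \<sigma> = \<pi>' k (sact K \<theta> \<sigma>)"
      proof (rule eq[OF Comp_in[OF p(1)[OF s] Vt] p(1)[OF s']])
        show "P k \<cdot>\<^bsub>C\<^esub> (FArr V \<theta> \<cdot>\<^bsub>C\<^esub> \<pi>' m \<sigma>) = P k \<cdot>\<^bsub>C\<^esub> \<pi>' k (sact K \<theta> \<sigma>)"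
          using Comp_assoc[OF p(1)[OF s] Vt Pn] smapD(4)[OF P t] Comp_assoc[OF p(1)[OF s] Pn Xt] p(2)[OF s]
            d(3)[OF t s] p(2)[OF s'] by simp
        show "Q k \<cdot>\<^bsub>C\<^esub> (FArr V \<theta> \<cdot>\<^bsub>C\<^esub> \<pi>' m \<sigma>) = Q k \<cdot>\<^bsub>C\<^esub> \<pi>' k (sact K \<theta> \<sigma>)"
          using Comp_assoc[OF p(1)[OF s] Vt Qn] smapD(4)[OF Q t] Comp_assoc[OF p(1)[OF s] Qn Wt] p(3)[OF s]
            Comp_assoc[OF d(4) y'(1)[OF s] Wt] y'(2)[OF s t] p(3)[OF s'] by simp
      qed
    qed (use d(1,4) p in auto)
  next
    fix T \<rho> w assume c: "over_cone C V Q B y K T \<rho> w"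
    have r: "\<rho> m \<sigma> \<in> hom C T (FObj V m)" "Q m \<cdot>\<^bsub>C\<^esub> \<rho> m \<sigma> = y m \<sigma> \<cdot>\<^bsub>C\<^esub> w"
      "\<theta> \<in> hom Delta k m \<Longrightarrow> FArr V \<theta> \<cdot>\<^bsub>C\<^esub> \<rho> m \<sigma> = \<rho> k (sact K \<theta> \<sigma>)" if "\<sigma> \<in> simplices K m" for k m \<sigma> \<theta>
      using c that unfolding over_cone_def matching_cone_iff by blast+
    have T: "T \<in> Obj C" and w: "w \<in> hom C T B" using c unfolding over_cone_def matching_cone_iff by blast+
    have "over_cone C X f B (\<lambda>m \<sigma>. g m \<cdot>\<^bsub>C\<^esub> y m \<sigma>) K T (\<lambda>m \<sigma>. P m \<cdot>\<^bsub>C\<^esub> \<rho> m \<sigma>) w"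
      unfolding over_cone_def matching_cone_iff
    proof (intro conjI allI ballI)
      show "P m \<cdot>\<^bsub>C\<^esub> \<rho> m \<sigma> \<in> hom C T (FObj X m)" if "\<sigma> \<in> simplices K m" for m \<sigma> using Comp_in[OF r(1)[OF that] Pn] .
      show "FArr X \<theta> \<cdot>\<^bsub>C\<^esub> (P m \<cdot>\<^bsub>C\<^esub> \<rho> m \<sigma>) = P k \<cdot>\<^bsub>C\<^esub> \<rho> k (sact K \<theta> \<sigma>)" if "\<theta> \<in> hom Delta k m" "\<sigma> \<in> simplices K m" for k m \<theta> \<sigma>
        using Comp_assoc[OF r(1)[OF that(2)] Pn sobj_hom[OF X that(1)]] smapD(4)[OF P that(1)]
          Comp_assoc[OF r(1)[OF that(2)] sobj_hom[OF V that(1)] Pn] r(3)[OF that(2,1)] by simp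
      show "f m \<cdot>\<^bsub>C\<^esub> (P m \<cdot>\<^bsub>C\<^esub> \<rho> m \<sigma>) = (g m \<cdot>\<^bsub>C\<^esub> y m \<sigma>) \<cdot>\<^bsub>C\<^esub> w" if "\<sigma> \<in> simplices K m" for m \<sigma>
        using Comp_assoc[OF r(1)[OF that] Pn fn] Comp_assoc[OF r(1)[OF that] Qn gn] is_pullbackD(9)[OF pb]
          r(2)[OF that] Comp_assoc[OF w y'(1)[OF that] gn] by simp
    qed (fact T w)+
    then obtain u where u: "u \<in> hom C T M" "\<And>m \<sigma>. \<sigma> \<in> simplices K m \<Longrightarrow> \<pi> m \<sigma> \<cdot>\<^bsub>C\<^esub> u = P m \<cdot>\<^bsub>C\<^esub> \<rho> m \<sigma>" "q \<cdot>\<^bsub>C\<^esub> u = w"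
      by (rule over_limit_lift[OF M]) blast
    have "\<pi>' m \<sigma> \<cdot>\<^bsub>C\<^esub> u = \<rho> m \<sigma>" if s: "\<sigma> \<in> simplices K m" for m \<sigma>
    proof (rule eq[OF Comp_in[OF u(1) p(1)[OF s]] r(1)[OF s]])
      show "P m \<cdot>\<^bsub>C\<^esub> (\<pi>' m \<sigma> \<cdot>\<^bsub>C\<^esub> u) = P m \<cdot>\<^bsub>C\<^esub> \<rho> m \<sigma>"
        using Comp_assoc[OF u(1) p(1)[OF s] Pn] p(2)[OF s] u(2)[OF s] by simp
      show "Q m \<cdot>\<^bsub>C\<^esub> (\<pi>' m \<sigma> \<cdot>\<^bsub>C\<^esub> u) = Q m \<cdot>\<^bsub>C\<^esub> \<rho> m \<sigma>"
        using Comp_assoc[OF u(1) p(1)[OF s] Qn] p(3)[OF s] Comp_assoc[OF u(1) d(4) y'(1)[OF s]] u(3) r(2)[OF s] by simp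
    qed
    then show "\<exists>u\<in>hom C T M. (\<forall>m. \<forall>\<sigma>\<in>simplices K m. \<pi>' m \<sigma> \<cdot>\<^bsub>C\<^esub> u = \<rho> m \<sigma>) \<and> q \<cdot>\<^bsub>C\<^esub> u = w" using u by blast
  next
    fix T u v assume u: "u \<in> hom C T M" and v: "v \<in> hom C T M"
      and e: "\<And>m \<sigma>. \<sigma> \<in> simplices K m \<Longrightarrow> \<pi>' m \<sigma> \<cdot>\<^bsub>C\<^esub> u = \<pi>' m \<sigma> \<cdot>\<^bsub>C\<^esub> v" "q \<cdot>\<^bsub>C\<^esub> u = q \<cdot>\<^bsub>C\<^esub> v"
    show "u = v"
    proof (rule over_limit_eq[OF f _ M u v _ e(2)])
      show "\<forall>m. \<forall>\<sigma>\<in>simplices K m. g m \<cdot>\<^bsub>C\<^esub> y m \<sigma> \<in> hom C B (FObj Y m)" using Comp_in[OF y'(1) gn] by blast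
      show "\<pi> m \<sigma> \<cdot>\<^bsub>C\<^esub> u = \<pi> m \<sigma> \<cdot>\<^bsub>C\<^esub> v" if s: "\<sigma> \<in> simplices K m" for m \<sigma>
        using Comp_assoc[OF u p(1)[OF s] Pn] Comp_assoc[OF v p(1)[OF s] Pn] p(2)[OF s] e(1)[OF s] by simp
    qed
  qed
  then show ?thesis using that p(2) by blast
qed

text \<open>For X \<rightarrow> Y \<rightarrow> Z, the map X^K \<times>_{Y^K} B \<rightarrow> X^K
  \<times>_{Z^K} E is the base change of B \<rightarrow> Y^K \<times>_{Z^K} E, hence a cover if the
  latter is one. This gives the horn maps of a composite such as V \<rightarrow> W \<rightarrow>
  *.\<close>

lemma over_limit_composite:
  assumes f: "(X, Y, f) \<in> Arr (simplicial_category C)" and h: "(Y, Z, h) \<in> Arr (simplicial_category C)"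
    and y: "matching_cone C Y K B y" and z: "matching_cone C Z K E z"
    and b: "b \<in> hom C B E" "\<And>m \<sigma>. \<sigma> \<in> simplices K m \<Longrightarrow> h m \<cdot>\<^bsub>C\<^esub> y m \<sigma> = z m \<sigma> \<cdot>\<^bsub>C\<^esub> b"
    and N: "over_limit C X f B y K N \<nu> r"
    and M: "over_limit C X (\<lambda>n. h n \<cdot>\<^bsub>C\<^esub> f n) E z K M \<pi> q"
    and L: "over_limit C Y h E z K L \<kappa> l"
    and w: "w \<in> hom C B L" "\<And>m \<sigma>. \<sigma> \<in> simplices K m \<Longrightarrow> \<kappa> m \<sigma> \<cdot>\<^bsub>C\<^esub> w = y m \<sigma>" "l \<cdot>\<^bsub>C\<^esub> w = b"
  obtains v a where "v \<in> hom C M L" "a \<in> hom C N M" "is_pullback C w v r a"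
    "\<And>m \<sigma>. \<sigma> \<in> simplices K m \<Longrightarrow> \<pi> m \<sigma> \<cdot>\<^bsub>C\<^esub> a = \<nu> m \<sigma>" "q \<cdot>\<^bsub>C\<^esub> a = b \<cdot>\<^bsub>C\<^esub> r"
proof -
  note fn = smapD(3)[OF f] and hn = smapD(3)[OF h]
  note hf = smap_Comp[OF f h]
  note X = smapD(1)[OF f] and Y = smapD(2)[OF f]
  note dN = over_limitD[OF N] and dM = over_limitD[OF M] and dL = over_limitD[OF L]
  have y': "y m \<sigma> \<in> hom C B (FObj Y m)" if "\<sigma> \<in> simplices K m" for m \<sigma>
    using y that unfolding matching_cone_iff by blast
  have z': "z m \<sigma> \<in> hom C E (FObj Z m)" if "\<sigma> \<in> simplices K m" for m \<sigma>
    using z that unfolding matching_cone_iff by blast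
  have yo: "\<forall>m. \<forall>\<sigma>\<in>simplices K m. y m \<sigma> \<in> hom C B (FObj Y m)" and zo: "\<forall>m. \<forall>\<sigma>\<in>simplices K m. z m \<sigma> \<in> hom C E (FObj Z m)"
    using y' z' by blast+
  have "over_cone C Y h E z K M (\<lambda>m \<sigma>. f m \<cdot>\<^bsub>C\<^esub> \<pi> m \<sigma>) q"
    unfolding over_cone_def matching_cone_iff
  proof (intro conjI allI ballI)
    show "f m \<cdot>\<^bsub>C\<^esub> \<pi> m \<sigma> \<in> hom C M (FObj Y m)" if "\<sigma> \<in> simplices K m" for m \<sigma> using Comp_in[OF dM(2)[OF that] fn] .
    show "FArr Y \<theta> \<cdot>\<^bsub>C\<^esub> (f m \<cdot>\<^bsub>C\<^esub> \<pi> m \<sigma>) = f k \<cdot>\<^bsub>C\<^esub> \<pi> k (sact K \<theta> \<sigma>)" if "\<theta> \<in> hom Delta k m" "\<sigma> \<in> simplices K m" for k m \<theta> \<sigma>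
      using Comp_assoc[OF dM(2)[OF that(2)] fn sobj_hom[OF Y that(1)]] smapD(4)[OF f that(1)]
        Comp_assoc[OF dM(2)[OF that(2)] sobj_hom[OF X that(1)] fn] dM(3)[OF that] by simp
    show "h m \<cdot>\<^bsub>C\<^esub> (f m \<cdot>\<^bsub>C\<^esub> \<pi> m \<sigma>) = z m \<sigma> \<cdot>\<^bsub>C\<^esub> q" if "\<sigma> \<in> simplices K m" for m \<sigma>
      using Comp_assoc[OF dM(2)[OF that] fn hn] dM(5)[OF that] by simp
  qed (fact dM(1) dM(4))+
  then obtain v where v: "v \<in> hom C M L" "\<And>m \<sigma>. \<sigma> \<in> simplices K m \<Longrightarrow> \<kappa> m \<sigma> \<cdot>\<^bsub>C\<^esub> v = f m \<cdot>\<^bsub>C\<^esub> \<pi> m \<sigma>" "l \<cdot>\<^bsub>C\<^esub> v = q"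
    by (rule over_limit_lift[OF L]) blast
  have "over_cone C X (\<lambda>n. h n \<cdot>\<^bsub>C\<^esub> f n) E z K N \<nu> (b \<cdot>\<^bsub>C\<^esub> r)"
    unfolding over_cone_def
  proof (intro conjI allI ballI)
    show "matching_cone C X K N \<nu>" using N unfolding over_limit_def over_cone_def by blast
    show "b \<cdot>\<^bsub>C\<^esub> r \<in> hom C N E" using Comp_in[OF dN(4) b(1)] .
    show "(h m \<cdot>\<^bsub>C\<^esub> f m) \<cdot>\<^bsub>C\<^esub> \<nu> m \<sigma> = z m \<sigma> \<cdot>\<^bsub>C\<^esub> (b \<cdot>\<^bsub>C\<^esub> r)" if "\<sigma> \<in> simplices K m" for m \<sigma>
      using Comp_assoc[OF dN(2)[OF that] fn hn] dN(5)[OF that] Comp_assoc[OF dN(4) y'[OF that] hn] b(2)[OF that]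
        Comp_assoc[OF dN(4) b(1) z'[OF that]] by simp
  qed
  then obtain a where a: "a \<in> hom C N M" "\<And>m \<sigma>. \<sigma> \<in> simplices K m \<Longrightarrow> \<pi> m \<sigma> \<cdot>\<^bsub>C\<^esub> a = \<nu> m \<sigma>" "q \<cdot>\<^bsub>C\<^esub> a = b \<cdot>\<^bsub>C\<^esub> r"
    by (rule over_limit_lift[OF M]) blast
  have "is_pullback C w v r a"
  proof (rule is_pullbackI[OF w(1) v(1) dN(4) a(1)])
    show "w \<cdot>\<^bsub>C\<^esub> r = v \<cdot>\<^bsub>C\<^esub> a"
    proof (rule over_limit_eq[OF h zo L Comp_in[OF dN(4) w(1)] Comp_in[OF a(1) v(1)]])
      show "\<kappa> m \<sigma> \<cdot>\<^bsub>C\<^esub> (w \<cdot>\<^bsub>C\<^esub> r) = \<kappa> m \<sigma> \<cdot>\<^bsub>C\<^esub> (v \<cdot>\<^bsub>C\<^esub> a)" if s: "\<sigma> \<in> simplices K m" for m \<sigma>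
        using Comp_assoc[OF dN(4) w(1) dL(2)[OF s]] w(2)[OF s] Comp_assoc[OF a(1) v(1) dL(2)[OF s]] v(2)[OF s]
          Comp_assoc[OF a(1) dM(2)[OF s] fn] a(2)[OF s] dN(5)[OF s] by simp
      show "l \<cdot>\<^bsub>C\<^esub> (w \<cdot>\<^bsub>C\<^esub> r) = l \<cdot>\<^bsub>C\<^esub> (v \<cdot>\<^bsub>C\<^esub> a)"
        using Comp_assoc[OF dN(4) w(1) dL(4)] w(3) Comp_assoc[OF a(1) v(1) dL(4)] v(3) a(3) by simp
    qed
  next
    fix T x c assume x: "x \<in> hom C T B" and c: "c \<in> hom C T M" and e: "w \<cdot>\<^bsub>C\<^esub> x = v \<cdot>\<^bsub>C\<^esub> c"
    have "over_cone C X f B y K T (\<lambda>m \<sigma>. \<pi> m \<sigma> \<cdot>\<^bsub>C\<^esub> c) x"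
      unfolding over_cone_def
    proof (intro conjI allI ballI)
      show "matching_cone C X K T (\<lambda>m \<sigma>. \<pi> m \<sigma> \<cdot>\<^bsub>C\<^esub> c)"
        using matching_cone_comp[OF category_axioms X _ c] M unfolding over_limit_def over_cone_def by blast
      show "f m \<cdot>\<^bsub>C\<^esub> (\<pi> m \<sigma> \<cdot>\<^bsub>C\<^esub> c) = y m \<sigma> \<cdot>\<^bsub>C\<^esub> x" if s: "\<sigma> \<in> simplices K m" for m \<sigma>
        using Comp_assoc[OF c dM(2)[OF s] fn] v(2)[OF s] Comp_assoc[OF c v(1) dL(2)[OF s]] e
          Comp_assoc[OF x w(1) dL(2)[OF s]] w(2)[OF s] by simp
    qed (fact x)
    then obtain u where u: "u \<in> hom C T N" "\<And>m \<sigma>. \<sigma> \<in> simplices K m \<Longrightarrow> \<nu> m \<sigma> \<cdot>\<^bsub>C\<^esub> u = \<pi> m \<sigma> \<cdot>\<^bsub>C\<^esub> c" "r \<cdot>\<^bsub>C\<^esub> u = x"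
      by (rule over_limit_lift[OF N]) blast
    have "a \<cdot>\<^bsub>C\<^esub> u = c"
    proof (rule over_limit_eq[OF hf zo M Comp_in[OF u(1) a(1)] c])
      show "\<pi> m \<sigma> \<cdot>\<^bsub>C\<^esub> (a \<cdot>\<^bsub>C\<^esub> u) = \<pi> m \<sigma> \<cdot>\<^bsub>C\<^esub> c" if s: "\<sigma> \<in> simplices K m" for m \<sigma>
        using Comp_assoc[OF u(1) a(1) dM(2)[OF s]] a(2)[OF s] u(2)[OF s] by simp
      have "q \<cdot>\<^bsub>C\<^esub> (a \<cdot>\<^bsub>C\<^esub> u) = b \<cdot>\<^bsub>C\<^esub> x"
        using Comp_assoc[OF u(1) a(1) dM(4)] a(3) Comp_assoc[OF u(1) dN(4) b(1)] u(3) by simp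
      also have "\<dots> = q \<cdot>\<^bsub>C\<^esub> c"
        using Comp_assoc[OF x w(1) dL(4)] w(3) e Comp_assoc[OF c v(1) dL(4)] v(3) by simp
      finally show "q \<cdot>\<^bsub>C\<^esub> (a \<cdot>\<^bsub>C\<^esub> u) = q \<cdot>\<^bsub>C\<^esub> c" .
    qed
    then show "\<exists>u\<in>hom C T N. r \<cdot>\<^bsub>C\<^esub> u = x \<and> a \<cdot>\<^bsub>C\<^esub> u = c" using u by blast
  next
    fix T u u' assume u: "u \<in> hom C T N" and u': "u' \<in> hom C T N" and e: "r \<cdot>\<^bsub>C\<^esub> u = r \<cdot>\<^bsub>C\<^esub> u'" "a \<cdot>\<^bsub>C\<^esub> u = a \<cdot>\<^bsub>C\<^esub> u'"
    show "u = u'"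
    proof (rule over_limit_eq[OF f yo N u u' _ e(1)])
      show "\<nu> m \<sigma> \<cdot>\<^bsub>C\<^esub> u = \<nu> m \<sigma> \<cdot>\<^bsub>C\<^esub> u'" if s: "\<sigma> \<in> simplices K m" for m \<sigma>
        using Comp_assoc[OF u a(1) dM(2)[OF s]] Comp_assoc[OF u' a(1) dM(2)[OF s]] a(2)[OF s] e(2) by simp
    qed
  qed
  then show ?thesis using that v(1) a by blast
qed

lemma matching_cone_sub_simplices:
  assumes Y: "Y \<in> simplicial_objects C" and A: "subcomplex (std_simplex n) A"
  shows "matching_cone C Y (sub (std_simplex n) A) (FObj Y n) (\<lambda>m. FArr Y)"
  using matching_cone_simplices[OF Y, of n] subcomplexD(1)[OF A] unfolding matching_cone_iff by simp

end

section \<open>Pullbacks along Kan fibrations from a pullback in level 0\<close>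

context geometric_pair
begin

text \<open>The cover \<open>X\<^sub>n \<times>\<^bsub>Y\<^sub>n\<^esub> B \<rightarrow> X\<^sup>\<Lambda> \<times>\<^bsub>Y\<^sup>\<Lambda>\<^esub> B\<close>, with both objects built from \<open>X\<^sub>0 \<times>\<^bsub>Y\<^sub>0\<^esub> B\<close>.\<close>

lemma preserved_horn_inclusion:
  assumes f: "(X, Y, f) \<in> Arr (simplicial_category C)" and y: "matching_cone C Y (std_simplex n) B y"
    and horns: "\<forall>m j. 1 \<le> m \<longrightarrow> j \<le> m \<longrightarrow> preserved_cover (X, Y, f) m (horn m j)"
    and n: "1 \<le> n" "k \<le> n"
    and pb: "is_pullback C (f 0) (y 0 (vertex n k)) x p"
      "is_pullback D (FArr F (f 0)) (FArr F (y 0 (vertex n k))) (FArr F x) (FArr F p)"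
  obtains N \<nu> r M \<pi> p' where "preserved X f B y (horn n k) N \<nu> r" "preserved X f B y (std_simplex n) M \<pi> (r \<cdot>\<^bsub>C\<^esub> p')"
    "p' \<in> hom C M N" "p' \<in> SC" "\<And>m \<sigma>. \<sigma> \<in> simplices (horn n k) m \<Longrightarrow> \<pi> m \<sigma> = \<nu> m \<sigma> \<cdot>\<^bsub>C\<^esub> p'"
proof -
  let ?K = "Pow ({..n} - {k}) - {{..n} - {k}}"
  have card: "\<forall>A\<in>Pow ({..n} - {k}). card A \<le> n"
    using card_mono[of "{..n} - {k}"] n by auto
  have horns': "\<forall>m j. 1 \<le> m \<longrightarrow> m \<le> n \<longrightarrow> j \<le> m \<longrightarrow> preserved_cover (X, Y, f) m (horn m j)"
    using horns by blast
  have card': "\<forall>A\<in>?K. card A \<le> n" "\<forall>A\<in>Pow ({..n} - {k}) - ?K. card A \<le> n" using card by blast+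
  have "\<exists>w\<le>n. w \<noteq> k" using n by (metis One_nat_def le_0_eq le_numeral_extra(4) nat_le_linear not_less_eq_eq zero_le)
  then have dc: "down_closed ?K" "{} \<in> ?K" "?K \<subseteq> Pow ({..n} - {k})" "down_closed (Pow ({..n} - {k}))"
    by (auto simp: down_closed_def)
  from preserved_cone[OF f y n(2) horns' pb dc(1-3) card'(1)]
  obtain N \<nu> r where N: "preserved X f B y (sub (std_simplex n) (image_in n (cone_family k ?K))) N \<nu> r" by blast
  from cone_chain[OF f y n(2) horns' dc(3,1,4,2) subset_refl card'(2) N]
  obtain M \<pi> p' where M: "preserved X f B y (std_simplex n) M \<pi> (r \<cdot>\<^bsub>C\<^esub> p')" "p' \<in> hom C M N" "p' \<in> SC"
    "\<And>j \<sigma>. \<sigma> \<in> image_in n (cone_family k ?K) j \<Longrightarrow> \<pi> j \<sigma> = \<nu> j \<sigma> \<cdot>\<^bsub>C\<^esub> p'"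
    unfolding sub_cone_full by blast
  show ?thesis
    by (rule that[OF N[folded horn_cone] M(1-3)]) (use M(4) in \<open>simp add: horn_cone\<close>)
qed

lemma over_limit_simplex_D:
  assumes f: "(X, Y, f) \<in> Arr (simplicial_category C)" and b: "b \<in> hom C B (FObj Y n)"
    and M: "preserved X f B (\<lambda>m \<sigma>. FArr Y \<sigma> \<cdot>\<^bsub>C\<^esub> b) (std_simplex n) M \<pi> q"
  shows "is_pullback C (f n) b (\<pi> n (Ident Delta n)) q"
    "is_pullback D (FArr F (f n)) (FArr F b) (FArr F (\<pi> n (Ident Delta n))) (FArr F q)"
proof -
  show "is_pullback C (f n) b (\<pi> n (Ident Delta n)) q"
    using C.over_limit_simplex_pullback[OF f b] M unfolding preserved_def by blast
  have b': "FArr F b \<in> hom D (FObj F B) (FObj (LX Y) n)" using FArr_in[OF b] by (simp add: levelwise_simps)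
  have "over_limit D (LX X) (Ff f) (FObj F B) (\<lambda>m \<sigma>. FArr F (FArr Y \<sigma> \<cdot>\<^bsub>C\<^esub> b)) (std_simplex n) (FObj F M) (Fy \<pi>) (FArr F q) \<longleftrightarrow>
    over_limit D (LX X) (Ff f) (FObj F B) (\<lambda>m \<sigma>. FArr (LX Y) \<sigma> \<cdot>\<^bsub>D\<^esub> FArr F b) (std_simplex n) (FObj F M) (Fy \<pi>) (FArr F q)"
  proof (rule over_limit_cong)
    fix m \<sigma> assume "\<sigma> \<in> simplices (std_simplex n) m"
    then have s: "\<sigma> \<in> hom Delta m n" by simp
    show "FArr F (FArr Y \<sigma> \<cdot>\<^bsub>C\<^esub> b) = FArr (LX Y) \<sigma> \<cdot>\<^bsub>D\<^esub> FArr F b"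
      using FArr_Comp[OF b C.sobj_hom[OF C.smapD(2)[OF f] s]] levelwise_FArr[OF s] by simp
  qed (use delta_Comp(1) in auto)
  then have "over_limit D (LX X) (Ff f) (FObj F B) (\<lambda>m \<sigma>. FArr (LX Y) \<sigma> \<cdot>\<^bsub>D\<^esub> FArr F b) (std_simplex n)
      (FObj F M) (Fy \<pi>) (FArr F q)"
    using M unfolding preserved_def by blast
  from D.over_limit_simplex_pullback[OF levelwise_smap[OF f] b' this]
  show "is_pullback D (FArr F (f n)) (FArr F b) (FArr F (\<pi> n (Ident Delta n))) (FArr F q)" .
qed

lemma preserved_cover_matching:
  "preserved_cover (X, Y, f) n K \<Longrightarrow> matching_map_cover C SC (X, Y, f) n K"
  unfolding preserved_cover_iff matching_map_cover_iff preserved_def by blast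

text \<open>That the pullback is again a groupoid is part of the claim, since otherwise it would not
  be an object of \<open>Gpd\<close>. Its horn map factors as V_n \<rightarrow> V^\<Lambda>
  \<times>_{W^\<Lambda>} W_n \<rightarrow> V^\<Lambda>: the first map is a cover by the Kan property
  of \<open>f\<close>, the second is a base change of the horn map of W.\<close>

lemma levelwise_pullback_exists:
  assumes f: "(X, Y, f) \<in> Arr (simplicial_category C)"
    and horns: "\<forall>m j. 1 \<le> m \<longrightarrow> j \<le> m \<longrightarrow> preserved_cover (X, Y, f) m (horn m j)"
    and g: "(W, Y, g) \<in> Arr (simplicial_category C)" and W: "infinity_groupoid C SC W"
    and pb0: "is_pullback C (f 0) (g 0) p0 q0"
      "is_pullback D (FArr F (f 0)) (FArr F (g 0)) (FArr F p0) (FArr F q0)"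
  obtains V P Q where "infinity_groupoid C SC V" "(V, X, P) \<in> Arr (simplicial_category C)"
    "(V, W, Q) \<in> Arr (simplicial_category C)" "\<And>n. is_pullback C (f n) (g n) (P n) (Q n)"
    "\<And>n. is_pullback D (FArr F (f n)) (FArr F (g n)) (FArr F (P n)) (FArr F (Q n))"
proof -
  note fn = C.smapD(3)[OF f] and gn = C.smapD(3)[OF g]
  note X = C.smapD(1)[OF f] and WS = C.smapD(1)[OF g] and Y = C.smapD(2)[OF f]
  define y where "y n m \<sigma> = FArr Y \<sigma> \<cdot>\<^bsub>C\<^esub> g n" for n :: nat and m :: nat and \<sigma>
  have yc: "matching_cone C Y (std_simplex n) (FObj W n) (y n)" for n
    unfolding y_def using C.matching_cone_std_simplex[OF Y gn] .
  \<comment> \<open>The square over a vertex is the given square in level 0 pasted with its base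
    change along W_n \<rightarrow> W_0, which is a cover because \<open>W\<close> is a
    groupoid.\<close>
  have pbv: "\<exists>x p. is_pullback C (f 0) (y n 0 (vertex n k)) x p
      \<and> is_pullback D (FArr F (f 0)) (FArr F (y n 0 (vertex n k))) (FArr F x) (FArr F p)" if k: "k \<le> n" for n k
  proof -
    note v = groupoid_vertex_cover[OF W k] and vh = vertex_hom[OF k]
    note Wv = C.sobj_hom[OF WS vh]
    note d = C.is_pullbackD[OF pb0(1)]
    have q0: "q0 \<in> Arr C" "Cod C (FArr W (vertex n k)) = Cod C q0"
      using d C.homD[OF Wv] C.homD[OF gn[of 0]] by auto
    obtain s r where sr: "is_pullback C (FArr W (vertex n k)) q0 s r"
      using C.pullback_exists[OF v q0] by blast
    have e: "y n 0 (vertex n k) = g 0 \<cdot>\<^bsub>C\<^esub> FArr W (vertex n k)" unfolding y_def using C.smapD(4)[OF g vh] by simp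
    have r: "r \<in> hom C (Dom C s) (Dom C p0)" using C.is_pullbackD[OF sr] d by (auto simp: hom_def)
    have p0: "p0 \<in> hom C (Dom C p0) (FObj X 0)" using d C.homD[OF fn[of 0]] by (auto simp: hom_def)
    show ?thesis unfolding e FArr_Comp[OF Wv gn]
      using C.pullback_paste[OF pb0(1) C.pullback_swap[OF sr]]
        D.pullback_paste[OF pb0(2) D.pullback_swap[OF preserves_cover_pullbacks[OF v sr]]]
        FArr_Comp[OF r p0] by metis
  qed
  have full: "\<exists>P Q. is_pullback C (f n) (g n) P Q \<and> is_pullback D (FArr F (f n)) (FArr F (g n)) (FArr F P) (FArr F Q)" for n
  proof (cases "n = 0")
    case True
    then show ?thesis using pb0 by blast
  next
    case False
    then have n: "1 \<le> n" "0 \<le> n" by auto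
    \<comment> \<open>Any vertex can serve as apex from which the simplex is filled; 0 is
      taken.\<close>
    obtain x p where xp: "is_pullback C (f 0) (y n 0 (vertex n 0)) x p"
      "is_pullback D (FArr F (f 0)) (FArr F (y n 0 (vertex n 0))) (FArr F x) (FArr F p)" using pbv[OF n(2)] by blast
    obtain N \<nu> r M \<pi> p' where "preserved X f (FObj W n) (y n) (std_simplex n) M \<pi> (r \<cdot>\<^bsub>C\<^esub> p')"
      by (rule preserved_horn_inclusion[OF f yc horns n xp]) blast
    from over_limit_simplex_D[OF f gn this[unfolded y_def]] show ?thesis by blast
  qed
  then obtain P Q where pb: "\<And>n. is_pullback C (f n) (g n) (P n) (Q n)"
    "\<And>n. is_pullback D (FArr F (f n)) (FArr F (g n)) (FArr F (P n)) (FArr F (Q n))" by metis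
  obtain V where P: "(V, X, P) \<in> Arr (simplicial_category C)" and Q: "(V, W, Q) \<in> Arr (simplicial_category C)"
    using C.pullback_sobj[OF f g pb(1)] by blast
  note Pn = C.smapD(3)[OF P] and Qn = C.smapD(3)[OF Q] and V = C.smapD(1)[OF P]
  have dom: "Dom C (f n) = FObj X n" "Dom C (g n) = FObj W n" "Dom C (P n) = FObj V n" for n
    using C.homD[OF fn] C.homD[OF gn] C.homD[OF Pn] by auto
  \<comment> \<open>The horn map of \<open>Q\<close> is the restriction X_n \<times>_{Y_n} W_n
    \<rightarrow> X^\<Lambda> \<times>_{Y^\<Lambda>} W_n, whose target is the relative matching
    object of \<open>Q\<close> by base change.\<close>
  have VW: "\<exists>N \<nu> r u. over_limit C V Q (FObj W n) (\<lambda>m. FArr W) (horn n k) N \<nu> r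
      \<and> matching_map C V Q n (horn n k) N \<nu> r u \<and> u \<in> SC" if n: "1 \<le> n" "k \<le> n" for n k
  proof -
    obtain x p where xp: "is_pullback C (f 0) (y n 0 (vertex n k)) x p"
      "is_pullback D (FArr F (f 0)) (FArr F (y n 0 (vertex n k))) (FArr F x) (FArr F p)" using pbv[OF n(2)] by blast
    obtain N \<nu> r M \<pi> p' where N: "preserved X f (FObj W n) (y n) (horn n k) N \<nu> r"
      and M: "preserved X f (FObj W n) (y n) (std_simplex n) M \<pi> (r \<cdot>\<^bsub>C\<^esub> p')" "p' \<in> hom C M N" "p' \<in> SC"
        "\<And>m \<sigma>. \<sigma> \<in> simplices (horn n k) m \<Longrightarrow> \<pi> m \<sigma> = \<nu> m \<sigma> \<cdot>\<^bsub>C\<^esub> p'"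
      by (rule preserved_horn_inclusion[OF f yc horns n xp]) blast
    have hs: "\<sigma> \<in> hom Delta m n" if "\<sigma> \<in> simplices (horn n k) m" for m \<sigma> using that by (simp add: horn_def)
    have cl: "sact (horn n k) \<theta> \<sigma> \<in> simplices (horn n k) m'" if "\<theta> \<in> hom Delta m' m" "\<sigma> \<in> simplices (horn n k) m" for \<theta> \<sigma> m m'
      unfolding horn_image_in by (rule subcomplex_closed[OF subcomplex_horn that(1)]) (use that(2) in \<open>simp add: horn_image_in\<close>)
    have "over_limit C X f (FObj W n) (\<lambda>m \<sigma>. g m \<cdot>\<^bsub>C\<^esub> FArr W \<sigma>) (horn n k) N \<nu> r \<longleftrightarrow>
        over_limit C X f (FObj W n) (y n) (horn n k) N \<nu> r"
      by (rule over_limit_cong) (use C.smapD(4)[OF g hs] cl in \<open>auto simp: y_def\<close>)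
    then have NC: "over_limit C X f (FObj W n) (\<lambda>m \<sigma>. g m \<cdot>\<^bsub>C\<^esub> FArr W \<sigma>) (horn n k) N \<nu> r"
      using N unfolding preserved_def by blast
    have Wc: "matching_cone C W (horn n k) (FObj W n) (\<lambda>m. FArr W)"
      unfolding horn_image_in by (rule C.matching_cone_sub_simplices[OF WS subcomplex_horn])
    obtain \<nu>' where N': "over_limit C V Q (FObj W n) (\<lambda>m. FArr W) (horn n k) N \<nu>' r"
      and nu: "\<And>m \<sigma>. \<sigma> \<in> simplices (horn n k) m \<Longrightarrow> P m \<cdot>\<^bsub>C\<^esub> \<nu>' m \<sigma> = \<nu> m \<sigma>"
      by (rule C.over_limit_base_change[OF f g pb(1) P Q Wc cl NC]) blast+
    note d = C.over_limitD[OF N']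
    have MC: "over_limit C X f (FObj W n) (y n) (std_simplex n) M \<pi> (r \<cdot>\<^bsub>C\<^esub> p')" using M(1) unfolding preserved_def by blast
    note dM = C.over_limitD[OF MC, simplified]
    have Mpb: "is_pullback C (f n) (g n) (\<pi> n (Ident Delta n)) (r \<cdot>\<^bsub>C\<^esub> p')"
      using C.over_limit_simplex_pullback[OF f gn MC[unfolded y_def]] .
    have domM: "Dom C (\<pi> n (Ident Delta n)) = M" using C.homD[OF dM(2)[OF delta_Ident(1)]] by simp
    obtain i where i: "i \<in> hom C (FObj V n) M" "iso_arrow C i" "\<pi> n (Ident Delta n) \<cdot>\<^bsub>C\<^esub> i = P n" "(r \<cdot>\<^bsub>C\<^esub> p') \<cdot>\<^bsub>C\<^esub> i = Q n"
      using C.pullback_unique[OF Mpb pb(1)[of n]] unfolding domM dom by blast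
    note u = C.Comp_in[OF i(1) M(2)]
    have ru: "r \<cdot>\<^bsub>C\<^esub> (p' \<cdot>\<^bsub>C\<^esub> i) = Q n" using C.Comp_assoc[OF i(1) M(2) d(4)] i(4) by simp
    have "\<nu>' m \<sigma> \<cdot>\<^bsub>C\<^esub> (p' \<cdot>\<^bsub>C\<^esub> i) = FArr V \<sigma>" if s: "\<sigma> \<in> simplices (horn n k) m" for m \<sigma>
    proof (rule C.pullback_eq[OF pb(1), unfolded dom])
      note sh = hs[OF s]
      note Xs = C.sobj_hom[OF X sh] and Vs = C.sobj_hom[OF V sh] and Ws = C.sobj_hom[OF WS sh]
      show "\<nu>' m \<sigma> \<cdot>\<^bsub>C\<^esub> (p' \<cdot>\<^bsub>C\<^esub> i) \<in> hom C (FObj V n) (FObj V m)" using C.Comp_in[OF u d(2)[OF s]] .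
      show "FArr V \<sigma> \<in> hom C (FObj V n) (FObj V m)" by (fact Vs)
      have ps: "\<pi> m \<sigma> \<in> hom C M (FObj X m)" using dM(2)[OF sh] .
      have "P m \<cdot>\<^bsub>C\<^esub> (\<nu>' m \<sigma> \<cdot>\<^bsub>C\<^esub> (p' \<cdot>\<^bsub>C\<^esub> i)) = \<nu> m \<sigma> \<cdot>\<^bsub>C\<^esub> (p' \<cdot>\<^bsub>C\<^esub> i)"
        using C.Comp_assoc[OF u d(2)[OF s] Pn] nu[OF s] by simp
      also have "\<dots> = \<pi> m \<sigma> \<cdot>\<^bsub>C\<^esub> i"
        using C.Comp_assoc[OF i(1) M(2) C.over_limitD(2)[OF NC s]] M(4)[OF s] by simp
      also have "\<dots> = (FArr X \<sigma> \<cdot>\<^bsub>C\<^esub> \<pi> n (Ident Delta n)) \<cdot>\<^bsub>C\<^esub> i"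
        using dM(3)[OF sh delta_Ident(1)] Delta.Ident_left[OF sh] by simp
      also have "\<dots> = FArr X \<sigma> \<cdot>\<^bsub>C\<^esub> P n"
        using C.Comp_assoc[OF i(1) dM(2)[OF delta_Ident(1)] Xs] i(3) by simp
      finally show "P m \<cdot>\<^bsub>C\<^esub> (\<nu>' m \<sigma> \<cdot>\<^bsub>C\<^esub> (p' \<cdot>\<^bsub>C\<^esub> i)) = P m \<cdot>\<^bsub>C\<^esub> FArr V \<sigma>" using C.smapD(4)[OF P sh] by simp
      show "Q m \<cdot>\<^bsub>C\<^esub> (\<nu>' m \<sigma> \<cdot>\<^bsub>C\<^esub> (p' \<cdot>\<^bsub>C\<^esub> i)) = Q m \<cdot>\<^bsub>C\<^esub> FArr V \<sigma>"
        using C.Comp_assoc[OF u d(2)[OF s] Qn] d(5)[OF s] C.Comp_assoc[OF u d(4) Ws] ru C.smapD(4)[OF Q sh] by simp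
    qed
    then have "matching_map C V Q n (horn n k) N \<nu>' r (p' \<cdot>\<^bsub>C\<^esub> i)"
      unfolding matching_map_def using u ru by blast
    moreover have "p' \<cdot>\<^bsub>C\<^esub> i \<in> SC" using C.cover_Comp[OF C.iso_cover[OF i(2)] M(3)] C.homD[OF i(1)] C.homD[OF M(2)] by simp
    ultimately show ?thesis using N' by blast
  qed
  obtain t h where t: "terminal_object C t" and h: "(W, constant_sobj C t, h) \<in> Arr (simplicial_category C)"
    and hg: "\<forall>n k. 1 \<le> n \<longrightarrow> k \<le> n \<longrightarrow> preserved_cover (W, constant_sobj C t, h) n (horn n k)"
    using groupoid_preserved_cover[OF W] by metis
  let ?h = "\<lambda>n. h n \<cdot>\<^bsub>C\<^esub> Q n"
  note hQ = C.smap_Comp[OF Q h]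
  \<comment> \<open>The induction over horns supplies the horn objects of V; what has to be shown is
    that the matching map is the composite of the two covers.\<close>
  have gc: "preserved_cover (V, constant_sobj C t, ?h) n (horn n k)" if n: "1 \<le> n" "k \<le> n" for n k
  proof (rule preserved_cover_horns[OF hQ _ _ n])
    fix n k M \<pi> q u assume n: "1 \<le> n" "k \<le> n"
      and M: "preserved V ?h (FObj (constant_sobj C t) n) (\<lambda>m. FArr (constant_sobj C t)) (horn n k) M \<pi> q"
      and u: "matching_map C V ?h n (horn n k) M \<pi> q u"
    obtain N \<nu> r u' where N: "over_limit C V Q (FObj W n) (\<lambda>m. FArr W) (horn n k) N \<nu> r"
      and u': "matching_map C V Q n (horn n k) N \<nu> r u'" "u' \<in> SC" using VW[OF n] by blast
    obtain L \<kappa> l w where L: "preserved W h (FObj (constant_sobj C t) n) (\<lambda>m. FArr (constant_sobj C t)) (horn n k) L \<kappa> l"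
      and w: "matching_map C W h n (horn n k) L \<kappa> l w" "w \<in> SC"
      using hg n unfolding preserved_cover_iff by blast
    have MC: "over_limit C V ?h (FObj (constant_sobj C t) n) (\<lambda>m. FArr (constant_sobj C t)) (horn n k) M \<pi> q"
      and LC: "over_limit C W h (FObj (constant_sobj C t) n) (\<lambda>m. FArr (constant_sobj C t)) (horn n k) L \<kappa> l"
      using M L unfolding preserved_def by blast+
    have hs: "\<sigma> \<in> hom Delta m n" if "\<sigma> \<in> simplices (horn n k) m" for m \<sigma> using that by (simp add: horn_def)
    have Wc: "matching_cone C W (horn n k) (FObj W n) (\<lambda>m. FArr W)"
      and tc: "matching_cone C (constant_sobj C t) (horn n k) (FObj (constant_sobj C t) n) (\<lambda>m. FArr (constant_sobj C t))"
      unfolding horn_image_in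
      by (rule C.matching_cone_sub_simplices[OF WS subcomplex_horn],
          rule C.matching_cone_sub_simplices[OF C.smapD(2)[OF h] subcomplex_horn])
    have hn: "h m \<cdot>\<^bsub>C\<^esub> FArr W \<sigma> = FArr (constant_sobj C t) \<sigma> \<cdot>\<^bsub>C\<^esub> h n" if "\<sigma> \<in> simplices (horn n k) m" for m \<sigma>
      using C.smapD(4)[OF h hs[OF that]] .
    note w' = w(1)[unfolded matching_map_def]
    obtain v a where a: "v \<in> hom C M L" "a \<in> hom C N M" "is_pullback C w v r a"
      "\<And>m \<sigma>. \<sigma> \<in> simplices (horn n k) m \<Longrightarrow> \<pi> m \<sigma> \<cdot>\<^bsub>C\<^esub> a = \<nu> m \<sigma>" "q \<cdot>\<^bsub>C\<^esub> a = h n \<cdot>\<^bsub>C\<^esub> r"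
      by (rule C.over_limit_composite[OF Q h Wc tc C.smapD(3)[OF h] hn N MC LC]) (use w' in blast)+
    note u1 = u[unfolded matching_map_def] and u2 = u'(1)[unfolded matching_map_def]
    have u2h: "u' \<in> hom C (FObj V n) N" and u1h: "u \<in> hom C (FObj V n) M" using u1 u2 by blast+
    note dM = C.over_limitD[OF MC] and dN = C.over_limitD[OF N]
    have "u = a \<cdot>\<^bsub>C\<^esub> u'"
    proof (rule C.over_limit_eq[OF hQ _ MC u1h C.Comp_in[OF u2h a(2)]])
      show "\<forall>m. \<forall>\<sigma>\<in>simplices (horn n k) m. FArr (constant_sobj C t) \<sigma> \<in> hom C (FObj (constant_sobj C t) n) (FObj (constant_sobj C t) m)"
        using C.sobj_hom[OF C.smapD(2)[OF h] hs] by blast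
      show "\<pi> m \<sigma> \<cdot>\<^bsub>C\<^esub> u = \<pi> m \<sigma> \<cdot>\<^bsub>C\<^esub> (a \<cdot>\<^bsub>C\<^esub> u')" if s: "\<sigma> \<in> simplices (horn n k) m" for m \<sigma>
        using C.Comp_assoc[OF u2h a(2) dM(2)[OF s]] a(4)[OF s] u1 u2 s by simp
      show "q \<cdot>\<^bsub>C\<^esub> u = q \<cdot>\<^bsub>C\<^esub> (a \<cdot>\<^bsub>C\<^esub> u')"
        using C.Comp_assoc[OF u2h a(2) dM(4)] a(5) C.Comp_assoc[OF u2h dN(4) C.smapD(3)[OF h]] u1 u2 by simp
    qed
    moreover have "a \<in> SC" using C.base_change[OF w(2) a(3)] .
    ultimately show "u \<in> SC" using C.cover_Comp[OF u'(2)] C.homD[OF u2h] C.homD[OF a(2)] by simp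
  qed (use constant_pullback[OF hQ] in blast)
  have "infinity_groupoid C SC V"
    unfolding infinity_groupoid_def kan_fibration_def using t hQ preserved_cover_matching[OF gc]
    by (intro exI[of _ t] exI[of _ "(V, constant_sobj C t, ?h)"]) (simp add: hom_def)
  then show ?thesis using that P Q pb by blast
qed

end

section \<open>The category of groupoids\<close>

lemma (in category) category_full_subcategory: "category (full_subcategory C A)"
proof -
  have h: "f \<in> hom (full_subcategory C A) a b \<longleftrightarrow> f \<in> hom C a b \<and> a \<in> A \<and> b \<in> A" for f a b
    by (auto simp: hom_def full_subcategory_def)
  have s: "Dom (full_subcategory C A) = Dom C" "Cod (full_subcategory C A) = Cod C"
    "Ident (full_subcategory C A) = Ident C" "Comp (full_subcategory C A) = Comp C"
    "a \<in> Obj (full_subcategory C A) \<longleftrightarrow> a \<in> Obj C \<and> a \<in> A" for a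
    by (auto simp: full_subcategory_def)
  show ?thesis
  proof
    show "Dom (full_subcategory C A) f \<in> Obj (full_subcategory C A)"
      "Cod (full_subcategory C A) f \<in> Obj (full_subcategory C A)" if "f \<in> Arr (full_subcategory C A)" for f
      using that Dom_in Cod_in by (auto simp: full_subcategory_def)
  qed (unfold h s, (use Ident_in Comp_in Ident_left Ident_right Comp_assoc in blast)+)
qed

context category
begin

lemma groupoid_sobj: "infinity_groupoid C S X \<Longrightarrow> X \<in> simplicial_objects C"
  unfolding infinity_groupoid_def
  using category.homD(4)[OF simplicial_category] by auto

lemma category_Gpd: "category (Gpd C S)"
  unfolding Gpd_def by (rule category.category_full_subcategory[OF simplicial_category])

lemma Obj_Gpd: "X \<in> Obj (Gpd C S) \<longleftrightarrow> infinity_groupoid C S X"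
  using groupoid_sobj by (auto simp: Gpd_def full_subcategory_def)

lemma Gpd_simps [simp]:
  "Dom (Gpd C S) (X, Y, f) = X" "Cod (Gpd C S) (X, Y, f) = Y"
  "Ident (Gpd C S) X = (X, X, \<lambda>n. Ident C (FObj X n))"
  "(Y', Z, g) \<cdot>\<^bsub>Gpd C S\<^esub> (X, Y, f) = (X, Z, \<lambda>n. g n \<cdot>\<^bsub>C\<^esub> f n)"
  by (simp_all add: Gpd_def full_subcategory_def)

lemma Arr_Gpd: "(X, Y, f) \<in> Arr (Gpd C S) \<longleftrightarrow>
    (X, Y, f) \<in> Arr (simplicial_category C) \<and> infinity_groupoid C S X \<and> infinity_groupoid C S Y"
  by (simp add: Gpd_def full_subcategory_def)

lemma hom_Gpd: "\<phi> \<in> hom (Gpd C S) X Y \<longleftrightarrow> (\<exists>f. \<phi> = (X, Y, f) \<and> (X, Y, f) \<in> Arr (Gpd C S))"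
  by (cases \<phi>) (auto simp: hom_def)

text \<open>A lift chosen in each level is automatically simplicial, because compatibility with
  operators can be tested on the projections.\<close>

lemma Gpd_pullbackI:
  assumes f: "(X, Y, f) \<in> Arr (Gpd C S)" and g: "(W, Y, g) \<in> Arr (Gpd C S)"
    and P: "(V, X, P) \<in> Arr (Gpd C S)" and Q: "(V, W, Q) \<in> Arr (Gpd C S)"
    and pb: "\<And>n. is_pullback C (f n) (g n) (P n) (Q n)"
  shows "is_pullback (Gpd C S) (X, Y, f) (W, Y, g) (V, X, P) (V, W, Q)"
proof (rule category.is_pullbackI[OF category_Gpd])
  show "(X, Y, f) \<in> hom (Gpd C S) X Y" "(W, Y, g) \<in> hom (Gpd C S) W Y"
    "(V, X, P) \<in> hom (Gpd C S) V X" "(V, W, Q) \<in> hom (Gpd C S) V W"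
    using assms by (auto simp: hom_Gpd)
  show "(X, Y, f) \<cdot>\<^bsub>Gpd C S\<^esub> (V, X, P) = (W, Y, g) \<cdot>\<^bsub>Gpd C S\<^esub> (V, W, Q)"
    using is_pullbackD(9)[OF pb] by simp
  note fs = f[unfolded Arr_Gpd, THEN conjunct1] and gs = g[unfolded Arr_Gpd, THEN conjunct1]
    and Ps = P[unfolded Arr_Gpd, THEN conjunct1] and Qs = Q[unfolded Arr_Gpd, THEN conjunct1]
  note fn = smapD(3)[OF fs] and gn = smapD(3)[OF gs] and Pn = smapD(3)[OF Ps] and Qn = smapD(3)[OF Qs]
  have dom: "Dom C (f n) = FObj X n" "Dom C (g n) = FObj W n" "Dom C (P n) = FObj V n" for n
    using homD[OF fn] homD[OF gn] homD[OF Pn] by auto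
  {
    fix T h k assume h: "h \<in> hom (Gpd C S) T X" and k: "k \<in> hom (Gpd C S) T W"
      and e: "(X, Y, f) \<cdot>\<^bsub>Gpd C S\<^esub> h = (W, Y, g) \<cdot>\<^bsub>Gpd C S\<^esub> k"
    obtain h' k' where hk: "h = (T, X, h')" "k = (T, W, k')" "(T, X, h') \<in> Arr (simplicial_category C)"
      "(T, W, k') \<in> Arr (simplicial_category C)" "infinity_groupoid C S T"
      using h k by (auto simp: hom_Gpd Arr_Gpd)
    have e': "f n \<cdot>\<^bsub>C\<^esub> h' n = g n \<cdot>\<^bsub>C\<^esub> k' n" for n using e hk(1,2) by (simp add: fun_eq_iff)
    have ex: "\<exists>u. u \<in> hom C (FObj T n) (FObj V n) \<and> P n \<cdot>\<^bsub>C\<^esub> u = h' n \<and> Q n \<cdot>\<^bsub>C\<^esub> u = k' n" for n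
      by (rule pullback_lift[OF pb[of n], unfolded dom, OF smapD(3)[OF hk(3)] smapD(3)[OF hk(4)] e']) blast
    then obtain u where u: "\<And>n. u n \<in> hom C (FObj T n) (FObj V n)" "\<And>n. P n \<cdot>\<^bsub>C\<^esub> u n = h' n" "\<And>n. Q n \<cdot>\<^bsub>C\<^esub> u n = k' n"
      by metis
    note T = smapD(1)[OF hk(3)] and V = smapD(1)[OF Ps] and X = smapD(2)[OF Ps] and W = smapD(2)[OF Qs]
    have us: "(T, V, u) \<in> Arr (simplicial_category C)"
    proof (rule smapI[OF T V u(1)])
      fix \<theta> m n assume t: "\<theta> \<in> hom Delta m n"
      note Tt = sobj_hom[OF T t] and Vt = sobj_hom[OF V t] and Xt = sobj_hom[OF X t] and Wt = sobj_hom[OF W t]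
      show "u m \<cdot>\<^bsub>C\<^esub> FArr T \<theta> = FArr V \<theta> \<cdot>\<^bsub>C\<^esub> u n"
      proof (rule pullback_eq[OF pb, unfolded dom, OF Comp_in[OF Tt u(1)] Comp_in[OF u(1) Vt]])
        show "P m \<cdot>\<^bsub>C\<^esub> (u m \<cdot>\<^bsub>C\<^esub> FArr T \<theta>) = P m \<cdot>\<^bsub>C\<^esub> (FArr V \<theta> \<cdot>\<^bsub>C\<^esub> u n)"
          using Comp_assoc[OF Tt u(1) Pn] u(2) smapD(4)[OF hk(3) t] Comp_assoc[OF u(1) Vt Pn] smapD(4)[OF Ps t]
            Comp_assoc[OF u(1) Pn Xt] by simp
        show "Q m \<cdot>\<^bsub>C\<^esub> (u m \<cdot>\<^bsub>C\<^esub> FArr T \<theta>) = Q m \<cdot>\<^bsub>C\<^esub> (FArr V \<theta> \<cdot>\<^bsub>C\<^esub> u n)"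
          using Comp_assoc[OF Tt u(1) Qn] u(3) smapD(4)[OF hk(4) t] Comp_assoc[OF u(1) Vt Qn] smapD(4)[OF Qs t]
            Comp_assoc[OF u(1) Qn Wt] by simp
      qed
    qed
    show "\<exists>u\<in>hom (Gpd C S) T V. (V, X, P) \<cdot>\<^bsub>Gpd C S\<^esub> u = h \<and> (V, W, Q) \<cdot>\<^bsub>Gpd C S\<^esub> u = k"
      using us u P hk by (intro bexI[of _ "(T, V, u)"]) (auto simp: hom_Gpd Arr_Gpd)
  next
    fix T u v assume u: "u \<in> hom (Gpd C S) T V" and v: "v \<in> hom (Gpd C S) T V"
      and e: "(V, X, P) \<cdot>\<^bsub>Gpd C S\<^esub> u = (V, X, P) \<cdot>\<^bsub>Gpd C S\<^esub> v" "(V, W, Q) \<cdot>\<^bsub>Gpd C S\<^esub> u = (V, W, Q) \<cdot>\<^bsub>Gpd C S\<^esub> v"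
    obtain u' v' where uv: "u = (T, V, u')" "v = (T, V, v')" "(T, V, u') \<in> Arr (simplicial_category C)"
      "(T, V, v') \<in> Arr (simplicial_category C)" using u v by (auto simp: hom_Gpd Arr_Gpd)
    have "u' n = v' n" for n
      by (rule pullback_eq[OF pb, unfolded dom, OF smapD(3)[OF uv(3)] smapD(3)[OF uv(4)]])
        (use e uv(1,2) in \<open>simp_all add: fun_eq_iff\<close>)
    then show "u = v" using uv(1,2) by auto
  }
qed

lemma Gpd_iso_levels:
  assumes "iso_arrow (Gpd C S) (X, Y, i)"
  shows "iso_arrow C (i n)"
proof -
  have i: "(X, Y, i) \<in> Arr (Gpd C S)" using assms by (simp add: iso_arrow_def)
  obtain g where g: "g \<in> hom (Gpd C S) Y X" "g \<cdot>\<^bsub>Gpd C S\<^esub> (X, Y, i) = Ident (Gpd C S) X"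
    "(X, Y, i) \<cdot>\<^bsub>Gpd C S\<^esub> g = Ident (Gpd C S) Y"
    using assms by (auto simp: iso_arrow_def)
  obtain j where j: "g = (Y, X, j)" "(Y, X, j) \<in> Arr (Gpd C S)" using g(1) by (auto simp: hom_Gpd)
  have "j n \<cdot>\<^bsub>C\<^esub> i n = Ident C (FObj X n)" "i n \<cdot>\<^bsub>C\<^esub> j n = Ident C (FObj Y n)"
    using g(2,3) j(1) by (simp_all add: fun_eq_iff)
  then show ?thesis using iso_arrowI[of "i n" "FObj X n" "FObj Y n" "j n"] smapD(3) i j(2) by (simp add: Arr_Gpd)
qed

lemma Gpd_pullback_levels:
  assumes Z: "is_pullback (Gpd C S) (X, Y, f) (W, Y, g) (Z, X, p) (Z, W, q)"
    and V: "is_pullback (Gpd C S) (X, Y, f) (W, Y, g) (V, X, P) (V, W, Q)"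
  obtains i where "\<And>n. i n \<in> hom C (FObj Z n) (FObj V n)" "\<And>n. iso_arrow C (i n)"
    "\<And>n. P n \<cdot>\<^bsub>C\<^esub> i n = p n" "\<And>n. Q n \<cdot>\<^bsub>C\<^esub> i n = q n"
proof -
  obtain \<phi> where p: "\<phi> \<in> hom (Gpd C S) Z V" "iso_arrow (Gpd C S) \<phi>"
    "(V, X, P) \<cdot>\<^bsub>Gpd C S\<^esub> \<phi> = (Z, X, p)" "(V, W, Q) \<cdot>\<^bsub>Gpd C S\<^esub> \<phi> = (Z, W, q)"
    using category.pullback_unique[OF category_Gpd V Z] by auto
  obtain i where i: "\<phi> = (Z, V, i)" "(Z, V, i) \<in> Arr (simplicial_category C)"
    using p(1) by (auto simp: hom_Gpd Arr_Gpd)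
  show ?thesis
    using that[of i] smapD(3)[OF i(2)] Gpd_iso_levels p(2-4) unfolding i(1) by (auto simp: fun_eq_iff)
qed

text \<open>A map into level 0 is spread over all levels by the operators of [n] \<rightarrow> [0];
  this is the representability of evaluation at 0.\<close>

lemma from_constant:
  assumes X: "X \<in> simplicial_objects C" and h: "h \<in> hom C a (FObj X 0)"
  shows "(constant_sobj C a, X, \<lambda>n. FArr X (to_point n) \<cdot>\<^bsub>C\<^esub> h) \<in> Arr (simplicial_category C)"
proof (rule smapI[OF constant_sobj[OF homD(4)[OF h]] X])
  note t = sobj_hom[OF X to_point_hom]
  show "FArr X (to_point n) \<cdot>\<^bsub>C\<^esub> h \<in> hom C (FObj (constant_sobj C a) n) (FObj X n)" for n
    using Comp_in[OF h t] by simp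
  show "(FArr X (to_point m) \<cdot>\<^bsub>C\<^esub> h) \<cdot>\<^bsub>C\<^esub> FArr (constant_sobj C a) \<theta> = FArr X \<theta> \<cdot>\<^bsub>C\<^esub> (FArr X (to_point n) \<cdot>\<^bsub>C\<^esub> h)"
    if th: "\<theta> \<in> hom Delta m n" for \<theta> m n
  proof -
    have "FArr X (to_point m) = FArr X \<theta> \<cdot>\<^bsub>C\<^esub> FArr X (to_point n)"
      using sobj_Comp[OF X th to_point_hom] delta_to_point[OF delta_Comp(1)[OF th to_point_hom]] by simp
    then have "FArr X (to_point m) \<cdot>\<^bsub>C\<^esub> h = FArr X \<theta> \<cdot>\<^bsub>C\<^esub> (FArr X (to_point n) \<cdot>\<^bsub>C\<^esub> h)"
      using Comp_assoc[OF h t sobj_hom[OF X th]] by simp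
    then show ?thesis using th Ident_right[OF Comp_in[OF h t]] by (metis constant_sobj_simps(2))
  qed
qed

lemma to_point_0: "to_point 0 = Ident Delta 0"
  using delta_to_point[OF delta_Ident(1)] by simp

end

context cover_category
begin

text \<open>Horns are connected, so a cone over a horn in a constant object is constant. The horn
  object is \<open>a\<close> with identity projections, and the matching map is an identity.\<close>

lemma constant_groupoid:
  assumes t: "terminal_object C t" and a: "a \<in> Obj C"
  shows "infinity_groupoid C S (constant_sobj C a)"
proof -
  let ?A = "constant_sobj C a"
  note A = constant_sobj[OF a]
  obtain c where c: "(?A, constant_sobj C t, c) \<in> Arr (simplicial_category C)"
    using to_constant_terminal[OF A t] by blast
  have "t \<in> Obj C" using t by (simp add: terminal_object_def)
  note c' = c[unfolded to_constant_iff[OF A this]]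
  have i: "(?A, ?A, \<lambda>n. Ident C a) \<in> Arr (simplicial_category C)" using smap_Ident[OF A] by simp
  have "matching_map_cover C S (?A, constant_sobj C t, c) n (horn n k)" if n: "1 \<le> n" "k \<le> n" for n k
  proof -
    have v: "vertex n k \<in> simplices (horn n k) 0" using star_connected_horn[OF n] by (simp add: star_connected_def)
    have "matching_object C ?A (horn n k) a (\<lambda>_ _. Ident C a)"
      unfolding matching_object_def
    proof (intro conjI allI impI)
      show "matching_cone C ?A (horn n k) a (\<lambda>_ _. Ident C a)"
        unfolding matching_cone_iff using a Ident_in[OF a] by simp
      fix T \<rho> assume r: "matching_cone C ?A (horn n k) T \<rho>"
      have rh: "\<rho> m \<sigma> \<in> hom C T a" if "\<sigma> \<in> simplices (horn n k) m" for m \<sigma>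
        using r that unfolding matching_cone_iff by simp
      have eq: "\<rho> m \<sigma> = \<rho> 0 (vertex n k)" if s: "\<sigma> \<in> simplices (horn n k) m" for m \<sigma>
        using star_connected_constant[OF star_connected_horn[OF n] horn_vertex_closed A a i r s]
          Ident_left[OF rh[OF s]] Ident_left[OF rh[OF v]] by simp
      show "\<exists>!u. u \<in> hom C T a \<and> (\<forall>m. \<forall>\<sigma>\<in>simplices (horn n k) m. Ident C a \<cdot>\<^bsub>C\<^esub> u = \<rho> m \<sigma>)"
      proof (rule ex1I[of _ "\<rho> 0 (vertex n k)"])
        show "\<rho> 0 (vertex n k) \<in> hom C T a \<and>
            (\<forall>m. \<forall>\<sigma>\<in>simplices (horn n k) m. Ident C a \<cdot>\<^bsub>C\<^esub> \<rho> 0 (vertex n k) = \<rho> m \<sigma>)"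
          using rh[OF v] Ident_left[OF rh[OF v]] eq by simp
        fix u assume "u \<in> hom C T a \<and> (\<forall>m. \<forall>\<sigma>\<in>simplices (horn n k) m. Ident C a \<cdot>\<^bsub>C\<^esub> u = \<rho> m \<sigma>)"
        then show "u = \<rho> 0 (vertex n k)" using v Ident_left by metis
      qed
    qed
    then have M: "over_limit C ?A c t (\<lambda>m. FArr (constant_sobj C t)) (horn n k) a (\<lambda>_ _. Ident C a) (c 0)"
      unfolding over_constant_horn[OF n c] using Ident_right c' by (metis constant_sobj_simps(1))
    have "c 0 = c n" using c' vertex_hom[OF n(2)] Ident_right by (metis constant_sobj_simps)
    then have "matching_map C ?A c n (horn n k) a (\<lambda>_ _. Ident C a) (c 0) (Ident C a)"
      unfolding matching_map_def using Ident_in[OF a] Ident_left[OF Ident_in[OF a]] c' Ident_right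
      by (auto simp: horn_def)
    then show ?thesis unfolding matching_map_cover_iff using M Ident_cover[OF a] by auto
  qed
  then show ?thesis
    unfolding infinity_groupoid_def kan_fibration_def using t c
    by (intro exI[of _ t] exI[of _ "(?A, constant_sobj C t, c)"]) (simp add: hom_def)
qed

text \<open>Evaluation at 0 is represented by the constant objects, so it preserves whatever limits exist
  among groupoids.\<close>

lemma Gpd_pullback_0:
  assumes pb: "is_pullback (Gpd C S) (X, Y, f) (W, Y, g) (Z, X, p) (Z, W, q)"
  shows "is_pullback C (f 0) (g 0) (p 0) (q 0)"
proof -
  note d = category.is_pullbackD[OF category_Gpd pb]
  have s: "(X, Y, f) \<in> Arr (simplicial_category C)" "(W, Y, g) \<in> Arr (simplicial_category C)"
    "(Z, X, p) \<in> Arr (simplicial_category C)" "(Z, W, q) \<in> Arr (simplicial_category C)"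
    and G: "infinity_groupoid C S X" "infinity_groupoid C S W" "infinity_groupoid C S Z"
    using d by (auto simp: Arr_Gpd)
  have e: "f n \<cdot>\<^bsub>C\<^esub> p n = g n \<cdot>\<^bsub>C\<^esub> q n" for n using d(9) by (simp add: fun_eq_iff)
  note X = smapD(1)[OF s(1)] and W = smapD(1)[OF s(2)] and Z = smapD(1)[OF s(3)]
  obtain t where t: "terminal_object C t" using G(1) unfolding infinity_groupoid_def by blast
  have pt: "f' n \<cdot>\<^bsub>C\<^esub> (FArr A (to_point n) \<cdot>\<^bsub>C\<^esub> h) = FArr B (to_point n) \<cdot>\<^bsub>C\<^esub> (f' 0 \<cdot>\<^bsub>C\<^esub> h)"
    if "(A, B, f') \<in> Arr (simplicial_category C)" "h \<in> hom C T (FObj A 0)" for A B f' h T n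
    using Comp_assoc[OF that(2) sobj_hom[OF smapD(1)[OF that(1)] to_point_hom] smapD(3)[OF that(1)]]
      smapD(4)[OF that(1) to_point_hom]
      Comp_assoc[OF that(2) smapD(3)[OF that(1)] sobj_hom[OF smapD(2)[OF that(1)] to_point_hom]] by simp
  have p0: "FArr A (to_point 0) \<cdot>\<^bsub>C\<^esub> h = h" if "A \<in> simplicial_objects C" "h \<in> hom C T (FObj A 0)" for A h T
    using sobj_Ident[OF that(1)] Ident_left[OF that(2)] by (simp add: to_point_0)
  show ?thesis
  proof (rule is_pullbackI[OF smapD(3)[OF s(1)] smapD(3)[OF s(2)] smapD(3)[OF s(3)] smapD(3)[OF s(4)] e])
    fix T h k assume h: "h \<in> hom C T (FObj X 0)" and k: "k \<in> hom C T (FObj W 0)" and hk: "f 0 \<cdot>\<^bsub>C\<^esub> h = g 0 \<cdot>\<^bsub>C\<^esub> k"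
    let ?T = "constant_sobj C T"
    have T: "infinity_groupoid C S ?T" using constant_groupoid[OF t homD(4)[OF h]] .
    have H: "(?T, X, \<lambda>n. FArr X (to_point n) \<cdot>\<^bsub>C\<^esub> h) \<in> hom (Gpd C S) ?T X"
      and K: "(?T, W, \<lambda>n. FArr W (to_point n) \<cdot>\<^bsub>C\<^esub> k) \<in> hom (Gpd C S) ?T W"
      using from_constant[OF X h] from_constant[OF W k] T G by (auto simp: hom_Gpd Arr_Gpd)
    have "(X, Y, f) \<cdot>\<^bsub>Gpd C S\<^esub> (?T, X, \<lambda>n. FArr X (to_point n) \<cdot>\<^bsub>C\<^esub> h) =
        (W, Y, g) \<cdot>\<^bsub>Gpd C S\<^esub> (?T, W, \<lambda>n. FArr W (to_point n) \<cdot>\<^bsub>C\<^esub> k)"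
      using pt[OF s(1) h] pt[OF s(2) k] hk by simp
    then obtain U where U: "U \<in> hom (Gpd C S) ?T Z" "(Z, X, p) \<cdot>\<^bsub>Gpd C S\<^esub> U = (?T, X, \<lambda>n. FArr X (to_point n) \<cdot>\<^bsub>C\<^esub> h)"
      "(Z, W, q) \<cdot>\<^bsub>Gpd C S\<^esub> U = (?T, W, \<lambda>n. FArr W (to_point n) \<cdot>\<^bsub>C\<^esub> k)"
      using category.pullback_lift[OF category_Gpd pb, unfolded Gpd_simps, OF H K] by metis
    obtain u where u: "U = (?T, Z, u)" "(?T, Z, u) \<in> Arr (simplicial_category C)" using U(1) by (auto simp: hom_Gpd Arr_Gpd)
    have "p 0 \<cdot>\<^bsub>C\<^esub> u 0 = h" "q 0 \<cdot>\<^bsub>C\<^esub> u 0 = k"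
      using U(2,3) p0[OF X h] p0[OF W k] unfolding u(1) by (auto simp: fun_eq_iff)
    moreover have "u 0 \<in> hom C T (FObj Z 0)" using smapD(3)[OF u(2), of 0] by simp
    ultimately show "\<exists>u\<in>hom C T (FObj Z 0). p 0 \<cdot>\<^bsub>C\<^esub> u = h \<and> q 0 \<cdot>\<^bsub>C\<^esub> u = k" by blast
  next
    fix T u v assume u: "u \<in> hom C T (FObj Z 0)" and v: "v \<in> hom C T (FObj Z 0)"
      and uv: "p 0 \<cdot>\<^bsub>C\<^esub> u = p 0 \<cdot>\<^bsub>C\<^esub> v" "q 0 \<cdot>\<^bsub>C\<^esub> u = q 0 \<cdot>\<^bsub>C\<^esub> v"
    let ?T = "constant_sobj C T"
    have T: "infinity_groupoid C S ?T" using constant_groupoid[OF t homD(4)[OF u]] .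
    let ?u = "(?T, Z, \<lambda>n. FArr Z (to_point n) \<cdot>\<^bsub>C\<^esub> u)" and ?v = "(?T, Z, \<lambda>n. FArr Z (to_point n) \<cdot>\<^bsub>C\<^esub> v)"
    have "?u = ?v"
    proof (rule category.pullback_eq[OF category_Gpd pb, unfolded Gpd_simps])
      show "?u \<in> hom (Gpd C S) ?T Z" "?v \<in> hom (Gpd C S) ?T Z"
        using from_constant[OF Z u] from_constant[OF Z v] T G by (auto simp: hom_Gpd Arr_Gpd)
    qed (use pt[OF s(3) u] pt[OF s(3) v] pt[OF s(4) u] pt[OF s(4) v] uv in simp_all)
    then have "(\<lambda>n. FArr Z (to_point n) \<cdot>\<^bsub>C\<^esub> u) = (\<lambda>n. FArr Z (to_point n) \<cdot>\<^bsub>C\<^esub> v)" by blast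
    from fun_cong[OF this, of 0] show "u = v" unfolding p0[OF Z u] p0[OF Z v] .
  qed
qed

end

section \<open>Pullbacks, hypercovers and reflection for the levelwise functor\<close>

context geometric_pair
begin

lemma levelwise_Gpd_Arr:
  assumes "terminal_object D t" "(X, Y, f) \<in> Arr (Gpd C SC)"
  shows "(LX X, LX Y, Ff f) \<in> Arr (Gpd D SD)"
  using assms levelwise_smap levelwise_groupoid[OF _ assms(1)] by (auto simp: C.Arr_Gpd D.Arr_Gpd)

lemma levelwise_functor:
  assumes t: "terminal_object D t"
  shows "cat_functor (Gpd C SC) (Gpd D SD) (levelwise F)"
proof -
  interpret GC: category "Gpd C SC" by (rule C.category_Gpd)
  interpret GD: category "Gpd D SD" by (rule D.category_Gpd)
  show ?thesis
  proof unfold_locales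
    show "LX X \<in> Obj (Gpd D SD)" if "X \<in> Obj (Gpd C SC)" for X
      using levelwise_groupoid[OF _ t] that by (simp add: C.Obj_Gpd D.Obj_Gpd)
    show "FArr (levelwise F) \<phi> \<in> hom (Gpd D SD) (LX X) (LX Y)" if "\<phi> \<in> hom (Gpd C SC) X Y" for \<phi> X Y
      using levelwise_Gpd_Arr[OF t] that by (auto simp: C.hom_Gpd D.hom_Gpd levelwise_simps)
    show "FArr (levelwise F) (Ident (Gpd C SC) X) = Ident (Gpd D SD) (LX X)" if "X \<in> Obj (Gpd C SC)" for X
      using FArr_Ident[OF C.sobj_Obj[OF C.groupoid_sobj]] that by (auto simp: levelwise_simps C.Obj_Gpd)
    show "FArr (levelwise F) (\<psi> \<cdot>\<^bsub>Gpd C SC\<^esub> \<phi>) = FArr (levelwise F) \<psi> \<cdot>\<^bsub>Gpd D SD\<^esub> FArr (levelwise F) \<phi>"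
      if f: "\<phi> \<in> hom (Gpd C SC) X Y" and g: "\<psi> \<in> hom (Gpd C SC) Y Z" for \<phi> \<psi> X Y Z
    proof -
      obtain f' g' where e: "\<phi> = (X, Y, f')" "\<psi> = (Y, Z, g')" "(X, Y, f') \<in> Arr (simplicial_category C)"
        "(Y, Z, g') \<in> Arr (simplicial_category C)" using f g by (auto simp: C.hom_Gpd C.Arr_Gpd)
      show ?thesis unfolding e using FArr_Comp[OF C.smapD(3)[OF e(3)] C.smapD(3)[OF e(4)]] by (simp add: levelwise_simps)
    qed
  qed
qed

text \<open>A pullback of groupoids is isomorphic to the levelwise one built from level 0, and
  inherits from it the pullback property in every level before and after \<open>F\<close>. The
  square in level 0 of \<open>C\<close> comes from evaluation at 0; that its image in
  \<open>D\<close> is a pullback is assumed.\<close>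

lemma Gpd_pullback_preserved:
  assumes t: "terminal_object D t" and k: "kan_fibration C SC (X, Y, f)"
    and pb: "is_pullback (Gpd C SC) (X, Y, f) (W, Y, g) (Z, X, p) (Z, W, q)"
    and pb0: "is_pullback D (FArr F (f 0)) (FArr F (g 0)) (FArr F (p 0)) (FArr F (q 0))"
  shows "is_pullback C (f n) (g n) (p n) (q n)"
    "is_pullback D (FArr F (f n)) (FArr F (g n)) (FArr F (p n)) (FArr F (q n))"
    "is_pullback (Gpd D SD) (LX X, LX Y, Ff f) (LX W, LX Y, Ff g) (LX Z, LX X, Ff p) (LX Z, LX W, Ff q)"
proof -
  note d = category.is_pullbackD[OF C.category_Gpd pb]
  have s: "(X, Y, f) \<in> Arr (simplicial_category C)" "(W, Y, g) \<in> Arr (simplicial_category C)"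
    and G: "infinity_groupoid C SC X" "infinity_groupoid C SC Y" "infinity_groupoid C SC W"
    using d by (auto simp: C.Arr_Gpd)
  have horns: "\<forall>m j. 1 \<le> m \<longrightarrow> j \<le> m \<longrightarrow> preserved_cover (X, Y, f) m (horn m j)" using kan_preserved_cover[OF k G(2)] by blast
  obtain V P Q where V: "infinity_groupoid C SC V" "(V, X, P) \<in> Arr (simplicial_category C)"
    "(V, W, Q) \<in> Arr (simplicial_category C)" "\<And>n. is_pullback C (f n) (g n) (P n) (Q n)"
    "\<And>n. is_pullback D (FArr F (f n)) (FArr F (g n)) (FArr F (P n)) (FArr F (Q n))"
    using levelwise_pullback_exists[OF s(1) horns s(2) G(3) C.Gpd_pullback_0[OF pb] pb0] by metis
  have "is_pullback (Gpd C SC) (X, Y, f) (W, Y, g) (V, X, P) (V, W, Q)"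
    by (rule C.Gpd_pullbackI) (use d V G in \<open>auto simp: C.Arr_Gpd\<close>)
  from C.Gpd_pullback_levels[OF pb this] obtain i where i: "\<And>n. i n \<in> hom C (FObj Z n) (FObj V n)"
    "\<And>n. iso_arrow C (i n)" "\<And>n. P n \<cdot>\<^bsub>C\<^esub> i n = p n" "\<And>n. Q n \<cdot>\<^bsub>C\<^esub> i n = q n" by blast
  note Pn = C.smapD(3)[OF V(2)] and Qn = C.smapD(3)[OF V(3)]
  have dom: "Dom C (P n) = FObj V n" "Dom D (FArr F (P n)) = FObj F (FObj V n)" for n
    using C.homD[OF Pn] by auto
  show "is_pullback C (f n) (g n) (p n) (q n)" for n
    using C.pullback_iso[OF V(4), unfolded dom, OF i(1,2)] i(3,4) by simp
  have D: "is_pullback D (FArr F (f n)) (FArr F (g n)) (FArr F (p n)) (FArr F (q n))" for n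
    using D.pullback_iso[OF V(5), unfolded dom, OF FArr_in[OF i(1)] FArr_iso[OF i(1,2)]]
      FArr_Comp[OF i(1) Pn] FArr_Comp[OF i(1) Qn] i(3,4) by simp
  then show "is_pullback D (FArr F (f n)) (FArr F (g n)) (FArr F (p n)) (FArr F (q n))" .
  show "is_pullback (Gpd D SD) (LX X, LX Y, Ff f) (LX W, LX Y, Ff g) (LX Z, LX X, Ff p) (LX Z, LX W, Ff q)"
    by (rule D.Gpd_pullbackI) (use levelwise_Gpd_Arr[OF t] d D in auto)
qed

text \<open>The counterpart for boundaries of the induction over horns. It starts from the empty
  complex, whose limit is Y_n, so no square in level 0 has to be supplied.\<close>

lemma preserved_cover_boundaries:
  assumes f: "(X, Y, f) \<in> Arr (simplicial_category C)"
    and cover: "\<And>n M \<pi> q u. preserved X f (FObj Y n) (\<lambda>m. FArr Y) (boundary n) M \<pi> q \<Longrightarrow>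
      matching_map C X f n (boundary n) M \<pi> q u \<Longrightarrow> u \<in> SC"
  shows "preserved_cover (X, Y, f) n (boundary n)"
proof (induction n rule: less_induct)
  case (less n)
  note Y = C.smapD(2)[OF f]
  let ?K = "Pow {..n} - {{..n}}"
  \<comment> \<open>The chain starts from a family that contains the empty set; no simplex has empty
    image, so the complex of \<open>{{}}\<close> is empty.\<close>
  have e: "image_in n {{}} = (\<lambda>_. {})" unfolding image_in_def using delta_image_nonempty by blast
  have M0: "preserved X f (FObj Y n) (\<lambda>m. FArr Y) (sub (std_simplex n) (image_in n {{}})) (FObj Y n) undefined (Ident C (FObj Y n))"
    unfolding e by (rule preserved_empty[OF C.sobj_Obj[OF Y]])
  have card: "\<forall>A\<in>?K - {{}}. card A \<le> n"
  proof
    fix A assume "A \<in> ?K - {{}}"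
    then have "A \<subset> {..n}" by blast
    then have "card A < card {..n}" by (intro psubset_card_mono) auto
    then show "card A \<le> n" by simp
  qed
  have dc: "{{}} \<subseteq> ?K" "down_closed {{}}" "down_closed ?K" "{} \<in> {{}}" "?K \<subseteq> Pow {..n}"
    by (auto simp: down_closed_def)
  have bd: "\<forall>m<n. preserved_cover (X, Y, f) m (boundary m)" using less by blast
  from boundary_chain[OF f C.matching_cone_simplices[OF Y] bd dc card M0]
  obtain M \<pi> q where M: "preserved X f (FObj Y n) (\<lambda>m. FArr Y) (sub (std_simplex n) (image_in n ?K)) M \<pi> q" by blast
  have fm: "image_in n ?K = image_in n {A. A \<noteq> {..n}}" by (rule image_in_cong) auto
  have M': "preserved X f (FObj Y n) (\<lambda>m. FArr Y) (boundary n) M \<pi> q" using M unfolding fm boundary_image_in .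
  then have "over_limit C X f (FObj Y n) (\<lambda>m. FArr Y) (boundary n) M \<pi> q" unfolding preserved_def by blast
  then obtain u where "matching_map C X f n (boundary n) M \<pi> q u"
    using C.matching_map_exists[OF f subcomplex_boundary] unfolding boundary_image_in by blast
  then show ?case using M' cover unfolding preserved_cover_iff by blast
qed

lemma levelwise_hypercover:
  assumes "hypercover C SC (X, Y, f)"
  shows "hypercover D SD (LX X, LX Y, Ff f)"
proof -
  have f: "(X, Y, f) \<in> Arr (simplicial_category C)" using assms by (simp add: hypercover_def)
  have "preserved_cover (X, Y, f) n (boundary n)" for n
  proof (rule preserved_cover_boundaries[OF f])
    show "u \<in> SC" if "preserved X f (FObj Y n) (\<lambda>m. FArr Y) (boundary n) M \<pi> q"
      "matching_map C X f n (boundary n) M \<pi> q u" for n M \<pi> q u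
      using C.matching_map_in_covers[OF f subcomplex_boundary[of n]] that assms
      unfolding hypercover_def preserved_def boundary_image_in by blast
  qed
  then show ?thesis
    unfolding hypercover_def boundary_image_in using levelwise_smap[OF f] preserved_cover_levelwise[OF f subcomplex_boundary] by blast
qed

text \<open>Preservation of the limit identifies the image of the matching map with a matching map
  in \<open>D\<close>, which is a cover; \<open>F\<close> then reflects it.\<close>

lemma matching_map_reflected:
  assumes R: "reflects_covers C SC SD F" and f: "(X, Y, f) \<in> Arr (simplicial_category C)"
    and A: "subcomplex (std_simplex n) A"
    and M: "preserved X f (FObj Y n) (\<lambda>m. FArr Y) (sub (std_simplex n) A) M \<pi> q"
    and u: "matching_map C X f n (sub (std_simplex n) A) M \<pi> q u"
    and mc: "matching_map_cover D SD (LX X, LX Y, Ff f) n (sub (std_simplex n) A)"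
  shows "u \<in> SC"
proof -
  have MC: "over_limit C X f (FObj Y n) (\<lambda>m. FArr Y) (sub (std_simplex n) A) M \<pi> q"
    using M unfolding preserved_def by blast
  have "matching_map D (LX X) (Ff f) n (sub (std_simplex n) A) (FObj F M) (Fy \<pi>) (FArr F q) (FArr F u)"
    by (rule levelwise_matching_map[OF C.smapD(1)[OF f] _ _ C.over_limitD(4)[OF MC] u])
      (use subcomplexD(1)[OF A] C.over_limitD(2)[OF MC] in auto)
  from D.matching_map_in_covers[OF levelwise_smap[OF f] A preserved_relative[OF M A] this mc]
  show ?thesis using R u unfolding reflects_covers_def matching_map_def by (auto simp: hom_def)
qed

text \<open>The boundary objects in \<open>C\<close> are not given. Each arises in the induction
  from the matching maps of lower dimension, already reflected to covers.\<close>

lemma hypercover_reflected: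
  assumes R: "reflects_covers C SC SD F" and f: "(X, Y, f) \<in> Arr (simplicial_category C)"
    and h: "hypercover D SD (LX X, LX Y, Ff f)"
  shows "hypercover C SC (X, Y, f)"
proof -
  have "preserved_cover (X, Y, f) n (boundary n)" for n
    by (rule preserved_cover_boundaries[OF f])
      (use matching_map_reflected[OF R f subcomplex_boundary] h in \<open>unfold hypercover_def boundary_image_in, blast\<close>)
  then show ?thesis unfolding hypercover_def using f preserved_cover_matching by blast
qed

lemma kan_fibration_reflected:
  assumes R: "reflects_covers C SC SD F" and f: "(X, Y, f) \<in> Arr (simplicial_category C)"
    and Y: "infinity_groupoid C SC Y" and h: "kan_fibration D SD (LX X, LX Y, Ff f)"
  shows "kan_fibration C SC (X, Y, f)"
proof -
  have "preserved_cover (X, Y, f) n (horn n k)" if "1 \<le> n" "k \<le> n" for n k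
    by (rule preserved_cover_horns[OF f groupoid_vertex_pullback[OF f Y] _ that])
      (use matching_map_reflected[OF R f subcomplex_horn] h in \<open>unfold kan_fibration_def horn_image_in, blast\<close>)+
  then show ?thesis unfolding kan_fibration_def using f preserved_cover_matching by blast
qed

end

section \<open>Path spaces\<close>

abbreviation prism :: "nat \<Rightarrow> (delta_arr \<times> delta_arr) sset" where
  "prism n \<equiv> sset_product (std_simplex n) (std_simplex 1)"

text \<open>The union of the first \<open>i\<close> of the \<^term>\<open>Suc n\<close> top-dimensional simplices, the \<open>j\<close>-th of which
  passes from level 0 to level 1 above the vertex \<open>j\<close>.\<close>

definition prism_part :: "nat \<Rightarrow> nat \<Rightarrow> nat \<Rightarrow> (delta_arr \<times> delta_arr) set" where
  "prism_part n i k = {(\<sigma>, \<tau>). \<sigma> \<in> hom Delta k n \<and> \<tau> \<in> hom Delta k 1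
     \<and> (\<exists>j<i. \<forall>l\<le>k. if delta_fun \<tau> l = 0 then delta_fun \<sigma> l \<le> j else j \<le> delta_fun \<sigma> l)}"

text \<open>The maximal chain (0,0), ..., (i,0), (i,1), ..., (n,1) of [n] \<times> [1]. Position i
  is (i,0) and position i + 1 is (i,1), which explains the shift in the second half.\<close>

definition prism_simplex :: "nat \<Rightarrow> nat \<Rightarrow> delta_arr \<times> delta_arr" where
  "prism_simplex n i = (delta_map (Suc n) n (\<lambda>l. if l \<le> i then l else l - 1),
     delta_map (Suc n) 1 (\<lambda>l. if l \<le> i then 0 else 1))"

lemma prism_part_iff:
  "s \<in> prism_part n i k \<longleftrightarrow> fst s \<in> hom Delta k n \<and> snd s \<in> hom Delta k 1 \<and> (\<exists>j<i. \<forall>l\<le>k.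
     if delta_fun (snd s) l = 0 then delta_fun (fst s) l \<le> j else j \<le> delta_fun (fst s) l)"
  unfolding prism_part_def by (simp add: case_prod_beta)

lemma is_sset_prism: "is_sset (prism n)"
  by (intro is_sset_product is_sset_std_simplex)

lemma prism_simplex:
  assumes "i \<le> n"
  shows "fst (prism_simplex n i) \<in> hom Delta (Suc n) n" "snd (prism_simplex n i) \<in> hom Delta (Suc n) 1"
    "l \<le> Suc n \<Longrightarrow> delta_fun (fst (prism_simplex n i)) l = (if l \<le> i then l else l - 1)"
    "l \<le> Suc n \<Longrightarrow> delta_fun (snd (prism_simplex n i)) l = (if l \<le> i then 0 else 1)"
  unfolding prism_simplex_def fst_conv snd_conv
  by (rule delta_map_hom; use assms in auto)+ simp_all

lemma sact_prism:
  "sact (prism n) \<theta> s = (fst s \<cdot>\<^bsub>Delta\<^esub> \<theta>, snd s \<cdot>\<^bsub>Delta\<^esub> \<theta>)"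
  by (cases s) simp

lemma subcomplex_prism_part: "subcomplex (prism n) (prism_part n i)"
  unfolding subcomplex_def
proof (intro conjI allI ballI)
  show "prism_part n i m \<subseteq> simplices (prism n) m" for m
    unfolding prism_part_def by auto
  fix k m \<theta> s assume t: "\<theta> \<in> hom Delta k m" and s: "s \<in> prism_part n i m"
  obtain \<sigma> \<tau> j where st: "s = (\<sigma>, \<tau>)" "\<sigma> \<in> hom Delta m n" "\<tau> \<in> hom Delta m 1" and j: "j < i"
    "\<forall>l\<le>m. if delta_fun \<tau> l = 0 then delta_fun \<sigma> l \<le> j else j \<le> delta_fun \<sigma> l"
    using s unfolding prism_part_def by auto
  have "\<forall>l\<le>k. if delta_fun (\<tau> \<cdot>\<^bsub>Delta\<^esub> \<theta>) l = 0 then delta_fun (\<sigma> \<cdot>\<^bsub>Delta\<^esub> \<theta>) l \<le> j else j \<le> delta_fun (\<sigma> \<cdot>\<^bsub>Delta\<^esub> \<theta>) l"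
    using delta_Comp(2)[OF t st(2)] delta_Comp(2)[OF t st(3)] delta_fun_le[OF t] j(2) by simp
  then show "sact (prism n) \<theta> s \<in> prism_part n i k"
    unfolding sact_prism st(1) prism_part_def using j(1) delta_Comp(1)[OF t st(2)] delta_Comp(1)[OF t st(3)] by auto
qed

lemma sact_prism_simplex:
  assumes i: "i \<le> n" and t: "\<theta> \<in> hom Delta k (Suc n)" and l: "l \<le> k"
  shows "delta_fun (fst (sact (prism n) \<theta> (prism_simplex n i))) l =
      (if delta_fun \<theta> l \<le> i then delta_fun \<theta> l else delta_fun \<theta> l - 1)"
    "delta_fun (snd (sact (prism n) \<theta> (prism_simplex n i))) l = (if delta_fun \<theta> l \<le> i then 0 else 1)"
  unfolding sact_prism fst_conv snd_conv
  using delta_Comp(2)[OF t prism_simplex(1)[OF i] l] delta_Comp(2)[OF t prism_simplex(2)[OF i] l]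
    prism_simplex(3,4)[OF i delta_fun_le[OF t l]] by simp_all

lemma sact_prism_simplex_hom:
  assumes i: "i \<le> n" and t: "\<theta> \<in> hom Delta k (Suc n)"
  shows "fst (sact (prism n) \<theta> (prism_simplex n i)) \<in> hom Delta k n"
    "snd (sact (prism n) \<theta> (prism_simplex n i)) \<in> hom Delta k 1"
  unfolding sact_prism fst_conv snd_conv
  using delta_Comp(1)[OF t] prism_simplex(1,2)[OF i] by blast+

lemma inj_prism_simplex:
  assumes i: "i \<le> n"
  shows "inj_on (\<lambda>\<theta>. sact (prism n) \<theta> (prism_simplex n i)) (hom Delta k (Suc n))"
proof (rule inj_onI)
  fix \<theta> \<theta>' assume t: "\<theta> \<in> hom Delta k (Suc n)" "\<theta>' \<in> hom Delta k (Suc n)"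
    and e: "sact (prism n) \<theta> (prism_simplex n i) = sact (prism n) \<theta>' (prism_simplex n i)"
  show "\<theta> = \<theta>'"
  proof (rule delta_eqI[OF t])
    fix l assume l: "l \<le> k"
    show "delta_fun \<theta> l = delta_fun \<theta>' l"
      using sact_prism_simplex[OF i t(1) l] sact_prism_simplex[OF i t(2) l] unfolding e
      by (auto split: if_splits)
  qed
qed

lemma attach_prism:
  assumes i: "i \<le> n"
  shows "attach (prism n) (prism_part n i) (prism_simplex n i) (Suc n) = prism_part n (Suc i)"
proof (intro ext set_eqI iffI)
  fix k s assume "s \<in> attach (prism n) (prism_part n i) (prism_simplex n i) (Suc n) k"
  then consider "s \<in> prism_part n i k" | \<theta> where "\<theta> \<in> hom Delta k (Suc n)" "s = sact (prism n) \<theta> (prism_simplex n i)"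
    unfolding attach_def by blast
  then show "s \<in> prism_part n (Suc i) k"
  proof cases
    case 1
    then show ?thesis unfolding prism_part_iff using less_SucI by blast
  next
    case 2
    have "\<forall>l\<le>k. if delta_fun (snd s) l = 0 then delta_fun (fst s) l \<le> i else i \<le> delta_fun (fst s) l"
      using sact_prism_simplex[OF i 2(1)] unfolding 2(2) by auto
    then show ?thesis
      using sact_prism_simplex_hom[OF i 2(1)] lessI unfolding 2(2)[symmetric] prism_part_iff by blast
  qed
next
  fix k s assume s: "s \<in> prism_part n (Suc i) k"
  obtain \<sigma> \<tau> j where st: "s = (\<sigma>, \<tau>)" "\<sigma> \<in> hom Delta k n" "\<tau> \<in> hom Delta k 1" and j: "j < Suc i"
    "\<forall>l\<le>k. if delta_fun \<tau> l = 0 then delta_fun \<sigma> l \<le> j else j \<le> delta_fun \<sigma> l"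
    using s unfolding prism_part_def by auto
  show "s \<in> attach (prism n) (prism_part n i) (prism_simplex n i) (Suc n) k"
  proof (cases "j = i")
    case False
    then have "j < i" using j(1) by simp
    then have "s \<in> prism_part n i k" unfolding prism_part_iff st(1) fst_conv snd_conv using st(2,3) j(2) by blast
    then show ?thesis unfolding attach_def by blast
  next
    case True
    \<comment> \<open>Along the maximal chain the position of a vertex is the sum of its
      coordinates, so the sum recovers the operator from the pair.\<close>
    let ?t = "delta_map k (Suc n) (\<lambda>l. delta_fun \<sigma> l + delta_fun \<tau> l)"
    have t: "?t \<in> hom Delta k (Suc n)"
    proof (rule delta_map_hom)
      show "delta_fun \<sigma> l + delta_fun \<tau> l \<le> Suc n" if "l \<le> k" for l
        using delta_fun_le[OF st(2) that] delta_fun_le[OF st(3) that] by simp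
      show "delta_fun \<sigma> a + delta_fun \<tau> a \<le> delta_fun \<sigma> b + delta_fun \<tau> b" if "a \<le> b" "b \<le> k" for a b
        using delta_fun_mono[OF st(2) that] delta_fun_mono[OF st(3) that] by simp
    qed
    note h = sact_prism_simplex_hom[OF i t] and v = sact_prism_simplex[OF i t]
    have tl: "delta_fun \<tau> l = 0 \<or> delta_fun \<tau> l = 1" if "l \<le> k" for l using delta_fun_le[OF st(3) that] by auto
    have "fst (sact (prism n) ?t (prism_simplex n i)) = \<sigma>"
      by (rule delta_eqI[OF h(1) st(2)]) (use v(1) tl j(2) True in fastforce)
    moreover have "snd (sact (prism n) ?t (prism_simplex n i)) = \<tau>"
      by (rule delta_eqI[OF h(2) st(3)]) (use v(2) tl j(2) True in fastforce)
    ultimately have "s = sact (prism n) ?t (prism_simplex n i)" unfolding st(1) by (simp add: prod_eq_iff)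
    then show ?thesis unfolding attach_def using t by blast
  qed
qed

text \<open>Simplex number i shares with its predecessor every vertex except (i,0), which is at
  position i and occurs in none of the earlier simplices. So it is glued along the facet opposite i;
  the first simplex is glued along nothing.\<close>

lemma attaching_prism:
  assumes i: "i \<le> n"
  shows "attaching (prism n) (prism_part n i) (prism_simplex n i) (Suc n) =
    sub (std_simplex (Suc n)) (\<lambda>k. {\<theta> \<in> hom Delta k (Suc n). 0 < i \<and> i \<notin> delta_image \<theta>})"
proof -
  have "sact (prism n) \<theta> (prism_simplex n i) \<in> prism_part n i k \<longleftrightarrow> 0 < i \<and> i \<notin> delta_image \<theta>"
    if t: "\<theta> \<in> hom Delta k (Suc n)" for k \<theta>
  proof
    note v = sact_prism_simplex[OF i t]
    assume "sact (prism n) \<theta> (prism_simplex n i) \<in> prism_part n i k"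
    then obtain j where j: "j < i" "\<forall>l\<le>k. if delta_fun (snd (sact (prism n) \<theta> (prism_simplex n i))) l = 0 then
        delta_fun (fst (sact (prism n) \<theta> (prism_simplex n i))) l \<le> j
        else j \<le> delta_fun (fst (sact (prism n) \<theta> (prism_simplex n i))) l"
      unfolding prism_part_iff by blast
    have "delta_fun \<theta> l \<noteq> i" if "l \<le> k" for l using j v[OF that] that by fastforce
    then show "0 < i \<and> i \<notin> delta_image \<theta>" using j(1) by (auto simp: delta_image_hom[OF t])
  next
    note v = sact_prism_simplex[OF i t]
    assume a: "0 < i \<and> i \<notin> delta_image \<theta>"
    then have "delta_fun \<theta> l \<noteq> i" if "l \<le> k" for l using that by (auto simp: delta_image_hom[OF t])
    \<comment> \<open>The facet lies in the immediately preceding simplex, number i - 1.\<close>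
    then have "\<forall>l\<le>k. if delta_fun (snd (sact (prism n) \<theta> (prism_simplex n i))) l = 0 then
        delta_fun (fst (sact (prism n) \<theta> (prism_simplex n i))) l \<le> i - 1
        else i - 1 \<le> delta_fun (fst (sact (prism n) \<theta> (prism_simplex n i))) l"
      using v by fastforce
    moreover have "i - 1 < i" using a by simp
    ultimately show "sact (prism n) \<theta> (prism_simplex n i) \<in> prism_part n i k"
      using sact_prism_simplex_hom[OF i t] unfolding prism_part_iff by blast
  qed
  then have "(\<lambda>k. {\<theta> \<in> hom Delta k (Suc n). sact (prism n) \<theta> (prism_simplex n i) \<in> prism_part n i k}) =
      (\<lambda>k. {\<theta> \<in> hom Delta k (Suc n). 0 < i \<and> i \<notin> delta_image \<theta>})" by blast
  then show ?thesis unfolding attaching_def by simp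
qed

lemma prism_part_full: "sub (prism n) (prism_part n (Suc n)) = prism n"
proof -
  have "s \<in> prism_part n (Suc n) k" if s: "s \<in> simplices (prism n) k" for s k
  proof -
    obtain \<sigma> \<tau> where st: "s = (\<sigma>, \<tau>)" "\<sigma> \<in> hom Delta k n" "\<tau> \<in> hom Delta k 1" using s by auto
    let ?Z = "{l. l \<le> k \<and> delta_fun \<tau> l = 0}"
    \<comment> \<open>The chain may change level above the last vertex that lies at level 0. A
      simplex entirely at level 1 belongs to simplex number 0.\<close>
    define j where "j = (if ?Z = {} then 0 else delta_fun \<sigma> (Max ?Z))"
    have fin: "finite ?Z" by simp
    have jz: "j = delta_fun \<sigma> (Max ?Z)" if "?Z \<noteq> {}" unfolding j_def by (rule if_not_P[OF that])
    have j0: "j = 0" if "?Z = {}" unfolding j_def by (rule if_P[OF that])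
    have zm: "Max ?Z \<le> k" "delta_fun \<tau> (Max ?Z) = 0" if "?Z \<noteq> {}" using Max_in[OF fin that] by blast+
    have lv: "if delta_fun \<tau> l = 0 then delta_fun \<sigma> l \<le> j else j \<le> delta_fun \<sigma> l" if l: "l \<le> k" for l
    proof (cases "delta_fun \<tau> l = 0")
      case True
      then have "l \<in> ?Z" using l by blast
      then have "?Z \<noteq> {}" "l \<le> Max ?Z" "Max ?Z \<le> k" using Max_ge[OF fin] zm(1) by blast+
      then have "delta_fun \<sigma> l \<le> j" using jz delta_fun_mono[OF st(2), of l "Max ?Z"] by metis
      then show ?thesis using True by simp
    next
      case False
      have "j \<le> delta_fun \<sigma> l"
      proof (cases "?Z = {}")
        case ne: False
        then have m: "Max ?Z \<le> k" "delta_fun \<tau> (Max ?Z) = 0" using zm by blast+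
        then have "Max ?Z \<le> l" using delta_fun_mono[OF st(3), of l "Max ?Z"] False by (cases "l \<le> Max ?Z") auto
        then show ?thesis using delta_fun_mono[OF st(2) _ l] jz[OF ne] by simp
      qed (metis j0 le0)
      then show ?thesis using False by simp
    qed
    have "j < Suc n"
    proof (cases "?Z = {}")
      case True
      show ?thesis unfolding j0[OF True] by simp
    next
      case False
      show ?thesis unfolding jz[OF False] less_Suc_eq_le by (rule delta_fun_le[OF st(2) zm(1)[OF False]])
    qed
    then show ?thesis unfolding prism_part_iff st(1) fst_conv snd_conv
      by (intro conjI exI[of _ j] allI impI st(2,3) lv)
  qed
  then have "prism_part n (Suc n) k = simplices (prism n) k" for k
    using subcomplexD(1)[OF subcomplex_prism_part, of _ n "Suc n" k] by blast
  then have "prism_part n (Suc n) = simplices (prism n)" by (rule ext)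
  then show ?thesis by simp
qed

text \<open>The prism has a least vertex, and an edge from it to any other vertex is formed in the
  two factors separately.\<close>

lemma star_connected_prism: "star_connected (prism n) (vertex n 0, vertex 1 0)"
proof -
  have "\<exists>e\<in>simplices (prism n) 1. {sact (prism n) (vertex 1 0) e, sact (prism n) (vertex 1 1) e} =
      {(vertex n 0, vertex 1 0), z}" if z: "z \<in> simplices (prism n) 0" for z
  proof -
    have edge: "\<exists>e\<in>hom Delta 1 m. e \<cdot>\<^bsub>Delta\<^esub> vertex 1 0 = vertex m 0 \<and> e \<cdot>\<^bsub>Delta\<^esub> vertex 1 1 = \<sigma>" if s: "\<sigma> \<in> hom Delta 0 m" for m \<sigma>
    proof -
      let ?e = "delta_map 1 m (\<lambda>l. if l = 0 then 0 else delta_fun \<sigma> 0)"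
      have i: "delta_fun \<sigma> 0 \<le> m" using delta_fun_le[OF s] by simp
      then have e: "?e \<in> hom Delta 1 m" by (intro delta_map_hom) auto
      have "\<sigma> = vertex m (delta_fun \<sigma> 0)" by (rule delta_eqI[OF s vertex_hom[OF i]]) (simp add: vertex_def)
      then show ?thesis using e vertex_Comp[OF e, of 0] vertex_Comp[OF e, of 1] by (intro bexI[of _ ?e]) auto
    qed
    obtain \<sigma> \<tau> where st: "z = (\<sigma>, \<tau>)" "\<sigma> \<in> hom Delta 0 n" "\<tau> \<in> hom Delta 0 1" using z by auto
    obtain e e' where "e \<in> hom Delta 1 n" "e \<cdot>\<^bsub>Delta\<^esub> vertex 1 0 = vertex n 0" "e \<cdot>\<^bsub>Delta\<^esub> vertex 1 1 = \<sigma>"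
      "e' \<in> hom Delta 1 1" "e' \<cdot>\<^bsub>Delta\<^esub> vertex 1 0 = vertex 1 0" "e' \<cdot>\<^bsub>Delta\<^esub> vertex 1 1 = \<tau>"
      using edge[OF st(2)] edge[OF st(3)] by blast
    then show ?thesis unfolding st(1) by (intro bexI[of _ "(e, e')"]) simp_all
  qed
  moreover have "(vertex n 0, vertex 1 0) \<in> simplices (prism n) 0" using vertex_hom by simp
  ultimately show ?thesis unfolding star_connected_def by blast
qed

lemma prism_vertex_closed: "\<sigma> \<in> simplices (prism n) m \<Longrightarrow> sact (prism n) (vertex m 0) \<sigma> \<in> simplices (prism n) 0"
  using is_ssetD(1)[OF is_sset_prism vertex_hom] by blast

section \<open>Uniqueness of matching objects and of path spaces\<close>

context category
begin

lemma matching_object_lift: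
  assumes "matching_object C X K M \<pi>" "matching_cone C X K T \<rho>"
  obtains u where "u \<in> hom C T M" "\<And>m \<sigma>. \<sigma> \<in> simplices K m \<Longrightarrow> \<pi> m \<sigma> \<cdot>\<^bsub>C\<^esub> u = \<rho> m \<sigma>"
  using assms unfolding matching_object_def by blast

lemma matching_object_eq:
  assumes X: "X \<in> simplicial_objects C" and M: "matching_object C X K M \<pi>"
    and u: "u \<in> hom C T M" and v: "v \<in> hom C T M"
    and e: "\<And>m \<sigma>. \<sigma> \<in> simplices K m \<Longrightarrow> \<pi> m \<sigma> \<cdot>\<^bsub>C\<^esub> u = \<pi> m \<sigma> \<cdot>\<^bsub>C\<^esub> v"
  shows "u = v"
proof -
  have "matching_cone C X K T (\<lambda>m \<sigma>. \<pi> m \<sigma> \<cdot>\<^bsub>C\<^esub> u)"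
    using matching_cone_comp[OF category_axioms X _ u] M unfolding matching_object_def by blast
  then have "\<exists>!w. w \<in> hom C T M \<and> (\<forall>m. \<forall>\<sigma>\<in>simplices K m. \<pi> m \<sigma> \<cdot>\<^bsub>C\<^esub> w = \<pi> m \<sigma> \<cdot>\<^bsub>C\<^esub> u)"
    using M unfolding matching_object_def by blast
  moreover have "v \<in> hom C T M \<and> (\<forall>m. \<forall>\<sigma>\<in>simplices K m. \<pi> m \<sigma> \<cdot>\<^bsub>C\<^esub> v = \<pi> m \<sigma> \<cdot>\<^bsub>C\<^esub> u)" using v e by simp
  ultimately show ?thesis using u by blast
qed

lemma matching_object_iso:
  assumes X: "X \<in> simplicial_objects C" and M: "matching_object C X K M \<pi>"
    and i: "i \<in> hom C M' M" "iso_arrow C i"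
    and p: "\<And>m \<sigma>. \<sigma> \<in> simplices K m \<Longrightarrow> \<pi> m \<sigma> \<cdot>\<^bsub>C\<^esub> i = \<pi>' m \<sigma>"
    and cl: "\<And>k m \<theta> \<sigma>. \<theta> \<in> hom Delta k m \<Longrightarrow> \<sigma> \<in> simplices K m \<Longrightarrow> sact K \<theta> \<sigma> \<in> simplices K k"
  shows "matching_object C X K M' \<pi>'"
  unfolding matching_object_def
proof (intro conjI allI impI)
  obtain j where j: "j \<in> hom C M M'" "j \<cdot>\<^bsub>C\<^esub> i = Ident C M'" "i \<cdot>\<^bsub>C\<^esub> j = Ident C M"
    using iso_arrow_inverse[OF i(2,1)] by blast
  have cone: "matching_cone C X K M \<pi>" using M unfolding matching_object_def by blast
  have ph: "\<pi> m \<sigma> \<in> hom C M (FObj X m)" if "\<sigma> \<in> simplices K m" for m \<sigma>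
    using cone that unfolding matching_cone_iff by blast
  show "matching_cone C X K M' \<pi>'"
    using matching_cone_comp[OF category_axioms X cone i(1)] p cl unfolding matching_cone_iff by simp
  fix T \<rho> assume r: "matching_cone C X K T \<rho>"
  obtain u where u: "u \<in> hom C T M" "\<And>m \<sigma>. \<sigma> \<in> simplices K m \<Longrightarrow> \<pi> m \<sigma> \<cdot>\<^bsub>C\<^esub> u = \<rho> m \<sigma>"
    using matching_object_lift[OF M r] by blast
  note ju = Comp_in[OF u(1) j(1)]
  have iju: "i \<cdot>\<^bsub>C\<^esub> (j \<cdot>\<^bsub>C\<^esub> u) = u" using Comp_assoc[OF u(1) j(1) i(1)] j(3) Ident_left[OF u(1)] by simp
  have eq: "\<pi>' m \<sigma> \<cdot>\<^bsub>C\<^esub> (j \<cdot>\<^bsub>C\<^esub> u) = \<rho> m \<sigma>" if s: "\<sigma> \<in> simplices K m" for m \<sigma>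
    using Comp_assoc[OF ju i(1) ph[OF s]] p[OF s] iju u(2)[OF s] by simp
  have un: "w = j \<cdot>\<^bsub>C\<^esub> u" if w: "w \<in> hom C T M'" "\<forall>m. \<forall>\<sigma>\<in>simplices K m. \<pi>' m \<sigma> \<cdot>\<^bsub>C\<^esub> w = \<rho> m \<sigma>" for w
  proof -
    have "i \<cdot>\<^bsub>C\<^esub> w = u"
    proof (rule matching_object_eq[OF X M Comp_in[OF w(1) i(1)] u(1)])
      show "\<pi> m \<sigma> \<cdot>\<^bsub>C\<^esub> (i \<cdot>\<^bsub>C\<^esub> w) = \<pi> m \<sigma> \<cdot>\<^bsub>C\<^esub> u" if s: "\<sigma> \<in> simplices K m" for m \<sigma>
        using Comp_assoc[OF w(1) i(1) ph[OF s]] p[OF s] w(2) s u(2)[OF s] by simp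
    qed
    then show ?thesis using Comp_assoc[OF w(1) i(1) j(1)] j(2) Ident_left[OF w(1)] by simp
  qed
  show "\<exists>!u. u \<in> hom C T M' \<and> (\<forall>m. \<forall>\<sigma>\<in>simplices K m. \<pi>' m \<sigma> \<cdot>\<^bsub>C\<^esub> u = \<rho> m \<sigma>)"
  proof (rule ex1I[of _ "j \<cdot>\<^bsub>C\<^esub> u"])
    show "j \<cdot>\<^bsub>C\<^esub> u \<in> hom C T M' \<and> (\<forall>m. \<forall>\<sigma>\<in>simplices K m. \<pi>' m \<sigma> \<cdot>\<^bsub>C\<^esub> (j \<cdot>\<^bsub>C\<^esub> u) = \<rho> m \<sigma>)"
      using ju eq by blast
    fix w assume "w \<in> hom C T M' \<and> (\<forall>m. \<forall>\<sigma>\<in>simplices K m. \<pi>' m \<sigma> \<cdot>\<^bsub>C\<^esub> w = \<rho> m \<sigma>)"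
    then show "w = j \<cdot>\<^bsub>C\<^esub> u" using un by blast
  qed
qed

lemma matching_object_unique:
  assumes X: "X \<in> simplicial_objects C" and M: "matching_object C X K M \<pi>" and M': "matching_object C X K M' \<pi>'"
  obtains i where "i \<in> hom C M' M" "iso_arrow C i" "\<And>m \<sigma>. \<sigma> \<in> simplices K m \<Longrightarrow> \<pi> m \<sigma> \<cdot>\<^bsub>C\<^esub> i = \<pi>' m \<sigma>"
proof -
  have c: "matching_cone C X K M \<pi>" "matching_cone C X K M' \<pi>'"
    using M M' unfolding matching_object_def by auto
  have ph: "\<pi> m \<sigma> \<in> hom C M (FObj X m)" "\<pi>' m \<sigma> \<in> hom C M' (FObj X m)" if "\<sigma> \<in> simplices K m" for m \<sigma>
    using c that unfolding matching_cone_iff by blast+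
  have o: "M \<in> Obj C" "M' \<in> Obj C" using c unfolding matching_cone_iff by auto
  obtain i where i: "i \<in> hom C M' M" "\<And>m \<sigma>. \<sigma> \<in> simplices K m \<Longrightarrow> \<pi> m \<sigma> \<cdot>\<^bsub>C\<^esub> i = \<pi>' m \<sigma>"
    using matching_object_lift[OF M c(2)] by blast
  obtain j where j: "j \<in> hom C M M'" "\<And>m \<sigma>. \<sigma> \<in> simplices K m \<Longrightarrow> \<pi>' m \<sigma> \<cdot>\<^bsub>C\<^esub> j = \<pi> m \<sigma>"
    using matching_object_lift[OF M' c(1)] by blast
  have "i \<cdot>\<^bsub>C\<^esub> j = Ident C M"
    by (rule matching_object_eq[OF X M Comp_in[OF j(1) i(1)] Ident_in[OF o(1)]])
      (use Comp_assoc[OF j(1) i(1) ph(1)] i(2) j(2) Ident_right[OF ph(1)] in simp)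
  moreover have "j \<cdot>\<^bsub>C\<^esub> i = Ident C M'"
    by (rule matching_object_eq[OF X M' Comp_in[OF i(1) j(1)] Ident_in[OF o(2)]])
      (use Comp_assoc[OF i(1) j(1) ph(2)] i(2) j(2) Ident_right[OF ph(2)] in simp)
  ultimately have "iso_arrow C i" using iso_arrowI[OF i(1) j(1)] by simp
  then show ?thesis using that i by blast
qed

lemma path_space_natural:
  assumes P: "path_space C X P ev" and t: "\<theta> \<in> hom Delta m n" and s: "\<sigma> \<in> hom Delta k m" "\<tau> \<in> hom Delta k 1"
  shows "ev m k (\<sigma>, \<tau>) \<cdot>\<^bsub>C\<^esub> FArr P \<theta> = ev n k (\<theta> \<cdot>\<^bsub>Delta\<^esub> \<sigma>, \<tau>)"
proof -
  note d = Delta.homD(1-3)[OF t]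
  show ?thesis
    using P[unfolded path_space_def, THEN conjunct2, THEN conjunct2, rule_format, OF d(1), of \<sigma> k \<tau>] s
    unfolding d by simp
qed

text \<open>The comparison in each level is determined by its composites with \<open>ev\<close>, and
  these composites also show that it commutes with operators.\<close>

lemma path_space_map:
  assumes X: "X \<in> simplicial_objects C" and P: "path_space C X P ev" and P': "path_space C X P' ev'"
  obtains \<phi> where "(P', P, \<phi>) \<in> Arr (simplicial_category C)"
    "\<And>n k \<sigma> \<tau>. \<sigma> \<in> hom Delta k n \<Longrightarrow> \<tau> \<in> hom Delta k 1 \<Longrightarrow> ev n k (\<sigma>, \<tau>) \<cdot>\<^bsub>C\<^esub> \<phi> n = ev' n k (\<sigma>, \<tau>)"
proof -
  have PS: "P \<in> simplicial_objects C" "P' \<in> simplicial_objects C" using P P' unfolding path_space_def by auto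
  have M: "matching_object C X (prism n) (FObj P n) (ev n)" "matching_object C X (prism n) (FObj P' n) (ev' n)" for n
    using P P' unfolding path_space_def by auto
  have c: "matching_cone C X (prism n) (FObj P n) (ev n)" "matching_cone C X (prism n) (FObj P' n) (ev' n)" for n
    using M unfolding matching_object_def by auto
  have evh: "ev n k (\<sigma>, \<tau>) \<in> hom C (FObj P n) (FObj X k)" "ev' n k (\<sigma>, \<tau>) \<in> hom C (FObj P' n) (FObj X k)"
    if "\<sigma> \<in> hom Delta k n" "\<tau> \<in> hom Delta k 1" for n k \<sigma> \<tau>
    using c[of n] that unfolding matching_cone_iff by auto
  have nat: "ev m k (\<sigma>, \<tau>) \<cdot>\<^bsub>C\<^esub> FArr P \<theta> = ev n k (\<theta> \<cdot>\<^bsub>Delta\<^esub> \<sigma>, \<tau>)" "ev' m k (\<sigma>, \<tau>) \<cdot>\<^bsub>C\<^esub> FArr P' \<theta> = ev' n k (\<theta> \<cdot>\<^bsub>Delta\<^esub> \<sigma>, \<tau>)"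
    if "\<theta> \<in> hom Delta m n" "\<sigma> \<in> hom Delta k m" "\<tau> \<in> hom Delta k 1" for m n k \<theta> \<sigma> \<tau>
    using path_space_natural[OF P that] path_space_natural[OF P' that] .
  have "\<exists>u. u \<in> hom C (FObj P' n) (FObj P n) \<and> (\<forall>k. \<forall>s\<in>simplices (prism n) k. ev n k s \<cdot>\<^bsub>C\<^esub> u = ev' n k s)" for n
    by (rule matching_object_lift[OF M(1)[of n] c(2)[of n]]) blast
  then obtain \<phi> where p: "\<And>n. \<phi> n \<in> hom C (FObj P' n) (FObj P n)"
    "\<And>n k s. s \<in> simplices (prism n) k \<Longrightarrow> ev n k s \<cdot>\<^bsub>C\<^esub> \<phi> n = ev' n k s" by metis
  have p': "ev n k (\<sigma>, \<tau>) \<cdot>\<^bsub>C\<^esub> \<phi> n = ev' n k (\<sigma>, \<tau>)" if "\<sigma> \<in> hom Delta k n" "\<tau> \<in> hom Delta k 1" for n k \<sigma> \<tau>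
    using p(2)[of "(\<sigma>, \<tau>)"] that by simp
  have "(P', P, \<phi>) \<in> Arr (simplicial_category C)"
  proof (rule smapI[OF PS(2,1) p(1)])
    fix \<theta> m n assume t: "\<theta> \<in> hom Delta m n"
    note Pt = sobj_hom[OF PS(1) t] and Pt' = sobj_hom[OF PS(2) t]
    show "\<phi> m \<cdot>\<^bsub>C\<^esub> FArr P' \<theta> = FArr P \<theta> \<cdot>\<^bsub>C\<^esub> \<phi> n"
    proof (rule matching_object_eq[OF X M(1)[of m] Comp_in[OF Pt' p(1)] Comp_in[OF p(1) Pt]])
      fix k s assume "s \<in> simplices (prism m) k"
      then obtain \<sigma> \<tau> where st: "s = (\<sigma>, \<tau>)" "\<sigma> \<in> hom Delta k m" "\<tau> \<in> hom Delta k 1" by auto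
      show "ev m k s \<cdot>\<^bsub>C\<^esub> (\<phi> m \<cdot>\<^bsub>C\<^esub> FArr P' \<theta>) = ev m k s \<cdot>\<^bsub>C\<^esub> (FArr P \<theta> \<cdot>\<^bsub>C\<^esub> \<phi> n)"
        unfolding st(1)
        using Comp_assoc[OF Pt' p(1) evh(1)[OF st(2,3)]] p'[OF st(2,3)] nat(2)[OF t st(2,3)]
          Comp_assoc[OF p(1) Pt evh(1)[OF st(2,3)]] nat(1)[OF t st(2,3)] p'[OF delta_Comp(1)[OF st(2) t] st(3)] by simp
    qed
  qed
  then show ?thesis using that p' by blast
qed

text \<open>The structure provides some canonical path with good properties, while weak equivalences
  are witnessed by any. An isomorphism compatible with both end point maps transfers properties
  between them.\<close>

lemma canonical_path_unique:
  assumes P: "canonical_path C S X P s d" and P': "canonical_path C S X P' s' d'"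
  obtains \<phi> where "\<phi> \<in> hom (Gpd C S) P' P" "iso_arrow (Gpd C S) \<phi>" "\<And>i. i < 2 \<Longrightarrow> d i \<cdot>\<^bsub>Gpd C S\<^esub> \<phi> = d' i"
proof -
  interpret G: category "Gpd C S" by (rule category_Gpd)
  obtain ev where ev: "path_space C X P ev"
    and de: "\<And>i n. i < 2 \<Longrightarrow> snd (snd (d i)) n = ev n n (Ident Delta n, coface 0 i \<cdot>\<^bsub>Delta\<^esub> to_point n)"
    using P unfolding canonical_path_def by blast
  obtain ev' where ev': "path_space C X P' ev'"
    and de': "\<And>i n. i < 2 \<Longrightarrow> snd (snd (d' i)) n = ev' n n (Ident Delta n, coface 0 i \<cdot>\<^bsub>Delta\<^esub> to_point n)"
    using P' unfolding canonical_path_def by blast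
  have G: "s \<in> hom (Gpd C S) X P" "s' \<in> hom (Gpd C S) X P'"
    and dh: "\<And>i. i < 2 \<Longrightarrow> d i \<in> hom (Gpd C S) P X" "\<And>i. i < 2 \<Longrightarrow> d' i \<in> hom (Gpd C S) P' X"
    using P P' unfolding canonical_path_def by auto
  have gp: "infinity_groupoid C S X" "infinity_groupoid C S P" "infinity_groupoid C S P'"
    using G by (auto simp: hom_Gpd Arr_Gpd)
  note X = groupoid_sobj[OF gp(1)]
  obtain \<phi> where p: "(P', P, \<phi>) \<in> Arr (simplicial_category C)"
    "\<And>n k \<sigma> \<tau>. \<sigma> \<in> hom Delta k n \<Longrightarrow> \<tau> \<in> hom Delta k 1 \<Longrightarrow> ev n k (\<sigma>, \<tau>) \<cdot>\<^bsub>C\<^esub> \<phi> n = ev' n k (\<sigma>, \<tau>)"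
    using path_space_map[OF X ev ev'] by metis
  obtain \<psi> where q: "(P, P', \<psi>) \<in> Arr (simplicial_category C)"
    "\<And>n k \<sigma> \<tau>. \<sigma> \<in> hom Delta k n \<Longrightarrow> \<tau> \<in> hom Delta k 1 \<Longrightarrow> ev' n k (\<sigma>, \<tau>) \<cdot>\<^bsub>C\<^esub> \<psi> n = ev n k (\<sigma>, \<tau>)"
    using path_space_map[OF X ev' ev] by metis
  have inv: "\<alpha> n \<cdot>\<^bsub>C\<^esub> \<beta> n = Ident C (FObj A n)"
    if e: "path_space C X A e" and a: "(B, A, \<alpha>) \<in> Arr (simplicial_category C)" and b: "(A, B, \<beta>) \<in> Arr (simplicial_category C)"
      and ae: "\<And>n k \<sigma> \<tau>. \<sigma> \<in> hom Delta k n \<Longrightarrow> \<tau> \<in> hom Delta k 1 \<Longrightarrow> e n k (\<sigma>, \<tau>) \<cdot>\<^bsub>C\<^esub> \<alpha> n = e' n k (\<sigma>, \<tau>)"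
      and be: "\<And>n k \<sigma> \<tau>. \<sigma> \<in> hom Delta k n \<Longrightarrow> \<tau> \<in> hom Delta k 1 \<Longrightarrow> e' n k (\<sigma>, \<tau>) \<cdot>\<^bsub>C\<^esub> \<beta> n = e n k (\<sigma>, \<tau>)"
    for A B e e' \<alpha> \<beta> n
  proof -
    have M: "matching_object C X (prism n) (FObj A n) (e n)" using e unfolding path_space_def by auto
    then have "matching_cone C X (prism n) (FObj A n) (e n)" unfolding matching_object_def by blast
    then have eh: "e n k (\<sigma>, \<tau>) \<in> hom C (FObj A n) (FObj X k)" if "\<sigma> \<in> hom Delta k n" "\<tau> \<in> hom Delta k 1" for k \<sigma> \<tau>
      using that unfolding matching_cone_iff by auto
    note an = smapD(3)[OF a] and bn = smapD(3)[OF b]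
    show ?thesis
    proof (rule matching_object_eq[OF X M Comp_in[OF bn an] Ident_in[OF homD(5)[OF an]]])
      fix k s assume "s \<in> simplices (prism n) k"
      then obtain \<sigma> \<tau> where st: "s = (\<sigma>, \<tau>)" "\<sigma> \<in> hom Delta k n" "\<tau> \<in> hom Delta k 1" by auto
      show "e n k s \<cdot>\<^bsub>C\<^esub> (\<alpha> n \<cdot>\<^bsub>C\<^esub> \<beta> n) = e n k s \<cdot>\<^bsub>C\<^esub> Ident C (FObj A n)"
        unfolding st(1) using Comp_assoc[OF bn an eh[OF st(2,3)]] ae[OF st(2,3)] be[OF st(2,3)]
          Ident_right[OF eh[OF st(2,3)]] by simp
    qed
  qed
  have hp: "(P', P, \<phi>) \<in> hom (Gpd C S) P' P" "(P, P', \<psi>) \<in> hom (Gpd C S) P P'"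
    using p(1) q(1) gp by (auto simp: hom_Gpd Arr_Gpd)
  have "iso_arrow (Gpd C S) (P', P, \<phi>)"
    by (rule G.iso_arrowI[OF hp]) (use inv[OF ev' q(1) p(1) q(2) p(2)] inv[OF ev p(1) q(1) p(2) q(2)] in simp_all)
  moreover have "d i \<cdot>\<^bsub>Gpd C S\<^esub> (P', P, \<phi>) = d' i" if i: "i < 2" for i
  proof -
    obtain a a' where a: "d i = (P, X, a)" "d' i = (P', X, a')" using dh i by (metis hom_Gpd)
    have c: "coface 0 i \<cdot>\<^bsub>Delta\<^esub> to_point n \<in> hom Delta n 1" for n
      using delta_Comp(1)[OF to_point_hom] coface_hom[of i 0] i by simp
    have "a n \<cdot>\<^bsub>C\<^esub> \<phi> n = a' n" for n
      using de[OF i, of n] de'[OF i, of n] p(2)[OF delta_Ident(1) c] a by simp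
    then show ?thesis unfolding a by simp
  qed
  ultimately show ?thesis using that hp(1) by blast
qed

end

section \<open>Path spaces under the levelwise functor\<close>

context geometric_pair
begin

text \<open>The prism is filled relative to a map to a constant object, and the base is discarded at
  the end by connectedness. \<open>tc\<close> says that maps to a terminal object are covers; it
  takes care of the first simplex, glued along the empty complex.\<close>

lemma prism_matching_object:
  assumes X: "infinity_groupoid C SC X"
    and tc: "\<forall>t g. terminal_object C t \<longrightarrow> g \<in> Arr C \<longrightarrow> Cod C g = t \<longrightarrow> g \<in> SC"
  shows "\<exists>M \<pi>. matching_object C X (prism n) M \<pi> \<and> matching_object D (LX X) (prism n) (FObj F M) (Fy \<pi>)"
proof -
  obtain t f where t: "terminal_object C t" and f: "(X, constant_sobj C t, f) \<in> Arr (simplicial_category C)"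
    and horns: "\<forall>n k. 1 \<le> n \<longrightarrow> k \<le> n \<longrightarrow> preserved_cover (X, constant_sobj C t, f) n (horn n k)"
    using groupoid_preserved_cover[OF X] by metis
  have to: "t \<in> Obj C" using t by (simp add: terminal_object_def)
  have fn: "f m \<in> hom C (FObj X m) t" for m using C.smapD(3)[OF f, of m] by simp
  let ?y = "\<lambda>(_::nat) (_::delta_arr \<times> delta_arr). Ident C t"
  have y: "matching_cone C (constant_sobj C t) (prism n) t ?y"
    unfolding matching_cone_iff using to C.Ident_in[OF to] C.Ident_left[OF C.Ident_in[OF to]] by simp
  have gc: "preserved_cover (X, constant_sobj C t, f) (Suc n)
      (attaching (prism n) (prism_part n i) (prism_simplex n i) (Suc n))" if i: "i \<le> n" for i
  proof (cases "i = 0")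
    case True
    \<comment> \<open>For the first simplex the matching map is X_{n+1} \<rightarrow> *.\<close>
    have e: "sub (std_simplex (Suc n)) (\<lambda>k. {\<theta> \<in> hom Delta k (Suc n). 0 < i \<and> i \<notin> delta_image \<theta>}) =
        sub (std_simplex (Suc n)) (\<lambda>_. {})" using True by simp
    have "preserved X f t (\<lambda>m. FArr (constant_sobj C t)) (sub (std_simplex (Suc n)) (\<lambda>_. {})) t undefined (Ident C t)"
      by (rule preserved_empty[OF to])
    moreover have "matching_map C X f (Suc n) (sub (std_simplex (Suc n)) (\<lambda>_. {})) t undefined (Ident C t) (f (Suc n))"
      unfolding matching_map_def using fn C.Ident_left[OF fn] by simp
    moreover have "f (Suc n) \<in> SC" using tc t C.homD[OF fn] by blast
    ultimately show ?thesis unfolding attaching_prism[OF i] e preserved_cover_iff by (metis C.constant_sobj_simps(1))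
  next
    case False
    \<comment> \<open>Since i > 0, the facet opposite i contains vertex 0 and is the cone with apex
      0 over the simplex on the remaining vertices. Its restriction map is a cover because X is a
      groupoid.\<close>
    let ?K = "Pow ({..Suc n} - {0, i})"
    have "image_in (Suc n) (cone_family 0 ?K) = image_in (Suc n) {B. i \<notin> B}"
      by (rule image_in_cong) (use False in \<open>auto simp: cone_family_def\<close>)
    also have "\<dots> = (\<lambda>k. {\<theta> \<in> hom Delta k (Suc n). 0 < i \<and> i \<notin> delta_image \<theta>})"
      using False by (simp add: image_in_def fun_eq_iff)
    finally have e: "(\<lambda>k. {\<theta> \<in> hom Delta k (Suc n). 0 < i \<and> i \<notin> delta_image \<theta>}) = image_in (Suc n) (cone_family 0 ?K)" ..
    have dc: "down_closed ?K" "{} \<in> ?K" "?K \<subseteq> Pow ({..Suc n} - {0})" by (auto simp: down_closed_def)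
    show ?thesis unfolding attaching_prism[OF i] e
      by (rule preserved_cover_cone[OF f _ horns constant_pullback[OF f] dc]) auto
  qed
  have "\<exists>M \<pi> q. preserved X f t ?y (sub (prism n) (prism_part n i)) M \<pi> q" if "i \<le> Suc n" for i
    using that
  proof (induction i)
    case 0
    have "prism_part n 0 = (\<lambda>_. {})" by (auto simp: prism_part_def)
    then show ?case using preserved_empty[OF to] by metis
  next
    case (Suc i)
    then have i: "i \<le> n" by simp
    obtain M \<pi> q where M: "preserved X f t ?y (sub (prism n) (prism_part n i)) M \<pi> q" using Suc by auto
    have s: "prism_simplex n i \<in> simplices (prism n) (Suc n)"
      using prism_simplex(1,2)[OF i] by (cases "prism_simplex n i") simp
    obtain M' \<pi>' p where "preserved X f t ?y (sub (prism n) (attach (prism n) (prism_part n i) (prism_simplex n i) (Suc n))) M' \<pi>' (q \<cdot>\<^bsub>C\<^esub> p)"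
      by (rule preserved_attach_cover[OF is_sset_prism subcomplex_prism_part s inj_prism_simplex[OF i] f y M gc[OF i]]) blast
    then show ?case unfolding attach_prism[OF i] by blast
  qed
  from this[of "Suc n"] obtain M \<pi> q where M: "preserved X f t ?y (prism n) M \<pi> q"
    unfolding prism_part_full by blast
  have Lf: "(LX X, constant_sobj D (FObj F t), Ff f) \<in> Arr (simplicial_category D)"
    using levelwise_smap[OF f] levelwise_constant[OF to] by simp
  have "over_limit C X f t ?y (prism n) M \<pi> q"
    "over_limit D (LX X) (Ff f) (FObj F t) (\<lambda>_ _. Ident D (FObj F t)) (prism n) (FObj F M) (Fy \<pi>) (FArr F q)"
    using M unfolding preserved_def FArr_Ident[OF to] by blast+
  then show ?thesis
    using C.over_constant_iff[OF star_connected_prism prism_vertex_closed f]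
      D.over_constant_iff[OF star_connected_prism prism_vertex_closed Lf] by blast
qed

text \<open>The given path space is in each level isomorphic to the matching object built from the
  filtration, for which preservation is known.\<close>

lemma levelwise_path_space:
  assumes X: "infinity_groupoid C SC X"
    and tc: "\<forall>t g. terminal_object C t \<longrightarrow> g \<in> Arr C \<longrightarrow> Cod C g = t \<longrightarrow> g \<in> SC"
    and P: "path_space C X P ev"
  shows "path_space D (LX X) (LX P) (\<lambda>n. Fy (ev n))"
  unfolding path_space_def
proof (intro conjI allI ballI)
  note XS = C.groupoid_sobj[OF X]
  have PS: "P \<in> simplicial_objects C" and M: "\<And>n. matching_object C X (prism n) (FObj P n) (ev n)"
    using P unfolding path_space_def by auto
  show "LX P \<in> simplicial_objects D" using levelwise_sobj[OF PS] .
  show "matching_object D (LX X) (prism n) (FObj (LX P) n) (Fy (ev n))" for n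
  proof -
    obtain M' \<pi> where M': "matching_object C X (prism n) M' \<pi>" "matching_object D (LX X) (prism n) (FObj F M') (Fy \<pi>)"
      using prism_matching_object[OF X tc] by blast
    obtain i where i: "i \<in> hom C (FObj P n) M'" "iso_arrow C i" "\<And>m \<sigma>. \<sigma> \<in> simplices (prism n) m \<Longrightarrow> \<pi> m \<sigma> \<cdot>\<^bsub>C\<^esub> i = ev n m \<sigma>"
      using C.matching_object_unique[OF XS M'(1) M] by metis
    have ph: "\<pi> m \<sigma> \<in> hom C M' (FObj X m)" if "\<sigma> \<in> simplices (prism n) m" for m \<sigma>
      using M'(1) that unfolding matching_object_def matching_cone_iff by blast
    show ?thesis unfolding levelwise_simps(1)
    proof (rule D.matching_object_iso[OF levelwise_sobj[OF XS] M'(2) FArr_in[OF i(1)] FArr_iso[OF i(1,2)]])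
      show "FArr F (\<pi> m \<sigma>) \<cdot>\<^bsub>D\<^esub> FArr F i = FArr F (ev n m \<sigma>)" if "\<sigma> \<in> simplices (prism n) m" for m \<sigma>
        using FArr_Comp[OF i(1) ph[OF that]] i(3)[OF that] by simp
    qed (rule is_ssetD(1)[OF is_sset_prism])
  qed
  fix \<theta> k \<sigma> \<tau> assume t: "\<theta> \<in> Arr Delta" and s: "\<sigma> \<in> hom Delta k (Dom Delta \<theta>)" and u: "\<tau> \<in> hom Delta k 1"
  have t': "\<theta> \<in> hom Delta (Dom Delta \<theta>) (Cod Delta \<theta>)" using t by (simp add: hom_def)
  have e: "ev (Dom Delta \<theta>) k (\<sigma>, \<tau>) \<cdot>\<^bsub>C\<^esub> FArr P \<theta> = ev (Cod Delta \<theta>) k (\<theta> \<cdot>\<^bsub>Delta\<^esub> \<sigma>, \<tau>)"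
    using C.path_space_natural[OF P t' s u] .
  have "ev (Dom Delta \<theta>) k (\<sigma>, \<tau>) \<in> hom C (FObj P (Dom Delta \<theta>)) (FObj X k)"
    using M[of "Dom Delta \<theta>"] s u unfolding matching_object_def matching_cone_iff by auto
  from FArr_Comp[OF C.sobj_hom[OF PS t'] this]
  show "FArr F (ev (Dom Delta \<theta>) k (\<sigma>, \<tau>)) \<cdot>\<^bsub>D\<^esub> FArr (LX P) \<theta> = FArr F (ev (Cod Delta \<theta>) k (\<theta> \<cdot>\<^bsub>Delta\<^esub> \<sigma>, \<tau>))"
    using e levelwise_FArr[OF t'] by simp
qed

lemma levelwise_canonical_path:
  assumes t: "terminal_object D t"
    and tc: "\<forall>t g. terminal_object C t \<longrightarrow> g \<in> Arr C \<longrightarrow> Cod C g = t \<longrightarrow> g \<in> SC"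
    and P: "canonical_path C SC X P s d"
  shows "canonical_path D SD (LX X) (LX P) (FArr (levelwise F) s) (\<lambda>i. FArr (levelwise F) (d i))"
proof -
  interpret L: cat_functor "Gpd C SC" "Gpd D SD" "levelwise F" by (rule levelwise_functor[OF t])
  have s: "s \<in> hom (Gpd C SC) X P" and d: "\<And>i. i < 2 \<Longrightarrow> d i \<in> hom (Gpd C SC) P X"
    using P unfolding canonical_path_def by auto
  obtain ev where ev: "path_space C X P ev"
    and se: "\<And>n k \<sigma> \<tau>. \<sigma> \<in> hom Delta k n \<Longrightarrow> \<tau> \<in> hom Delta k 1 \<Longrightarrow> ev n k (\<sigma>, \<tau>) \<cdot>\<^bsub>C\<^esub> snd (snd s) n = FArr X \<sigma>"
    and de: "\<And>i n. i < 2 \<Longrightarrow> snd (snd (d i)) n = ev n n (Ident Delta n, coface 0 i \<cdot>\<^bsub>Delta\<^esub> to_point n)"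
    using P unfolding canonical_path_def by blast
  obtain s' where s': "s = (X, P, s')" "(X, P, s') \<in> Arr (simplicial_category C)" and X: "infinity_groupoid C SC X"
    using s by (auto simp: C.hom_Gpd C.Arr_Gpd)
  have M: "matching_object C X (prism n) (FObj P n) (ev n)" for n using ev unfolding path_space_def by auto
  have evh: "ev n k (\<sigma>, \<tau>) \<in> hom C (FObj P n) (FObj X k)" if "\<sigma> \<in> hom Delta k n" "\<tau> \<in> hom Delta k 1" for n k \<sigma> \<tau>
    using M[of n] that unfolding matching_object_def matching_cone_iff by auto
  have 1: "FArr F (ev n k (\<sigma>, \<tau>)) \<cdot>\<^bsub>D\<^esub> snd (snd (FArr (levelwise F) s)) n = FArr (LX X) \<sigma>"
    if "\<sigma> \<in> hom Delta k n" "\<tau> \<in> hom Delta k 1" for n k \<sigma> \<tau>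
    using FArr_Comp[OF C.smapD(3)[OF s'(2)] evh[OF that]] se[OF that] levelwise_FArr[OF that(1)]
    unfolding s'(1) by (simp add: levelwise_simps)
  have 2: "snd (snd (FArr (levelwise F) (d i))) n = FArr F (ev n n (Ident Delta n, coface 0 i \<cdot>\<^bsub>Delta\<^esub> to_point n))"
    if "i < 2" for i n
    using de[OF that, of n] by (cases "d i") (simp add: levelwise_simps)
  show ?thesis
    unfolding canonical_path_def
    using L.FArr_in[OF s] L.FArr_in[OF d] levelwise_path_space[OF X tc ev] 1 2
    by (intro conjI exI[of _ "\<lambda>n. Fy (ev n)"]) auto
qed

end

section \<open>Exactness of the levelwise functor\<close>

context category
begin

text \<open>Over a terminal object every square commutes, so the two universal properties ask for
  the same lifts. This makes closure of fibrations under base change applicable to product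
  projections.\<close>

lemma is_product_pullback:
  assumes t: "terminal_object C t" and f: "f \<in> hom C a t" and g: "g \<in> hom C b t"
    and P: "is_product C {..<2::nat} A P pr" and A: "A 0 = a" "A 1 = b"
  shows "is_pullback C f g (pr 0) (pr 1)"
proof -
  have two: "i < 2 \<longleftrightarrow> i = 0 \<or> i = 1" for i :: nat by auto
  have pr: "pr 0 \<in> hom C P a" "pr 1 \<in> hom C P b" using P A unfolding is_product_def by auto
  have u: "x = y" if "x \<in> hom C T t" "y \<in> hom C T t" for x y T
    using t that homD(4)[OF that(1)] unfolding terminal_object_def by blast
  have ex: "\<exists>!u. u \<in> hom C T P \<and> (\<forall>i\<in>{..<2}. pr i \<cdot>\<^bsub>C\<^esub> u = h i)" if "T \<in> Obj C" "\<forall>i\<in>{..<2}. h i \<in> hom C T (A i)" for T h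
    using P that unfolding is_product_def by blast
  show ?thesis
  proof (rule is_pullbackI[OF f g pr])
    show "f \<cdot>\<^bsub>C\<^esub> pr 0 = g \<cdot>\<^bsub>C\<^esub> pr 1" using u Comp_in[OF pr(1) f] Comp_in[OF pr(2) g] by blast
  next
    fix T h k assume h: "h \<in> hom C T a" and k: "k \<in> hom C T b"
    have "\<forall>i\<in>{..<2}. (if i = 0 then h else k) \<in> hom C T (A i)" using h k A by (auto simp: two)
    from ex[OF homD(4)[OF h] this] obtain u where "u \<in> hom C T P" "\<forall>i\<in>{..<2}. pr i \<cdot>\<^bsub>C\<^esub> u = (if i = 0 then h else k)"
      by blast
    then show "\<exists>u\<in>hom C T P. pr 0 \<cdot>\<^bsub>C\<^esub> u = h \<and> pr 1 \<cdot>\<^bsub>C\<^esub> u = k" by (intro bexI[of _ u]) auto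
  next
    fix T x y assume x: "x \<in> hom C T P" and y: "y \<in> hom C T P" and e: "pr 0 \<cdot>\<^bsub>C\<^esub> x = pr 0 \<cdot>\<^bsub>C\<^esub> y" "pr 1 \<cdot>\<^bsub>C\<^esub> x = pr 1 \<cdot>\<^bsub>C\<^esub> y"
    have "\<forall>i\<in>{..<2}. pr i \<cdot>\<^bsub>C\<^esub> x \<in> hom C T (A i)" using Comp_in[OF x] pr A by (auto simp: two)
    from ex[OF homD(4)[OF x] this] show "x = y" using x y e two by (metis lessThan_iff)
  qed
qed

lemma pullback_is_product:
  assumes t: "terminal_object C t" and f: "f \<in> hom C a t" and pb: "is_pullback C f f p q"
  shows "is_product C {..<2::nat} (\<lambda>i. a) (Dom C p) (\<lambda>i. if i = 0 then p else q)"
proof -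
  note d = is_pullbackD[OF pb] and ff = homD[OF f]
  have pq: "p \<in> hom C (Dom C p) a" "q \<in> hom C (Dom C p) a" using d ff by (auto simp: hom_def)
  have u: "x = y" if "x \<in> hom C T t" "y \<in> hom C T t" for x y T
    using t that homD(4)[OF that(1)] unfolding terminal_object_def by blast
  have two: "i < 2 \<longleftrightarrow> i = 0 \<or> i = 1" for i :: nat by auto
  have "\<exists>!u. u \<in> hom C T (Dom C p) \<and> (\<forall>i\<in>{..<2}. (if i = 0 then p else q) \<cdot>\<^bsub>C\<^esub> u = h i)"
    if "T \<in> Obj C" "\<forall>i\<in>{..<2::nat}. h i \<in> hom C T a" for T h
  proof -
    have h: "h 0 \<in> hom C T a" "h 1 \<in> hom C T a" using that(2) by (auto simp: two)
    have "f \<cdot>\<^bsub>C\<^esub> h 0 = f \<cdot>\<^bsub>C\<^esub> h 1" using u Comp_in[OF h(1) f] Comp_in[OF h(2) f] by blast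
    then obtain w where w: "w \<in> hom C T (Dom C p)" "p \<cdot>\<^bsub>C\<^esub> w = h 0" "q \<cdot>\<^bsub>C\<^esub> w = h 1"
      using pullback_lift[OF pb] h ff by metis
    show ?thesis
    proof (rule ex1I[of _ w])
      show "w \<in> hom C T (Dom C p) \<and> (\<forall>i\<in>{..<2}. (if i = 0 then p else q) \<cdot>\<^bsub>C\<^esub> w = h i)" using w by (auto simp: two)
      fix v assume v: "v \<in> hom C T (Dom C p) \<and> (\<forall>i\<in>{..<2}. (if i = 0 then p else q) \<cdot>\<^bsub>C\<^esub> v = h i)"
      then have "p \<cdot>\<^bsub>C\<^esub> v = h 0" "q \<cdot>\<^bsub>C\<^esub> v = h 1"
        using bspec[OF conjunct2[OF v], of 0] bspec[OF conjunct2[OF v], of 1] by simp_all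
      then show "v = w" using pullback_eq[OF pb, of v T w] v w by simp
    qed
  qed
  then show ?thesis unfolding is_product_def using homD(4)[OF pq(1)] pq by auto
qed

lemma Gpd_terminalI:
  assumes T: "infinity_groupoid C S T" and t: "\<And>n. terminal_object C (FObj T n)"
  shows "terminal_object (Gpd C S) T"
  unfolding terminal_object_def
proof (intro conjI ballI)
  show "T \<in> Obj (Gpd C S)" using T Obj_Gpd by blast
  fix X assume "X \<in> Obj (Gpd C S)"
  then have X: "infinity_groupoid C S X" using Obj_Gpd by blast
  note XS = groupoid_sobj[OF X] and TS = groupoid_sobj[OF T]
  have u: "x = y" if "x \<in> hom C A (FObj T n)" "y \<in> hom C A (FObj T n)" for x y A n
    using t[of n] that homD(4)[OF that(1)] unfolding terminal_object_def by blast
  have "\<forall>n. \<exists>f. f \<in> hom C (FObj X n) (FObj T n)" using t sobj_Obj[OF XS] unfolding terminal_object_def by blast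
  then obtain f where f: "\<And>n. f n \<in> hom C (FObj X n) (FObj T n)" by metis
  have fs: "(X, T, f) \<in> Arr (simplicial_category C)"
  proof (rule smapI[OF XS TS f])
    show "f m \<cdot>\<^bsub>C\<^esub> FArr X \<theta> = FArr T \<theta> \<cdot>\<^bsub>C\<^esub> f n" if "\<theta> \<in> hom Delta m n" for \<theta> m n
      using u Comp_in[OF sobj_hom[OF XS that] f] Comp_in[OF f sobj_hom[OF TS that]] by blast
  qed
  show "\<exists>!f. f \<in> hom (Gpd C S) X T"
  proof (rule ex1I[of _ "(X, T, f)"])
    show "(X, T, f) \<in> hom (Gpd C S) X T" using fs X T by (simp add: hom_Gpd Arr_Gpd)
    fix g assume "g \<in> hom (Gpd C S) X T"
    then obtain g' where g: "g = (X, T, g')" "(X, T, g') \<in> Arr (simplicial_category C)" by (auto simp: hom_Gpd Arr_Gpd)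
    have "g' n = f n" for n using u smapD(3)[OF g(2)] f by blast
    then show "g = (X, T, f)" unfolding g(1) by auto
  qed
qed

end

context cover_category
begin

lemma Gpd_constant_terminal:
  assumes t: "terminal_object C t"
  shows "terminal_object (Gpd C S) (constant_sobj C t)"
  using Gpd_terminalI[OF constant_groupoid[OF t]] t by (simp add: terminal_object_def)

text \<open>A terminal groupoid is isomorphic to the constant one, and isomorphisms of groupoids are
  isomorphisms in each level.\<close>

lemma Gpd_terminal_levels:
  assumes t: "terminal_object C t" and T: "terminal_object (Gpd C S) T"
  shows "terminal_object C (FObj T n)"
proof -
  obtain \<phi> where p: "\<phi> \<in> hom (Gpd C S) (constant_sobj C t) T" "iso_arrow (Gpd C S) \<phi>"
    using category.terminal_iso[OF category_Gpd Gpd_constant_terminal[OF t] T] by blast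
  obtain i where i: "\<phi> = (constant_sobj C t, T, i)" "(constant_sobj C t, T, i) \<in> Arr (simplicial_category C)"
    using p(1) by (auto simp: hom_Gpd Arr_Gpd)
  have "i n \<in> hom C t (FObj T n)" using smapD(3)[OF i(2), of n] by simp
  then show ?thesis using terminal_iso_object[OF t] Gpd_iso_levels p(2) unfolding i(1) by blast
qed

text \<open>The boundary of the 0-simplex is empty, so the matching object in dimension 0 is Y_0 and
  the matching map is f_0.\<close>

lemma hypercover_level_0:
  assumes "hypercover C S (X, Y, f)" shows "f 0 \<in> S"
proof -
  have f: "(X, Y, f) \<in> Arr (simplicial_category C)" using assms by (simp add: hypercover_def)
  have "delta_image \<sigma> = {..0}" if "\<sigma> \<in> hom Delta m 0" for \<sigma> m
    using delta_image_subset[OF that] delta_image_nonempty[OF that] by auto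
  then have e: "image_in 0 {A. A \<noteq> {..0}} = (\<lambda>_. {})" unfolding image_in_def by blast
  have y: "FObj Y 0 \<in> Obj C" using sobj_Obj[OF smapD(2)[OF f]] .
  have M: "over_limit C X f (FObj Y 0) (\<lambda>m. FArr Y) (sub (std_simplex 0) (image_in 0 {A. A \<noteq> {..0}}))
      (FObj Y 0) undefined (Ident C (FObj Y 0))"
    unfolding e by (rule over_limit_empty[OF y])
  have "matching_map C X f 0 (sub (std_simplex 0) (image_in 0 {A. A \<noteq> {..0}})) (FObj Y 0) undefined (Ident C (FObj Y 0)) (f 0)"
    unfolding e matching_map_def using smapD(3)[OF f] Ident_left[OF smapD(3)[OF f]] by simp
  from matching_map_in_covers[OF f subcomplex_boundary M this]
  show ?thesis using assms unfolding hypercover_def boundary_image_in by blast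
qed

text \<open>If \<open>j\<close> is levelwise monic and every horn lifting problem against \<open>j \<circ> e\<close> already lives over the
  source of \<open>j\<close>, then \<open>e\<close> and \<open>j \<circ> e\<close> have the same relative matching objects.\<close>

lemma kan_fibration_monic_Comp:
  assumes e: "kan_fibration C S (A, B, e)" and j: "(B, B', j) \<in> Arr (simplicial_category C)"
    and mono: "\<And>n T x y. x \<in> hom C T (FObj B n) \<Longrightarrow> y \<in> hom C T (FObj B n) \<Longrightarrow> j n \<cdot>\<^bsub>C\<^esub> x = j n \<cdot>\<^bsub>C\<^esub> y \<Longrightarrow> x = y"
    and lift: "\<And>n k T \<rho> y. 1 \<le> n \<Longrightarrow> k \<le> n \<Longrightarrow> matching_cone C A (horn n k) T \<rho> \<Longrightarrow> y \<in> hom C T (FObj B' n) \<Longrightarrow>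
      (\<And>m \<sigma>. \<sigma> \<in> simplices (horn n k) m \<Longrightarrow> (j m \<cdot>\<^bsub>C\<^esub> e m) \<cdot>\<^bsub>C\<^esub> \<rho> m \<sigma> = FArr B' \<sigma> \<cdot>\<^bsub>C\<^esub> y) \<Longrightarrow>
      \<exists>x\<in>hom C T (FObj B n). j n \<cdot>\<^bsub>C\<^esub> x = y"
  shows "kan_fibration C S (A, B', \<lambda>n. j n \<cdot>\<^bsub>C\<^esub> e n)"
proof -
  have es: "(A, B, e) \<in> Arr (simplicial_category C)" using e by (simp add: kan_fibration_def)
  note en = smapD(3)[OF es] and jn = smapD(3)[OF j] and As = smapD(1)[OF es] and Bs = smapD(2)[OF es] and Bs' = smapD(2)[OF j]
  note je = smap_Comp[OF es j]
  have "matching_map_cover C S (A, B', \<lambda>n. j n \<cdot>\<^bsub>C\<^esub> e n) n (horn n k)" if n: "1 \<le> n" "k \<le> n" for n k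
  proof -
    obtain M \<pi> q u where M: "over_limit C A e (FObj B n) (\<lambda>m. FArr B) (horn n k) M \<pi> q"
      and u: "matching_map C A e n (horn n k) M \<pi> q u" "u \<in> S"
      using e n unfolding kan_fibration_def matching_map_cover_iff by blast
    have hs: "\<sigma> \<in> hom Delta m n" if "\<sigma> \<in> simplices (horn n k) m" for m \<sigma> using that by (simp add: horn_def)
    note d = over_limitD[OF M]
    \<comment> \<open>As \<open>j\<close> is monic, a cone whose base leg factors through
      \<open>j\<close> satisfies the compatibility over \<open>B'\<close> exactly when it satisfies
      it over \<open>B\<close>.\<close>
    have cone: "over_cone C A e (FObj B n) (\<lambda>m. FArr B) (horn n k) T \<rho> x \<longleftrightarrow>
        over_cone C A (\<lambda>n. j n \<cdot>\<^bsub>C\<^esub> e n) (FObj B' n) (\<lambda>m. FArr B') (horn n k) T \<rho> (j n \<cdot>\<^bsub>C\<^esub> x)"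
      if x: "x \<in> hom C T (FObj B n)" for T \<rho> x
    proof -
      have "e m \<cdot>\<^bsub>C\<^esub> \<rho> m \<sigma> = FArr B \<sigma> \<cdot>\<^bsub>C\<^esub> x \<longleftrightarrow> (j m \<cdot>\<^bsub>C\<^esub> e m) \<cdot>\<^bsub>C\<^esub> \<rho> m \<sigma> = FArr B' \<sigma> \<cdot>\<^bsub>C\<^esub> (j n \<cdot>\<^bsub>C\<^esub> x)"
        if r: "\<rho> m \<sigma> \<in> hom C T (FObj A m)" and s: "\<sigma> \<in> simplices (horn n k) m" for m \<sigma>
      proof -
        note Bsh = sobj_hom[OF Bs hs[OF s]] and Bsh' = sobj_hom[OF Bs' hs[OF s]]
        have 1: "(j m \<cdot>\<^bsub>C\<^esub> e m) \<cdot>\<^bsub>C\<^esub> \<rho> m \<sigma> = j m \<cdot>\<^bsub>C\<^esub> (e m \<cdot>\<^bsub>C\<^esub> \<rho> m \<sigma>)" by (rule Comp_assoc[OF r en jn])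
        have 2: "FArr B' \<sigma> \<cdot>\<^bsub>C\<^esub> (j n \<cdot>\<^bsub>C\<^esub> x) = j m \<cdot>\<^bsub>C\<^esub> (FArr B \<sigma> \<cdot>\<^bsub>C\<^esub> x)"
          using Comp_assoc[OF x jn Bsh'] smapD(4)[OF j hs[OF s]] Comp_assoc[OF x Bsh jn] by simp
        show ?thesis unfolding 1 2 using mono[OF Comp_in[OF r en] Comp_in[OF x Bsh]] by auto
      qed
      then show ?thesis unfolding over_cone_def matching_cone_iff using x Comp_in[OF x jn] by (auto; blast)
    qed
    have "over_limit C A (\<lambda>n. j n \<cdot>\<^bsub>C\<^esub> e n) (FObj B' n) (\<lambda>m. FArr B') (horn n k) M \<pi> (j n \<cdot>\<^bsub>C\<^esub> q)"
    proof (rule over_limitI)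
      show "over_cone C A (\<lambda>n. j n \<cdot>\<^bsub>C\<^esub> e n) (FObj B' n) (\<lambda>m. FArr B') (horn n k) M \<pi> (j n \<cdot>\<^bsub>C\<^esub> q)"
        using cone[OF d(4)] M unfolding over_limit_def by blast
    next
      fix T \<rho> w assume c: "over_cone C A (\<lambda>n. j n \<cdot>\<^bsub>C\<^esub> e n) (FObj B' n) (\<lambda>m. FArr B') (horn n k) T \<rho> w"
      obtain x where x: "x \<in> hom C T (FObj B n)" "j n \<cdot>\<^bsub>C\<^esub> x = w"
        using lift[OF n, of T \<rho> w] c unfolding over_cone_def by blast
      then have "over_cone C A e (FObj B n) (\<lambda>m. FArr B) (horn n k) T \<rho> x" using cone[OF x(1)] c by simp
      then obtain v where v: "v \<in> hom C T M" "\<And>m \<sigma>. \<sigma> \<in> simplices (horn n k) m \<Longrightarrow> \<pi> m \<sigma> \<cdot>\<^bsub>C\<^esub> v = \<rho> m \<sigma>" "q \<cdot>\<^bsub>C\<^esub> v = x"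
        by (rule over_limit_lift[OF M]) blast
      have "(j n \<cdot>\<^bsub>C\<^esub> q) \<cdot>\<^bsub>C\<^esub> v = w" using Comp_assoc[OF v(1) d(4) jn] v(3) x(2) by simp
      then show "\<exists>u\<in>hom C T M. (\<forall>m. \<forall>\<sigma>\<in>simplices (horn n k) m. \<pi> m \<sigma> \<cdot>\<^bsub>C\<^esub> u = \<rho> m \<sigma>) \<and> (j n \<cdot>\<^bsub>C\<^esub> q) \<cdot>\<^bsub>C\<^esub> u = w"
        using v by blast
    next
      fix T a b assume a: "a \<in> hom C T M" and b: "b \<in> hom C T M"
        and eq: "\<And>m \<sigma>. \<sigma> \<in> simplices (horn n k) m \<Longrightarrow> \<pi> m \<sigma> \<cdot>\<^bsub>C\<^esub> a = \<pi> m \<sigma> \<cdot>\<^bsub>C\<^esub> b" "(j n \<cdot>\<^bsub>C\<^esub> q) \<cdot>\<^bsub>C\<^esub> a = (j n \<cdot>\<^bsub>C\<^esub> q) \<cdot>\<^bsub>C\<^esub> b"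
      show "a = b"
      proof (rule over_limit_eq[OF es _ M a b eq(1)])
        show "\<forall>m. \<forall>\<sigma>\<in>simplices (horn n k) m. FArr B \<sigma> \<in> hom C (FObj B n) (FObj B m)" using sobj_hom[OF Bs hs] by blast
        show "q \<cdot>\<^bsub>C\<^esub> a = q \<cdot>\<^bsub>C\<^esub> b"
          using mono[OF Comp_in[OF a d(4)] Comp_in[OF b d(4)]] eq(2) Comp_assoc[OF a d(4) jn] Comp_assoc[OF b d(4) jn] by simp
      qed
    qed
    moreover have "matching_map C A (\<lambda>n. j n \<cdot>\<^bsub>C\<^esub> e n) n (horn n k) M \<pi> (j n \<cdot>\<^bsub>C\<^esub> q) u"
    proof -
      have uh: "u \<in> hom C (FObj A n) M" using u(1) unfolding matching_map_def by blast
      show ?thesis using u(1) Comp_assoc[OF uh d(4) jn] unfolding matching_map_def by simp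
    qed
    ultimately show ?thesis unfolding matching_map_cover_iff using u(2) by blast
  qed
  then show ?thesis unfolding kan_fibration_def using je by blast
qed

text \<open>Boundary objects are carried along the levelwise inverse \<open>j\<close>: same object,
  projections composed with \<open>j\<close>. The result absorbs the isomorphism between two choices
  of path space when weak equivalences are reflected.\<close>

lemma hypercover_iso_Comp:
  assumes f: "hypercover C S (Y, Z, f)" and i: "(X, Y, i) \<in> Arr (simplicial_category C)" "\<And>n. iso_arrow C (i n)"
  shows "hypercover C S (X, Z, \<lambda>n. f n \<cdot>\<^bsub>C\<^esub> i n)"
proof -
  have fs: "(Y, Z, f) \<in> Arr (simplicial_category C)" using f by (simp add: hypercover_def)
  note fi = smap_Comp[OF i(1) fs]
  note fn = smapD(3)[OF fs] and i' = smapD(3)[OF i(1)] and X = smapD(1)[OF i(1)] and Y = smapD(2)[OF i(1)]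
  have "\<exists>j. j \<in> hom C (FObj Y n) (FObj X n) \<and> j \<cdot>\<^bsub>C\<^esub> i n = Ident C (FObj X n) \<and> i n \<cdot>\<^bsub>C\<^esub> j = Ident C (FObj Y n)" for n
    by (rule iso_arrow_inverse[OF i(2) i', of n]) blast
  then obtain j where j: "\<And>n. j n \<in> hom C (FObj Y n) (FObj X n)" "\<And>n. j n \<cdot>\<^bsub>C\<^esub> i n = Ident C (FObj X n)"
    "\<And>n. i n \<cdot>\<^bsub>C\<^esub> j n = Ident C (FObj Y n)"
    by metis
  have ij: "i m \<cdot>\<^bsub>C\<^esub> (j m \<cdot>\<^bsub>C\<^esub> x) = x" if "x \<in> hom C T (FObj Y m)" for x T m
    using Comp_assoc[OF that j(1) i'] j(3) Ident_left[OF that] by simp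
  have ji: "j m \<cdot>\<^bsub>C\<^esub> (i m \<cdot>\<^bsub>C\<^esub> x) = x" if "x \<in> hom C T (FObj X m)" for x T m
    using Comp_assoc[OF that i' j(1)] j(2) Ident_left[OF that] by simp
  have jnat: "j m \<cdot>\<^bsub>C\<^esub> FArr Y \<theta> = FArr X \<theta> \<cdot>\<^bsub>C\<^esub> j n" if t: "\<theta> \<in> hom Delta m n" for \<theta> m n
  proof -
    note Xt = sobj_hom[OF X t] and Yt = sobj_hom[OF Y t]
    have "FArr Y \<theta> = i m \<cdot>\<^bsub>C\<^esub> (FArr X \<theta> \<cdot>\<^bsub>C\<^esub> j n)"
      using Comp_assoc[OF j(1) Xt i'] smapD(4)[OF i(1) t] Comp_assoc[OF j(1) i' Yt] j(3) Ident_right[OF Yt] by simp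
    then show ?thesis using ji[OF Comp_in[OF j(1) Xt]] by simp
  qed
  have "matching_map_cover C S (X, Z, \<lambda>n. f n \<cdot>\<^bsub>C\<^esub> i n) n (boundary n)" for n
  proof -
    obtain M \<pi> q u where M: "over_limit C Y f (FObj Z n) (\<lambda>m. FArr Z) (boundary n) M \<pi> q"
      and u: "matching_map C Y f n (boundary n) M \<pi> q u" "u \<in> S"
      using f unfolding hypercover_def matching_map_cover_iff by blast
    have cl: "sact (boundary n) \<theta> \<sigma> \<in> simplices (boundary n) k" if "\<theta> \<in> hom Delta k m" "\<sigma> \<in> simplices (boundary n) m" for \<theta> \<sigma> k m
      unfolding boundary_image_in by (rule subcomplex_closed[OF subcomplex_boundary that(1)]) (use that(2) in \<open>simp add: boundary_image_in\<close>)
    have hs: "\<sigma> \<in> hom Delta m n" if "\<sigma> \<in> simplices (boundary n) m" for m \<sigma> using that by (simp add: boundary_def)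
    note d = over_limitD[OF M]
    let ?p = "\<lambda>m \<sigma>. j m \<cdot>\<^bsub>C\<^esub> \<pi> m \<sigma>"
    have "over_limit C X (\<lambda>n. f n \<cdot>\<^bsub>C\<^esub> i n) (FObj Z n) (\<lambda>m. FArr Z) (boundary n) M ?p q"
    proof (rule over_limitI)
      show "over_cone C X (\<lambda>n. f n \<cdot>\<^bsub>C\<^esub> i n) (FObj Z n) (\<lambda>m. FArr Z) (boundary n) M ?p q"
        unfolding over_cone_def matching_cone_iff
      proof (intro conjI allI ballI)
        show "j m \<cdot>\<^bsub>C\<^esub> \<pi> m \<sigma> \<in> hom C M (FObj X m)" if "\<sigma> \<in> simplices (boundary n) m" for m \<sigma>
          using Comp_in[OF d(2)[OF that] j(1)] .
        show "FArr X \<theta> \<cdot>\<^bsub>C\<^esub> (j m \<cdot>\<^bsub>C\<^esub> \<pi> m \<sigma>) = j k \<cdot>\<^bsub>C\<^esub> \<pi> k (sact (boundary n) \<theta> \<sigma>)"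
          if t: "\<theta> \<in> hom Delta k m" and s: "\<sigma> \<in> simplices (boundary n) m" for k m \<theta> \<sigma>
          using Comp_assoc[OF d(2)[OF s] j(1) sobj_hom[OF X t]] jnat[OF t]
            Comp_assoc[OF d(2)[OF s] sobj_hom[OF Y t] j(1)] d(3)[OF t s] by simp
        show "(f m \<cdot>\<^bsub>C\<^esub> i m) \<cdot>\<^bsub>C\<^esub> (j m \<cdot>\<^bsub>C\<^esub> \<pi> m \<sigma>) = FArr Z \<sigma> \<cdot>\<^bsub>C\<^esub> q" if s: "\<sigma> \<in> simplices (boundary n) m" for m \<sigma>
          using Comp_assoc[OF Comp_in[OF d(2)[OF s] j(1)] i' fn] ij[OF d(2)[OF s]] d(5)[OF s] by simp
      qed (fact d(1) d(4))+
    next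
      fix T \<rho> w assume c: "over_cone C X (\<lambda>n. f n \<cdot>\<^bsub>C\<^esub> i n) (FObj Z n) (\<lambda>m. FArr Z) (boundary n) T \<rho> w"
      have r: "\<rho> m \<sigma> \<in> hom C T (FObj X m)" "(f m \<cdot>\<^bsub>C\<^esub> i m) \<cdot>\<^bsub>C\<^esub> \<rho> m \<sigma> = FArr Z \<sigma> \<cdot>\<^bsub>C\<^esub> w"
        "\<theta> \<in> hom Delta k m \<Longrightarrow> FArr X \<theta> \<cdot>\<^bsub>C\<^esub> \<rho> m \<sigma> = \<rho> k (sact (boundary n) \<theta> \<sigma>)"
        if "\<sigma> \<in> simplices (boundary n) m" for k m \<sigma> \<theta>
        using c that unfolding over_cone_def matching_cone_iff by blast+
      have T: "T \<in> Obj C" "w \<in> hom C T (FObj Z n)" using c unfolding over_cone_def matching_cone_iff by blast+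
      have "over_cone C Y f (FObj Z n) (\<lambda>m. FArr Z) (boundary n) T (\<lambda>m \<sigma>. i m \<cdot>\<^bsub>C\<^esub> \<rho> m \<sigma>) w"
        unfolding over_cone_def matching_cone_iff
      proof (intro conjI allI ballI)
        show "i m \<cdot>\<^bsub>C\<^esub> \<rho> m \<sigma> \<in> hom C T (FObj Y m)" if "\<sigma> \<in> simplices (boundary n) m" for m \<sigma>
          using Comp_in[OF r(1)[OF that] i'] .
        show "FArr Y \<theta> \<cdot>\<^bsub>C\<^esub> (i m \<cdot>\<^bsub>C\<^esub> \<rho> m \<sigma>) = i k \<cdot>\<^bsub>C\<^esub> \<rho> k (sact (boundary n) \<theta> \<sigma>)"
          if t: "\<theta> \<in> hom Delta k m" and s: "\<sigma> \<in> simplices (boundary n) m" for k m \<theta> \<sigma>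
          using Comp_assoc[OF r(1)[OF s] i' sobj_hom[OF Y t]] smapD(4)[OF i(1) t]
            Comp_assoc[OF r(1)[OF s] sobj_hom[OF X t] i'] r(3)[OF s t] by simp
        show "f m \<cdot>\<^bsub>C\<^esub> (i m \<cdot>\<^bsub>C\<^esub> \<rho> m \<sigma>) = FArr Z \<sigma> \<cdot>\<^bsub>C\<^esub> w" if s: "\<sigma> \<in> simplices (boundary n) m" for m \<sigma>
          using Comp_assoc[OF r(1)[OF s] i' fn] r(2)[OF s] by simp
      qed (fact T)+
      then obtain v where v: "v \<in> hom C T M" "\<And>m \<sigma>. \<sigma> \<in> simplices (boundary n) m \<Longrightarrow> \<pi> m \<sigma> \<cdot>\<^bsub>C\<^esub> v = i m \<cdot>\<^bsub>C\<^esub> \<rho> m \<sigma>" "q \<cdot>\<^bsub>C\<^esub> v = w"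
        by (rule over_limit_lift[OF M]) blast
      have "?p m \<sigma> \<cdot>\<^bsub>C\<^esub> v = \<rho> m \<sigma>" if s: "\<sigma> \<in> simplices (boundary n) m" for m \<sigma>
        using Comp_assoc[OF v(1) d(2)[OF s] j(1)] v(2)[OF s] ji[OF r(1)[OF s]] by simp
      then show "\<exists>u\<in>hom C T M. (\<forall>m. \<forall>\<sigma>\<in>simplices (boundary n) m. ?p m \<sigma> \<cdot>\<^bsub>C\<^esub> u = \<rho> m \<sigma>) \<and> q \<cdot>\<^bsub>C\<^esub> u = w" using v by blast
    next
      fix T a b assume a: "a \<in> hom C T M" and b: "b \<in> hom C T M"
        and e: "\<And>m \<sigma>. \<sigma> \<in> simplices (boundary n) m \<Longrightarrow> ?p m \<sigma> \<cdot>\<^bsub>C\<^esub> a = ?p m \<sigma> \<cdot>\<^bsub>C\<^esub> b" "q \<cdot>\<^bsub>C\<^esub> a = q \<cdot>\<^bsub>C\<^esub> b"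
      show "a = b"
      proof (rule over_limit_eq[OF fs _ M a b _ e(2)])
        show "\<forall>m. \<forall>\<sigma>\<in>simplices (boundary n) m. FArr Z \<sigma> \<in> hom C (FObj Z n) (FObj Z m)"
          using sobj_hom[OF smapD(2)[OF fs] hs] by blast
        show "\<pi> m \<sigma> \<cdot>\<^bsub>C\<^esub> a = \<pi> m \<sigma> \<cdot>\<^bsub>C\<^esub> b" if s: "\<sigma> \<in> simplices (boundary n) m" for m \<sigma>
          using ij[OF Comp_in[OF a d(2)[OF s]]] ij[OF Comp_in[OF b d(2)[OF s]]] e(1)[OF s]
            Comp_assoc[OF a d(2)[OF s] j(1)] Comp_assoc[OF b d(2)[OF s] j(1)] by metis
      qed
    qed
    moreover have "matching_map C X (\<lambda>n. f n \<cdot>\<^bsub>C\<^esub> i n) n (boundary n) M ?p q (u \<cdot>\<^bsub>C\<^esub> i n)"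
      unfolding matching_map_def
    proof (intro conjI allI ballI)
      have u': "u \<in> hom C (FObj Y n) M" "q \<cdot>\<^bsub>C\<^esub> u = f n" "\<And>m \<sigma>. \<sigma> \<in> simplices (boundary n) m \<Longrightarrow> \<pi> m \<sigma> \<cdot>\<^bsub>C\<^esub> u = FArr Y \<sigma>"
        using u(1) unfolding matching_map_def by blast+
      show "u \<cdot>\<^bsub>C\<^esub> i n \<in> hom C (FObj X n) M" using Comp_in[OF i' u'(1)] .
      show "q \<cdot>\<^bsub>C\<^esub> (u \<cdot>\<^bsub>C\<^esub> i n) = f n \<cdot>\<^bsub>C\<^esub> i n" using Comp_assoc[OF i' u'(1) d(4)] u'(2) by simp
      fix m \<sigma> assume s: "\<sigma> \<in> simplices (boundary n) m"
      have "(j m \<cdot>\<^bsub>C\<^esub> \<pi> m \<sigma>) \<cdot>\<^bsub>C\<^esub> (u \<cdot>\<^bsub>C\<^esub> i n) = j m \<cdot>\<^bsub>C\<^esub> (FArr Y \<sigma> \<cdot>\<^bsub>C\<^esub> i n)"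
        using Comp_assoc[OF Comp_in[OF i' u'(1)] d(2)[OF s] j(1)] Comp_assoc[OF i' u'(1) d(2)[OF s]] u'(3)[OF s] by simp
      also have "\<dots> = FArr X \<sigma>"
        using smapD(4)[OF i(1) hs[OF s]] ji[OF sobj_hom[OF X hs[OF s]]] by simp
      finally show "(j m \<cdot>\<^bsub>C\<^esub> \<pi> m \<sigma>) \<cdot>\<^bsub>C\<^esub> (u \<cdot>\<^bsub>C\<^esub> i n) = FArr X \<sigma>" .
    qed
    moreover have "u \<cdot>\<^bsub>C\<^esub> i n \<in> S"
      using cover_Comp[OF iso_cover[OF i(2)] u(2)] homD[OF i'[of n]] u(1) unfolding matching_map_def by (auto simp: hom_def)
    ultimately show ?thesis unfolding matching_map_cover_iff by blast
  qed
  then show ?thesis unfolding hypercover_def using fi by blast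
qed

end

context category
begin

text \<open>Moves an isomorphism from a leg of the cospan into the projection, as needed when one
  path space is exchanged for another.\<close>

lemma pullback_iso_leg:
  assumes pb: "is_pullback C f (g \<cdot>\<^bsub>C\<^esub> i) p q" and i: "i \<in> hom C a b" "iso_arrow C i" and g: "g \<in> hom C b c"
  shows "is_pullback C f g p (i \<cdot>\<^bsub>C\<^esub> q)"
proof -
  note d = is_pullbackD[OF pb] and ii = homD[OF i(1)] and gg = homD[OF g]
  obtain j where j: "j \<in> hom C b a" "j \<cdot>\<^bsub>C\<^esub> i = Ident C a" "i \<cdot>\<^bsub>C\<^esub> j = Ident C b"
    using iso_arrow_inverse[OF i(2,1)] by blast
  have gi: "Dom C (g \<cdot>\<^bsub>C\<^esub> i) = a" "Cod C (g \<cdot>\<^bsub>C\<^esub> i) = c" using ii gg by simp_all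
  have f: "f \<in> hom C (Dom C f) c" and p: "p \<in> hom C (Dom C p) (Dom C f)" and q: "q \<in> hom C (Dom C p) a"
    using d gi by (auto simp: hom_def)
  show ?thesis
  proof (rule is_pullbackI[OF f g p Comp_in[OF q i(1)]])
    show "f \<cdot>\<^bsub>C\<^esub> p = g \<cdot>\<^bsub>C\<^esub> (i \<cdot>\<^bsub>C\<^esub> q)" using d(9) Comp_assoc[OF q i(1) g] by simp
  next
    fix T h k assume h: "h \<in> hom C T (Dom C f)" and k: "k \<in> hom C T b" and e: "f \<cdot>\<^bsub>C\<^esub> h = g \<cdot>\<^bsub>C\<^esub> k"
    note jk = Comp_in[OF k j(1)]
    have ijk: "i \<cdot>\<^bsub>C\<^esub> (j \<cdot>\<^bsub>C\<^esub> k) = k" using Comp_assoc[OF k j(1) i(1)] j(3) Ident_left[OF k] by simp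
    have "f \<cdot>\<^bsub>C\<^esub> h = (g \<cdot>\<^bsub>C\<^esub> i) \<cdot>\<^bsub>C\<^esub> (j \<cdot>\<^bsub>C\<^esub> k)" using Comp_assoc[OF jk i(1) g] ijk e by simp
    then obtain u where u: "u \<in> hom C T (Dom C p)" "p \<cdot>\<^bsub>C\<^esub> u = h" "q \<cdot>\<^bsub>C\<^esub> u = j \<cdot>\<^bsub>C\<^esub> k"
      using pullback_lift[OF pb h, of "j \<cdot>\<^bsub>C\<^esub> k"] jk gi by metis
    have "(i \<cdot>\<^bsub>C\<^esub> q) \<cdot>\<^bsub>C\<^esub> u = k" using Comp_assoc[OF u(1) q i(1)] u(3) ijk by simp
    then show "\<exists>u\<in>hom C T (Dom C p). p \<cdot>\<^bsub>C\<^esub> u = h \<and> (i \<cdot>\<^bsub>C\<^esub> q) \<cdot>\<^bsub>C\<^esub> u = k" using u by blast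
  next
    fix T u v assume u: "u \<in> hom C T (Dom C p)" and v: "v \<in> hom C T (Dom C p)"
      and e: "p \<cdot>\<^bsub>C\<^esub> u = p \<cdot>\<^bsub>C\<^esub> v" "(i \<cdot>\<^bsub>C\<^esub> q) \<cdot>\<^bsub>C\<^esub> u = (i \<cdot>\<^bsub>C\<^esub> q) \<cdot>\<^bsub>C\<^esub> v"
    have "q \<cdot>\<^bsub>C\<^esub> x = j \<cdot>\<^bsub>C\<^esub> ((i \<cdot>\<^bsub>C\<^esub> q) \<cdot>\<^bsub>C\<^esub> x)" if "x \<in> hom C T (Dom C p)" for x
      using Comp_assoc[OF that q i(1)] Comp_assoc[OF Comp_in[OF that q] i(1) j(1)] j(2) Ident_left[OF Comp_in[OF that q]] by simp
    then have "q \<cdot>\<^bsub>C\<^esub> u = q \<cdot>\<^bsub>C\<^esub> v" using u v e(2) by simp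
    then show "u = v" using pullback_eq[OF pb u v e(1)] by blast
  qed
qed

lemma Gpd_square:
  assumes "is_pullback (Gpd C S) f g p q"
  obtains X Y W Z f' g' p' q' where "f = (X, Y, f')" "g = (W, Y, g')" "p = (Z, X, p')" "q = (Z, W, q')"
proof -
  note d = category.is_pullbackD[OF category_Gpd assms]
  obtain X Y f' W Y' g' Z X' p' Z' W' q' where e: "f = (X, Y, f')" "g = (W, Y', g')" "p = (Z, X', p')" "q = (Z', W', q')"
    by (metis prod_cases3)
  show ?thesis using that[OF e(1)] d(3,6,7,8) unfolding e by simp
qed

end

text \<open>For the path object provided by the structure, d^0 is a fibration followed by a product
  projection, itself a base change of X \<rightarrow> *. It is a weak equivalence by 2-out-of-3,
  since d^0 \<circ> s is the identity. Any other canonical path is isomorphic to this one over the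
  end points.\<close>

lemma (in cover_category) canonical_path_hypercover:
  assumes adm: "admits_canonical_iCFO C S" and t: "terminal_object C t" and P: "canonical_path C S X P s d"
  shows "d 0 \<in> hypercovers C S"
proof -
  let ?G = "Gpd C S" and ?W = "weak_equivalences C S" and ?F = "kan_fibrations C S"
  interpret E: iCFO ?G ?W ?F using adm by (simp add: admits_canonical_iCFO_def)
  have WF: "?W \<inter> ?F = hypercovers C S" using adm by (simp add: admits_canonical_iCFO_def)
  have Fc: "g \<cdot>\<^bsub>?G\<^esub> f \<in> ?F" if "f \<in> ?F" "g \<in> ?F" "Cod ?G f = Dom ?G g" for f g
    using E.fibrations_wide that unfolding wide_subcategory_def subcategory_def by blast
  have Wc: "g \<cdot>\<^bsub>?G\<^esub> f \<in> ?W" if "f \<in> ?W" "g \<in> ?W" "Cod ?G f = Dom ?G g" for f g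
    using E.weak_equivalences_wide that unfolding wide_subcategory_def subcategory_def by blast
  have X: "X \<in> Obj ?G" using P E.homD(4) unfolding canonical_path_def by blast
  obtain P' s' d' where P': "canonical_path C S X P' s' d'" "path_object ?G ?W ?F X P' s' d'"
    using adm X unfolding admits_canonical_iCFO_def by blast
  obtain Q pr dd diag where s': "s' \<in> hom ?G X P'" "s' \<in> ?W" and pr: "is_product ?G {..<2::nat} (\<lambda>i. X) Q pr"
    and diag: "diag \<in> hom ?G X Q" "\<forall>i<2. pr i \<cdot>\<^bsub>?G\<^esub> diag = Ident ?G X"
    and dd: "dd \<in> hom ?G P' Q" "\<forall>i<2. pr i \<cdot>\<^bsub>?G\<^esub> dd = d' i" "dd \<cdot>\<^bsub>?G\<^esub> s' = diag" "dd \<in> ?F"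
    using P'(2) unfolding path_object_def by blast
  note T = Gpd_constant_terminal[OF t]
  obtain x where x: "x \<in> hom ?G X (constant_sobj C t)" using T X unfolding terminal_object_def by blast
  have "x \<in> ?F" using E.to_terminal_fibration[OF T] E.homD[OF x] by blast
  then have pr0F: "pr 0 \<in> ?F"
    using E.fibration_base_change[OF _ E.pullback_swap[OF E.is_product_pullback[OF T x x pr]]] by simp
  have pr0: "pr 0 \<in> hom ?G Q X" using pr unfolding is_product_def by auto
  have d0: "d' 0 = pr 0 \<cdot>\<^bsub>?G\<^esub> dd" using dd(2) by simp
  have d0h: "d' 0 \<in> hom ?G P' X" unfolding d0 using E.Comp_in[OF dd(1) pr0] .
  have "d' 0 \<in> ?F" unfolding d0 by (rule Fc[OF dd(4) pr0F]) (use E.homD[OF dd(1)] E.homD[OF pr0] in simp)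
  have "d' 0 \<cdot>\<^bsub>?G\<^esub> s' = Ident ?G X"
    unfolding d0 using E.Comp_assoc[OF s'(1) dd(1) pr0] dd(3) diag(2) by (metis zero_less_numeral)
  also have "\<dots> \<in> ?W" using E.weak_equivalences_wide X unfolding wide_subcategory_def by blast
  finally have "d' 0 \<in> ?W" using E.two_of_three_left[OF s'(1) d0h s'(2)] by blast
  obtain \<phi> where p: "\<phi> \<in> hom ?G P P'" "iso_arrow ?G \<phi>" "\<And>i. i < 2 \<Longrightarrow> d' i \<cdot>\<^bsub>?G\<^esub> \<phi> = d i"
    using canonical_path_unique[OF P'(1) P] by blast
  note pWF = E.iso_acyclic_fibration[OF p(2)]
  have c: "Cod ?G \<phi> = Dom ?G (d' 0)" using E.homD[OF p(1)] E.homD[OF d0h] by simp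
  have "d 0 = d' 0 \<cdot>\<^bsub>?G\<^esub> \<phi>" using p(3)[of 0] by simp
  then have "d 0 \<in> ?W \<inter> ?F" using Wc[OF _ \<open>d' 0 \<in> ?W\<close> c] Fc[OF _ \<open>d' 0 \<in> ?F\<close> c] pWF by simp
  then show ?thesis unfolding WF .
qed

lemma (in cover_category) hypercovers_covering:
  assumes adm: "admits_canonical_iCFO C S" shows "hypercovers C S \<subseteq> covering_fibrations C S"
proof
  fix h assume h: "h \<in> hypercovers C S"
  obtain X Y f where e: "h = (X, Y, f)" by (cases h)
  have "h \<in> kan_fibrations C S" using adm h unfolding admits_canonical_iCFO_def by blast
  then show "h \<in> covering_fibrations C S"
    using hypercover_level_0[of X Y f] h unfolding covering_fibrations_def hypercovers_def e by simp
qed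

section \<open>Preservation and reflection of fibrations and weak equivalences\<close>

context geometric_pair
begin

lemma levelwise_kan_fibrations:
  assumes t: "terminal_object D t" and f: "f \<in> kan_fibrations C SC"
  shows "FArr (levelwise F) f \<in> kan_fibrations D SD"
proof -
  obtain X Y f' where e: "f = (X, Y, f')" by (cases f)
  show ?thesis
    using f levelwise_Gpd_Arr[OF t] levelwise_kan_fibration
    unfolding kan_fibrations_def e levelwise_simps by (auto simp: C.Arr_Gpd)
qed

lemma levelwise_hypercovers:
  assumes t: "terminal_object D t" and f: "f \<in> hypercovers C SC"
  shows "FArr (levelwise F) f \<in> hypercovers D SD"
proof -
  obtain X Y f' where e: "f = (X, Y, f')" by (cases f)
  show ?thesis
    using f levelwise_Gpd_Arr[OF t] levelwise_hypercover
    unfolding hypercovers_def e levelwise_simps by auto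
qed

text \<open>Preservation in level 0 is left as a premise with two ways to discharge it: f_0 is a
  cover, or \<open>F\<close> preserves finite limits.\<close>

lemma levelwise_pullback:
  assumes t: "terminal_object D t" and f: "f \<in> kan_fibrations C SC"
    and pb: "is_pullback (Gpd C SC) f g p q"
    and pb0: "is_pullback C (snd (snd f) 0) (snd (snd g) 0) (snd (snd p) 0) (snd (snd q) 0) \<Longrightarrow>
      is_pullback D (FArr F (snd (snd f) 0)) (FArr F (snd (snd g) 0)) (FArr F (snd (snd p) 0)) (FArr F (snd (snd q) 0))"
  shows "is_pullback (Gpd D SD) (FArr (levelwise F) f) (FArr (levelwise F) g) (FArr (levelwise F) p) (FArr (levelwise F) q)"
proof -
  obtain X Y W Z f' g' p' q' where e: "f = (X, Y, f')" "g = (W, Y, g')" "p = (Z, X, p')" "q = (Z, W, q')"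
    using C.Gpd_square[OF pb] by metis
  note pb' = pb[unfolded e]
  have k: "kan_fibration C SC (X, Y, f')" using f unfolding kan_fibrations_def e by simp
  have "is_pullback D (FArr F (f' 0)) (FArr F (g' 0)) (FArr F (p' 0)) (FArr F (q' 0))"
    using pb0 C.Gpd_pullback_0[OF pb'] unfolding e by simp
  from Gpd_pullback_preserved(3)[OF t k pb' this] show ?thesis unfolding e levelwise_simps .
qed

lemma levelwise_covering_pullback:
  assumes t: "terminal_object D t" and f: "f \<in> covering_fibrations C SC"
    and pb: "is_pullback (Gpd C SC) f g p q"
  shows "is_pullback (Gpd D SD) (FArr (levelwise F) f) (FArr (levelwise F) g) (FArr (levelwise F) p) (FArr (levelwise F) q)"
proof (rule levelwise_pullback[OF t _ pb])
  show "f \<in> kan_fibrations C SC" using f unfolding covering_fibrations_def by auto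
  have "snd (snd f) 0 \<in> SC" using f unfolding covering_fibrations_def by auto
  then show "is_pullback C (snd (snd f) 0) (snd (snd g) 0) (snd (snd p) 0) (snd (snd q) 0) \<Longrightarrow>
      is_pullback D (FArr F (snd (snd f) 0)) (FArr F (snd (snd g) 0)) (FArr F (snd (snd p) 0)) (FArr F (snd (snd q) 0))"
    by (rule preserves_cover_pullbacks)
qed

text \<open>The pullback that defines a weak equivalence is taken along d^0, a hypercover and hence
  a covering fibration. So it is preserved by \<open>F\<close> whatever the map \<open>f\<close>
  is.\<close>

lemma levelwise_weak_equivalence:
  assumes tC: "terminal_object C tC" and t: "terminal_object D t" and adm: "admits_canonical_iCFO C SC"
    and tc: "\<forall>t g. terminal_object C t \<longrightarrow> g \<in> Arr C \<longrightarrow> Cod C g = t \<longrightarrow> g \<in> SC"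
    and f: "f \<in> weak_equivalences C SC"
  shows "FArr (levelwise F) f \<in> weak_equivalences D SD"
proof -
  interpret L: cat_functor "Gpd C SC" "Gpd D SD" "levelwise F" by (rule levelwise_functor[OF t])
  let ?L = "FArr (levelwise F)"
  obtain P s d p q where P: "canonical_path C SC (Cod (Gpd C SC) f) P s d"
    and pb: "is_pullback (Gpd C SC) f (d 0) p q" and h: "d 1 \<cdot>\<^bsub>Gpd C SC\<^esub> q \<in> hypercovers C SC"
    using f unfolding weak_equivalences_def by blast
  have fA: "f \<in> Arr (Gpd C SC)" using f unfolding weak_equivalences_def by blast
  have "d 0 \<in> covering_fibrations C SC"
    using C.canonical_path_hypercover[OF adm tC P] C.hypercovers_covering[OF adm] by blast
  from L.cod.pullback_swap[OF levelwise_covering_pullback[OF t this L.dom.pullback_swap[OF pb]]]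
  have pb': "is_pullback (Gpd D SD) (?L f) (?L (d 0)) (?L p) (?L q)" .
  have d: "d i \<in> hom (Gpd C SC) P (Cod (Gpd C SC) f)" if "i < 2" for i using P that unfolding canonical_path_def by blast
  have "q \<in> hom (Gpd C SC) (Dom (Gpd C SC) q) P"
    using L.dom.is_pullbackD[OF pb] L.dom.homD[OF d[of 0]] by (auto simp: hom_def)
  from L.FArr_Comp[OF this d[of 1]] have "?L (d 1) \<cdot>\<^bsub>Gpd D SD\<^esub> ?L q = ?L (d 1 \<cdot>\<^bsub>Gpd C SC\<^esub> q)" by simp
  then have "?L (d 1) \<cdot>\<^bsub>Gpd D SD\<^esub> ?L q \<in> hypercovers D SD" using levelwise_hypercovers[OF t h] by simp
  moreover have "canonical_path D SD (Cod (Gpd D SD) (?L f)) (LX P) (?L s) (\<lambda>i. ?L (d i))"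
    using levelwise_canonical_path[OF t tc P] L.FArr_simps[OF fA] by simp
  ultimately show ?thesis
    unfolding weak_equivalences_def using L.FArr_simps(1)[OF fA] pb'
    by (intro CollectI conjI exI[of _ "LX P"] exI[of _ "?L s"] exI[of _ "\<lambda>i. ?L (d i)"] exI[of _ "?L p"] exI[of _ "?L q"])
qed

text \<open>In \<open>C\<close> the pullback along d^0 exists because d^0 is an acyclic fibration,
  and its image is a pullback in \<open>D\<close>. It remains to compare with the data that make the
  image of \<open>f\<close> a weak equivalence, and to reflect the resulting hypercover.\<close>

lemma weak_equivalence_reflected:
  assumes tC: "terminal_object C tC" and t: "terminal_object D t" and adm: "admits_canonical_iCFO C SC"
    and tc: "\<forall>t g. terminal_object C t \<longrightarrow> g \<in> Arr C \<longrightarrow> Cod C g = t \<longrightarrow> g \<in> SC"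
    and R: "reflects_covers C SC SD F" and f: "f \<in> Arr (Gpd C SC)"
    and w: "FArr (levelwise F) f \<in> weak_equivalences D SD"
  shows "f \<in> weak_equivalences C SC"
proof -
  interpret L: cat_functor "Gpd C SC" "Gpd D SD" "levelwise F" by (rule levelwise_functor[OF t])
  interpret E: iCFO "Gpd C SC" "weak_equivalences C SC" "kan_fibrations C SC"
    using adm by (simp add: admits_canonical_iCFO_def)
  let ?L = "FArr (levelwise F)" and ?G = "Gpd C SC" and ?H = "Gpd D SD"
  have Y: "Cod ?G f \<in> Obj ?G" using L.dom.Cod_in[OF f] .
  obtain P s d where P: "canonical_path C SC (Cod ?G f) P s d"
    using adm Y unfolding admits_canonical_iCFO_def by blast
  note d0 = C.canonical_path_hypercover[OF adm tC P]
  have d: "d i \<in> hom ?G P (Cod ?G f)" if "i < 2" for i using P that unfolding canonical_path_def by blast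
  have "d 0 \<in> weak_equivalences C SC \<inter> kan_fibrations C SC" using d0 adm unfolding admits_canonical_iCFO_def by blast
  moreover have "Cod ?G (d 0) = Cod ?G f" using L.dom.homD[OF d[of 0]] by simp
  ultimately obtain q p where "is_pullback ?G (d 0) f q p" using E.acyclic_pullback_exists f by blast
  then have pb: "is_pullback ?G f (d 0) p q" using L.dom.pullback_swap by blast
  have "d 0 \<in> covering_fibrations C SC" using d0 C.hypercovers_covering[OF adm] by blast
  from L.cod.pullback_swap[OF levelwise_covering_pullback[OF t this L.dom.pullback_swap[OF pb]]]
  have Lpb: "is_pullback ?H (?L f) (?L (d 0)) (?L p) (?L q)" .
  note LP = levelwise_canonical_path[OF t tc P]
  have cod: "Cod ?H (?L f) = LX (Cod ?G f)" using L.FArr_simps[OF f] by simp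
  \<comment> \<open>The witness in \<open>D\<close> may use another path space and another pullback;
    the comparison isomorphisms \<open>\<phi>\<close> and \<open>i\<close> account for both.\<close>
  obtain P' s' d' p' q' where P': "canonical_path D SD (LX (Cod ?G f)) P' s' d'"
    and pb': "is_pullback ?H (?L f) (d' 0) p' q'" and h: "d' 1 \<cdot>\<^bsub>?H\<^esub> q' \<in> hypercovers D SD"
    using w unfolding weak_equivalences_def mem_Collect_eq cod by blast
  have d': "d' i \<in> hom ?H P' (LX (Cod ?G f))" if "i < 2" for i using P' that unfolding canonical_path_def by blast
  obtain \<phi> where ph: "\<phi> \<in> hom ?H (LX P) P'" "iso_arrow ?H \<phi>" "\<And>i. i < 2 \<Longrightarrow> d' i \<cdot>\<^bsub>?H\<^esub> \<phi> = ?L (d i)"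
    using D.canonical_path_unique[OF P' LP] by blast
  have "is_pullback ?H (?L f) (d' 0 \<cdot>\<^bsub>?H\<^esub> \<phi>) (?L p) (?L q)" using Lpb ph(3)[of 0] by simp
  from L.cod.pullback_iso_leg[OF this ph(1,2) d'[of 0]]
  have pb2: "is_pullback ?H (?L f) (d' 0) (?L p) (\<phi> \<cdot>\<^bsub>?H\<^esub> ?L q)" by simp
  obtain i where i: "i \<in> hom ?H (Dom ?H (?L p)) (Dom ?H p')" "iso_arrow ?H i" "q' \<cdot>\<^bsub>?H\<^esub> i = \<phi> \<cdot>\<^bsub>?H\<^esub> ?L q"
    using L.cod.pullback_unique[OF pb' pb2] by metis
  have q: "q \<in> hom ?G (Dom ?G p) P"
    using L.dom.is_pullbackD[OF pb] L.dom.homD[OF d[of 0]] by (auto simp: hom_def)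
  have q': "q' \<in> hom ?H (Dom ?H p') P'"
    using L.cod.is_pullbackD[OF pb'] L.cod.homD[OF d'[of 0]] by (auto simp: hom_def)
  note dq = L.dom.Comp_in[OF q d[of 1]]
  have "?L (d 1 \<cdot>\<^bsub>?G\<^esub> q) = (d' 1 \<cdot>\<^bsub>?H\<^esub> \<phi>) \<cdot>\<^bsub>?H\<^esub> ?L q" using L.FArr_Comp[OF q d[of 1]] ph(3)[of 1] by simp
  also have "\<dots> = (d' 1 \<cdot>\<^bsub>?H\<^esub> q') \<cdot>\<^bsub>?H\<^esub> i"
    using L.cod.Comp_assoc[OF L.FArr_in[OF q] ph(1) d'[of 1]] L.cod.Comp_assoc[OF i(1) q' d'[of 1]] i(3) by simp
  finally have e: "?L (d 1 \<cdot>\<^bsub>?G\<^esub> q) = (d' 1 \<cdot>\<^bsub>?H\<^esub> q') \<cdot>\<^bsub>?H\<^esub> i" .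
  obtain Z Y dq' where Zd: "d 1 \<cdot>\<^bsub>?G\<^esub> q = (Z, Y, dq')" "(Z, Y, dq') \<in> Arr (simplicial_category C)"
    "(Z, Y, dq') \<in> Arr ?G"
    using dq by (auto simp: C.hom_Gpd C.Arr_Gpd)
  obtain A B i' where ie: "i = (A, B, i')" "(A, B, i') \<in> Arr (simplicial_category D)"
    using i(1) by (auto simp: D.hom_Gpd D.Arr_Gpd)
  obtain B' Y' k where ke: "d' 1 \<cdot>\<^bsub>?H\<^esub> q' = (B', Y', k)" by (cases "d' 1 \<cdot>\<^bsub>?H\<^esub> q'")
  have "Cod ?H i = Dom ?H (d' 1 \<cdot>\<^bsub>?H\<^esub> q')"
    using L.cod.homD[OF i(1)] L.cod.homD[OF L.cod.Comp_in[OF q' d'[of 1]]] by simp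
  then have B: "B' = B" unfolding ie(1) ke by simp
  have "hypercover D SD (B, Y', k)" using h unfolding ke B hypercovers_def by blast
  then have "hypercover D SD (A, Y', \<lambda>n. k n \<cdot>\<^bsub>D\<^esub> i' n)"
    using D.hypercover_iso_Comp[OF _ ie(2)] D.Gpd_iso_levels i(2) unfolding ie(1) by blast
  moreover have "(LX Z, LX Y, Ff dq') = (A, Y', \<lambda>n. k n \<cdot>\<^bsub>D\<^esub> i' n)"
    using e unfolding Zd(1) ke ie(1) by (simp add: levelwise_simps)
  ultimately have "hypercover C SC (Z, Y, dq')" using hypercover_reflected[OF R Zd(2)] by simp
  then have "d 1 \<cdot>\<^bsub>?G\<^esub> q \<in> hypercovers C SC" unfolding hypercovers_def Zd(1) using Zd(3) by blast
  then show ?thesis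
    unfolding weak_equivalences_def using f P pb
    by (intro CollectI conjI exI[of _ P] exI[of _ s] exI[of _ d] exI[of _ p] exI[of _ q])
qed

end

text \<open>With the identity functor the two-sided development yields statements about a single
  category, in particular about \<open>D\<close>.\<close>

lemma (in cover_category) identity_pair: "geometric_pair C S C S \<lparr>FObj = id, FArr = id\<rparr>"
  by unfold_locales simp_all

text \<open>The product of X with itself as a levelwise pullback over a constant terminal object.
  Finite limits supply the square in level 0, from which all other levels follow.\<close>

lemma (in cover_category) groupoid_square:
  assumes X: "infinity_groupoid C S X" and fl: "has_finite_limits C"
  obtains t x V P Q where "terminal_object C t" "(X, constant_sobj C t, x) \<in> Arr (simplicial_category C)"
    "infinity_groupoid C S V" "(V, X, P) \<in> Arr (simplicial_category C)" "(V, X, Q) \<in> Arr (simplicial_category C)"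
    "\<And>n. is_pullback C (x n) (x n) (P n) (Q n)"
proof -
  interpret I: geometric_pair C S C S "\<lparr>FObj = id, FArr = id\<rparr>" by (rule identity_pair)
  obtain t x where t: "terminal_object C t" and x: "(X, constant_sobj C t, x) \<in> Arr (simplicial_category C)"
    and horns: "\<forall>n k. 1 \<le> n \<longrightarrow> k \<le> n \<longrightarrow> I.preserved_cover (X, constant_sobj C t, x) n (horn n k)"
    using I.groupoid_preserved_cover[OF X] by metis
  obtain p q where pq: "is_pullback C (x 0) (x 0) p q"
    using finite_limits_pullback[OF fl] homD(1)[OF smapD(3)[OF x, of 0]] by blast
  then have pq': "is_pullback C (FArr \<lparr>FObj = id, FArr = id\<rparr> (x 0)) (FArr \<lparr>FObj = id, FArr = id\<rparr> (x 0))
      (FArr \<lparr>FObj = id, FArr = id\<rparr> p) (FArr \<lparr>FObj = id, FArr = id\<rparr> q)" by simp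
  show ?thesis
    by (rule I.levelwise_pullback_exists[OF x horns x X pq pq']) (rule that[OF t x])
qed

section \<open>Path objects and exactness\<close>

context geometric_pair
begin

text \<open>The image of the product \<open>Q\<close> is a fibre product over F*, in general not a
  product in \<open>D\<close>. The fibration required for a path object is therefore the image of
  \<open>dd\<close> followed by the comparison with the actual product \<open>V\<close>, and the
  point is that this composite is a Kan fibration.\<close>

lemma levelwise_path_object:
  assumes tC: "terminal_object C tC" and t: "terminal_object D t" and adm: "admits_canonical_iCFO C SC"
    and tc: "\<forall>t g. terminal_object C t \<longrightarrow> g \<in> Arr C \<longrightarrow> Cod C g = t \<longrightarrow> g \<in> SC"
    and fl: "has_finite_limits D"
    and P: "path_object (Gpd C SC) (weak_equivalences C SC) (kan_fibrations C SC) X P s d"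
  shows "path_object (Gpd D SD) (weak_equivalences D SD) (kan_fibrations D SD) (LX X) (LX P)
    (FArr (levelwise F) s) (\<lambda>i. FArr (levelwise F) (d i))"
proof -
  interpret L: cat_functor "Gpd C SC" "Gpd D SD" "levelwise F" by (rule levelwise_functor[OF t])
  interpret E: iCFO "Gpd C SC" "weak_equivalences C SC" "kan_fibrations C SC"
    using adm by (simp add: admits_canonical_iCFO_def)
  let ?L = "FArr (levelwise F)" and ?G = "Gpd C SC" and ?H = "Gpd D SD"
  have two: "i < 2 \<longleftrightarrow> i = 0 \<or> i = 1" for i :: nat by auto
  obtain Q pr dd diag where s: "s \<in> hom ?G X P" "s \<in> weak_equivalences C SC"
    and pr: "is_product ?G {..<2::nat} (\<lambda>i. X) Q pr"
    and diag: "diag \<in> hom ?G X Q" "\<forall>i<2. pr i \<cdot>\<^bsub>?G\<^esub> diag = Ident ?G X"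
    and dd: "dd \<in> hom ?G P Q" "\<forall>i<2. pr i \<cdot>\<^bsub>?G\<^esub> dd = d i" "dd \<cdot>\<^bsub>?G\<^esub> s = diag" "dd \<in> kan_fibrations C SC"
    using P unfolding path_object_def by blast
  have prh: "pr i \<in> hom ?G Q X" if "i < 2" for i using pr that unfolding is_product_def by auto
  have XO: "X \<in> Obj ?G" using L.dom.homD(4)[OF s(1)] .
  then have X: "infinity_groupoid C SC X" using C.Obj_Gpd by blast
  note LXX = levelwise_groupoid[OF X t]

  note TC = C.Gpd_constant_terminal[OF tC]
  obtain \<phi> where x0: "\<phi> \<in> hom ?G X (constant_sobj C tC)" using TC XO unfolding terminal_object_def by blast
  then obtain x where x: "\<phi> = (X, constant_sobj C tC, x)" "(X, constant_sobj C tC, x) \<in> Arr (simplicial_category C)"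
    by (auto simp: C.hom_Gpd C.Arr_Gpd)
  note xh = x0[unfolded x(1)]
  have "(X, constant_sobj C tC, x) \<in> kan_fibrations C SC"
    using E.to_terminal_fibration[OF TC] L.dom.homD[OF xh] by blast
  then have xk: "kan_fibration C SC (X, constant_sobj C tC, x)" unfolding kan_fibrations_def by blast
  obtain p0 where p0: "pr 0 = (Q, X, p0)" "(Q, X, p0) \<in> Arr (simplicial_category C)"
    using prh[of 0] by (auto simp: C.hom_Gpd C.Arr_Gpd)
  obtain p1 where p1: "pr 1 = (Q, X, p1)" "(Q, X, p1) \<in> Arr (simplicial_category C)"
    using prh[of 1] by (auto simp: C.hom_Gpd C.Arr_Gpd)
  obtain e where e: "dd = (P, Q, e)" "(P, Q, e) \<in> Arr (simplicial_category C)"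
    and GQ: "infinity_groupoid C SC Q" "infinity_groupoid C SC P"
    using dd(1) by (auto simp: C.hom_Gpd C.Arr_Gpd)
  have Cpb: "is_pullback ?G (X, constant_sobj C tC, x) (X, constant_sobj C tC, x) (Q, X, p0) (Q, X, p1)"
    using L.dom.is_product_pullback[OF TC xh xh pr] unfolding p0(1) p1(1) by simp
  have xn: "x n \<in> hom C (FObj X n) tC" for n using C.smapD(3)[OF x(2), of n] by simp
  \<comment> \<open>X_0 \<rightarrow> * is a cover, so \<open>F\<close> carries \<open>Q\<close> in
    every level to the fibre product of FX with itself over F*.\<close>
  have "x 0 \<in> SC" using tc tC C.homD[OF xn[of 0]] by blast
  from Gpd_pullback_preserved(2)[OF t xk Cpb preserves_cover_pullbacks[OF this C.Gpd_pullback_0[OF Cpb]]]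
  have Dpb: "is_pullback D (FArr F (x n)) (FArr F (x n)) (FArr F (p0 n)) (FArr F (p1 n))" for n .

  \<comment> \<open>\<open>V\<close> is the product of the image of X with itself in
    \<open>D\<close>, formed over an actual terminal object.\<close>
  obtain t' y V A B where t': "terminal_object D t'" and y: "(LX X, constant_sobj D t', y) \<in> Arr (simplicial_category D)"
    and V: "infinity_groupoid D SD V" and A: "(V, LX X, A) \<in> Arr (simplicial_category D)"
    and B: "(V, LX X, B) \<in> Arr (simplicial_category D)"
    and Vpb: "\<And>n. is_pullback D (y n) (y n) (A n) (B n)"
    using D.groupoid_square[OF LXX fl] by metis
  note TD = D.Gpd_constant_terminal[OF t']
  have GT: "infinity_groupoid D SD (constant_sobj D t')" using TD D.Obj_Gpd unfolding terminal_object_def by blast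
  have HA: "(V, LX X, A) \<in> hom ?H V (LX X)" and HB: "(V, LX X, B) \<in> hom ?H V (LX X)"
    and Hy: "(LX X, constant_sobj D t', y) \<in> hom ?H (LX X) (constant_sobj D t')"
    using A B y V LXX GT by (simp_all add: D.hom_Gpd D.Arr_Gpd)
  have Hpb: "is_pullback ?H (LX X, constant_sobj D t', y) (LX X, constant_sobj D t', y) (V, LX X, A) (V, LX X, B)"
    by (rule D.Gpd_pullbackI) (use A B y V LXX GT Vpb in \<open>simp_all add: D.Arr_Gpd\<close>)
  let ?pr = "\<lambda>i::nat. if i = 0 then (V, LX X, A) else (V, LX X, B)"
  have prod: "is_product ?H {..<2::nat} (\<lambda>i. LX X) V ?pr"
    using L.cod.pullback_is_product[OF TD Hy Hpb] by simp
  have lift: "\<exists>u\<in>hom ?H T V. (V, LX X, A) \<cdot>\<^bsub>?H\<^esub> u = a \<and> (V, LX X, B) \<cdot>\<^bsub>?H\<^esub> u = b"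
    if "a \<in> hom ?H T (LX X)" "b \<in> hom ?H T (LX X)" for T a b
  proof -
    have "(LX X, constant_sobj D t', y) \<cdot>\<^bsub>?H\<^esub> a = (LX X, constant_sobj D t', y) \<cdot>\<^bsub>?H\<^esub> b"
      using TD L.cod.Comp_in[OF that(1) Hy] L.cod.Comp_in[OF that(2) Hy] L.cod.homD(4)[OF that(1)]
      unfolding terminal_object_def by blast
    then show ?thesis
      by (rule L.cod.pullback_lift[OF Hpb, unfolded D.Gpd_simps, OF that]) blast
  qed
  have Veq: "u = v" if "u \<in> hom ?H T V" "v \<in> hom ?H T V"
      "(V, LX X, A) \<cdot>\<^bsub>?H\<^esub> u = (V, LX X, A) \<cdot>\<^bsub>?H\<^esub> v" "(V, LX X, B) \<cdot>\<^bsub>?H\<^esub> u = (V, LX X, B) \<cdot>\<^bsub>?H\<^esub> v" for u v T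
    using L.cod.pullback_eq[OF Hpb, unfolded D.Gpd_simps, OF that] .

  have dh: "d i \<in> hom ?G P X" if "i < 2" for i
    using dd(2) that L.dom.Comp_in[OF dd(1) prh[OF that]] by auto
  have I: "Ident ?H (LX X) \<in> hom ?H (LX X) (LX X)" using L.cod.Ident_in LXX D.Obj_Gpd by blast
  obtain diag' where diag': "diag' \<in> hom ?H (LX X) V" "(V, LX X, A) \<cdot>\<^bsub>?H\<^esub> diag' = Ident ?H (LX X)"
    "(V, LX X, B) \<cdot>\<^bsub>?H\<^esub> diag' = Ident ?H (LX X)"
    using lift[OF I I] by blast
  have Lpr: "?L (pr i) \<in> hom ?H (LX Q) (LX X)" if "i < 2" for i using L.FArr_in[OF prh[OF that]] .
  \<comment> \<open>The comparison F(X \<times> X) \<rightarrow> FX \<times> FX.\<close>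
  obtain J where J: "J \<in> hom ?H (LX Q) V" "(V, LX X, A) \<cdot>\<^bsub>?H\<^esub> J = ?L (pr 0)" "(V, LX X, B) \<cdot>\<^bsub>?H\<^esub> J = ?L (pr 1)"
    using lift[OF Lpr[of 0] Lpr[of 1]] by auto
  obtain j where j: "J = (LX Q, V, j)" "(LX Q, V, j) \<in> Arr (simplicial_category D)"
    using J(1) by (auto simp: D.hom_Gpd D.Arr_Gpd)
  note Ldd = L.FArr_in[OF dd(1)]
  define dd' where "dd' = J \<cdot>\<^bsub>?H\<^esub> ?L dd"
  have dd': "dd' \<in> hom ?H (LX P) V" unfolding dd'_def using L.cod.Comp_in[OF Ldd J(1)] .
  have prJ: "?pr i \<cdot>\<^bsub>?H\<^esub> J = ?L (pr i)" if "i < 2" for i using J(2,3) that by (auto simp: two)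
  have prh': "?pr i \<in> hom ?H V (LX X)" for i using HA HB by simp
  have prdd': "?pr i \<cdot>\<^bsub>?H\<^esub> dd' = ?L (d i)" if i: "i < 2" for i
    unfolding dd'_def L.cod.Comp_assoc[OF Ldd J(1) prh', symmetric] prJ[OF i]
    using L.FArr_Comp[OF dd(1) prh[OF i]] dd(2) i by simp
  have dds: "dd' \<cdot>\<^bsub>?H\<^esub> ?L s = diag'"
  proof (rule Veq[OF L.cod.Comp_in[OF L.FArr_in[OF s(1)] dd'] diag'(1)])
    have "?pr i \<cdot>\<^bsub>?H\<^esub> (dd' \<cdot>\<^bsub>?H\<^esub> ?L s) = Ident ?H (LX X)" if i: "i < 2" for i
    proof -
      have "?pr i \<cdot>\<^bsub>?H\<^esub> (dd' \<cdot>\<^bsub>?H\<^esub> ?L s) = ?L (d i) \<cdot>\<^bsub>?H\<^esub> ?L s"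
        using L.cod.Comp_assoc[OF L.FArr_in[OF s(1)] dd' prh'[of i]] prdd'[OF i] by simp
      also have "\<dots> = ?L (d i \<cdot>\<^bsub>?G\<^esub> s)" using L.FArr_Comp[OF s(1) dh[OF i]] by simp
      also have "d i \<cdot>\<^bsub>?G\<^esub> s = Ident ?G X"
        using L.dom.Comp_assoc[OF s(1) dd(1) prh[OF i]] dd(2,3) diag(2) i by metis
      finally show ?thesis using L.FArr_Ident[OF XO] by simp
    qed
    from this[of 0] this[of 1] show "(V, LX X, A) \<cdot>\<^bsub>?H\<^esub> (dd' \<cdot>\<^bsub>?H\<^esub> ?L s) = (V, LX X, A) \<cdot>\<^bsub>?H\<^esub> diag'"
      "(V, LX X, B) \<cdot>\<^bsub>?H\<^esub> (dd' \<cdot>\<^bsub>?H\<^esub> ?L s) = (V, LX X, B) \<cdot>\<^bsub>?H\<^esub> diag'"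
      using diag'(2,3) by simp_all
  qed

  have ke: "kan_fibration D SD (LX P, LX Q, Ff e)"
    using levelwise_kan_fibration[OF _ GQ(1)] dd(4) unfolding kan_fibrations_def e(1) by blast
  have Aj: "A n \<cdot>\<^bsub>D\<^esub> j n = FArr F (p0 n)" and Bj: "B n \<cdot>\<^bsub>D\<^esub> j n = FArr F (p1 n)" for n
    using J(2,3) unfolding j(1) p0(1) p1(1) by (simp_all add: levelwise_simps fun_eq_iff)
  note jn = D.smapD(3)[OF j(2)] and An = D.smapD(3)[OF A] and Bn = D.smapD(3)[OF B]
  have en: "FArr F (e n) \<in> hom D (FObj (LX P) n) (FObj (LX Q) n)" for n
    using D.smapD(3)[OF levelwise_smap[OF e(2)]] .
  have p0n: "FArr F (p0 n) \<in> hom D (FObj (LX Q) n) (FObj (LX X) n)" and p1n: "FArr F (p1 n) \<in> hom D (FObj (LX Q) n) (FObj (LX X) n)" for n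
    using D.smapD(3)[OF levelwise_smap[OF p0(2)]] D.smapD(3)[OF levelwise_smap[OF p1(2)]] by auto
  have Fx: "FArr F (x n) \<in> hom D (FObj (LX X) n) (FObj F tC)" for n using FArr_in[OF xn] by (simp add: levelwise_simps)
  have Lx: "(LX X, constant_sobj D (FObj F tC), Ff x) \<in> Arr (simplicial_category D)"
    using levelwise_smap[OF x(2)] levelwise_constant C.homD(5)[OF xn[of 0]] by simp
  have yn: "y n \<in> hom D (FObj (LX X) n) t'" for n using D.smapD(3)[OF y, of n] by simp
  have domQ: "Dom D (FArr F (x n)) = FObj (LX X) n" "Dom D (FArr F (p0 n)) = FObj (LX Q) n"
    "Dom D (y n) = FObj (LX X) n" "Dom D (A n) = FObj V n" for n
    using D.homD[OF Fx] D.homD[OF p0n] D.homD[OF yn] D.homD[OF An] by auto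
  have "kan_fibration D SD (LX P, V, \<lambda>n. j n \<cdot>\<^bsub>D\<^esub> FArr F (e n))"
  proof (rule D.kan_fibration_monic_Comp[OF ke j(2)])
    \<comment> \<open>Composing \<open>j\<close> with the projections of \<open>V\<close> gives the
      projections of the fibre product over F*, which are jointly monic.\<close>
    fix n T u v assume u: "u \<in> hom D T (FObj (LX Q) n)" and v: "v \<in> hom D T (FObj (LX Q) n)" and uv: "j n \<cdot>\<^bsub>D\<^esub> u = j n \<cdot>\<^bsub>D\<^esub> v"
    have "FArr F (p0 n) \<cdot>\<^bsub>D\<^esub> u = FArr F (p0 n) \<cdot>\<^bsub>D\<^esub> v"
      using D.Comp_assoc[OF u jn An] D.Comp_assoc[OF v jn An] Aj uv by simp
    moreover have "FArr F (p1 n) \<cdot>\<^bsub>D\<^esub> u = FArr F (p1 n) \<cdot>\<^bsub>D\<^esub> v"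
      using D.Comp_assoc[OF u jn Bn] D.Comp_assoc[OF v jn Bn] Bj uv by simp
    ultimately show "u = v" using D.pullback_eq[OF Dpb, unfolded domQ, OF u v] by blast
  next
    fix n k T \<rho> z assume n: "1 \<le> n" "k \<le> n" and r: "matching_cone D (LX P) (horn n k) T \<rho>"
      and z: "z \<in> hom D T (FObj V n)"
      and rz: "\<And>m \<sigma>. \<sigma> \<in> simplices (horn n k) m \<Longrightarrow> (j m \<cdot>\<^bsub>D\<^esub> FArr F (e m)) \<cdot>\<^bsub>D\<^esub> \<rho> m \<sigma> = FArr V \<sigma> \<cdot>\<^bsub>D\<^esub> z"
    let ?v = "vertex n k"
    have v: "?v \<in> simplices (horn n k) 0" using star_connected_horn[OF n] by (simp add: star_connected_def)
    note vh = vertex_hom[OF n(2)]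
    have rv: "\<rho> 0 ?v \<in> hom D T (FObj (LX P) 0)" using r v unfolding matching_cone_iff by blast
    note er = D.Comp_in[OF rv en]
    have xv: "FArr F (x 0) \<cdot>\<^bsub>D\<^esub> FArr (LX X) ?v = FArr F (x n)"
      using D.smapD(4)[OF Lx vh] D.Ident_left[OF Fx] vh by simp
    note Xv = D.sobj_hom[OF D.smapD(1)[OF Lx] vh] and Vv = D.sobj_hom[OF D.smapD(1)[OF A] vh]
    \<comment> \<open>The image in F* of either component of \<open>z\<close> can be computed at the
      vertex \<open>k\<close>. This vertex lies in the horn, where \<open>z\<close> comes from the
      image of \<open>Q\<close>; so both components have the same image in F* and \<open>z\<close>
      factors through \<open>j\<close>.\<close>
    have key: "FArr F (x n) \<cdot>\<^bsub>D\<^esub> (G n \<cdot>\<^bsub>D\<^esub> z) = (FArr F (x 0) \<cdot>\<^bsub>D\<^esub> g0') \<cdot>\<^bsub>D\<^esub> (FArr F (e 0) \<cdot>\<^bsub>D\<^esub> \<rho> 0 ?v)"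
      if G: "(V, LX X, G) \<in> Arr (simplicial_category D)" and Gj: "G 0 \<cdot>\<^bsub>D\<^esub> j 0 = g0'"
        and g0: "g0' \<in> hom D (FObj (LX Q) 0) (FObj (LX X) 0)" for G g0'
    proof -
      note Gn = D.smapD(3)[OF G]
      have "FArr F (x n) \<cdot>\<^bsub>D\<^esub> (G n \<cdot>\<^bsub>D\<^esub> z) = FArr F (x 0) \<cdot>\<^bsub>D\<^esub> (FArr (LX X) ?v \<cdot>\<^bsub>D\<^esub> (G n \<cdot>\<^bsub>D\<^esub> z))"
        using D.Comp_assoc[OF D.Comp_in[OF z Gn] Xv Fx] xv by simp
      also have "FArr (LX X) ?v \<cdot>\<^bsub>D\<^esub> (G n \<cdot>\<^bsub>D\<^esub> z) = G 0 \<cdot>\<^bsub>D\<^esub> (FArr V ?v \<cdot>\<^bsub>D\<^esub> z)"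
        using D.Comp_assoc[OF z Gn Xv] D.smapD(4)[OF G vh] D.Comp_assoc[OF z Vv Gn] by simp
      also have "FArr V ?v \<cdot>\<^bsub>D\<^esub> z = j 0 \<cdot>\<^bsub>D\<^esub> (FArr F (e 0) \<cdot>\<^bsub>D\<^esub> \<rho> 0 ?v)"
        using rz[OF v] D.Comp_assoc[OF rv en jn] by simp
      also have "G 0 \<cdot>\<^bsub>D\<^esub> (j 0 \<cdot>\<^bsub>D\<^esub> (FArr F (e 0) \<cdot>\<^bsub>D\<^esub> \<rho> 0 ?v)) = g0' \<cdot>\<^bsub>D\<^esub> (FArr F (e 0) \<cdot>\<^bsub>D\<^esub> \<rho> 0 ?v)"
        using D.Comp_assoc[OF er jn Gn] Gj by simp
      finally show ?thesis using D.Comp_assoc[OF er g0 Fx] by simp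
    qed
    have "FArr F (x n) \<cdot>\<^bsub>D\<^esub> (A n \<cdot>\<^bsub>D\<^esub> z) = FArr F (x n) \<cdot>\<^bsub>D\<^esub> (B n \<cdot>\<^bsub>D\<^esub> z)"
      unfolding key[OF A Aj[of 0] p0n[of 0]] key[OF B Bj[of 0] p1n[of 0]] using D.is_pullbackD(9)[OF Dpb, of 0] by simp
    then obtain u where u: "u \<in> hom D T (FObj (LX Q) n)" "FArr F (p0 n) \<cdot>\<^bsub>D\<^esub> u = A n \<cdot>\<^bsub>D\<^esub> z" "FArr F (p1 n) \<cdot>\<^bsub>D\<^esub> u = B n \<cdot>\<^bsub>D\<^esub> z"
      by (rule D.pullback_lift[OF Dpb, unfolded domQ, OF D.Comp_in[OF z An] D.Comp_in[OF z Bn]]) blast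
    have "j n \<cdot>\<^bsub>D\<^esub> u = z"
    proof (rule D.pullback_eq[OF Vpb, unfolded domQ, OF D.Comp_in[OF u(1) jn] z])
      show "A n \<cdot>\<^bsub>D\<^esub> (j n \<cdot>\<^bsub>D\<^esub> u) = A n \<cdot>\<^bsub>D\<^esub> z" using D.Comp_assoc[OF u(1) jn An] Aj u(2) by simp
      show "B n \<cdot>\<^bsub>D\<^esub> (j n \<cdot>\<^bsub>D\<^esub> u) = B n \<cdot>\<^bsub>D\<^esub> z" using D.Comp_assoc[OF u(1) jn Bn] Bj u(3) by simp
    qed
    then show "\<exists>x\<in>hom D T (FObj (LX Q) n). j n \<cdot>\<^bsub>D\<^esub> x = z" using u(1) by blast
  qed
  moreover have "dd' = (LX P, V, \<lambda>n. j n \<cdot>\<^bsub>D\<^esub> FArr F (e n))"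
    unfolding dd'_def j(1) e(1) by (simp add: levelwise_simps)
  moreover have "dd' \<in> Arr ?H" using L.cod.homD[OF dd'] by simp
  ultimately have "dd' \<in> kan_fibrations D SD" unfolding kan_fibrations_def by simp
  moreover have "\<forall>i<2. ?pr i \<cdot>\<^bsub>?H\<^esub> diag' = Ident ?H (LX X)" using diag'(2,3) by simp
  moreover have "\<forall>i<2. ?pr i \<cdot>\<^bsub>?H\<^esub> dd' = ?L (d i)" using prdd' by blast
  ultimately show ?thesis
    unfolding path_object_def
    using L.FArr_in[OF s(1)] levelwise_weak_equivalence[OF tC t adm tc s(2)] prod diag'(1) dd' dds
    by (intro conjI exI[of _ V] exI[of _ ?pr] exI[of _ dd'] exI[of _ diag'])
qed

lemma levelwise_terminal:
  assumes tC: "terminal_object C tC" and t: "terminal_object D t" and F: "preserves_terminal C D F"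
  shows "preserves_terminal (Gpd C SC) (Gpd D SD) (levelwise F)"
  unfolding preserves_terminal_def
proof (intro allI impI)
  fix T assume T: "terminal_object (Gpd C SC) T"
  then have "infinity_groupoid C SC T" using C.Obj_Gpd unfolding terminal_object_def by blast
  from D.Gpd_terminalI[OF levelwise_groupoid[OF this t]]
  show "terminal_object (Gpd D SD) (LX T)"
    using C.Gpd_terminal_levels[OF tC T] F unfolding preserves_terminal_def levelwise_simps by blast
qed

text \<open>The class \<open>S\<close> and the preservation of pullbacks along it are left open, so
  that both exactness statements are instances.\<close>

lemma levelwise_exact:
  assumes tC: "terminal_object C tC" and t: "terminal_object D t" and adm: "admits_canonical_iCFO C SC"
    and tc: "\<forall>t g. terminal_object C t \<longrightarrow> g \<in> Arr C \<longrightarrow> Cod C g = t \<longrightarrow> g \<in> SC"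
    and F: "preserves_terminal C D F"
    and S: "exactness_class (Gpd C SC) (weak_equivalences C SC) (kan_fibrations C SC) S"
    and pb: "\<And>f g p q. f \<in> S \<Longrightarrow> is_pullback (Gpd C SC) f g p q \<Longrightarrow>
      is_pullback (Gpd D SD) (FArr (levelwise F) f) (FArr (levelwise F) g) (FArr (levelwise F) p) (FArr (levelwise F) q)"
  shows "exact_wrt (Gpd C SC) (weak_equivalences C SC) (kan_fibrations C SC)
    (Gpd D SD) (weak_equivalences D SD) (kan_fibrations D SD) S (levelwise F)"
  unfolding exact_wrt_def
proof (intro conjI ballI allI impI)
  show "FArr (levelwise F) f \<in> weak_equivalences D SD \<inter> kan_fibrations D SD"
    if "f \<in> weak_equivalences C SC \<inter> kan_fibrations C SC" for f
    using levelwise_weak_equivalence[OF tC t adm tc] levelwise_kan_fibrations[OF t] that by blast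
  show "FArr (levelwise F) f \<in> kan_fibrations D SD" if "f \<in> S" for f
    using levelwise_kan_fibrations[OF t] S that unfolding exactness_class_def by blast
qed (use levelwise_functor[OF t] S levelwise_terminal[OF tC t F] pb in blast)+

end

lemma (in iCFO) exactness_class_fibrations: "exactness_class E W Fib Fib"
  unfolding exactness_class_def
  using fibrations_wide to_terminal_fibration by (auto simp: wide_subcategory_def)

text \<open>A terminal groupoid is terminal in level 0, so a map into it has a cover in level 0.
  Hypercovers have one because the boundary of the 0-simplex is empty.\<close>

lemma (in category_with_covers) exactness_class_covering:
  assumes adm: "admits_canonical_iCFO C S"
  shows "exactness_class (Gpd C S) (weak_equivalences C S) (kan_fibrations C S) (covering_fibrations C S)"
proof -
  interpret cc: cover_category C S by (rule cover_category)
  let ?G = "Gpd C S" and ?F = "kan_fibrations C S"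
  interpret E: iCFO ?G "weak_equivalences C S" ?F
    using adm by (simp add: admits_canonical_iCFO_def)
  have Fs: "subcategory ?G ?F" using E.fibrations_wide by (simp add: wide_subcategory_def)
  obtain t where t: "terminal_object C t" using has_terminal by blast
  have cov: "(X, Y, f) \<in> covering_fibrations C S \<longleftrightarrow> (X, Y, f) \<in> ?F \<and> f 0 \<in> S" for X Y f
    by (simp add: covering_fibrations_def)
  have sm: "(X, Y, f) \<in> Arr (simplicial_category C)" if "(X, Y, f) \<in> ?F" for X Y f
    using that by (simp add: kan_fibrations_def Arr_Gpd)
  have "subcategory ?G (covering_fibrations C S)"
    unfolding subcategory_def
  proof (intro conjI ballI impI)
    show "covering_fibrations C S \<subseteq> Arr ?G" unfolding covering_fibrations_def kan_fibrations_def by auto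
  next
    fix f assume f: "f \<in> covering_fibrations C S"
    obtain X Y f' where e: "f = (X, Y, f')" by (cases f)
    note fF = f[unfolded e cov, THEN conjunct1]
    have "Ident ?G X \<in> ?F" "Ident ?G Y \<in> ?F" using Fs fF unfolding subcategory_def by fastforce+
    moreover have "FObj X 0 \<in> Obj C" "FObj Y 0 \<in> Obj C" using sobj_Obj smapD(1,2)[OF sm[OF fF]] by auto
    ultimately show "Ident ?G (Dom ?G f) \<in> covering_fibrations C S" "Ident ?G (Cod ?G f) \<in> covering_fibrations C S"
      unfolding e using cc.Ident_cover by (simp_all add: cov)
  next
    fix f g assume f: "f \<in> covering_fibrations C S" and g: "g \<in> covering_fibrations C S" and c: "Cod ?G f = Dom ?G g"
    obtain X Y f' where e: "f = (X, Y, f')" by (cases f)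
    obtain Y' Z g' where "g = (Y', Z, g')" by (cases g)
    then have e': "g = (Y, Z, g')" using c e by simp
    note ff = f[unfolded e cov] and gg = g[unfolded e' cov]
    have "g \<cdot>\<^bsub>?G\<^esub> f \<in> ?F" using Fs ff gg c unfolding subcategory_def e e' by blast
    moreover have "g' 0 \<cdot>\<^bsub>C\<^esub> f' 0 \<in> S"
      using cc.cover_Comp ff gg homD[OF smapD(3)[OF sm[of X Y f'], of 0]] homD[OF smapD(3)[OF sm[of Y Z g'], of 0]] by simp
    ultimately show "g \<cdot>\<^bsub>?G\<^esub> f \<in> covering_fibrations C S" unfolding e e' by (simp add: cov)
  qed
  moreover have "f \<in> covering_fibrations C S" if f: "f \<in> Arr ?G" "terminal_object ?G T" "Cod ?G f = T" for f T
  proof -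
    obtain X Y f' where e: "f = (X, Y, f')" by (cases f)
    have F: "f \<in> ?F" using E.to_terminal_fibration f by blast
    have "terminal_object C (FObj Y 0)" using cc.Gpd_terminal_levels[OF t f(2)] f(3) e by simp
    then have "f' 0 \<in> S"
      using to_terminal_cover homD[OF smapD(3)[OF sm[of X Y f'], of 0]] F unfolding e by blast
    then show ?thesis using F unfolding e by (simp add: cov)
  qed
  moreover have "weak_equivalences C S \<inter> ?F \<subseteq> covering_fibrations C S"
    using cc.hypercovers_covering[OF adm] adm unfolding admits_canonical_iCFO_def by simp
  moreover have "covering_fibrations C S \<subseteq> ?F" unfolding covering_fibrations_def by auto
  ultimately show ?thesis unfolding exactness_class_def by blast
qed

text \<open>Exactness includes preservation of terminal objects, which a geometric functor need not
  provide; hence the premise of the first clause. In the last clause it follows from preservation of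
  the empty limit. Preservation of path objects is stated both for arbitrary path objects and for
  the canonical ones.\<close>

theorem proposition2p31:
  fixes C :: "('o, 'm) category" and SC :: "'m set"
    and D :: "('p, 'n) category" and SD :: "'n set"
    and F :: "('o, 'm, 'p, 'n) cat_functor"
  assumes "category_with_covers C SC"
    and "admits_canonical_iCFO C SC"
    and "descent_category D SD"
    and "geometric_functor C SC D SD F"
  shows
    "(preserves_terminal C D F \<longrightarrow>
        exact_wrt (Gpd C SC) (weak_equivalences C SC) (kan_fibrations C SC)
          (Gpd D SD) (weak_equivalences D SD) (kan_fibrations D SD)
          (covering_fibrations C SC) (levelwise F))
     \<and> (\<forall>f\<in>kan_fibrations C SC. FArr (levelwise F) f \<in> kan_fibrations D SD)
     \<and> (\<forall>X P s d.
          path_object (Gpd C SC) (weak_equivalences C SC) (kan_fibrations C SC) X P s d \<longrightarrow>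
          path_object (Gpd D SD) (weak_equivalences D SD) (kan_fibrations D SD)
            (FObj (levelwise F) X) (FObj (levelwise F) P)
            (FArr (levelwise F) s) (\<lambda>i. FArr (levelwise F) (d i)))
     \<and> (\<forall>X P s d. canonical_path C SC X P s d \<longrightarrow>
          canonical_path D SD (FObj (levelwise F) X) (FObj (levelwise F) P)
            (FArr (levelwise F) s) (\<lambda>i. FArr (levelwise F) (d i)))
     \<and> (reflects_covers C SC SD F \<longrightarrow>
          (\<forall>f\<in>Arr (Gpd C SC).
             (FArr (levelwise F) f \<in> kan_fibrations D SD \<longrightarrow> f \<in> kan_fibrations C SC)
           \<and> (FArr (levelwise F) f \<in> weak_equivalences D SD \<longrightarrow> f \<in> weak_equivalences C SC)))
     \<and> (preserves_finite_limits C D F \<longrightarrow>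
          exact_wrt (Gpd C SC) (weak_equivalences C SC) (kan_fibrations C SC)
            (Gpd D SD) (weak_equivalences D SD) (kan_fibrations D SD)
            (kan_fibrations C SC) (levelwise F))"
proof -
  interpret CC: category_with_covers C SC by fact
  interpret DD: descent_category D SD by fact
  interpret C: cover_category C SC by (rule CC.cover_category)
  interpret D: cover_category D SD by (rule DD.cover_category)
  interpret geometric_pair C SC D SD F
    by (intro geometric_pair.intro C.cover_category_axioms D.cover_category_axioms assms(4))
  note adm = assms(2)
  interpret E: iCFO "Gpd C SC" "weak_equivalences C SC" "kan_fibrations C SC"
    using adm by (simp add: admits_canonical_iCFO_def)
  obtain tC where tC: "terminal_object C tC" using CC.has_terminal by blast
  obtain t where t: "terminal_object D t" using DD.finite_limits_terminal[OF DD.finite_limits] by blast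
  have tc: "\<forall>t g. terminal_object C t \<longrightarrow> g \<in> Arr C \<longrightarrow> Cod C g = t \<longrightarrow> g \<in> SC"
    using CC.to_terminal_cover by blast
  have reflect: "f \<in> kan_fibrations C SC"
    if R: "reflects_covers C SC SD F" and f: "f \<in> Arr (Gpd C SC)" and k: "FArr (levelwise F) f \<in> kan_fibrations D SD" for f
  proof -
    obtain X Y f' where e: "f = (X, Y, f')" by (cases f)
    show ?thesis
      using kan_fibration_reflected[OF R, of X Y f'] f k
      unfolding e levelwise_simps kan_fibrations_def by (simp add: CC.Arr_Gpd DD.Arr_Gpd)
  qed
  show ?thesis
  proof (intro conjI impI ballI allI)
    assume "preserves_terminal C D F"
    then show "exact_wrt (Gpd C SC) (weak_equivalences C SC) (kan_fibrations C SC)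
        (Gpd D SD) (weak_equivalences D SD) (kan_fibrations D SD) (covering_fibrations C SC) (levelwise F)"
      by (rule levelwise_exact[OF tC t adm tc _ CC.exactness_class_covering[OF adm] levelwise_covering_pullback[OF t]])
  next
    show "FArr (levelwise F) f \<in> kan_fibrations D SD" if "f \<in> kan_fibrations C SC" for f
      by (rule levelwise_kan_fibrations[OF t that])
  next
    fix X P s d assume "path_object (Gpd C SC) (weak_equivalences C SC) (kan_fibrations C SC) X P s d"
    then show "path_object (Gpd D SD) (weak_equivalences D SD) (kan_fibrations D SD)
        (FObj (levelwise F) X) (FObj (levelwise F) P) (FArr (levelwise F) s) (\<lambda>i. FArr (levelwise F) (d i))"
      by (rule levelwise_path_object[OF tC t adm tc DD.finite_limits])
  next
    fix X P s d assume "canonical_path C SC X P s d"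
    then show "canonical_path D SD (FObj (levelwise F) X) (FObj (levelwise F) P)
        (FArr (levelwise F) s) (\<lambda>i. FArr (levelwise F) (d i))"
      by (rule levelwise_canonical_path[OF t tc])
  next
    fix f assume "reflects_covers C SC SD F" "f \<in> Arr (Gpd C SC)" "FArr (levelwise F) f \<in> kan_fibrations D SD"
    then show "f \<in> kan_fibrations C SC" by (rule reflect)
  next
    fix f assume "reflects_covers C SC SD F" "f \<in> Arr (Gpd C SC)" "FArr (levelwise F) f \<in> weak_equivalences D SD"
    then show "f \<in> weak_equivalences C SC" by (rule weak_equivalence_reflected[OF tC t adm tc])
  next
    assume F: "preserves_finite_limits C D F"
    show "exact_wrt (Gpd C SC) (weak_equivalences C SC) (kan_fibrations C SC)
        (Gpd D SD) (weak_equivalences D SD) (kan_fibrations D SD) (kan_fibrations C SC) (levelwise F)"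
      by (rule levelwise_exact[OF tC t adm tc preserves_finite_limits_terminal[OF F] E.exactness_class_fibrations
            levelwise_pullback[OF t _ _ preserves_finite_limits_pullback[OF F]]])
  qed
qed

end
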